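(* The following hold for rooted structures. 1. Viewing a class of display maps as a full subcategory of the arrow category gives an isomorphism and (by inclusion of strict maps in pseudo maps) an equivalence of 2-categories $$\mathbf{DMC}_{\mathrm{rtd}}\;\cong\;\mathbf{CompCat}^{\mathrm{str2}}_{\mathrm{rtd},\mathrm{repl}}\;\simeq\;\mathbf{CompCat}_{\mathrm{rtd},\mathrm{repl}}.$$ 2. In the chain of inclusions $$\mathbf{CompCat}_{\mathrm{rtd},\mathrm{repl}}\hookrightarrow\mathbf{CompCat}_{\mathrm{rtd},\mathrm{sub}}\hookrightarrow\mathbf{CompCat}_{\mathrm{rtd},\mathrm{full}}\hookrightarrow\mathbf{CompCat}_{\mathrm{rtd}}$$ the first two are equivalences of 2-categories and the third has a left adjoint. 3. There is an isomorphism of 2-categories $\mathbf{sDMC}_{\mathrm{rtd}}\cong\mathbf{CompCat}^{\mathrm{str2}}_{\mathrm{rtd},\mathrm{sub}}$. 4. The inclusion $\mathbf{DMC}_{\mathrm{rtd}}\hookrightarrow\mathbf{sDMC}_{\mathrm{rtd}}$, or equivalently $\mathbf{CompCat}^{\mathrm{str2}}_{\mathrm{rtd},\mathrm{repl}}\hookrightarrow\mathbf{CompCat}^{\mathrm{str2}}_{\mathrm{rtd},\mathrm{sub}}$, has a left adjoint. Here the maps in the "strict" 2-categories (superscript $\mathrm{str2}$) are maps that are strict as maps of comprehension categories, but that need not preserve the root strictly (only up to isomorphism).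
   Context: **Comprehension categories.** A comprehension category $(\mathcal C,\mathcal T,p,\chi)$ is a category $\mathcal C$, a fibration $p:\mathcal T\to\mathcal C$, and a functor $\chi:\mathcal T\to\mathcal C^{\to}$ to the arrow category with $\mathrm{cod}\circ\chi=p$ strictly, sending $p$-cartesian maps to pullback squares. For $A\in\mathcal T_\Gamma=p^{-1}(\Gamma)$ the domain of $\chi(A)$ is written $\Gamma.A$. A *pseudo map* $(F,\bar F,\varphi)$ is a functor $F:\mathcal C\to\mathcal C'$, a functor $\bar F:\mathcal T\to\mathcal T'$ strictly over $F$ preserving cartesian maps, and a natural isomorphism $\varphi:\chi'\bar F\cong F^{\to}\chi$ lying strictly over the identity of $F$; it is *strict* if $\chi'\bar F=F^{\to}\chi$ and $\varphi$ is the identity. A *transformation* $(F,\bar F,\varphi)\Rightarrow(G,\bar G,\gamma)$ is a natural transformation $\alpha:F\Rightarrow G$ and another $\bar\alpha:\bar F\Rightarrow\bar G$ strictly over $\alpha$, with $\gamma_A\circ\chi'(\bar\alpha_A)=\alpha_{\Gamma.A}\circ\varphi_A$ for all $A\in\mathcal T_\Gamma$. A comprehension category is *full* if $\chi$ is fully faithful; *subcategorical* ($\mathrm{sub}$) if $\chi$ is a full subcategory inclusion (full, faithful, injective on objects; $\mathcal T$ is identified with its image); *replete* ($\mathrm{repl}$) if it is subcategorical and $\mathcal T$ is a replete (isomorphism-closed) subcategory of $\mathcal C^{\to}$. It is *pointed* if equipped with a distinguished object $\diamond\in\mathcal C$; pointed maps preserve $\diamond$ up to a specified isomorphism, and a transformation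 is pointed if its value at $\diamond$ commutes with these isomorphisms. A pointed comprehension category is *rooted* if the distinguished object is terminal (written $1$) and every object is isomorphic to an iterated context extension $1.A_0\ldots A_{n-1}$, $n\ge 0$, with each $A_k\in\mathcal T_{1.A_0\ldots A_{k-1}}$. $\mathbf{CompCat}_{\mathrm{rtd}}$ is the 2-category of rooted comprehension categories, pointed pseudo maps and pointed transformations; further subscripts denote full sub-2-categories; superscript $\mathrm{str2}$ restricts the maps as stated in the claim. **Display map categories.** A structured display map category is a category $\mathcal C$ with a class $\mathcal D$ of morphisms (display maps) such that for any display map $d$ and any map $f$ into its target there is a display map $f^*d$ that is a pullback of $d$ along $f$. It is a display map category if moreover $\mathcal D$ is replete (isomorphism-invariant). Either is *rooted* if $\mathcal C$ has a terminal object and all morphisms to the terminal object are composites of display maps and isomorphisms. $\mathbf{sDMC}_{\mathrm{rtd}}$ and $\mathbf{DMC}_{\mathrm{rtd}}$ are the 2-categories of rooted structured display map categories and rooted display map categories, with functors preserving display maps, pullbacks thereof, and terminal objects, and all natural transformations. For the isomorphisms of 2-categories, a terminal object is regarded as chosen (but need only be preserved up to isomorphism). **Conventions.** 2-categories and 2-functors are strict; $\cong$ is isomorphism of 2-categories; an equivalence $\simeq$ is a 2-functor inducing equivalences on hom-categories and surjective on objects up to internal equivalence; a left adjoint is a left 2-adjoint (2-natural isomorphisms of hom-categories). *)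

theory Defs
  imports "HOL-Library.FuncSet"
begin

text \<open>
  Conventions. A category has a set of objects in one type and a set of arrows in another.
  Structure maps, functors and natural transformations are required to be \<open>undefined\<close> outside
  their domain, so that HOL equality of records is the strict equality of the structures they
  represent; this is what makes strict 2-categories and isomorphisms of 2-categories meaningful.
  \<open>cmp C g f\<close> is \<open>g\<close> after \<open>f\<close>.
\<close>

section \<open>Categories\<close>

record ('o, 'm) cat =
  obj :: "'o set"
  arr :: "'m set"
  src :: "'m \<Rightarrow> 'o"
  trg :: "'m \<Rightarrow> 'o"
  idn :: "'o \<Rightarrow> 'm"
  cmp :: "'m \<Rightarrow> 'm \<Rightarrow> 'm"

definition composable :: "('o, 'm) cat \<Rightarrow> 'm \<Rightarrow> 'm \<Rightarrow> bool" where
  "composable C g f \<longleftrightarrow> g \<in> arr C \<and> f \<in> arr C \<and> src C g = trg C f"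

definition hom :: "('o, 'm) cat \<Rightarrow> 'o \<Rightarrow> 'o \<Rightarrow> 'm set" where
  "hom C x y = {f \<in> arr C. src C f = x \<and> trg C f = y}"

definition category :: "('o, 'm) cat \<Rightarrow> bool" where
  "category C \<longleftrightarrow>
     src C \<in> arr C \<rightarrow>\<^sub>E obj C \<and> trg C \<in> arr C \<rightarrow>\<^sub>E obj C \<and> idn C \<in> obj C \<rightarrow>\<^sub>E arr C \<and>
     (\<forall>x\<in>obj C. idn C x \<in> hom C x x) \<and>
     (\<forall>g f. composable C g f \<longrightarrow> cmp C g f \<in> hom C (src C f) (trg C g)) \<and>
     (\<forall>g f. \<not> composable C g f \<longrightarrow> cmp C g f = undefined) \<and>
     (\<forall>f\<in>arr C. cmp C f (idn C (src C f)) = f \<and> cmp C (idn C (trg C f)) f = f) \<and>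
     (\<forall>h g f. composable C h g \<longrightarrow> composable C g f \<longrightarrow>
        cmp C h (cmp C g f) = cmp C (cmp C h g) f)"

definition iso_arr :: "('o, 'm) cat \<Rightarrow> 'm \<Rightarrow> bool" where
  "iso_arr C f \<longleftrightarrow> f \<in> arr C \<and>
     (\<exists>g \<in> hom C (trg C f) (src C f).
        cmp C g f = idn C (src C f) \<and> cmp C f g = idn C (trg C f))"

definition isomorphic_objs :: "('o, 'm) cat \<Rightarrow> 'o \<Rightarrow> 'o \<Rightarrow> bool" where
  "isomorphic_objs C x y \<longleftrightarrow> (\<exists>f \<in> hom C x y. iso_arr C f)"

definition terminal :: "('o, 'm) cat \<Rightarrow> 'o \<Rightarrow> bool" where
  "terminal C t \<longleftrightarrow> t \<in> obj C \<and> (\<forall>x\<in>obj C. \<exists>!f. f \<in> hom C x t)"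

definition full_sub :: "('o, 'm) cat \<Rightarrow> 'o set \<Rightarrow> ('o, 'm) cat" where
  "full_sub C S =
     (let A = {f \<in> arr C. src C f \<in> S \<and> trg C f \<in> S} in
      \<lparr> obj = S, arr = A, src = restrict (src C) A, trg = restrict (trg C) A,
        idn = restrict (idn C) S,
        cmp = (\<lambda>g f. if g \<in> A \<and> f \<in> A then cmp C g f else undefined) \<rparr>)"

text \<open>Isomorphism-closed subcategory \<open>S\<close> of \<open>C\<close>.\<close>

definition replete_sub :: "('o, 'm) cat \<Rightarrow> ('o, 'm) cat \<Rightarrow> bool" where
  "replete_sub C S \<longleftrightarrow>
     (\<forall>f. iso_arr C f \<longrightarrow> src C f \<in> obj S \<longrightarrow> trg C f \<in> obj S \<and> f \<in> arr S)"

section \<open>Functors and natural transformations\<close>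

record ('o, 'm, 'p, 'n) fctr =
  fob :: "'o \<Rightarrow> 'p"
  far :: "'m \<Rightarrow> 'n"

definition is_functor :: "('o, 'm) cat \<Rightarrow> ('p, 'n) cat \<Rightarrow> ('o, 'm, 'p, 'n) fctr \<Rightarrow> bool" where
  "is_functor C D F \<longleftrightarrow> category C \<and> category D \<and>
     fob F \<in> obj C \<rightarrow>\<^sub>E obj D \<and> far F \<in> arr C \<rightarrow>\<^sub>E arr D \<and>
     (\<forall>f\<in>arr C. src D (far F f) = fob F (src C f) \<and> trg D (far F f) = fob F (trg C f)) \<and>
     (\<forall>x\<in>obj C. far F (idn C x) = idn D (fob F x)) \<and>
     (\<forall>g f. composable C g f \<longrightarrow> far F (cmp C g f) = cmp D (far F g) (far F f))"

definition fid :: "('o, 'm) cat \<Rightarrow> ('o, 'm, 'o, 'm) fctr" where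
  "fid C = \<lparr> fob = (\<lambda>x\<in>obj C. x), far = (\<lambda>f\<in>arr C. f) \<rparr>"

text \<open>\<open>fcomp C G F\<close> is \<open>G\<close> after \<open>F\<close>, where \<open>C\<close> is the source of \<open>F\<close>.\<close>

definition fcomp ::
  "('o, 'm) cat \<Rightarrow> ('p, 'n, 'q, 'k) fctr \<Rightarrow> ('o, 'm, 'p, 'n) fctr \<Rightarrow> ('o, 'm, 'q, 'k) fctr" where
  "fcomp C G F = \<lparr> fob = (\<lambda>x\<in>obj C. fob G (fob F x)), far = (\<lambda>f\<in>arr C. far G (far F f)) \<rparr>"

definition faithful :: "('o, 'm) cat \<Rightarrow> ('o, 'm, 'p, 'n) fctr \<Rightarrow> bool" where
  "faithful C F \<longleftrightarrow> (\<forall>x\<in>obj C. \<forall>y\<in>obj C. inj_on (far F) (hom C x y))"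

definition full :: "('o, 'm) cat \<Rightarrow> ('p, 'n) cat \<Rightarrow> ('o, 'm, 'p, 'n) fctr \<Rightarrow> bool" where
  "full C D F \<longleftrightarrow> (\<forall>x\<in>obj C. \<forall>y\<in>obj C. hom D (fob F x) (fob F y) \<subseteq> far F ` hom C x y)"

definition nat_trans ::
  "('o, 'm) cat \<Rightarrow> ('p, 'n) cat \<Rightarrow> ('o, 'm, 'p, 'n) fctr \<Rightarrow> ('o, 'm, 'p, 'n) fctr
    \<Rightarrow> ('o \<Rightarrow> 'n) \<Rightarrow> bool" where
  "nat_trans C D F G \<alpha> \<longleftrightarrow> is_functor C D F \<and> is_functor C D G \<and> \<alpha> \<in> extensional (obj C) \<and>
     (\<forall>x\<in>obj C. \<alpha> x \<in> hom D (fob F x) (fob G x)) \<and>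
     (\<forall>f\<in>arr C. cmp D (\<alpha> (trg C f)) (far F f) = cmp D (far G f) (\<alpha> (src C f)))"

definition nat_iso ::
  "('o, 'm) cat \<Rightarrow> ('p, 'n) cat \<Rightarrow> ('o, 'm, 'p, 'n) fctr \<Rightarrow> ('o, 'm, 'p, 'n) fctr
    \<Rightarrow> ('o \<Rightarrow> 'n) \<Rightarrow> bool" where
  "nat_iso C D F G \<alpha> \<longleftrightarrow> nat_trans C D F G \<alpha> \<and> (\<forall>x\<in>obj C. iso_arr D (\<alpha> x))"

definition equivalence_of_cats ::
  "('o, 'm) cat \<Rightarrow> ('p, 'n) cat \<Rightarrow> ('o, 'm, 'p, 'n) fctr \<Rightarrow> bool" where
  "equivalence_of_cats C D F \<longleftrightarrow> is_functor C D F \<and>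
     (\<exists>G. is_functor D C G \<and>
        (\<exists>\<eta>. nat_iso C C (fid C) (fcomp C G F) \<eta>) \<and>
        (\<exists>\<epsilon>. nat_iso D D (fcomp D F G) (fid D) \<epsilon>))"

definition isomorphism_of_cats ::
  "('o, 'm) cat \<Rightarrow> ('p, 'n) cat \<Rightarrow> ('o, 'm, 'p, 'n) fctr \<Rightarrow> bool" where
  "isomorphism_of_cats C D F \<longleftrightarrow> is_functor C D F \<and>
     (\<exists>G. is_functor D C G \<and> fcomp C G F = fid C \<and> fcomp D F G = fid D)"

section \<open>Arrow categories, pullbacks, fibrations\<close>

text \<open>
  \<open>Square f g u v\<close> is the commuting square \<open>g u = v f\<close>, regarded as an arrow \<open>f \<rightarrow> g\<close> of the arrow
  category; \<open>u\<close> and \<open>v\<close> are its images under the domain and codomain functors.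
\<close>

datatype 'm square = Square (sqsrc: 'm) (sqtrg: 'm) (sqdom: 'm) (sqcod: 'm)

definition arrcat :: "('o, 'm) cat \<Rightarrow> ('m, 'm square) cat" where
  "arrcat C =
     (let A = {Square f g u v | f g u v. f \<in> arr C \<and> g \<in> arr C \<and>
                 u \<in> hom C (src C f) (src C g) \<and> v \<in> hom C (trg C f) (trg C g) \<and>
                 cmp C g u = cmp C v f} in
      \<lparr> obj = arr C, arr = A, src = restrict sqsrc A, trg = restrict sqtrg A,
        idn = (\<lambda>f\<in>arr C. Square f f (idn C (src C f)) (idn C (trg C f))),
        cmp = (\<lambda>t s. if t \<in> A \<and> s \<in> A \<and> sqsrc t = sqtrg s
                 then Square (sqsrc s) (sqtrg t) (cmp C (sqdom t) (sqdom s))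
                        (cmp C (sqcod t) (sqcod s))
                 else undefined) \<rparr>)"

definition codf :: "('o, 'm) cat \<Rightarrow> ('m, 'm square, 'o, 'm) fctr" where
  "codf C = \<lparr> fob = (\<lambda>f\<in>arr C. trg C f), far = (\<lambda>s\<in>arr (arrcat C). sqcod s) \<rparr>"

definition arrf ::
  "('o, 'm) cat \<Rightarrow> ('o, 'm, 'p, 'n) fctr \<Rightarrow> ('m, 'm square, 'n, 'n square) fctr" where
  "arrf C F =
     \<lparr> fob = (\<lambda>f\<in>arr C. far F f),
       far = (\<lambda>s\<in>arr (arrcat C). Square (far F (sqsrc s)) (far F (sqtrg s))
                                   (far F (sqdom s)) (far F (sqcod s))) \<rparr>"

definition pullback_square :: "('o, 'm) cat \<Rightarrow> 'm square \<Rightarrow> bool" where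
  "pullback_square C s \<longleftrightarrow> s \<in> arr (arrcat C) \<and>
     (\<forall>a b. a \<in> arr C \<longrightarrow> b \<in> arr C \<longrightarrow> src C a = src C b \<longrightarrow>
        trg C a = trg C (sqdom s) \<longrightarrow> trg C b = trg C (sqsrc s) \<longrightarrow>
        cmp C (sqtrg s) a = cmp C (sqcod s) b \<longrightarrow>
        (\<exists>!h. h \<in> hom C (src C a) (src C (sqdom s)) \<and>
              cmp C (sqdom s) h = a \<and> cmp C (sqsrc s) h = b))"

definition cartesian ::
  "('t, 's) cat \<Rightarrow> ('o, 'm) cat \<Rightarrow> ('t, 's, 'o, 'm) fctr \<Rightarrow> 's \<Rightarrow> bool" where
  "cartesian T C p u \<longleftrightarrow> u \<in> arr T \<and>
     (\<forall>w\<in>arr T. trg T w = trg T u \<longrightarrow>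
        (\<forall>h \<in> hom C (fob p (src T w)) (fob p (src T u)).
           cmp C (far p u) h = far p w \<longrightarrow>
           (\<exists>!k. k \<in> hom T (src T w) (src T u) \<and> far p k = h \<and> cmp T u k = w)))"

definition fibration :: "('t, 's) cat \<Rightarrow> ('o, 'm) cat \<Rightarrow> ('t, 's, 'o, 'm) fctr \<Rightarrow> bool" where
  "fibration T C p \<longleftrightarrow> is_functor T C p \<and>
     (\<forall>A\<in>obj T. \<forall>f\<in>arr C. trg C f = fob p A \<longrightarrow>
        (\<exists>u. cartesian T C p u \<and> trg T u = A \<and> far p u = f))"

section \<open>Strict 2-categories\<close>

record ('a, 'b, 'c) twocat =
  c0 :: "'a set"
  c1 :: "'b set"
  c2 :: "'c set"
  s1 :: "'b \<Rightarrow> 'a"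
  t1 :: "'b \<Rightarrow> 'a"
  s2 :: "'c \<Rightarrow> 'b"
  t2 :: "'c \<Rightarrow> 'b"
  i1 :: "'a \<Rightarrow> 'b"
  i2 :: "'b \<Rightarrow> 'c"
  comp1 :: "'b \<Rightarrow> 'b \<Rightarrow> 'b"
  vcomp :: "'c \<Rightarrow> 'c \<Rightarrow> 'c"
  hcomp :: "'c \<Rightarrow> 'c \<Rightarrow> 'c"

definition hom1 :: "('a, 'b, 'c) twocat \<Rightarrow> 'a \<Rightarrow> 'a \<Rightarrow> 'b set" where
  "hom1 K x y = {f \<in> c1 K. s1 K f = x \<and> t1 K f = y}"

definition hom2 :: "('a, 'b, 'c) twocat \<Rightarrow> 'b \<Rightarrow> 'b \<Rightarrow> 'c set" where
  "hom2 K f g = {\<alpha> \<in> c2 K. s2 K \<alpha> = f \<and> t2 K \<alpha> = g}"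

definition hcomposable :: "('a, 'b, 'c) twocat \<Rightarrow> 'c \<Rightarrow> 'c \<Rightarrow> bool" where
  "hcomposable K \<beta> \<alpha> \<longleftrightarrow> \<beta> \<in> c2 K \<and> \<alpha> \<in> c2 K \<and> s1 K (s2 K \<beta>) = t1 K (s2 K \<alpha>)"

definition vcomposable :: "('a, 'b, 'c) twocat \<Rightarrow> 'c \<Rightarrow> 'c \<Rightarrow> bool" where
  "vcomposable K \<beta> \<alpha> \<longleftrightarrow> \<beta> \<in> c2 K \<and> \<alpha> \<in> c2 K \<and> s2 K \<beta> = t2 K \<alpha>"

definition strict_2cat :: "('a, 'b, 'c) twocat \<Rightarrow> bool" where
  "strict_2cat K \<longleftrightarrow>
     (\<forall>f\<in>c1 K. s1 K f \<in> c0 K \<and> t1 K f \<in> c0 K) \<and>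
     (\<forall>\<alpha>\<in>c2 K. s2 K \<alpha> \<in> c1 K \<and> t2 K \<alpha> \<in> c1 K \<and>
        s1 K (s2 K \<alpha>) = s1 K (t2 K \<alpha>) \<and> t1 K (s2 K \<alpha>) = t1 K (t2 K \<alpha>)) \<and>
     (\<forall>x\<in>c0 K. i1 K x \<in> hom1 K x x) \<and>
     (\<forall>f\<in>c1 K. i2 K f \<in> hom2 K f f) \<and>
     (\<forall>x y z. \<forall>f \<in> hom1 K x y. \<forall>g \<in> hom1 K y z. comp1 K g f \<in> hom1 K x z) \<and>
     (\<forall>f g h. \<forall>\<alpha> \<in> hom2 K f g. \<forall>\<beta> \<in> hom2 K g h. vcomp K \<beta> \<alpha> \<in> hom2 K f h) \<and>
     (\<forall>\<beta> \<alpha>. hcomposable K \<beta> \<alpha> \<longrightarrow>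
        hcomp K \<beta> \<alpha> \<in> hom2 K (comp1 K (s2 K \<beta>) (s2 K \<alpha>)) (comp1 K (t2 K \<beta>) (t2 K \<alpha>))) \<and>
     (\<forall>f\<in>c1 K. comp1 K f (i1 K (s1 K f)) = f \<and> comp1 K (i1 K (t1 K f)) f = f) \<and>
     (\<forall>f\<in>c1 K. \<forall>g\<in>c1 K. \<forall>h\<in>c1 K. s1 K g = t1 K f \<longrightarrow> s1 K h = t1 K g \<longrightarrow>
        comp1 K h (comp1 K g f) = comp1 K (comp1 K h g) f) \<and>
     (\<forall>\<alpha>\<in>c2 K. vcomp K \<alpha> (i2 K (s2 K \<alpha>)) = \<alpha> \<and> vcomp K (i2 K (t2 K \<alpha>)) \<alpha> = \<alpha>) \<and>
     (\<forall>\<gamma> \<beta> \<alpha>. vcomposable K \<gamma> \<beta> \<longrightarrow> vcomposable K \<beta> \<alpha> \<longrightarrow>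
        vcomp K \<gamma> (vcomp K \<beta> \<alpha>) = vcomp K (vcomp K \<gamma> \<beta>) \<alpha>) \<and>
     (\<forall>\<alpha>\<in>c2 K. hcomp K \<alpha> (i2 K (i1 K (s1 K (s2 K \<alpha>)))) = \<alpha> \<and>
               hcomp K (i2 K (i1 K (t1 K (s2 K \<alpha>)))) \<alpha> = \<alpha>) \<and>
     (\<forall>\<gamma> \<beta> \<alpha>. hcomposable K \<gamma> \<beta> \<longrightarrow> hcomposable K \<beta> \<alpha> \<longrightarrow>
        hcomp K \<gamma> (hcomp K \<beta> \<alpha>) = hcomp K (hcomp K \<gamma> \<beta>) \<alpha>) \<and>
     (\<forall>f\<in>c1 K. \<forall>g\<in>c1 K. s1 K g = t1 K f \<longrightarrow>
        hcomp K (i2 K g) (i2 K f) = i2 K (comp1 K g f)) \<and>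
     (\<forall>\<alpha> \<alpha>' \<beta> \<beta>'. vcomposable K \<alpha>' \<alpha> \<longrightarrow> vcomposable K \<beta>' \<beta> \<longrightarrow> hcomposable K \<beta> \<alpha> \<longrightarrow>
        hcomp K (vcomp K \<beta>' \<beta>) (vcomp K \<alpha>' \<alpha>) = vcomp K (hcomp K \<beta>' \<alpha>') (hcomp K \<beta> \<alpha>))"

definition homcat :: "('a, 'b, 'c) twocat \<Rightarrow> 'a \<Rightarrow> 'a \<Rightarrow> ('b, 'c) cat" where
  "homcat K x y =
     (let H = hom1 K x y; A = {\<alpha> \<in> c2 K. s2 K \<alpha> \<in> H \<and> t2 K \<alpha> \<in> H} in
      \<lparr> obj = H, arr = A, src = restrict (s2 K) A, trg = restrict (t2 K) A,
        idn = restrict (i2 K) H,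
        cmp = (\<lambda>\<beta> \<alpha>. if \<beta> \<in> A \<and> \<alpha> \<in> A \<and> s2 K \<beta> = t2 K \<alpha> then vcomp K \<beta> \<alpha> else undefined) \<rparr>)"

record ('a, 'b, 'c, 'd, 'e, 'f) twofun =
  F0 :: "'a \<Rightarrow> 'd"
  F1 :: "'b \<Rightarrow> 'e"
  F2 :: "'c \<Rightarrow> 'f"

definition is_2functor ::
  "('a, 'b, 'c) twocat \<Rightarrow> ('d, 'e, 'f) twocat \<Rightarrow> ('a, 'b, 'c, 'd, 'e, 'f) twofun \<Rightarrow> bool" where
  "is_2functor K L F \<longleftrightarrow> strict_2cat K \<and> strict_2cat L \<and>
     (\<forall>x\<in>c0 K. F0 F x \<in> c0 L) \<and>
     (\<forall>f\<in>c1 K. F1 F f \<in> hom1 L (F0 F (s1 K f)) (F0 F (t1 K f))) \<and>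
     (\<forall>\<alpha>\<in>c2 K. F2 F \<alpha> \<in> hom2 L (F1 F (s2 K \<alpha>)) (F1 F (t2 K \<alpha>))) \<and>
     (\<forall>x\<in>c0 K. F1 F (i1 K x) = i1 L (F0 F x)) \<and>
     (\<forall>f\<in>c1 K. F2 F (i2 K f) = i2 L (F1 F f)) \<and>
     (\<forall>f\<in>c1 K. \<forall>g\<in>c1 K. s1 K g = t1 K f \<longrightarrow>
        F1 F (comp1 K g f) = comp1 L (F1 F g) (F1 F f)) \<and>
     (\<forall>\<beta> \<alpha>. vcomposable K \<beta> \<alpha> \<longrightarrow> F2 F (vcomp K \<beta> \<alpha>) = vcomp L (F2 F \<beta>) (F2 F \<alpha>)) \<and>
     (\<forall>\<beta> \<alpha>. hcomposable K \<beta> \<alpha> \<longrightarrow> F2 F (hcomp K \<beta> \<alpha>) = hcomp L (F2 F \<beta>) (F2 F \<alpha>))"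

definition isomorphism_of_2cats ::
  "('a, 'b, 'c) twocat \<Rightarrow> ('d, 'e, 'f) twocat \<Rightarrow> ('a, 'b, 'c, 'd, 'e, 'f) twofun \<Rightarrow> bool" where
  "isomorphism_of_2cats K L F \<longleftrightarrow> is_2functor K L F \<and>
     (\<exists>G. is_2functor L K G \<and>
        (\<forall>x\<in>c0 K. F0 G (F0 F x) = x) \<and> (\<forall>y\<in>c0 L. F0 F (F0 G y) = y) \<and>
        (\<forall>f\<in>c1 K. F1 G (F1 F f) = f) \<and> (\<forall>g\<in>c1 L. F1 F (F1 G g) = g) \<and>
        (\<forall>\<alpha>\<in>c2 K. F2 G (F2 F \<alpha>) = \<alpha>) \<and> (\<forall>\<beta>\<in>c2 L. F2 F (F2 G \<beta>) = \<beta>))"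

definition hom_functor ::
  "('a, 'b, 'c) twocat \<Rightarrow> ('a, 'b, 'c, 'd, 'e, 'f) twofun \<Rightarrow> 'a \<Rightarrow> 'a \<Rightarrow> ('b, 'c, 'e, 'f) fctr" where
  "hom_functor K F x y =
     \<lparr> fob = restrict (F1 F) (obj (homcat K x y)), far = restrict (F2 F) (arr (homcat K x y)) \<rparr>"

definition internally_equivalent :: "('a, 'b, 'c) twocat \<Rightarrow> 'a \<Rightarrow> 'a \<Rightarrow> bool" where
  "internally_equivalent K x y \<longleftrightarrow>
     (\<exists>f \<in> hom1 K x y. \<exists>g \<in> hom1 K y x.
        isomorphic_objs (homcat K x x) (i1 K x) (comp1 K g f) \<and>
        isomorphic_objs (homcat K y y) (comp1 K f g) (i1 K y))"

definition equivalence_of_2cats ::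
  "('a, 'b, 'c) twocat \<Rightarrow> ('d, 'e, 'f) twocat \<Rightarrow> ('a, 'b, 'c, 'd, 'e, 'f) twofun \<Rightarrow> bool" where
  "equivalence_of_2cats K L F \<longleftrightarrow> is_2functor K L F \<and>
     (\<forall>x\<in>c0 K. \<forall>y\<in>c0 K.
        equivalence_of_cats (homcat K x y) (homcat L (F0 F x) (F0 F y)) (hom_functor K F x y)) \<and>
     (\<forall>z\<in>c0 L. \<exists>x\<in>c0 K. internally_equivalent L (F0 F x) z)"

text \<open>
  \<open>R : K \<rightarrow> L\<close> has a left 2-adjoint \<open>P\<close>: isomorphisms of hom-categories \<open>K(P x, y) \<cong> L(x, R y)\<close>,
  2-natural in \<open>x\<close> and \<open>y\<close> (naturality on 1-cells and on 2-cells).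
\<close>

definition has_left_2adjoint ::
  "('a, 'b, 'c) twocat \<Rightarrow> ('d, 'e, 'f) twocat \<Rightarrow> ('a, 'b, 'c, 'd, 'e, 'f) twofun \<Rightarrow> bool" where
  "has_left_2adjoint K L R \<longleftrightarrow> is_2functor K L R \<and>
     (\<exists>P \<Phi>. is_2functor L K P \<and>
        (\<forall>x\<in>c0 L. \<forall>y\<in>c0 K.
           isomorphism_of_cats (homcat K (F0 P x) y) (homcat L x (F0 R y)) (\<Phi> x y)) \<and>
        (\<forall>h\<in>c1 L. \<forall>k\<in>c1 K. \<forall>f \<in> hom1 K (F0 P (t1 L h)) (s1 K k).
           fob (\<Phi> (s1 L h) (t1 K k)) (comp1 K k (comp1 K f (F1 P h))) =
             comp1 L (F1 R k) (comp1 L (fob (\<Phi> (t1 L h) (s1 K k)) f) h)) \<and>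
        (\<forall>\<eta>\<in>c2 L. \<forall>\<kappa>\<in>c2 K.
           \<forall>\<alpha> \<in> arr (homcat K (F0 P (t1 L (s2 L \<eta>))) (s1 K (s2 K \<kappa>))).
           far (\<Phi> (s1 L (s2 L \<eta>)) (t1 K (s2 K \<kappa>))) (hcomp K \<kappa> (hcomp K \<alpha> (F2 P \<eta>))) =
             hcomp L (F2 R \<kappa>)
               (hcomp L (far (\<Phi> (t1 L (s2 L \<eta>)) (s1 K (s2 K \<kappa>))) \<alpha>) \<eta>)))"

definition incl :: "('a, 'b, 'c, 'a, 'b, 'c) twofun" where
  "incl = \<lparr> F0 = (\<lambda>x. x), F1 = (\<lambda>f. f), F2 = (\<lambda>\<alpha>. \<alpha>) \<rparr>"

definition full_sub2 :: "('a, 'b, 'c) twocat \<Rightarrow> ('a \<Rightarrow> bool) \<Rightarrow> ('a, 'b, 'c) twocat" where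
  "full_sub2 K Q = K\<lparr> c0 := {x \<in> c0 K. Q x},
     c1 := {f \<in> c1 K. Q (s1 K f) \<and> Q (t1 K f)},
     c2 := {\<alpha> \<in> c2 K. Q (s1 K (s2 K \<alpha>)) \<and> Q (t1 K (s2 K \<alpha>))} \<rparr>"

text \<open>Restriction to a class of 1-cells, keeping all objects and all 2-cells between these 1-cells.\<close>

definition locally_full_sub2 :: "('a, 'b, 'c) twocat \<Rightarrow> ('b \<Rightarrow> bool) \<Rightarrow> ('a, 'b, 'c) twocat" where
  "locally_full_sub2 K Q = K\<lparr> c1 := {f \<in> c1 K. Q f},
     c2 := {\<alpha> \<in> c2 K. Q (s2 K \<alpha>) \<and> Q (t2 K \<alpha>)} \<rparr>"

section \<open>Pointed and rooted comprehension categories\<close>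

record ('o, 'm, 't, 's) compcat =
  base :: "('o, 'm) cat"
  tot :: "('t, 's) cat"
  proj :: "('t, 's, 'o, 'm) fctr"
  compr :: "('t, 's, 'm, 'm square) fctr"

record ('o, 'm, 't, 's) pcompcat = "('o, 'm, 't, 's) compcat" +
  pt :: 'o

definition comprehension_category :: "('o, 'm, 't, 's, 'z) compcat_scheme \<Rightarrow> bool" where
  "comprehension_category X \<longleftrightarrow> category (base X) \<and>
     fibration (tot X) (base X) (proj X) \<and>
     is_functor (tot X) (arrcat (base X)) (compr X) \<and>
     fcomp (tot X) (codf (base X)) (compr X) = proj X \<and>
     (\<forall>u. cartesian (tot X) (base X) (proj X) u \<longrightarrow> pullback_square (base X) (far (compr X) u))"

text \<open>The context extension \<open>\<Gamma>.A\<close>, where \<open>\<Gamma>\<close> is the projection of \<open>A\<close>.\<close>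

definition ext :: "('o, 'm, 't, 's, 'z) compcat_scheme \<Rightarrow> 't \<Rightarrow> 'o" where
  "ext X A = src (base X) (fob (compr X) A)"

definition full_cc :: "('o, 'm, 't, 's, 'z) compcat_scheme \<Rightarrow> bool" where
  "full_cc X \<longleftrightarrow> full (tot X) (arrcat (base X)) (compr X) \<and> faithful (tot X) (compr X)"

text \<open>
  The total category is identified with its image: it literally is a full subcategory of the
  arrow category, and comprehension is the inclusion functor.
\<close>

definition sub_cc :: "('o, 'm, 'm, 'm square, 'z) compcat_scheme \<Rightarrow> bool" where
  "sub_cc X \<longleftrightarrow> obj (tot X) \<subseteq> arr (base X) \<and>
     tot X = full_sub (arrcat (base X)) (obj (tot X)) \<and> compr X = fid (tot X)"

definition repl_cc :: "('o, 'm, 'm, 'm square, 'z) compcat_scheme \<Rightarrow> bool" where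
  "repl_cc X \<longleftrightarrow> sub_cc X \<and> replete_sub (arrcat (base X)) (tot X)"

inductive_set contexts :: "('o, 'm, 't, 's) pcompcat \<Rightarrow> 'o set"
  for X :: "('o, 'm, 't, 's) pcompcat" where
  empty: "pt X \<in> contexts X"
| extend: "\<Gamma> \<in> contexts X \<Longrightarrow> A \<in> obj (tot X) \<Longrightarrow> fob (proj X) A = \<Gamma> \<Longrightarrow> ext X A \<in> contexts X"

definition rooted_cc :: "('o, 'm, 't, 's) pcompcat \<Rightarrow> bool" where
  "rooted_cc X \<longleftrightarrow> comprehension_category X \<and> terminal (base X) (pt X) \<and>
     (\<forall>x \<in> obj (base X). \<exists>\<Gamma> \<in> contexts X. isomorphic_objs (base X) x \<Gamma>)"

definition pseudo_map ::
  "('o, 'm, 't, 's, 'z) compcat_scheme \<Rightarrow> ('o, 'm, 't, 's, 'z) compcat_scheme \<Rightarrow>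
    ('o, 'm, 'o, 'm) fctr \<Rightarrow> ('t, 's, 't, 's) fctr \<Rightarrow> ('t \<Rightarrow> 'm square) \<Rightarrow> bool" where
  "pseudo_map X Y F F' \<phi> \<longleftrightarrow>
     is_functor (base X) (base Y) F \<and> is_functor (tot X) (tot Y) F' \<and>
     fcomp (tot X) (proj Y) F' = fcomp (tot X) F (proj X) \<and>
     (\<forall>u. cartesian (tot X) (base X) (proj X) u \<longrightarrow>
          cartesian (tot Y) (base Y) (proj Y) (far F' u)) \<and>
     nat_iso (tot X) (arrcat (base Y))
       (fcomp (tot X) (compr Y) F') (fcomp (tot X) (arrf (base X) F) (compr X)) \<phi> \<and>
     (\<forall>A\<in>obj (tot X). sqcod (\<phi> A) = idn (base Y) (fob F (fob (proj X) A)))"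

text \<open>
  A pointed pseudo map with its source and target; \<open>mpt\<close> is the specified isomorphism
  \<open>F \<diamond> \<rightarrow> \<diamond>'\<close>.
\<close>

record ('o, 'm, 't, 's) cc_map =
  msrc :: "('o, 'm, 't, 's) pcompcat"
  mtrg :: "('o, 'm, 't, 's) pcompcat"
  mbase :: "('o, 'm, 'o, 'm) fctr"
  mtot :: "('t, 's, 't, 's) fctr"
  miso :: "'t \<Rightarrow> 'm square"
  mpt :: 'm

definition pointed_pseudo_map :: "('o, 'm, 't, 's) cc_map \<Rightarrow> bool" where
  "pointed_pseudo_map f \<longleftrightarrow>
     pseudo_map (msrc f) (mtrg f) (mbase f) (mtot f) (miso f) \<and>
     mpt f \<in> hom (base (mtrg f)) (fob (mbase f) (pt (msrc f))) (pt (mtrg f)) \<and>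
     iso_arr (base (mtrg f)) (mpt f)"

text \<open>Strict as a map of comprehension categories; no condition on \<open>mpt\<close>.\<close>

definition strict_cc_map :: "('o, 'm, 't, 's) cc_map \<Rightarrow> bool" where
  "strict_cc_map f \<longleftrightarrow>
     fcomp (tot (msrc f)) (compr (mtrg f)) (mtot f) =
       fcomp (tot (msrc f)) (arrf (base (msrc f)) (mbase f)) (compr (msrc f)) \<and>
     miso f = (\<lambda>A\<in>obj (tot (msrc f)).
                 idn (arrcat (base (mtrg f))) (fob (compr (mtrg f)) (fob (mtot f) A)))"

record ('o, 'm, 't, 's) cc_trans =
  tsrc :: "('o, 'm, 't, 's) cc_map"
  ttrg :: "('o, 'm, 't, 's) cc_map"
  tbase :: "'o \<Rightarrow> 'm"
  ttot :: "'t \<Rightarrow> 's"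

definition pointed_transformation :: "('o, 'm, 't, 's) cc_trans \<Rightarrow> bool" where
  "pointed_transformation \<alpha> \<longleftrightarrow>
     (let f = tsrc \<alpha>; g = ttrg \<alpha>; X = msrc f; Y = mtrg f in
      msrc g = X \<and> mtrg g = Y \<and>
      nat_trans (base X) (base Y) (mbase f) (mbase g) (tbase \<alpha>) \<and>
      nat_trans (tot X) (tot Y) (mtot f) (mtot g) (ttot \<alpha>) \<and>
      (\<forall>A\<in>obj (tot X). far (proj Y) (ttot \<alpha> A) = tbase \<alpha> (fob (proj X) A)) \<and>
      (\<forall>A\<in>obj (tot X).
         cmp (base Y) (sqdom (miso g A)) (sqdom (far (compr Y) (ttot \<alpha> A))) =
         cmp (base Y) (tbase \<alpha> (ext X A)) (sqdom (miso f A))) \<and>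
      cmp (base Y) (mpt g) (tbase \<alpha> (pt X)) = mpt f)"

definition cc_id :: "('o, 'm, 't, 's) pcompcat \<Rightarrow> ('o, 'm, 't, 's) cc_map" where
  "cc_id X = \<lparr> msrc = X, mtrg = X, mbase = fid (base X), mtot = fid (tot X),
     miso = (\<lambda>A\<in>obj (tot X). idn (arrcat (base X)) (fob (compr X) A)),
     mpt = idn (base X) (pt X) \<rparr>"

definition cc_comp ::
  "('o, 'm, 't, 's) cc_map \<Rightarrow> ('o, 'm, 't, 's) cc_map \<Rightarrow> ('o, 'm, 't, 's) cc_map" where
  "cc_comp g f =
     (let X = msrc f; Y = msrc g; Z = mtrg g in
      \<lparr> msrc = X, mtrg = Z, mbase = fcomp (base X) (mbase g) (mbase f),
        mtot = fcomp (tot X) (mtot g) (mtot f),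
        miso = (\<lambda>A\<in>obj (tot X). cmp (arrcat (base Z))
                  (far (arrf (base Y) (mbase g)) (miso f A)) (miso g (fob (mtot f) A))),
        mpt = cmp (base Z) (mpt g) (far (mbase g) (mpt f)) \<rparr>)"

definition cc_trans_id :: "('o, 'm, 't, 's) cc_map \<Rightarrow> ('o, 'm, 't, 's) cc_trans" where
  "cc_trans_id f = \<lparr> tsrc = f, ttrg = f,
     tbase = (\<lambda>x\<in>obj (base (msrc f)). idn (base (mtrg f)) (fob (mbase f) x)),
     ttot = (\<lambda>A\<in>obj (tot (msrc f)). idn (tot (mtrg f)) (fob (mtot f) A)) \<rparr>"

definition cc_vcomp ::
  "('o, 'm, 't, 's) cc_trans \<Rightarrow> ('o, 'm, 't, 's) cc_trans \<Rightarrow> ('o, 'm, 't, 's) cc_trans" where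
  "cc_vcomp \<beta> \<alpha> =
     (let X = msrc (tsrc \<alpha>); Y = mtrg (tsrc \<alpha>) in
      \<lparr> tsrc = tsrc \<alpha>, ttrg = ttrg \<beta>,
        tbase = (\<lambda>x\<in>obj (base X). cmp (base Y) (tbase \<beta> x) (tbase \<alpha> x)),
        ttot = (\<lambda>A\<in>obj (tot X). cmp (tot Y) (ttot \<beta> A) (ttot \<alpha> A)) \<rparr>)"

definition cc_hcomp ::
  "('o, 'm, 't, 's) cc_trans \<Rightarrow> ('o, 'm, 't, 's) cc_trans \<Rightarrow> ('o, 'm, 't, 's) cc_trans" where
  "cc_hcomp \<beta> \<alpha> =
     (let f = tsrc \<alpha>; g = ttrg \<alpha>; h = tsrc \<beta>; X = msrc f; Z = mtrg h in
      \<lparr> tsrc = cc_comp h f, ttrg = cc_comp (ttrg \<beta>) g,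
        tbase = (\<lambda>x\<in>obj (base X).
                   cmp (base Z) (tbase \<beta> (fob (mbase g) x)) (far (mbase h) (tbase \<alpha> x))),
        ttot = (\<lambda>A\<in>obj (tot X).
                   cmp (tot Z) (ttot \<beta> (fob (mtot g) A)) (far (mtot h) (ttot \<alpha> A))) \<rparr>)"

text \<open>
  Size: \<open>'o\<close> and \<open>'m\<close> are the universes of objects and arrows of the base categories. The total
  categories have their objects in \<open>'m\<close> and their arrows in \<open>'m square\<close> (which has the cardinality
  of \<open>'m\<close> if \<open>'m\<close> is infinite), without any relation between these and the base being imposed.
  This single choice of types accommodates both general comprehension categories and those whose
  total category literally is a subcategory of the arrow category.
\<close>

type_synonym ('o, 'm) rcc = "('o, 'm, 'm, 'm square) pcompcat"
type_synonym ('o, 'm) rcc_map = "('o, 'm, 'm, 'm square) cc_map"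
type_synonym ('o, 'm) rcc_trans = "('o, 'm, 'm, 'm square) cc_trans"
type_synonym ('o, 'm) rcc_2cat = "(('o, 'm) rcc, ('o, 'm) rcc_map, ('o, 'm) rcc_trans) twocat"

definition CompCat_rtd :: "('o, 'm) rcc_2cat" where
  "CompCat_rtd =
     (let M = {f. rooted_cc (msrc f) \<and> rooted_cc (mtrg f) \<and> pointed_pseudo_map f} in
      \<lparr> c0 = {X. rooted_cc X}, c1 = M,
        c2 = {\<alpha>. tsrc \<alpha> \<in> M \<and> ttrg \<alpha> \<in> M \<and> pointed_transformation \<alpha>},
        s1 = msrc, t1 = mtrg, s2 = tsrc, t2 = ttrg, i1 = cc_id, i2 = cc_trans_id,
        comp1 = cc_comp, vcomp = cc_vcomp, hcomp = cc_hcomp \<rparr>)"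

definition CompCat_rtd_full :: "('o, 'm) rcc_2cat" where
  "CompCat_rtd_full = full_sub2 CompCat_rtd full_cc"

definition CompCat_rtd_sub :: "('o, 'm) rcc_2cat" where
  "CompCat_rtd_sub = full_sub2 CompCat_rtd sub_cc"

definition CompCat_rtd_repl :: "('o, 'm) rcc_2cat" where
  "CompCat_rtd_repl = full_sub2 CompCat_rtd repl_cc"

definition CompCat_rtd_sub_str2 :: "('o, 'm) rcc_2cat" where
  "CompCat_rtd_sub_str2 = locally_full_sub2 CompCat_rtd_sub strict_cc_map"

definition CompCat_rtd_repl_str2 :: "('o, 'm) rcc_2cat" where
  "CompCat_rtd_repl_str2 = locally_full_sub2 CompCat_rtd_repl strict_cc_map"

section \<open>Rooted display map categories\<close>

text \<open>\<open>dtop\<close> is the chosen terminal object.\<close>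

record ('o, 'm) dmc =
  dbase :: "('o, 'm) cat"
  disp :: "'m set"
  dtop :: 'o

definition structured_dmc :: "('o, 'm) dmc \<Rightarrow> bool" where
  "structured_dmc X \<longleftrightarrow> category (dbase X) \<and> disp X \<subseteq> arr (dbase X) \<and>
     (\<forall>d\<in>disp X. \<forall>f\<in>arr (dbase X). trg (dbase X) f = trg (dbase X) d \<longrightarrow>
        (\<exists>e\<in>disp X. \<exists>q. pullback_square (dbase X) (Square e d q f)))"

text \<open>Display maps are closed under isomorphism in the arrow category.\<close>

definition replete_dmc :: "('o, 'm) dmc \<Rightarrow> bool" where
  "replete_dmc X \<longleftrightarrow>
     (\<forall>d\<in>disp X. \<forall>e. isomorphic_objs (arrcat (dbase X)) d e \<longrightarrow> e \<in> disp X)"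

inductive_set disp_composites :: "('o, 'm) dmc \<Rightarrow> 'm set" for X :: "('o, 'm) dmc" where
  disp: "d \<in> disp X \<Longrightarrow> d \<in> disp_composites X"
| iso: "iso_arr (dbase X) f \<Longrightarrow> f \<in> disp_composites X"
| comp: "g \<in> disp_composites X \<Longrightarrow> f \<in> disp_composites X \<Longrightarrow> composable (dbase X) g f \<Longrightarrow>
           cmp (dbase X) g f \<in> disp_composites X"

definition rooted_sdmc :: "('o, 'm) dmc \<Rightarrow> bool" where
  "rooted_sdmc X \<longleftrightarrow> structured_dmc X \<and> terminal (dbase X) (dtop X) \<and>
     (\<forall>f\<in>arr (dbase X). trg (dbase X) f = dtop X \<longrightarrow> f \<in> disp_composites X)"

record ('o, 'm) dmc_map =
  dsrc :: "('o, 'm) dmc"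
  dtrg :: "('o, 'm) dmc"
  dfun :: "('o, 'm, 'o, 'm) fctr"

text \<open>
  Preservation of pullbacks of display maps concerns all pullback squares whose right-hand side
  is a display map, whether or not the left-hand side is.
\<close>

definition is_dmc_map :: "('o, 'm) dmc_map \<Rightarrow> bool" where
  "is_dmc_map f \<longleftrightarrow>
     (let X = dsrc f; Y = dtrg f; F = dfun f in
      is_functor (dbase X) (dbase Y) F \<and>
      (\<forall>d\<in>disp X. far F d \<in> disp Y) \<and>
      (\<forall>s. pullback_square (dbase X) s \<longrightarrow> sqtrg s \<in> disp X \<longrightarrow>
         pullback_square (dbase Y) (far (arrf (dbase X) F) s)) \<and>
      (\<forall>x. terminal (dbase X) x \<longrightarrow> terminal (dbase Y) (fob F x)))"

record ('o, 'm) dmc_trans =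
  dtsrc :: "('o, 'm) dmc_map"
  dttrg :: "('o, 'm) dmc_map"
  dtnat :: "'o \<Rightarrow> 'm"

definition is_dmc_trans :: "('o, 'm) dmc_trans \<Rightarrow> bool" where
  "is_dmc_trans \<alpha> \<longleftrightarrow>
     dsrc (dttrg \<alpha>) = dsrc (dtsrc \<alpha>) \<and> dtrg (dttrg \<alpha>) = dtrg (dtsrc \<alpha>) \<and>
     nat_trans (dbase (dsrc (dtsrc \<alpha>))) (dbase (dtrg (dtsrc \<alpha>)))
       (dfun (dtsrc \<alpha>)) (dfun (dttrg \<alpha>)) (dtnat \<alpha>)"

definition dmc_id :: "('o, 'm) dmc \<Rightarrow> ('o, 'm) dmc_map" where
  "dmc_id X = \<lparr> dsrc = X, dtrg = X, dfun = fid (dbase X) \<rparr>"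

definition dmc_comp :: "('o, 'm) dmc_map \<Rightarrow> ('o, 'm) dmc_map \<Rightarrow> ('o, 'm) dmc_map" where
  "dmc_comp g f =
     \<lparr> dsrc = dsrc f, dtrg = dtrg g, dfun = fcomp (dbase (dsrc f)) (dfun g) (dfun f) \<rparr>"

definition dmc_trans_id :: "('o, 'm) dmc_map \<Rightarrow> ('o, 'm) dmc_trans" where
  "dmc_trans_id f = \<lparr> dtsrc = f, dttrg = f,
     dtnat = (\<lambda>x\<in>obj (dbase (dsrc f)). idn (dbase (dtrg f)) (fob (dfun f) x)) \<rparr>"

definition dmc_vcomp :: "('o, 'm) dmc_trans \<Rightarrow> ('o, 'm) dmc_trans \<Rightarrow> ('o, 'm) dmc_trans" where
  "dmc_vcomp \<beta> \<alpha> = \<lparr> dtsrc = dtsrc \<alpha>, dttrg = dttrg \<beta>,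
     dtnat = (\<lambda>x\<in>obj (dbase (dsrc (dtsrc \<alpha>))).
                cmp (dbase (dtrg (dtsrc \<alpha>))) (dtnat \<beta> x) (dtnat \<alpha> x)) \<rparr>"

definition dmc_hcomp :: "('o, 'm) dmc_trans \<Rightarrow> ('o, 'm) dmc_trans \<Rightarrow> ('o, 'm) dmc_trans" where
  "dmc_hcomp \<beta> \<alpha> =
     (let f = dtsrc \<alpha>; g = dttrg \<alpha>; h = dtsrc \<beta> in
      \<lparr> dtsrc = dmc_comp h f, dttrg = dmc_comp (dttrg \<beta>) g,
        dtnat = (\<lambda>x\<in>obj (dbase (dsrc f)).
                   cmp (dbase (dtrg h)) (dtnat \<beta> (fob (dfun g) x)) (far (dfun h) (dtnat \<alpha> x))) \<rparr>)"

type_synonym ('o, 'm) dmc_2cat = "(('o, 'm) dmc, ('o, 'm) dmc_map, ('o, 'm) dmc_trans) twocat"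

definition sDMC_rtd :: "('o, 'm) dmc_2cat" where
  "sDMC_rtd =
     (let M = {f. rooted_sdmc (dsrc f) \<and> rooted_sdmc (dtrg f) \<and> is_dmc_map f} in
      \<lparr> c0 = {X. rooted_sdmc X}, c1 = M,
        c2 = {\<alpha>. dtsrc \<alpha> \<in> M \<and> dttrg \<alpha> \<in> M \<and> is_dmc_trans \<alpha>},
        s1 = dsrc, t1 = dtrg, s2 = dtsrc, t2 = dttrg, i1 = dmc_id, i2 = dmc_trans_id,
        comp1 = dmc_comp, vcomp = dmc_vcomp, hcomp = dmc_hcomp \<rparr>)"

definition DMC_rtd :: "('o, 'm) dmc_2cat" where
  "DMC_rtd = full_sub2 sDMC_rtd replete_dmc"

section \<open>Display maps as a full subcategory of the arrow category\<close>

definition view0 :: "('o, 'm) dmc \<Rightarrow> ('o, 'm) rcc" where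
  "view0 X =
     (let T = full_sub (arrcat (dbase X)) (disp X) in
      \<lparr> base = dbase X, tot = T, proj = fcomp T (codf (dbase X)) (fid T), compr = fid T,
        pt = dtop X \<rparr>)"

text \<open>
  The root comparison of \<open>view1 f\<close> is the unique arrow into the terminal root of the target; it
  is invertible because \<open>f\<close> preserves terminal objects.
\<close>

definition view1 :: "('o, 'm) dmc_map \<Rightarrow> ('o, 'm) rcc_map" where
  "view1 f =
     (let X = view0 (dsrc f); Y = view0 (dtrg f) in
      \<lparr> msrc = X, mtrg = Y, mbase = dfun f,
        mtot = fcomp (tot X) (arrf (base X) (dfun f)) (fid (tot X)),
        miso = (\<lambda>d\<in>obj (tot X). idn (arrcat (base Y)) (far (dfun f) d)),
        mpt = (THE u. u \<in> hom (base Y) (fob (dfun f) (pt X)) (pt Y)) \<rparr>)"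

definition view2 :: "('o, 'm) dmc_trans \<Rightarrow> ('o, 'm) rcc_trans" where
  "view2 \<alpha> =
     (let f = dtsrc \<alpha>; g = dttrg \<alpha>; C = dbase (dsrc f) in
      \<lparr> tsrc = view1 f, ttrg = view1 g, tbase = dtnat \<alpha>,
        ttot = (\<lambda>d\<in>disp (dsrc f). Square (far (dfun f) d) (far (dfun g) d)
                  (dtnat \<alpha> (src C d)) (dtnat \<alpha> (trg C d))) \<rparr>)"

definition view :: "(('o, 'm) dmc, ('o, 'm) dmc_map, ('o, 'm) dmc_trans,
    ('o, 'm) rcc, ('o, 'm) rcc_map, ('o, 'm) rcc_trans) twofun" where
  "view = \<lparr> F0 = view0, F1 = view1, F2 = view2 \<rparr>"

end

theory Submission
  imports Defs
begin

text \<open>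
  Let \<open>Y\<close> be a full comprehension category. A pseudo map \<open>(F, F', \<phi>)\<close> into \<open>Y\<close> is determined by \<open>F\<close>, the
  action of \<open>F'\<close> on objects and \<open>\<phi>\<close>, and all such data come from a pseudo map as long as \<open>F\<close> sends the
  comprehensions of cartesian arrows to pullback squares; a pointed transformation between maps into
  a rooted \<open>Y\<close> is determined by its base component, which can be any natural transformation. So
  pseudo maps into \<open>Y\<close> over the same base functor are canonically isomorphic. This yields the
  equivalences: a full comprehension category is compared over the identity of its base with its
  image in the arrow category and with the repletion of that image, where pulling back along
  identities makes the isomorphisms vertical; and a pseudo map into a replete \<open>Y\<close> is isomorphic to a
  strict one since \<open>F (\<chi> A)\<close> is isomorphic to an object of \<open>Y\<close>. It also shows that replacing the arrows
  of the total category by all squares between comprehensions is a universal arrow into the full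
  ones. For display maps, the repletion is a universal arrow because functors preserve
  isomorphisms.
\<close>

section \<open>Categories, functors and natural transformations\<close>

text \<open>All equations between functors, maps and 2-cells are strict, so little is compared by
  computing: something with the wanted properties is produced by an existence lemma and then
  identified by a uniqueness lemma (\<open>view1_eqI\<close>, \<open>rtd_trans_eq\<close>,
  \<open>pseudo_map_into_full_unique\<close>). Being \<open>undefined\<close> outside the domain is
  what turns agreement on a category into equality of records. Pullbacks are handled through
  \<open>pullback_iff_cartesian\<close>: they are the cartesian arrows of the codomain functor, so
  composing, cancelling and comparing pullbacks comes from a short theory of cartesian arrows over
  any functor. Lifts are only known to exist; where an arbitrary cartesian arrow is out of reach,
  preservation is checked on one lift over the same base arrow. The root needs no bookkeeping: it is
  terminal, so root comparisons are unique and every transformation respects them. The full image of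
  a comprehension must have the same types as the original; since comprehension need not be
  injective on objects, its arrows are squares labelled with objects of the total category.\<close>

locale is_cat =
  fixes C :: "('o, 'm) cat"
  assumes category: "category C"
begin

lemma src_obj [simp]: "f \<in> arr C \<Longrightarrow> src C f \<in> obj C"
  and trg_obj [simp]: "f \<in> arr C \<Longrightarrow> trg C f \<in> obj C"
  and idn_arr [simp]: "x \<in> obj C \<Longrightarrow> idn C x \<in> arr C"
  using category by (auto simp: category_def)

lemma src_idn [simp]: "x \<in> obj C \<Longrightarrow> src C (idn C x) = x"
  and trg_idn [simp]: "x \<in> obj C \<Longrightarrow> trg C (idn C x) = x"
  using category by (auto simp: category_def hom_def)

lemma
  assumes "g \<in> arr C" "f \<in> arr C" "src C g = trg C f"
  shows cmp_arr [simp]: "cmp C g f \<in> arr C"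
    and src_cmp [simp]: "src C (cmp C g f) = src C f"
    and trg_cmp [simp]: "trg C (cmp C g f) = trg C g"
  using category assms by (auto simp: category_def composable_def hom_def)

lemma cmp_idr [simp]: "f \<in> arr C \<Longrightarrow> src C f = x \<Longrightarrow> cmp C f (idn C x) = f"
  and cmp_idl [simp]: "f \<in> arr C \<Longrightarrow> trg C f = x \<Longrightarrow> cmp C (idn C x) f = f"
  using category by (auto simp: category_def)

lemma cmp_assoc [simp]:
  "h \<in> arr C \<Longrightarrow> g \<in> arr C \<Longrightarrow> f \<in> arr C \<Longrightarrow> src C h = trg C g \<Longrightarrow> src C g = trg C f \<Longrightarrow>
    cmp C (cmp C h g) f = cmp C h (cmp C g f)"
  using category by (auto simp: category_def composable_def)

text \<open>Composites are normalised with brackets to the right, so an equation between two binary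
  composites no longer matches inside a longer one. This form precomposes it with \<open>x\<close>
  and stays in normal form.\<close>

lemma cmp_eq_cmp:
  assumes "cmp C g f = cmp C k h" and "g \<in> arr C" "f \<in> arr C" "k \<in> arr C" "h \<in> arr C" "x \<in> arr C"
    "src C g = trg C f" "src C k = trg C h" "trg C x = src C f" "src C h = src C f"
  shows "cmp C g (cmp C f x) = cmp C k (cmp C h x)"
  using assms by (metis cmp_assoc)

lemma iso_idn: "x \<in> obj C \<Longrightarrow> iso_arr C (idn C x)"
  by (auto simp: iso_arr_def hom_def intro!: bexI[where x = "idn C x"])

lemma iso_cmp:
  assumes "iso_arr C g" "iso_arr C f" "src C g = trg C f"
  shows "iso_arr C (cmp C g f)"
proof -
  from assms obtain g' f'
    where g: "g \<in> arr C" "g' \<in> arr C" "src C g' = trg C g" "trg C g' = src C g"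
        "cmp C g' g = idn C (src C g)" "cmp C g g' = idn C (trg C g)"
      and f: "f \<in> arr C" "f' \<in> arr C" "src C f' = trg C f" "trg C f' = src C f"
        "cmp C f' f = idn C (src C f)" "cmp C f f' = idn C (trg C f)"
    by (auto simp: iso_arr_def hom_def)
  have "cmp C (cmp C f' g') (cmp C g f) = cmp C f' (cmp C (cmp C g' g) f)"
    using f(1-4) g(1-4) assms(3) by simp
  moreover have "cmp C (cmp C g f) (cmp C f' g') = cmp C g (cmp C (cmp C f f') g')"
    using f(1-4) g(1-4) assms(3) by simp
  ultimately have "cmp C (cmp C f' g') (cmp C g f) = idn C (src C f)"
    "cmp C (cmp C g f) (cmp C f' g') = idn C (trg C g)"
    using f g assms(3) by (simp_all del: cmp_assoc)
  then show ?thesis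
    using f g assms(3) unfolding iso_arr_def
    by (intro conjI bexI[where x = "cmp C f' g'"]) (simp_all add: hom_def del: cmp_assoc)
qed

lemma isoE:
  assumes "iso_arr C f"
  obtains g where "f \<in> arr C" "g \<in> arr C" "src C g = trg C f" "trg C g = src C f"
    "cmp C g f = idn C (src C f)" "cmp C f g = idn C (trg C f)" "iso_arr C g"
  using assms by (auto simp: iso_arr_def hom_def)

lemma isoI:
  assumes "f \<in> arr C" "g \<in> arr C" "src C g = trg C f" "trg C g = src C f"
    "cmp C g f = idn C (src C f)" "cmp C f g = idn C (trg C f)"
  shows "iso_arr C f"
  using assms by (auto simp: iso_arr_def hom_def)

lemma isomorphic_refl: "x \<in> obj C \<Longrightarrow> isomorphic_objs C x x"
  using iso_idn[of x] by (auto simp: isomorphic_objs_def hom_def intro!: exI[where x = "idn C x"])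

lemma isomorphic_sym:
  assumes "isomorphic_objs C x y"
  shows "isomorphic_objs C y x"
proof -
  obtain f where "iso_arr C f" "src C f = x" "trg C f = y"
    using assms by (auto simp: isomorphic_objs_def hom_def)
  then obtain g where "iso_arr C g" "g \<in> hom C y x"
    by (auto simp: hom_def elim: isoE)
  then show ?thesis
    by (auto simp: isomorphic_objs_def)
qed

lemma isomorphic_trans:
  assumes "isomorphic_objs C x y" "isomorphic_objs C y z"
  shows "isomorphic_objs C x z"
proof -
  obtain f g where "iso_arr C f" "iso_arr C g" "f \<in> hom C x y" "g \<in> hom C y z"
    using assms by (auto simp: isomorphic_objs_def)
  then have "iso_arr C (cmp C g f)" "cmp C g f \<in> hom C x z"
    by (auto simp: hom_def intro: iso_cmp)
  then show ?thesis
    by (auto simp: isomorphic_objs_def)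
qed

lemma terminal_unique: "terminal C t \<Longrightarrow> f \<in> hom C x t \<Longrightarrow> g \<in> hom C x t \<Longrightarrow> f = g"
  by (auto simp: terminal_def hom_def) (metis src_obj)

text \<open>Maps preserve the root only up to isomorphism; this turns such an isomorphism into
  preservation of terminality.\<close>

lemma terminal_isomorphic:
  assumes "terminal C s" "isomorphic_objs C s t"
  shows "terminal C t"
proof -
  obtain i where "iso_arr C i" and i: "src C i = s" "trg C i = t"
    using assms(2) by (auto simp: isomorphic_objs_def hom_def)
  then obtain j where j: "i \<in> arr C" "j \<in> arr C" "src C j = t" "trg C j = s"
    "cmp C i j = idn C t"
    by (auto elim: isoE)
  have "\<exists>!f. f \<in> hom C x t" if x: "x \<in> obj C" for x
  proof -
    obtain f where f: "f \<in> hom C x s"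
      using assms(1) x by (auto simp: terminal_def)
    have "g = h" if g: "g \<in> hom C x t" and h: "h \<in> hom C x t" for g h
    proof -
      have "cmp C j g = cmp C j h"
        using terminal_unique[OF assms(1), of "cmp C j g" x "cmp C j h"] g h j
        by (auto simp: hom_def)
      then have "cmp C i (cmp C j g) = cmp C i (cmp C j h)"
        by simp
      then show ?thesis
        using g h i j cmp_assoc[of i j g] cmp_assoc[of i j h] by (auto simp: hom_def)
    qed
    moreover have "cmp C i f \<in> hom C x t"
      using f i j by (auto simp: hom_def)
    ultimately show ?thesis by blast
  qed
  then show ?thesis
    using i j unfolding terminal_def by auto
qed

lemma terminal_iso:
  assumes "terminal C s" "terminal C t" "f \<in> hom C s t"
  shows "iso_arr C f"
proof -
  obtain g where g: "g \<in> hom C t s"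
    using assms by (auto simp: terminal_def hom_def)
  have "cmp C g f = idn C s" "cmp C f g = idn C t"
    using terminal_unique[OF assms(1), of "cmp C g f" s "idn C s"]
      terminal_unique[OF assms(2), of "cmp C f g" t "idn C t"] g assms
    by (auto simp: hom_def terminal_def)
  with g assms(3) show ?thesis
    by (auto simp: hom_def iso_arr_def intro!: bexI[where x = g])
qed

end

locale is_ftr =
  fixes C :: "('o, 'm) cat" and D :: "('p, 'n) cat" and F :: "('o, 'm, 'p, 'n) fctr"
  assumes is_functor: "is_functor C D F"

sublocale is_ftr \<subseteq> dom: is_cat C
  using is_functor by unfold_locales (simp add: is_functor_def)

sublocale is_ftr \<subseteq> cod: is_cat D
  using is_functor by unfold_locales (simp add: is_functor_def)

context is_ftr
begin

lemma fob_obj [simp]: "x \<in> obj C \<Longrightarrow> fob F x \<in> obj D"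
  and far_arr [simp]: "f \<in> arr C \<Longrightarrow> far F f \<in> arr D"
  and src_far [simp]: "f \<in> arr C \<Longrightarrow> src D (far F f) = fob F (src C f)"
  and trg_far [simp]: "f \<in> arr C \<Longrightarrow> trg D (far F f) = fob F (trg C f)"
  and far_idn [simp]: "x \<in> obj C \<Longrightarrow> far F (idn C x) = idn D (fob F x)"
  using is_functor by (auto simp: is_functor_def)

lemma far_cmp [simp]:
  "g \<in> arr C \<Longrightarrow> f \<in> arr C \<Longrightarrow> src C g = trg C f \<Longrightarrow> far F (cmp C g f) = cmp D (far F g) (far F f)"
  using is_functor by (auto simp: is_functor_def composable_def)

lemma fob_ext: "fob F \<in> extensional (obj C)"
  and far_ext: "far F \<in> extensional (arr C)"
  using is_functor by (auto simp: is_functor_def PiE_def)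

lemma iso_far: "iso_arr C f \<Longrightarrow> iso_arr D (far F f)"
proof (erule dom.isoE)
  fix g assume *: "f \<in> arr C" "g \<in> arr C" "src C g = trg C f" "trg C g = src C f"
    "cmp C g f = idn C (src C f)" "cmp C f g = idn C (trg C f)"
  have "cmp D (far F g) (far F f) = idn D (src D (far F f))"
    "cmp D (far F f) (far F g) = idn D (trg D (far F f))"
    using far_cmp[of g f] far_cmp[of f g] * by simp_all
  with * show ?thesis
    by (auto intro: cod.isoI[where g = "far F g"])
qed

end

lemma is_functorI:
  assumes "category C" "category D" "fob F \<in> extensional (obj C)" "far F \<in> extensional (arr C)"
    "\<And>x. x \<in> obj C \<Longrightarrow> fob F x \<in> obj D" "\<And>f. f \<in> arr C \<Longrightarrow> far F f \<in> arr D"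
    "\<And>f. f \<in> arr C \<Longrightarrow> src D (far F f) = fob F (src C f)"
    "\<And>f. f \<in> arr C \<Longrightarrow> trg D (far F f) = fob F (trg C f)"
    "\<And>x. x \<in> obj C \<Longrightarrow> far F (idn C x) = idn D (fob F x)"
    "\<And>g f. g \<in> arr C \<Longrightarrow> f \<in> arr C \<Longrightarrow> src C g = trg C f \<Longrightarrow>
       far F (cmp C g f) = cmp D (far F g) (far F f)"
  shows "is_functor C D F"
  using assms by (simp add: is_functor_def PiE_def composable_def)

text \<open>Functors are \<open>undefined\<close> off their source and do not record their target,
  so the values on \<open>C\<close> decide equality, even when the targets \<open>D\<close> and
  \<open>D'\<close> are given separately.\<close>

lemma fctr_eqI:
  assumes "is_functor C D F" "is_functor C D' G"
    "\<And>x. x \<in> obj C \<Longrightarrow> fob F x = fob G x" "\<And>f. f \<in> arr C \<Longrightarrow> far F f = far G f"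
  shows "F = G"
proof -
  interpret F: is_ftr C D F using assms(1) by unfold_locales
  interpret G: is_ftr C D' G using assms(2) by unfold_locales
  have "fob F = fob G" "far F = far G"
    using F.fob_ext F.far_ext G.fob_ext G.far_ext assms(3,4) by (auto intro: extensionalityI)
  then show ?thesis by simp
qed

lemma fid_simps [simp]:
  "x \<in> obj C \<Longrightarrow> fob (fid C) x = x" "f \<in> arr C \<Longrightarrow> far (fid C) f = f"
  by (simp_all add: fid_def)

lemma fcomp_simps [simp]:
  "x \<in> obj C \<Longrightarrow> fob (fcomp C G F) x = fob G (fob F x)"
  "f \<in> arr C \<Longrightarrow> far (fcomp C G F) f = far G (far F f)"
  by (simp_all add: fcomp_def)

lemma functor_fid: "category C \<Longrightarrow> is_functor C C (fid C)"
proof -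
  assume "category C"
  then interpret is_cat C by unfold_locales
  show ?thesis
    by (rule is_functorI) (auto simp: category, auto simp: fid_def)
qed

lemma functor_fcomp:
  assumes "is_functor C D F" "is_functor D E G"
  shows "is_functor C E (fcomp C G F)"
proof -
  interpret F: is_ftr C D F using assms(1) by unfold_locales
  interpret G: is_ftr D E G using assms(2) by unfold_locales
  show ?thesis
    by (rule is_functorI) (auto simp: F.dom.category G.cod.category, auto simp: fcomp_def)
qed

lemma fcomp_fid_right: "is_functor C D F \<Longrightarrow> fcomp C F (fid C) = F"
proof -
  assume F: "is_functor C D F"
  then interpret F: is_ftr C D F by unfold_locales
  show ?thesis
    by (rule fctr_eqI[OF functor_fcomp[OF functor_fid F] F]) (auto simp: F.dom.category)
qed

lemma fcomp_fid_left:
  assumes "is_functor C D F"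
  shows "fcomp C (fid D) F = F"
proof -
  interpret F: is_ftr C D F using assms by unfold_locales
  show ?thesis
    by (rule fctr_eqI[OF functor_fcomp[OF assms functor_fid] assms]) (auto simp: F.cod.category)
qed

lemma fcomp_assoc:
  assumes "is_functor C D F"
  shows "fcomp C H (fcomp C G F) = fcomp C (fcomp D H G) F"
proof -
  interpret F: is_ftr C D F using assms by unfold_locales
  show ?thesis by (auto simp: fcomp_def intro!: restrict_ext)
qed

locale is_nt =
  fixes C :: "('o, 'm) cat" and D :: "('p, 'n) cat" and F G :: "('o, 'm, 'p, 'n) fctr"
    and \<alpha> :: "'o \<Rightarrow> 'n"
  assumes nat_trans: "nat_trans C D F G \<alpha>"

sublocale is_nt \<subseteq> F: is_ftr C D F
  using nat_trans by unfold_locales (simp add: nat_trans_def)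

sublocale is_nt \<subseteq> G: is_ftr C D G
  using nat_trans by unfold_locales (simp add: nat_trans_def)

context is_nt
begin

lemma nt_arr [simp]: "x \<in> obj C \<Longrightarrow> \<alpha> x \<in> arr D"
  and src_nt [simp]: "x \<in> obj C \<Longrightarrow> src D (\<alpha> x) = fob F x"
  and trg_nt [simp]: "x \<in> obj C \<Longrightarrow> trg D (\<alpha> x) = fob G x"
  and nt_ext: "\<alpha> \<in> extensional (obj C)"
  using nat_trans by (auto simp: nat_trans_def hom_def)

lemma naturality:
  "f \<in> arr C \<Longrightarrow> src C f = x \<Longrightarrow> trg C f = y \<Longrightarrow>
    cmp D (\<alpha> y) (far F f) = cmp D (far G f) (\<alpha> x)"
  using nat_trans by (auto simp: nat_trans_def)

lemma naturality_cmp: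
  "f \<in> arr C \<Longrightarrow> src C f = x \<Longrightarrow> trg C f = y \<Longrightarrow> h \<in> arr D \<Longrightarrow> trg D h = fob F x \<Longrightarrow>
    cmp D (\<alpha> y) (cmp D (far F f) h) = cmp D (far G f) (cmp D (\<alpha> x) h)"
  by (rule F.cod.cmp_eq_cmp) (auto simp: naturality)

end

lemma nat_transI:
  assumes "is_functor C D F" "is_functor C D G" "\<alpha> \<in> extensional (obj C)"
    "\<And>x. x \<in> obj C \<Longrightarrow> \<alpha> x \<in> arr D" "\<And>x. x \<in> obj C \<Longrightarrow> src D (\<alpha> x) = fob F x"
    "\<And>x. x \<in> obj C \<Longrightarrow> trg D (\<alpha> x) = fob G x"
    "\<And>f. f \<in> arr C \<Longrightarrow> cmp D (\<alpha> (trg C f)) (far F f) = cmp D (far G f) (\<alpha> (src C f))"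
  shows "nat_trans C D F G \<alpha>"
  using assms by (simp add: nat_trans_def hom_def)

text \<open>The three operations are abbreviations so that the components of 2-cells of
  comprehension categories (on base and total category) and of display map categories unfold to the
  same terms. Each 2-category law is then proved once, for natural transformations.\<close>

abbreviation nt_id ::
  "('o, 'm) cat \<Rightarrow> ('p, 'n) cat \<Rightarrow> ('o, 'm, 'p, 'n) fctr \<Rightarrow> 'o \<Rightarrow> 'n" where
  "nt_id C D F \<equiv> (\<lambda>x\<in>obj C. idn D (fob F x))"

abbreviation nt_vcomp ::
  "('o, 'm) cat \<Rightarrow> ('p, 'n) cat \<Rightarrow> ('o \<Rightarrow> 'n) \<Rightarrow> ('o \<Rightarrow> 'n) \<Rightarrow> 'o \<Rightarrow> 'n" where
  "nt_vcomp C D \<beta> \<alpha> \<equiv> (\<lambda>x\<in>obj C. cmp D (\<beta> x) (\<alpha> x))"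

text \<open>Here \<open>\<alpha> : F \<Rightarrow> G\<close> goes into the source of \<open>\<beta> : H \<Rightarrow> K\<close>.\<close>

abbreviation nt_hcomp ::
  "('o, 'm) cat \<Rightarrow> ('q, 'k) cat \<Rightarrow> ('o, 'm, 'p, 'n) fctr \<Rightarrow> ('p, 'n, 'q, 'k) fctr
    \<Rightarrow> ('p \<Rightarrow> 'k) \<Rightarrow> ('o \<Rightarrow> 'n) \<Rightarrow> 'o \<Rightarrow> 'k" where
  "nt_hcomp C E G H \<beta> \<alpha> \<equiv> (\<lambda>x\<in>obj C. cmp E (\<beta> (fob G x)) (far H (\<alpha> x)))"

lemma nat_trans_id:
  assumes "is_functor C D F"
  shows "nat_trans C D F F (nt_id C D F)"
proof -
  interpret F: is_ftr C D F using assms by unfold_locales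
  show ?thesis by (rule nat_transI) (auto simp: assms)
qed

lemma nat_trans_vcomp:
  assumes "nat_trans C D F G \<alpha>" "nat_trans C D G H \<beta>"
  shows "nat_trans C D F H (nt_vcomp C D \<beta> \<alpha>)"
proof -
  interpret a: is_nt C D F G \<alpha> using assms(1) by unfold_locales
  interpret b: is_nt C D G H \<beta> using assms(2) by unfold_locales
  show ?thesis
  proof (rule nat_transI)
    fix f assume f: "f \<in> arr C"
    show "cmp D (nt_vcomp C D \<beta> \<alpha> (trg C f)) (far F f) = cmp D (far H f) (nt_vcomp C D \<beta> \<alpha> (src C f))"
      using f by (simp add: a.naturality b.naturality_cmp)
  qed (auto simp: a.F.is_functor b.G.is_functor)
qed

lemma nat_trans_hcomp:
  assumes "nat_trans C D F G \<alpha>" "nat_trans D E H K \<beta>"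
  shows "nat_trans C E (fcomp C H F) (fcomp C K G) (nt_hcomp C E G H \<beta> \<alpha>)"
proof -
  interpret a: is_nt C D F G \<alpha> using assms(1) by unfold_locales
  interpret b: is_nt D E H K \<beta> using assms(2) by unfold_locales
  show ?thesis
  proof (rule nat_transI)
    fix f assume f: "f \<in> arr C"
    \<comment> \<open>The image under \<open>H\<close> of the naturality square of
      \<open>\<alpha>\<close>; naturality of \<open>\<beta>\<close> at \<open>far G f\<close> does
      the rest.\<close>
    have "cmp E (far H (\<alpha> (trg C f))) (far H (far F f)) = cmp E (far H (far G f)) (far H (\<alpha> (src C f)))"
      using f b.F.far_cmp[of "\<alpha> (trg C f)" "far F f"] b.F.far_cmp[of "far G f" "\<alpha> (src C f)"]
      by (simp add: a.naturality)
    with f show "cmp E (nt_hcomp C E G H \<beta> \<alpha> (trg C f)) (far (fcomp C H F) f) =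
        cmp E (far (fcomp C K G) f) (nt_hcomp C E G H \<beta> \<alpha> (src C f))"
      by (simp add: b.naturality_cmp)
  qed (auto intro: functor_fcomp a.F.is_functor a.G.is_functor b.F.is_functor b.G.is_functor)
qed

lemma nt_vcomp_id_right:
  assumes "nat_trans C D F G \<alpha>"
  shows "nt_vcomp C D \<alpha> (nt_id C D F) = \<alpha>"
proof -
  interpret a: is_nt C D F G \<alpha> using assms(1) by unfold_locales
  show ?thesis by (rule extensionalityI[where A = "obj C"]) (auto simp: a.nt_ext)
qed

lemma nt_vcomp_id_left:
  assumes "nat_trans C D F G \<alpha>"
  shows "nt_vcomp C D (nt_id C D G) \<alpha> = \<alpha>"
proof -
  interpret a: is_nt C D F G \<alpha> using assms(1) by unfold_locales
  show ?thesis by (rule extensionalityI[where A = "obj C"]) (auto simp: a.nt_ext)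
qed

lemma nt_vcomp_assoc:
  assumes "nat_trans C D F G \<alpha>" "nat_trans C D G H \<beta>" "nat_trans C D H K \<gamma>"
  shows "nt_vcomp C D \<gamma> (nt_vcomp C D \<beta> \<alpha>) = nt_vcomp C D (nt_vcomp C D \<gamma> \<beta>) \<alpha>"
proof -
  interpret a: is_nt C D F G \<alpha> using assms(1) by unfold_locales
  interpret b: is_nt C D G H \<beta> using assms(2) by unfold_locales
  interpret c: is_nt C D H K \<gamma> using assms(3) by unfold_locales
  show ?thesis by (rule restrict_ext) simp
qed

lemma nt_hcomp_id_right:
  assumes "nat_trans C D F G \<alpha>"
  shows "nt_hcomp C D (fid C) F \<alpha> (nt_id C C (fid C)) = \<alpha>"
proof -
  interpret a: is_nt C D F G \<alpha> using assms(1) by unfold_locales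
  show ?thesis by (rule extensionalityI[where A = "obj C"]) (auto simp: a.nt_ext)
qed

lemma nt_hcomp_id_left:
  assumes "nat_trans C D F G \<alpha>"
  shows "nt_hcomp C D G (fid D) (nt_id D D (fid D)) \<alpha> = \<alpha>"
proof -
  interpret a: is_nt C D F G \<alpha> using assms(1) by unfold_locales
  show ?thesis by (rule extensionalityI[where A = "obj C"]) (auto simp: a.nt_ext)
qed

lemma nt_hcomp_assoc:
  assumes "nat_trans C D F G \<alpha>" "nat_trans D E H K \<beta>" "nat_trans E J L M \<gamma>"
  shows "nt_hcomp C J (fcomp C K G) L \<gamma> (nt_hcomp C E G H \<beta> \<alpha>) =
    nt_hcomp C J G (fcomp D L H) (nt_hcomp D J K L \<gamma> \<beta>) \<alpha>"
proof -
  interpret a: is_nt C D F G \<alpha> using assms(1) by unfold_locales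
  interpret b: is_nt D E H K \<beta> using assms(2) by unfold_locales
  interpret c: is_nt E J L M \<gamma> using assms(3) by unfold_locales
  show ?thesis by (rule restrict_ext) simp
qed

lemma nt_hcomp_id_id:
  assumes "is_functor C D F" "is_functor D E G"
  shows "nt_hcomp C E F G (nt_id D E G) (nt_id C D F) = nt_id C E (fcomp C G F)"
proof -
  interpret F: is_ftr C D F using assms(1) by unfold_locales
  interpret G: is_ftr D E G using assms(2) by unfold_locales
  show ?thesis by (rule restrict_ext) simp
qed

lemma nt_interchange:
  assumes "nat_trans C D F F' \<alpha>" "nat_trans C D F' F'' \<alpha>'"
    "nat_trans D E G G' \<beta>" "nat_trans D E G' G'' \<beta>'"
  shows "nt_hcomp C E F'' G (nt_vcomp D E \<beta>' \<beta>) (nt_vcomp C D \<alpha>' \<alpha>) =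
    nt_vcomp C E (nt_hcomp C E F'' G' \<beta>' \<alpha>') (nt_hcomp C E F' G \<beta> \<alpha>)"
proof -
  interpret a: is_nt C D F F' \<alpha> using assms(1) by unfold_locales
  interpret a': is_nt C D F' F'' \<alpha>' using assms(2) by unfold_locales
  interpret b: is_nt D E G G' \<beta> using assms(3) by unfold_locales
  interpret b': is_nt D E G' G'' \<beta>' using assms(4) by unfold_locales
  \<comment> \<open>Beyond associativity and functoriality, the equation is naturality of
    \<open>\<beta>\<close> at the components of \<open>\<alpha>'\<close>.\<close>
  show ?thesis by (rule restrict_ext) (simp add: b.naturality_cmp)
qed

section \<open>Cartesian arrows\<close>

context is_ftr
begin

lemma cartesianI:
  assumes "u \<in> arr C"
    "\<And>w h. w \<in> arr C \<Longrightarrow> trg C w = trg C u \<Longrightarrow> h \<in> arr D \<Longrightarrow> src D h = fob F (src C w) \<Longrightarrow>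
      trg D h = fob F (src C u) \<Longrightarrow> cmp D (far F u) h = far F w \<Longrightarrow>
      \<exists>!k. (k \<in> arr C \<and> src C k = src C w \<and> trg C k = src C u) \<and> far F k = h \<and> cmp C u k = w"
  shows "cartesian C D F u"
  using assms by (auto simp: cartesian_def hom_def)

lemma cartesian_arr: "cartesian C D F u \<Longrightarrow> u \<in> arr C"
  by (simp add: cartesian_def)

lemma cartesian_lift:
  assumes "cartesian C D F u" "w \<in> arr C" "trg C w = trg C u" "h \<in> arr D" "src D h = fob F (src C w)"
    "trg D h = fob F (src C u)" "cmp D (far F u) h = far F w"
  shows "\<exists>k. k \<in> arr C \<and> src C k = src C w \<and> trg C k = src C u \<and> far F k = h \<and> cmp C u k = w"
  using assms unfolding cartesian_def hom_def by blast

text \<open>The uniqueness half of the lifting property. The common source of \<open>k\<close> and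
  \<open>l\<close> is read off from the equal composites, so it need not be supplied.\<close>

lemma cartesian_cancel:
  assumes "cartesian C D F u" "k \<in> arr C" "l \<in> arr C" "trg C k = src C u" "trg C l = src C u"
    "cmp C u k = cmp C u l" "far F k = far F l"
  shows "k = l"
proof -
  have u: "u \<in> arr C" using assms(1) by (rule cartesian_arr)
  have "src C k = src C l"
    using assms u by (metis dom.src_cmp)
  moreover have "cmp D (far F u) (far F l) = far F (cmp C u l)"
    using assms u by simp
  ultimately have "\<exists>!m. m \<in> hom C (src C l) (src C u) \<and> far F m = far F l \<and> cmp C u m = cmp C u l"
    using assms(1-5) u unfolding cartesian_def
    by (elim conjE ballE[where x = "cmp C u l"] impE ballE[where x = "far F l"]) (auto simp: hom_def)
  then show ?thesis
    using assms \<open>src C k = src C l\<close> by (auto simp: hom_def)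
qed

text \<open>Composing \<open>w\<close> with the inverse \<open>v\<close> of \<open>u\<close> gives
  the only possible lift; it lies over \<open>h\<close> because \<open>far F v\<close> is inverse to
  \<open>far F u\<close>.\<close>

lemma cartesian_iso:
  assumes "iso_arr C u"
  shows "cartesian C D F u"
proof -
  obtain v where v: "u \<in> arr C" "v \<in> arr C" "src C v = trg C u" "trg C v = src C u"
    "cmp C v u = idn C (src C u)" "cmp C u v = idn C (trg C u)"
    using assms by (rule dom.isoE)
  show ?thesis
  proof (rule cartesianI)
    fix w h assume w: "w \<in> arr C" "trg C w = trg C u"
      and h: "h \<in> arr D" "src D h = fob F (src C w)" "trg D h = fob F (src C u)"
        "cmp D (far F u) h = far F w"
    have "far F (cmp C v w) = cmp D (cmp D (far F v) (far F u)) h"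
      using v w h by (simp del: h(4) add: h(4)[symmetric])
    also have "cmp D (far F v) (far F u) = idn D (fob F (src C u))"
      using v far_cmp[of v u] by simp
    finally have "far F (cmp C v w) = h"
      using v h by simp
    moreover have "cmp C u (cmp C v w) = w"
      using dom.cmp_assoc[of u v w] v w by simp
    moreover have "k = cmp C v w"
      if "k \<in> arr C" "trg C k = src C u" "cmp C u k = w" for k
      using dom.cmp_assoc[of v u k] v that by simp
    ultimately show "\<exists>!k. (k \<in> arr C \<and> src C k = src C w \<and> trg C k = src C u) \<and> far F k = h \<and>
        cmp C u k = w"
      using v w by (intro ex1I[where a = "cmp C v w"]) auto
  qed (use v in simp)
qed

lemma cartesian_cmp:
  assumes u: "cartesian C D F u" and v: "cartesian C D F v" and uv: "src C u = trg C v"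
  shows "cartesian C D F (cmp C u v)"
proof -
  note [simp] = cartesian_arr[OF u] cartesian_arr[OF v] uv
  show ?thesis
  proof (rule cartesianI)
    fix w h assume w: "w \<in> arr C" "trg C w = trg C (cmp C u v)"
      and h: "h \<in> arr D" "src D h = fob F (src C w)" "trg D h = fob F (src C (cmp C u v))"
        "cmp D (far F (cmp C u v)) h = far F w"
    \<comment> \<open>The lift is made in two stages: along \<open>u\<close> over the composite of
      \<open>far F v\<close> with \<open>h\<close>, then along \<open>v\<close> over
      \<open>h\<close>.\<close>
    obtain k where k: "k \<in> arr C" "src C k = src C w" "trg C k = src C u"
      "far F k = cmp D (far F v) h" "cmp C u k = w"
      using cartesian_lift[OF u w(1), of "cmp D (far F v) h"] w h by auto
    obtain l where l: "l \<in> arr C" "src C l = src C k" "trg C l = src C v" "far F l = h"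
      "cmp C v l = k"
      using cartesian_lift[OF v k(1) _ h(1)] w h k by auto
    have "l' = l" if l': "l' \<in> arr C" "trg C l' = src C v" "far F l' = h"
      "cmp C (cmp C u v) l' = w" for l'
    proof (rule cartesian_cancel[OF v])
      show "cmp C v l' = cmp C v l"
        by (rule cartesian_cancel[OF u]) (use l' l k in simp_all)
    qed (use l l' in simp_all)
    moreover have "src C l = src C w" "trg C l = src C (cmp C u v)" "cmp C (cmp C u v) l = w"
      using l k by simp_all
    ultimately show "\<exists>!l. (l \<in> arr C \<and> src C l = src C w \<and> trg C l = src C (cmp C u v)) \<and>
        far F l = h \<and> cmp C (cmp C u v) l = w"
      using l(1,4) by (metis cartesian_arr dom.src_cmp u uv v)
  qed simp
qed

text \<open>Each of the two arrows is lifted along the other over an identity, and the two lifts are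
  mutually inverse by cancellation.\<close>

lemma cartesian_unique:
  assumes u: "cartesian C D F u" and v: "cartesian C D F v"
    and uv: "trg C u = trg C v" "far F u = far F v"
  obtains i where "iso_arr C i" "src C i = src C v" "trg C i = src C u" "cmp C u i = v"
    "far F i = idn D (fob F (src C v))"
proof -
  note [simp] = cartesian_arr[OF u] cartesian_arr[OF v]
  have [simp]: "fob F (src C u) = fob F (src C v)"
    using uv(2) by (metis cartesian_arr src_far u v)
  obtain i where i: "i \<in> arr C" "src C i = src C v" "trg C i = src C u"
    "far F i = idn D (fob F (src C v))" "cmp C u i = v"
    using cartesian_lift[OF u, of v "idn D (fob F (src C v))"] uv by auto
  obtain j where j: "j \<in> arr C" "src C j = src C u" "trg C j = src C v"
    "far F j = idn D (fob F (src C v))" "cmp C v j = u"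
    using cartesian_lift[OF v, of u "idn D (fob F (src C v))"] uv by auto
  have "cmp C j i = idn C (src C v)"
    by (rule cartesian_cancel[OF v]) (use i j dom.cmp_assoc[of v j i] in simp_all)
  moreover have "cmp C i j = idn C (src C u)"
    by (rule cartesian_cancel[OF u]) (use i j dom.cmp_assoc[of u i j] in simp_all)
  ultimately have "iso_arr C i"
    using i j by (intro dom.isoI[where g = j]) auto
  with i show thesis by (intro that) auto
qed

text \<open>Lifting the identity of the target along \<open>u\<close>, over the inverse of
  \<open>far F u\<close>, produces the inverse of \<open>u\<close>. For the codomain functor:
  pulling back along an isomorphism gives an isomorphic arrow.\<close>

lemma cartesian_over_iso:
  assumes u: "cartesian C D F u" and iso: "iso_arr D (far F u)"
  shows "iso_arr C u"
proof -
  note [simp] = cartesian_arr[OF u]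
  obtain v where v: "v \<in> arr D" "src D v = trg D (far F u)" "trg D v = src D (far F u)"
    "cmp D v (far F u) = idn D (src D (far F u))" "cmp D (far F u) v = idn D (trg D (far F u))"
    using iso by (rule cod.isoE)
  obtain k where k: "k \<in> arr C" "src C k = trg C u" "trg C k = src C u" "far F k = v"
    "cmp C u k = idn C (trg C u)"
    using cartesian_lift[OF u, of "idn C (trg C u)" v] v by auto
  have "cmp C k u = idn C (src C u)"
    by (rule cartesian_cancel[OF u]) (use k v dom.cmp_assoc[of u k u] in simp_all)
  then show ?thesis
    using k by (intro dom.isoI[where g = k]) auto
qed

lemma faithful_eq:
  assumes "faithful C F" and f: "f \<in> arr C" "g \<in> arr C" "src C f = src C g" "trg C f = trg C g"
    "far F f = far F g"
  shows "f = g"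
proof -
  have "inj_on (far F) (hom C (src C f) (trg C f))"
    using assms(1) f(1) by (simp add: faithful_def)
  then show ?thesis
    using f by (auto simp: inj_on_def hom_def)
qed

lemma full_lift:
  assumes "full C D F" "x \<in> obj C" "y \<in> obj C" "k \<in> arr D" "src D k = fob F x" "trg D k = fob F y"
  shows "\<exists>l. l \<in> arr C \<and> src C l = x \<and> trg C l = y \<and> far F l = k"
proof -
  have "k \<in> far F ` hom C x y"
    using assms by (auto simp: full_def hom_def)
  then show ?thesis by (auto simp: hom_def)
qed

end

text \<open>A lift found in \<open>S\<close> runs between objects in the image of \<open>H\<close>,
  so fullness brings it to \<open>T\<close> and faithfulness makes it unique there. This is why a
  full comprehension detects cartesian arrows by their squares.\<close>

lemma cartesian_reflect:
  assumes H: "is_functor T S H" and p: "is_functor S C q" and full: "full T S H" and faithful: "faithful T H"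
    and u: "u \<in> arr T" "cartesian S C q (far H u)"
  shows "cartesian T C (fcomp T q H) u"
proof -
  interpret H: is_ftr T S H using H by unfold_locales
  interpret q: is_ftr S C q using p by unfold_locales
  interpret p: is_ftr T C "fcomp T q H" by unfold_locales (rule functor_fcomp[OF H p])
  show ?thesis
  proof (rule p.cartesianI)
    fix w h assume w: "w \<in> arr T" "trg T w = trg T u"
      and h: "h \<in> arr C" "src C h = fob (fcomp T q H) (src T w)"
        "trg C h = fob (fcomp T q H) (src T u)"
        "cmp C (far (fcomp T q H) u) h = far (fcomp T q H) w"
    obtain k where k: "k \<in> arr S" "src S k = fob H (src T w)" "trg S k = fob H (src T u)"
      "far q k = h" "cmp S (far H u) k = far H w"
      using q.cartesian_lift[OF u(2), of "far H w" h] w h u(1) by auto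
    then obtain l where l: "l \<in> arr T" "src T l = src T w" "trg T l = src T u" "far H l = k"
      using H.full_lift[OF full, of "src T w" "src T u" k] w(1) u(1) by auto
    note inj = H.faithful_eq[OF faithful]
    have "cmp T u l = w"
      by (rule inj) (use u(1) l w k in simp_all)
    moreover have "l' = l" if l': "l' \<in> arr T" "src T l' = src T w" "trg T l' = src T u"
      "far (fcomp T q H) l' = h" "cmp T u l' = w" for l'
    proof (rule inj)
      show "far H l' = far H l"
      proof (rule q.cartesian_cancel[OF u(2)])
        have "cmp S (far H u) (far H l') = far H (cmp T u l')"
          using u(1) l'(1-3) by simp
        then show "cmp S (far H u) (far H l') = cmp S (far H u) (far H l)"
          using l'(5) l(4) k(5) by simp
      qed (use l l' k u(1) in simp_all)
    qed (use l l' in simp_all)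
    moreover have "far (fcomp T q H) l = h"
      using l k by simp
    ultimately show "\<exists>!k. (k \<in> arr T \<and> src T k = src T w \<and> trg T k = src T u) \<and>
        far (fcomp T q H) k = h \<and> cmp T u k = w"
      using l by blast
  qed (use u in simp)
qed

text \<open>Two cartesian lifts of one arrow differ by an isomorphism, so one preserved lift suffices.\<close>

lemma cartesian_preserve:
  assumes H: "is_functor T S H" and q: "is_functor S C q" and p: "is_functor T C' p"
    and lift: "cartesian T C' p u'" "trg T u' = trg T u" "far p u' = far p u"
    and u': "cartesian S C q (far H u')"
    and u: "cartesian T C' p u"
  shows "cartesian S C q (far H u)"
proof -
  interpret H: is_ftr T S H using H by unfold_locales
  interpret q: is_ftr S C q using q by unfold_locales
  interpret p: is_ftr T C' p using p by unfold_locales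
  obtain i where i: "iso_arr T i" "src T i = src T u" "trg T i = src T u'" "cmp T u' i = u"
    by (rule p.cartesian_unique[OF lift(1) u lift(2,3)])
  have "i \<in> arr T" "u' \<in> arr T"
    using i(1) lift(1) by (auto simp: iso_arr_def p.cartesian_arr)
  then have "far H u = cmp S (far H u') (far H i)" "src S (far H u') = trg S (far H i)"
    using i H.far_cmp[of u' i] by auto
  then show ?thesis
    using q.cartesian_cmp[OF u' q.cartesian_iso[OF H.iso_far[OF i(1)]]] by simp
qed

section \<open>Arrow categories\<close>

lemma obj_arrcat [simp]: "obj (arrcat C) = arr C"
  by (simp add: arrcat_def Let_def)

lemma Square_arr [simp]:
  "Square f g u v \<in> arr (arrcat C) \<longleftrightarrow> f \<in> arr C \<and> g \<in> arr C \<and>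
    u \<in> arr C \<and> src C u = src C f \<and> trg C u = src C g \<and>
    v \<in> arr C \<and> src C v = trg C f \<and> trg C v = trg C g \<and> cmp C g u = cmp C v f"
  by (auto simp: arrcat_def Let_def hom_def)

lemma square_arr_iff:
  "s \<in> arr (arrcat C) \<longleftrightarrow> sqsrc s \<in> arr C \<and> sqtrg s \<in> arr C \<and>
    sqdom s \<in> arr C \<and> src C (sqdom s) = src C (sqsrc s) \<and> trg C (sqdom s) = src C (sqtrg s) \<and>
    sqcod s \<in> arr C \<and> src C (sqcod s) = trg C (sqsrc s) \<and> trg C (sqcod s) = trg C (sqtrg s) \<and>
    cmp C (sqtrg s) (sqdom s) = cmp C (sqcod s) (sqsrc s)"
  using Square_arr[of "sqsrc s" "sqtrg s" "sqdom s" "sqcod s" C] by simp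

lemma square_arrD:
  assumes "s \<in> arr (arrcat C)"
  shows "sqsrc s \<in> arr C" "sqtrg s \<in> arr C" "sqdom s \<in> arr C" "sqcod s \<in> arr C"
    "src C (sqdom s) = src C (sqsrc s)" "trg C (sqdom s) = src C (sqtrg s)"
    "src C (sqcod s) = trg C (sqsrc s)" "trg C (sqcod s) = trg C (sqtrg s)"
  using assms by (auto simp: square_arr_iff)

lemma square_comm: "s \<in> arr (arrcat C) \<Longrightarrow> cmp C (sqtrg s) (sqdom s) = cmp C (sqcod s) (sqsrc s)"
  by (simp add: square_arr_iff)

lemma src_arrcat: "s \<in> arr (arrcat C) \<Longrightarrow> src (arrcat C) s = sqsrc s"
  and trg_arrcat: "s \<in> arr (arrcat C) \<Longrightarrow> trg (arrcat C) s = sqtrg s"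
  and idn_arrcat: "f \<in> arr C \<Longrightarrow> idn (arrcat C) f = Square f f (idn C (src C f)) (idn C (trg C f))"
  by (simp_all add: arrcat_def Let_def)

lemma cmp_arrcat:
  "t \<in> arr (arrcat C) \<Longrightarrow> s \<in> arr (arrcat C) \<Longrightarrow> sqsrc t = sqtrg s \<Longrightarrow>
    cmp (arrcat C) t s =
      Square (sqsrc s) (sqtrg t) (cmp C (sqdom t) (sqdom s)) (cmp C (sqcod t) (sqcod s))"
  by (simp add: arrcat_def Let_def)

text \<open>
  The category whose objects are those of \<open>S\<close> and whose arrows \<open>A \<rightarrow> B\<close> are the squares
  \<open>c A \<rightarrow> c B\<close>, the square with sides \<open>u\<close>, \<open>v\<close> being encoded as \<open>Square A B u v\<close>. It serves both for
  full subcategories of the arrow category (\<open>c A = A\<close>) and for the full image of a comprehension.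
\<close>

definition along :: "('o, 'm) cat \<Rightarrow> 'm set \<Rightarrow> ('m \<Rightarrow> 'm) \<Rightarrow> ('m, 'm square) cat" where
  "along C S c =
     (let A = {s. sqsrc s \<in> S \<and> sqtrg s \<in> S \<and>
                  Square (c (sqsrc s)) (c (sqtrg s)) (sqdom s) (sqcod s) \<in> arr (arrcat C)} in
      \<lparr> obj = S, arr = A, src = restrict sqsrc A, trg = restrict sqtrg A,
        idn = (\<lambda>f\<in>S. Square f f (idn C (src C (c f))) (idn C (trg C (c f)))),
        cmp = (\<lambda>t s. if t \<in> A \<and> s \<in> A \<and> sqsrc t = sqtrg s
                 then Square (sqsrc s) (sqtrg t) (cmp C (sqdom t) (sqdom s))
                        (cmp C (sqcod t) (sqcod s))
                 else undefined) \<rparr>)"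

definition alongf ::
  "('o, 'm) cat \<Rightarrow> 'm set \<Rightarrow> ('m \<Rightarrow> 'm) \<Rightarrow> ('m, 'm square, 'm, 'm square) fctr" where
  "alongf C S c =
     \<lparr> fob = restrict c S,
       far = (\<lambda>s\<in>arr (along C S c). Square (c (sqsrc s)) (c (sqtrg s)) (sqdom s) (sqcod s)) \<rparr>"

lemma obj_along [simp]: "obj (along C S c) = S"
  by (simp add: along_def Let_def)

lemma along_arr:
  "s \<in> arr (along C S c) \<longleftrightarrow> sqsrc s \<in> S \<and> sqtrg s \<in> S \<and>
    Square (c (sqsrc s)) (c (sqtrg s)) (sqdom s) (sqcod s) \<in> arr (arrcat C)"
  by (simp add: along_def Let_def)

lemma src_along: "s \<in> arr (along C S c) \<Longrightarrow> src (along C S c) s = sqsrc s"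
  and trg_along: "s \<in> arr (along C S c) \<Longrightarrow> trg (along C S c) s = sqtrg s"
  and idn_along: "A \<in> S \<Longrightarrow> idn (along C S c) A =
    Square A A (idn C (src C (c A))) (idn C (trg C (c A)))"
  and cmp_along: "t \<in> arr (along C S c) \<Longrightarrow> s \<in> arr (along C S c) \<Longrightarrow> sqsrc t = sqtrg s \<Longrightarrow>
    cmp (along C S c) t s =
      Square (sqsrc s) (sqtrg t) (cmp C (sqdom t) (sqdom s)) (cmp C (sqcod t) (sqcod s))"
  by (simp_all add: along_def Let_def)

text \<open>With this and \<open>full_sub_eq_along\<close> the category axioms for squares are
  checked only once, for \<open>along\<close>.\<close>

lemma arrcat_eq_along: "arrcat C = along C (arr C) (\<lambda>f. f)"
proof -
  have A: "{s. sqsrc s \<in> arr C \<and> sqtrg s \<in> arr C \<and>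
      Square (sqsrc s) (sqtrg s) (sqdom s) (sqcod s) \<in> arr (arrcat C)} = arr (arrcat C)"
    by (auto simp: square_arr_iff)
  show ?thesis
    unfolding along_def A Let_def by (simp add: arrcat_def Let_def)
qed

lemma full_sub_eq_along:
  assumes "S \<subseteq> arr C"
  shows "full_sub (arrcat C) S = along C S (\<lambda>f. f)"
proof -
  define B where "B = {s \<in> arr (arrcat C). src (arrcat C) s \<in> S \<and> trg (arrcat C) s \<in> S}"
  have A: "arr (along C S (\<lambda>f. f)) = B"
    by (auto simp: B_def along_arr src_arrcat trg_arrcat)
  have "src (full_sub (arrcat C) S) = src (along C S (\<lambda>f. f))"
    "trg (full_sub (arrcat C) S) = trg (along C S (\<lambda>f. f))"
    by (auto simp: full_sub_def along_def Let_def src_arrcat trg_arrcat intro!: ext)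
  moreover have "idn (full_sub (arrcat C) S) = idn (along C S (\<lambda>f. f))"
    using assms by (auto simp: full_sub_def along_def Let_def idn_arrcat intro!: restrict_ext)
  \<comment> \<open>The default values agree as well: \<open>full_sub\<close> falls back on the
    composition of \<open>arrcat\<close>, which is \<open>undefined\<close> unless source and target
    match.\<close>
  moreover have "cmp (full_sub (arrcat C) S) = cmp (along C S (\<lambda>f. f))"
    by (intro ext) (auto simp: full_sub_def along_def Let_def src_arrcat trg_arrcat arrcat_def)
  moreover have "arr (full_sub (arrcat C) S) = arr (along C S (\<lambda>f. f))"
    unfolding A by (simp add: full_sub_def Let_def B_def)
  moreover have "obj (full_sub (arrcat C) S) = obj (along C S (\<lambda>f. f))"
    by (simp add: full_sub_def Let_def)
  ultimately show ?thesis
    by (intro cat.equality) simp_all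
qed

lemma categoryI:
  assumes "src C \<in> extensional (arr C)" "trg C \<in> extensional (arr C)" "idn C \<in> extensional (obj C)"
    "\<And>f. f \<in> arr C \<Longrightarrow> src C f \<in> obj C" "\<And>f. f \<in> arr C \<Longrightarrow> trg C f \<in> obj C"
    "\<And>x. x \<in> obj C \<Longrightarrow> idn C x \<in> arr C"
    "\<And>x. x \<in> obj C \<Longrightarrow> src C (idn C x) = x" "\<And>x. x \<in> obj C \<Longrightarrow> trg C (idn C x) = x"
    "\<And>g f. g \<in> arr C \<Longrightarrow> f \<in> arr C \<Longrightarrow> src C g = trg C f \<Longrightarrow>
       cmp C g f \<in> arr C \<and> src C (cmp C g f) = src C f \<and> trg C (cmp C g f) = trg C g"
    "\<And>g f. \<not> composable C g f \<Longrightarrow> cmp C g f = undefined"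
    "\<And>f. f \<in> arr C \<Longrightarrow> cmp C f (idn C (src C f)) = f"
    "\<And>f. f \<in> arr C \<Longrightarrow> cmp C (idn C (trg C f)) f = f"
    "\<And>h g f. h \<in> arr C \<Longrightarrow> g \<in> arr C \<Longrightarrow> f \<in> arr C \<Longrightarrow> src C h = trg C g \<Longrightarrow> src C g = trg C f \<Longrightarrow>
       cmp C h (cmp C g f) = cmp C (cmp C h g) f"
  shows "category C"
  unfolding category_def using assms
  by (intro conjI allI ballI impI) (auto simp: PiE_def hom_def composable_def)

context is_cat
begin

lemma category_along:
  assumes c: "c \<in> S \<rightarrow> arr C"
  shows "category (along C S c)"
proof -
  let ?T = "along C S c"
  note A = along_arr src_along trg_along idn_along cmp_along
  have c' [simp]: "c A \<in> arr C" if "A \<in> S" for A using c that by auto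
  have cmp: "cmp ?T t s \<in> arr ?T \<and> sqsrc (cmp ?T t s) = sqsrc s \<and> sqtrg (cmp ?T t s) = sqtrg t \<and>
      sqdom (cmp ?T t s) = cmp C (sqdom t) (sqdom s) \<and> sqcod (cmp ?T t s) = cmp C (sqcod t) (sqcod s)"
    if t: "t \<in> arr ?T" and s: "s \<in> arr ?T" and ts: "sqsrc t = sqtrg s" for t s
  proof -
    \<comment> \<open>Pasting of the two squares along their common edge
      \<open>c (sqsrc t)\<close>.\<close>
    have "cmp C (c (sqtrg t)) (cmp C (sqdom t) (sqdom s)) =
        cmp C (sqcod t) (cmp C (c (sqsrc t)) (sqdom s))"
      using t s ts by (intro cmp_eq_cmp) (auto simp: along_arr)
    then show ?thesis
      unfolding cmp_along[OF that] using that by (auto simp: along_arr)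
  qed
  show ?thesis
  proof (rule categoryI)
    show "src ?T \<in> extensional (arr ?T)" "trg ?T \<in> extensional (arr ?T)"
      "idn ?T \<in> extensional (obj ?T)"
      by (auto simp: along_def Let_def)
  next
    fix t s assume "\<not> composable ?T t s"
    then have "\<not> (t \<in> arr ?T \<and> s \<in> arr ?T \<and> sqsrc t = sqtrg s)"
      by (auto simp: composable_def src_along trg_along)
    then show "cmp ?T t s = undefined"
      by (auto simp: along_def Let_def)
  next
    fix s assume s: "s \<in> arr ?T"
    have i: "idn ?T (sqsrc s) \<in> arr ?T" "idn ?T (sqtrg s) \<in> arr ?T"
      using s by (auto simp: A)
    show "cmp ?T s (idn ?T (src ?T s)) = s" "cmp ?T (idn ?T (trg ?T s)) s = s"
      using s i by (auto simp: src_along trg_along cmp_along intro!: square.expand)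
        (auto simp: A)
  next
    fix r t s assume *: "r \<in> arr ?T" "t \<in> arr ?T" "s \<in> arr ?T" "src ?T r = trg ?T t" "src ?T t = trg ?T s"
    then have "sqsrc r = sqtrg t" "sqsrc t = sqtrg s"
      by (simp_all add: src_along trg_along)
    with * cmp[of r t] cmp[of t s] cmp[of r "cmp ?T t s"] cmp[of "cmp ?T r t" s]
    show "cmp ?T r (cmp ?T t s) = cmp ?T (cmp ?T r t) s"
      by (intro square.expand) (auto simp: along_arr)
  qed (use cmp in \<open>auto simp: A\<close>)
qed

lemma category_arrcat: "category (arrcat C)"
  unfolding arrcat_eq_along by (rule category_along) auto

text \<open>Full and faithful by construction, as the arrows of \<open>along\<close> are the squares
  between the values of \<open>c\<close>. Faithfulness compares arrows between fixed objects:
  \<open>alongf\<close> forgets the labels, and \<open>c\<close> may identify objects.\<close>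

lemma functor_alongf:
  assumes c: "c \<in> S \<rightarrow> arr C"
  shows "is_functor (along C S c) (arrcat C) (alongf C S c)"
    and full_alongf: "full (along C S c) (arrcat C) (alongf C S c)"
    and faithful_alongf: "faithful (along C S c) (alongf C S c)"
proof -
  let ?T = "along C S c"
  interpret T: is_cat ?T using category_along[OF c] by unfold_locales
  note A = along_arr src_along trg_along idn_along cmp_along
  have c' [simp]: "c A \<in> arr C" if "A \<in> S" for A using c that by auto
  have arr: "Square (c (sqsrc s)) (c (sqtrg s)) (sqdom s) (sqcod s) \<in> arr (arrcat C)"
    if "s \<in> arr ?T" for s using that by (simp only: along_arr)
  show "is_functor ?T (arrcat C) (alongf C S c)"
  proof (rule is_functorI)
    fix t s assume *: "t \<in> arr ?T" "s \<in> arr ?T" "src ?T t = trg ?T s"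
    then have ts: "sqsrc t = sqtrg s" by (simp add: A)
    have "cmp ?T t s \<in> arr ?T" using * by simp
    then show "far (alongf C S c) (cmp ?T t s) =
        cmp (arrcat C) (far (alongf C S c) t) (far (alongf C S c) s)"
      using * ts arr[OF *(1)] arr[OF *(2)]
      by (simp add: alongf_def cmp_arrcat cmp_along del: Square_arr)
  next
    fix A assume "A \<in> obj ?T"
    then have "A \<in> S" "idn ?T A \<in> arr ?T" by simp_all
    then show "far (alongf C S c) (idn ?T A) = idn (arrcat C) (fob (alongf C S c) A)"
      by (simp add: alongf_def idn_arrcat idn_along)
  next
    fix s assume s: "s \<in> arr ?T"
    then show "src (arrcat C) (far (alongf C S c) s) = fob (alongf C S c) (src ?T s)"
      "trg (arrcat C) (far (alongf C S c) s) = fob (alongf C S c) (trg ?T s)"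
      "far (alongf C S c) s \<in> arr (arrcat C)"
      using arr[OF s] s T.src_obj[OF s] T.trg_obj[OF s]
      by (simp_all add: alongf_def src_arrcat trg_arrcat src_along trg_along del: Square_arr)
  qed (auto simp: category_along[OF c] category_arrcat alongf_def)
  show "faithful ?T (alongf C S c)"
    unfolding faithful_def
  proof (intro ballI inj_onI)
    fix A B s t assume *: "s \<in> hom ?T A B" "t \<in> hom ?T A B" "far (alongf C S c) s = far (alongf C S c) t"
    then have "s \<in> arr ?T" "t \<in> arr ?T" "sqsrc s = sqsrc t" "sqtrg s = sqtrg t"
      by (auto simp: hom_def src_along trg_along)
    then show "s = t"
      using *(3) by (simp add: alongf_def square.expand)
  qed
  show "full ?T (arrcat C) (alongf C S c)"
    unfolding full_def
  proof (intro ballI subsetI)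
    fix A B k assume *: "A \<in> obj ?T" "B \<in> obj ?T"
      "k \<in> hom (arrcat C) (fob (alongf C S c) A) (fob (alongf C S c) B)"
    then have k: "k \<in> arr (arrcat C)" "sqsrc k = c A" "sqtrg k = c B"
      by (auto simp: hom_def alongf_def src_arrcat trg_arrcat)
    have "Square A B (sqdom k) (sqcod k) \<in> arr ?T"
      using k * by (auto simp: along_arr square_arr_iff)
    then show "k \<in> far (alongf C S c) ` hom ?T A B"
      using k
      by (intro image_eqI[where x = "Square A B (sqdom k) (sqcod k)"])
        (simp_all add: hom_def src_along trg_along alongf_def square.expand)
  qed
qed

end

lemma alongf_eq_fid: "S \<subseteq> arr C \<Longrightarrow> alongf C S (\<lambda>f. f) = fid (along C S (\<lambda>f. f))"
  by (auto simp: alongf_def fid_def intro!: restrict_ext)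

section \<open>The codomain functor, arrow functors, and pullbacks as cartesian arrows\<close>

lemma functor_codf: "category C \<Longrightarrow> is_functor (arrcat C) C (codf C)"
proof -
  assume "category C"
  then interpret C: is_cat C by unfold_locales
  interpret A: is_cat "arrcat C" using C.category_arrcat by unfold_locales
  have arr: "idn (arrcat C) f \<in> arr (arrcat C)" if "f \<in> arr C" for f using that by simp
  show ?thesis
    by (rule is_functorI)
      (auto simp: A.category C.category codf_def src_arrcat trg_arrcat square_arrD arr
        simp del: Square_arr, auto simp: idn_arrcat cmp_arrcat src_arrcat trg_arrcat)
qed

lemma arrf_simps [simp]:
  "f \<in> arr C \<Longrightarrow> fob (arrf C F) f = far F f"
  "s \<in> arr (arrcat C) \<Longrightarrow> far (arrf C F) s =
    Square (far F (sqsrc s)) (far F (sqtrg s)) (far F (sqdom s)) (far F (sqcod s))"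
  by (simp_all add: arrf_def)

lemma functor_arrf:
  assumes "is_functor C D F"
  shows "is_functor (arrcat C) (arrcat D) (arrf C F)"
proof -
  interpret F: is_ftr C D F using assms by unfold_locales
  interpret A: is_cat "arrcat C" using F.dom.category_arrcat by unfold_locales
  interpret B: is_cat "arrcat D" using F.cod.category_arrcat by unfold_locales
  have arr: "Square (far F (sqsrc s)) (far F (sqtrg s)) (far F (sqdom s)) (far F (sqcod s)) \<in> arr (arrcat D)"
    if s: "s \<in> arr (arrcat C)" for s
    using square_arrD[OF s] square_comm[OF s] F.far_cmp[of "sqtrg s" "sqdom s"]
      F.far_cmp[of "sqcod s" "sqsrc s"] by simp
  show ?thesis
  proof (rule is_functorI)
    fix t s assume *: "t \<in> arr (arrcat C)" "s \<in> arr (arrcat C)" "src (arrcat C) t = trg (arrcat C) s"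
    then have K: "cmp (arrcat C) t s \<in> arr (arrcat C)" by simp
    show "far (arrf C F) (cmp (arrcat C) t s) =
        cmp (arrcat D) (far (arrf C F) t) (far (arrf C F) s)"
      unfolding arrf_simps(2)[OF K] using * arr[OF *(1)] arr[OF *(2)]
      by (simp add: cmp_arrcat src_arrcat trg_arrcat square_arrD del: Square_arr)
  next
    fix f assume "f \<in> obj (arrcat C)"
    then have "f \<in> arr C" "idn (arrcat C) f \<in> arr (arrcat C)" by (auto simp del: Square_arr)
    then show "far (arrf C F) (idn (arrcat C) f) = idn (arrcat D) (fob (arrf C F) f)"
      by (simp add: idn_arrcat)
  qed (use arr in \<open>auto simp: A.category B.category arrf_def src_arrcat trg_arrcat square_arrD
        simp del: Square_arr\<close>)
qed

lemma arrf_fcomp: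
  assumes "is_functor C D F" "is_functor D E G"
  shows "arrf C (fcomp C G F) = fcomp (arrcat C) (arrf D G) (arrf C F)"
proof -
  interpret F: is_ftr C D F using assms by unfold_locales
  interpret A: is_ftr "arrcat C" "arrcat D" "arrf C F"
    using functor_arrf[OF assms(1)] by unfold_locales
  show ?thesis
    using A.far_arr by (auto simp: arrf_def fcomp_def square_arrD intro!: restrict_ext simp del: Square_arr)
qed

lemma arrf_fid: "category C \<Longrightarrow> arrf C (fid C) = fid (arrcat C)"
  by (auto simp: arrf_def fid_def square_arrD intro!: restrict_ext)

lemma square_iso:
  assumes "category C" "iso_arr (arrcat C) s"
  shows "iso_arr C (sqdom s)" "iso_arr C (sqcod s)"
proof -
  interpret C: is_cat C using assms(1) by unfold_locales
  interpret A: is_cat "arrcat C" using C.category_arrcat by unfold_locales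
  obtain t where t: "s \<in> arr (arrcat C)" "t \<in> arr (arrcat C)" "src (arrcat C) t = trg (arrcat C) s"
    "trg (arrcat C) t = src (arrcat C) s"
    "cmp (arrcat C) t s = idn (arrcat C) (src (arrcat C) s)"
    "cmp (arrcat C) s t = idn (arrcat C) (trg (arrcat C) s)"
    using assms(2) by (rule A.isoE)
  then show "iso_arr C (sqdom s)" "iso_arr C (sqcod s)"
    using square_arrD[OF t(1)] square_arrD[OF t(2)]
    by (auto simp: src_arrcat trg_arrcat cmp_arrcat idn_arrcat
        intro!: C.isoI[where f = "sqdom s" and g = "sqdom t"] C.isoI[where f = "sqcod s" and g = "sqcod t"])
qed

text \<open>A square \<open>w\<close> into \<open>sqtrg s\<close> with codomain side
  \<open>cmp C (sqcod s) h\<close> gives a cone with legs \<open>sqdom w\<close> and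
  \<open>cmp C h (sqsrc w)\<close>; lifts of \<open>w\<close> along \<open>s\<close> over
  \<open>h\<close> are the fillers of that cone.\<close>

lemma pullback_iff_cartesian:
  assumes "category C"
  shows "pullback_square C s \<longleftrightarrow> cartesian (arrcat C) C (codf C) s"
proof -
  interpret C: is_cat C using assms by unfold_locales
  interpret p: is_ftr "arrcat C" C "codf C" using functor_codf[OF assms] by unfold_locales
  have codf: "far (codf C) t = sqcod t" if "t \<in> arr (arrcat C)" for t
    using that by (simp add: codf_def)
  have codo: "fob (codf C) f = trg C f" if "f \<in> arr C" for f
    using that by (simp add: codf_def)
  show ?thesis
  proof
    assume pb: "pullback_square C s"
    then have s: "s \<in> arr (arrcat C)" by (simp add: pullback_square_def)
    note s' = square_arrD[OF s]
    show "cartesian (arrcat C) C (codf C) s"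
    proof (rule p.cartesianI)
      fix w h assume w: "w \<in> arr (arrcat C)" "trg (arrcat C) w = trg (arrcat C) s"
        and h: "h \<in> arr C" "src C h = fob (codf C) (src (arrcat C) w)"
          "trg C h = fob (codf C) (src (arrcat C) s)"
          "cmp C (far (codf C) s) h = far (codf C) w"
      note w' = square_arrD[OF w(1)]
      have wt: "sqtrg w = sqtrg s" using w s by (simp add: trg_arrcat)
      have h': "src C h = trg C (sqsrc w)" "trg C h = trg C (sqsrc s)" "cmp C (sqcod s) h = sqcod w"
        using h s w w' s' by (simp_all add: codf codo src_arrcat)
      have "cmp C (sqtrg s) (sqdom w) = cmp C (sqcod s) (cmp C h (sqsrc w))"
        using square_comm[OF w(1)] wt h(1) h' s' w' C.cmp_assoc[of "sqcod s" h "sqsrc w"] by simp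
      then have ex: "\<exists>!k. k \<in> hom C (src C (sqdom w)) (src C (sqdom s)) \<and>
          cmp C (sqdom s) k = sqdom w \<and> cmp C (sqsrc s) k = cmp C h (sqsrc w)"
        using pb[unfolded pullback_square_def, THEN conjunct2, rule_format,
            of "sqdom w" "cmp C h (sqsrc w)"] h(1) h' s' w' wt by simp
      then obtain k where k: "k \<in> arr C" "src C k = src C (sqsrc w)" "trg C k = src C (sqsrc s)"
        "cmp C (sqdom s) k = sqdom w" "cmp C (sqsrc s) k = cmp C h (sqsrc w)"
        using s' w' by (auto simp: hom_def)
      have K: "Square (sqsrc w) (sqsrc s) k h \<in> arr (arrcat C)"
        using k h(1) h' s' w' by simp
      show "\<exists>!k. (k \<in> arr (arrcat C) \<and> src (arrcat C) k = src (arrcat C) w \<and>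
          trg (arrcat C) k = src (arrcat C) s) \<and> far (codf C) k = h \<and> cmp (arrcat C) s k = w"
      proof (rule ex1I[where a = "Square (sqsrc w) (sqsrc s) k h"])
        show "(Square (sqsrc w) (sqsrc s) k h \<in> arr (arrcat C) \<and>
            src (arrcat C) (Square (sqsrc w) (sqsrc s) k h) = src (arrcat C) w \<and>
            trg (arrcat C) (Square (sqsrc w) (sqsrc s) k h) = src (arrcat C) s) \<and>
            far (codf C) (Square (sqsrc w) (sqsrc s) k h) = h \<and>
            cmp (arrcat C) s (Square (sqsrc w) (sqsrc s) k h) = w"
          using K s w k h' wt
          by (auto simp: src_arrcat trg_arrcat codf cmp_arrcat simp del: Square_arr intro!: square.expand)
      next
        fix l assume l: "(l \<in> arr (arrcat C) \<and> src (arrcat C) l = src (arrcat C) w \<and>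
            trg (arrcat C) l = src (arrcat C) s) \<and> far (codf C) l = h \<and> cmp (arrcat C) s l = w"
        then have la: "l \<in> arr (arrcat C)" by simp
        have l': "sqsrc l = sqsrc w" "sqtrg l = sqsrc s" "sqcod l = h"
          using l codf[OF la] src_arrcat[OF la] trg_arrcat[OF la] src_arrcat[OF s] src_arrcat[OF w(1)]
          by simp_all
        moreover have "cmp C (sqdom s) (sqdom l) = sqdom (cmp (arrcat C) s l)"
          using cmp_arrcat[OF s la] l' by simp
        ultimately have l': "sqsrc l = sqsrc w" "sqtrg l = sqsrc s" "sqcod l = h"
          "cmp C (sqdom s) (sqdom l) = sqdom w"
          using l by simp_all
        then have "cmp C (sqsrc s) (sqdom l) = cmp C h (sqsrc w)"
          using square_comm[OF la] by simp
        moreover have "sqdom l \<in> hom C (src C (sqdom w)) (src C (sqdom s))"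
          "k \<in> hom C (src C (sqdom w)) (src C (sqdom s))"
          using k l' square_arrD[OF la] w' s' by (simp_all add: hom_def)
        ultimately have "sqdom l = k"
          using ex k(4,5) l'(4) by blast
        then show "l = Square (sqsrc w) (sqsrc s) k h"
          using l' by (auto intro!: square.expand)
      qed
    qed (rule s)
  next
    assume ca: "cartesian (arrcat C) C (codf C) s"
    then have s: "s \<in> arr (arrcat C)" by (rule p.cartesian_arr)
    note s' = square_arrD[OF s]
    show "pullback_square C s"
      unfolding pullback_square_def
    proof (intro conjI allI impI)
      fix a b assume ab: "a \<in> arr C" "b \<in> arr C" "src C a = src C b" "trg C a = trg C (sqdom s)"
        "trg C b = trg C (sqsrc s)" "cmp C (sqtrg s) a = cmp C (sqcod s) b"
      \<comment> \<open>The cone is read as a square out of \<open>b\<close> with the codomain side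
        of \<open>s\<close>. Its lift along \<open>s\<close> lies over an identity and has the
        sought filler as domain side.\<close>
      define w where "w = Square b (sqtrg s) a (sqcod s)"
      have w: "w \<in> arr (arrcat C)"
        using ab s' by (simp add: w_def)
      have wsel: "sqsrc w = b" "sqtrg w = sqtrg s" "sqdom w = a" "sqcod w = sqcod s"
        by (simp_all add: w_def)
      obtain k where k: "k \<in> arr (arrcat C)" "src (arrcat C) k = b" "trg (arrcat C) k = sqsrc s"
        "far (codf C) k = idn C (trg C b)" "cmp (arrcat C) s k = w"
        using p.cartesian_lift[OF ca w, of "idn C (trg C b)"] s' ab w s wsel
        by (auto simp: src_arrcat trg_arrcat codf codo)
      note k'' = square_arrD[OF k(1)]
      have k': "sqsrc k = b" "sqtrg k = sqsrc s" "sqcod k = idn C (trg C b)"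
        using k(1-4) by (simp_all add: src_arrcat trg_arrcat codf)
      have "cmp C (sqdom s) (sqdom k) = a"
        using k(1,5) k' s by (simp add: cmp_arrcat w_def)
      moreover have "cmp C (sqsrc s) (sqdom k) = b"
        using square_comm[OF k(1)] k' ab by simp
      moreover have "h = sqdom k" if h: "h \<in> hom C (src C a) (src C (sqdom s))"
        "cmp C (sqdom s) h = a" "cmp C (sqsrc s) h = b" for h
      proof -
        have H: "Square b (sqsrc s) h (idn C (trg C b)) \<in> arr (arrcat C)"
          using h ab s' by (auto simp: hom_def)
        have "Square b (sqsrc s) h (idn C (trg C b)) = k"
        proof (rule p.cartesian_cancel[OF ca H k(1)])
          show "cmp (arrcat C) s (Square b (sqsrc s) h (idn C (trg C b))) = cmp (arrcat C) s k"
            using H h s ab s' k(5) by (simp add: cmp_arrcat w_def del: Square_arr)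
        qed (use H k k' s in \<open>simp_all add: codf src_arrcat trg_arrcat del: Square_arr\<close>)
        then show ?thesis by auto
      qed
      moreover have sqdom_k: "sqdom k \<in> hom C (src C a) (src C (sqdom s))"
        using k'' k' ab s' by (simp add: hom_def)
      ultimately show "\<exists>!h. h \<in> hom C (src C a) (src C (sqdom s)) \<and>
          cmp C (sqdom s) h = a \<and> cmp C (sqsrc s) h = b"
        using sqdom_k by blast
    qed (rule s)
  qed
qed

section \<open>Equivalences and isomorphisms of categories\<close>

text \<open>The inverse bijections form a functor because \<open>F\<close> respects the structure
  and is injective, so an inverse need not be exhibited.\<close>

lemma isomorphism_of_catsI:
  assumes F: "is_functor C D F" and ob: "bij_betw (fob F) (obj C) (obj D)"
    and ar: "bij_betw (far F) (arr C) (arr D)"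
  shows "isomorphism_of_cats C D F"
proof -
  interpret F: is_ftr C D F using F by unfold_locales
  define G where "G = \<lparr> fob = restrict (inv_into (obj C) (fob F)) (obj D),
    far = restrict (inv_into (arr C) (far F)) (arr D) \<rparr>"
  have Go [simp]: "fob G (fob F x) = x" if "x \<in> obj C" for x
    using that ob by (simp add: G_def bij_betw_def)
  have Ga [simp]: "far G (far F f) = f" if "f \<in> arr C" for f
    using that ar by (simp add: G_def bij_betw_def)
  have oD: "\<exists>x\<in>obj C. y = fob F x" if "y \<in> obj D" for y
    using that ob by (auto simp: bij_betw_def)
  have aD: "\<exists>f\<in>arr C. g = far F f" if "g \<in> arr D" for g
    using that ar by (auto simp: bij_betw_def)
  have G: "is_functor D C G"
  proof (rule is_functorI)
    fix g f assume gf: "g \<in> arr D" "f \<in> arr D" "src D g = trg D f"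
    obtain g' f' where *: "g' \<in> arr C" "f' \<in> arr C" "g = far F g'" "f = far F f'"
      using aD gf by blast
    then have "fob F (src C g') = fob F (trg C f')" using gf by simp
    then have "src C g' = trg C f'" using * by (metis Go F.dom.src_obj F.dom.trg_obj)
    then show "far G (cmp D g f) = cmp C (far G g) (far G f)"
      using * F.far_cmp[of g' f'] by (metis F.dom.cmp_arr Ga)
  next
    fix f assume "f \<in> arr D"
    then obtain f' where "f' \<in> arr C" "f = far F f'" using aD by blast
    then show "far G f \<in> arr C" "src C (far G f) = fob G (src D f)"
      "trg C (far G f) = fob G (trg D f)" by simp_all
  next
    fix x assume "x \<in> obj D"
    then obtain x' where "x' \<in> obj C" "x = fob F x'" using oD by blast
    moreover then have "far G (idn D x) = far G (far F (idn C x'))" by simp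
    ultimately show "fob G x \<in> obj C" "far G (idn D x) = idn C (fob G x)"
      by (simp_all del: F.far_idn)
  qed (auto simp: F.dom.category F.cod.category G_def)
  interpret G: is_ftr D C G using G by unfold_locales
  have "fcomp C G F = fid C"
    by (auto simp: fcomp_def fid_def intro!: restrict_ext)
  have "fob F (fob G y) = y" if "y \<in> obj D" for y
    using oD[OF that] by auto
  moreover have "far F (far G g) = g" if "g \<in> arr D" for g
    using aD[OF that] by auto
  ultimately have "fcomp D F G = fid D"
    by (simp add: fcomp_def fid_def cong: restrict_cong)
  with \<open>fcomp C G F = fid C\<close> show ?thesis
    using F G unfolding isomorphism_of_cats_def by blast
qed

lemma equivalence_fid:
  assumes "category C"
  shows "equivalence_of_cats C C (fid C)"
proof -
  note F = functor_fid[OF assms]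
  interpret C: is_cat C using assms by unfold_locales
  have "nat_iso C C (fid C) (fid C) (nt_id C C (fid C))"
    using nat_trans_id[OF F] by (auto simp: nat_iso_def C.iso_idn)
  then show ?thesis
    using F fcomp_fid_left[OF F] unfolding equivalence_of_cats_def by metis
qed

lemma equivalence_of_catsI:
  assumes F: "is_functor C D F" and full: "full C D F" and faithful: "faithful C F"
    and es: "\<And>y. y \<in> obj D \<Longrightarrow> \<exists>x\<in>obj C. isomorphic_objs D (fob F x) y"
  shows "equivalence_of_cats C D F"
proof -
  interpret F: is_ftr C D F using F by unfold_locales
  \<comment> \<open>The inverse \<open>e'\<close> is chosen together with \<open>e\<close>, so that
    both cancellation laws can serve as rewrite rules.\<close>
  have "\<exists>x e e'. x \<in> obj C \<and> e \<in> arr D \<and> e' \<in> arr D \<and> src D e = fob F x \<and> trg D e = y \<and>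
    src D e' = y \<and> trg D e' = fob F x \<and> cmp D e' e = idn D (fob F x) \<and> cmp D e e' = idn D y"
    if y: "y \<in> obj D" for y
  proof -
    obtain x f where x: "x \<in> obj C" "iso_arr D f" "src D f = fob F x" "trg D f = y"
      using es[OF y] by (auto simp: isomorphic_objs_def hom_def)
    obtain g where "f \<in> arr D" "g \<in> arr D" "src D g = trg D f" "trg D g = src D f"
      "cmp D g f = idn D (src D f)" "cmp D f g = idn D (trg D f)"
      using x(2) by (rule F.cod.isoE)
    with x show ?thesis
      by (intro exI[where x = x] exI[where x = f] exI[where x = g]) simp
  qed
  then obtain Go e e' where G: "\<And>y. y \<in> obj D \<Longrightarrow> Go y \<in> obj C \<and> e y \<in> arr D \<and> e' y \<in> arr D \<and>
    src D (e y) = fob F (Go y) \<and> trg D (e y) = y \<and> src D (e' y) = y \<and> trg D (e' y) = fob F (Go y) \<and>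
    cmp D (e' y) (e y) = idn D (fob F (Go y)) \<and> cmp D (e y) (e' y) = idn D y"
    by metis
  then have [simp]: "\<And>y. y \<in> obj D \<Longrightarrow> Go y \<in> obj C"
    "\<And>y. y \<in> obj D \<Longrightarrow> e y \<in> arr D" "\<And>y. y \<in> obj D \<Longrightarrow> e' y \<in> arr D"
    "\<And>y. y \<in> obj D \<Longrightarrow> src D (e y) = fob F (Go y)" "\<And>y. y \<in> obj D \<Longrightarrow> trg D (e y) = y"
    "\<And>y. y \<in> obj D \<Longrightarrow> src D (e' y) = y" "\<And>y. y \<in> obj D \<Longrightarrow> trg D (e' y) = fob F (Go y)"
    "\<And>y. y \<in> obj D \<Longrightarrow> cmp D (e' y) (e y) = idn D (fob F (Go y))"
    "\<And>y. y \<in> obj D \<Longrightarrow> cmp D (e y) (e' y) = idn D y"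
    by simp_all
  have [simp]: "cmp D (e' y) (cmp D (e y) f) = f" if "y \<in> obj D" "f \<in> arr D" "trg D f = fob F (Go y)" for y f
    using F.cod.cmp_assoc[of "e' y" "e y" f] that by simp
  have [simp]: "cmp D (e y) (cmp D (e' y) g) = g" if "y \<in> obj D" "g \<in> arr D" "trg D g = y" for y g
    using F.cod.cmp_assoc[of "e y" "e' y" g] that by simp
  \<comment> \<open>An arrow of \<open>D\<close> is conjugated into the image of \<open>F\<close>
    and lifted by fullness.\<close>
  have "\<exists>k. k \<in> arr C \<and> src C k = Go (src D g) \<and> trg C k = Go (trg D g) \<and>
      far F k = cmp D (e' (trg D g)) (cmp D g (e (src D g)))" if "g \<in> arr D" for g
    by (rule F.full_lift[OF full]) (use that in simp_all)
  then obtain Ga where Ga [simp]: "\<And>g. g \<in> arr D \<Longrightarrow> Ga g \<in> arr C"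
    "\<And>g. g \<in> arr D \<Longrightarrow> src C (Ga g) = Go (src D g)"
    "\<And>g. g \<in> arr D \<Longrightarrow> trg C (Ga g) = Go (trg D g)"
    "\<And>g. g \<in> arr D \<Longrightarrow> far F (Ga g) = cmp D (e' (trg D g)) (cmp D g (e (src D g)))"
    by metis
  define G where "G = \<lparr> fob = restrict Go (obj D), far = restrict Ga (arr D) \<rparr>"
  have G_simps [simp]: "y \<in> obj D \<Longrightarrow> fob G y = Go y" "g \<in> arr D \<Longrightarrow> far G g = Ga g" for y g
    by (simp_all add: G_def)
  have FG: "is_functor D C G"
  proof (rule is_functorI)
    fix g f assume gf: "g \<in> arr D" "f \<in> arr D" "src D g = trg D f"
    show "far G (cmp D g f) = cmp C (far G g) (far G f)"
      by (rule F.faithful_eq[OF faithful]) (use gf in simp_all)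
  next
    fix y assume y: "y \<in> obj D"
    show "far G (idn D y) = idn C (fob G y)"
      by (rule F.faithful_eq[OF faithful]) (use y in simp_all)
  qed (auto simp: F.cod.category F.dom.category, auto simp: G_def)
  have e_iso: "iso_arr D (e y)" "iso_arr D (e' y)" if "y \<in> obj D" for y
    using that by (auto intro: F.cod.isoI[where g = "e' y"] F.cod.isoI[where g = "e y"])
  have "nat_trans D D (fcomp D F G) (fid D) (restrict e (obj D))"
  proof (rule nat_transI)
    fix f assume "f \<in> arr D"
    then show "cmp D (restrict e (obj D) (trg D f)) (far (fcomp D F G) f) =
        cmp D (far (fid D) f) (restrict e (obj D) (src D f))"
      by simp
  qed (auto intro!: functor_fcomp FG F functor_fid simp: F.cod.category)
  then have eps: "nat_iso D D (fcomp D F G) (fid D) (restrict e (obj D))"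
    using e_iso by (simp add: nat_iso_def)
  \<comment> \<open>The unit at \<open>x\<close> is lifted from the inverse of the counit at
    \<open>fob F x\<close>; the inverse of the unit will be lifted from the counit itself.\<close>
  have "\<exists>k. k \<in> arr C \<and> src C k = x \<and> trg C k = Go (fob F x) \<and> far F k = e' (fob F x)"
    if "x \<in> obj C" for x
    by (rule F.full_lift[OF full]) (use that in simp_all)
  then obtain n where n [simp]: "\<And>x. x \<in> obj C \<Longrightarrow> n x \<in> arr C" "\<And>x. x \<in> obj C \<Longrightarrow> src C (n x) = x"
    "\<And>x. x \<in> obj C \<Longrightarrow> trg C (n x) = Go (fob F x)" "\<And>x. x \<in> obj C \<Longrightarrow> far F (n x) = e' (fob F x)"
    by metis
  have n_iso: "iso_arr C (n x)" if x: "x \<in> obj C" for x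
  proof -
    obtain k where k: "k \<in> arr C" "src C k = Go (fob F x)" "trg C k = x" "far F k = e (fob F x)"
      using F.full_lift[OF full, of "Go (fob F x)" x "e (fob F x)"] x by auto
    have "cmp C k (n x) = idn C x"
      by (rule F.faithful_eq[OF faithful]) (use x k in simp_all)
    moreover have "cmp C (n x) k = idn C (Go (fob F x))"
      by (rule F.faithful_eq[OF faithful]) (use x k in simp_all)
    ultimately show ?thesis
      using k x by (intro F.dom.isoI[where g = k]) simp_all
  qed
  have "nat_trans C C (fid C) (fcomp C G F) (restrict n (obj C))"
  proof (rule nat_transI)
    fix f assume f: "f \<in> arr C"
    show "cmp C (restrict n (obj C) (trg C f)) (far (fid C) f) =
        cmp C (far (fcomp C G F) f) (restrict n (obj C) (src C f))"
      by (rule F.faithful_eq[OF faithful]) (use f in simp_all)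
  qed (auto intro!: functor_fcomp FG F functor_fid simp: F.dom.category)
  then have "nat_iso C C (fid C) (fcomp C G F) (restrict n (obj C))"
    using n_iso by (simp add: nat_iso_def)
  with eps F FG show ?thesis
    unfolding equivalence_of_cats_def by blast
qed

section \<open>Strict 2-categories\<close>

locale is_2cat =
  fixes K :: "('a, 'b, 'c) twocat"
  assumes strict: "strict_2cat K"
begin

lemma c1_obj [simp]: "f \<in> c1 K \<Longrightarrow> s1 K f \<in> c0 K" "f \<in> c1 K \<Longrightarrow> t1 K f \<in> c0 K"
  using strict by (simp_all add: strict_2cat_def)

lemma c2_c1 [simp]: "\<alpha> \<in> c2 K \<Longrightarrow> s2 K \<alpha> \<in> c1 K" "\<alpha> \<in> c2 K \<Longrightarrow> t2 K \<alpha> \<in> c1 K"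
  "\<alpha> \<in> c2 K \<Longrightarrow> s1 K (t2 K \<alpha>) = s1 K (s2 K \<alpha>)" "\<alpha> \<in> c2 K \<Longrightarrow> t1 K (t2 K \<alpha>) = t1 K (s2 K \<alpha>)"
  using strict by (simp_all add: strict_2cat_def)

lemma i1 [simp]: "x \<in> c0 K \<Longrightarrow> i1 K x \<in> c1 K" "x \<in> c0 K \<Longrightarrow> s1 K (i1 K x) = x"
  "x \<in> c0 K \<Longrightarrow> t1 K (i1 K x) = x"
  using strict by (simp_all add: strict_2cat_def hom1_def)

lemma i2 [simp]: "f \<in> c1 K \<Longrightarrow> i2 K f \<in> c2 K" "f \<in> c1 K \<Longrightarrow> s2 K (i2 K f) = f"
  "f \<in> c1 K \<Longrightarrow> t2 K (i2 K f) = f"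
  using strict by (simp_all add: strict_2cat_def hom2_def)

lemma comp1 [simp]:
  assumes "g \<in> c1 K" "f \<in> c1 K" "s1 K g = t1 K f"
  shows "comp1 K g f \<in> c1 K" "s1 K (comp1 K g f) = s1 K f" "t1 K (comp1 K g f) = t1 K g"
proof -
  have "\<forall>x y z. \<forall>f\<in>hom1 K x y. \<forall>g\<in>hom1 K y z. comp1 K g f \<in> hom1 K x z"
    using strict unfolding strict_2cat_def by (elim conjE)
  from this[rule_format, of f "s1 K f" "t1 K f" g "t1 K g"] assms
  show "comp1 K g f \<in> c1 K" "s1 K (comp1 K g f) = s1 K f" "t1 K (comp1 K g f) = t1 K g"
    by (simp_all add: hom1_def)
qed

lemma vcomp [simp]:
  assumes "\<beta> \<in> c2 K" "\<alpha> \<in> c2 K" "s2 K \<beta> = t2 K \<alpha>"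
  shows "vcomp K \<beta> \<alpha> \<in> c2 K" "s2 K (vcomp K \<beta> \<alpha>) = s2 K \<alpha>" "t2 K (vcomp K \<beta> \<alpha>) = t2 K \<beta>"
proof -
  have "\<forall>f g h. \<forall>\<alpha>\<in>hom2 K f g. \<forall>\<beta>\<in>hom2 K g h. vcomp K \<beta> \<alpha> \<in> hom2 K f h"
    using strict unfolding strict_2cat_def by (elim conjE)
  from this[rule_format, of \<alpha> "s2 K \<alpha>" "t2 K \<alpha>" \<beta> "t2 K \<beta>"] assms
  show "vcomp K \<beta> \<alpha> \<in> c2 K" "s2 K (vcomp K \<beta> \<alpha>) = s2 K \<alpha>" "t2 K (vcomp K \<beta> \<alpha>) = t2 K \<beta>"
    by (simp_all add: hom2_def)
qed

lemma hcomp [simp]: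
  assumes "\<beta> \<in> c2 K" "\<alpha> \<in> c2 K" "s1 K (s2 K \<beta>) = t1 K (s2 K \<alpha>)"
  shows "hcomp K \<beta> \<alpha> \<in> c2 K" "s2 K (hcomp K \<beta> \<alpha>) = comp1 K (s2 K \<beta>) (s2 K \<alpha>)"
    "t2 K (hcomp K \<beta> \<alpha>) = comp1 K (t2 K \<beta>) (t2 K \<alpha>)"
  using strict assms by (simp_all add: strict_2cat_def hcomposable_def hom2_def)

lemma comp1_idr [simp]: "f \<in> c1 K \<Longrightarrow> s1 K f = x \<Longrightarrow> comp1 K f (i1 K x) = f"
  and comp1_idl [simp]: "f \<in> c1 K \<Longrightarrow> t1 K f = x \<Longrightarrow> comp1 K (i1 K x) f = f"
  using strict by (auto simp: strict_2cat_def)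

lemma comp1_assoc [simp]:
  "h \<in> c1 K \<Longrightarrow> g \<in> c1 K \<Longrightarrow> f \<in> c1 K \<Longrightarrow> s1 K h = t1 K g \<Longrightarrow> s1 K g = t1 K f \<Longrightarrow>
    comp1 K (comp1 K h g) f = comp1 K h (comp1 K g f)"
  using strict by (simp add: strict_2cat_def)

lemma vcomp_id [simp]: "\<alpha> \<in> c2 K \<Longrightarrow> s2 K \<alpha> = f \<Longrightarrow> vcomp K \<alpha> (i2 K f) = \<alpha>"
  "\<alpha> \<in> c2 K \<Longrightarrow> t2 K \<alpha> = f \<Longrightarrow> vcomp K (i2 K f) \<alpha> = \<alpha>"
  using strict by (auto simp: strict_2cat_def)

lemma vcomp_assoc [simp]:
  "\<gamma> \<in> c2 K \<Longrightarrow> \<beta> \<in> c2 K \<Longrightarrow> \<alpha> \<in> c2 K \<Longrightarrow> s2 K \<gamma> = t2 K \<beta> \<Longrightarrow> s2 K \<beta> = t2 K \<alpha> \<Longrightarrow>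
    vcomp K (vcomp K \<gamma> \<beta>) \<alpha> = vcomp K \<gamma> (vcomp K \<beta> \<alpha>)"
  using strict by (simp add: strict_2cat_def vcomposable_def)

lemma hcomp_id [simp]:
  "\<alpha> \<in> c2 K \<Longrightarrow> s1 K (s2 K \<alpha>) = x \<Longrightarrow> hcomp K \<alpha> (i2 K (i1 K x)) = \<alpha>"
  "\<alpha> \<in> c2 K \<Longrightarrow> t1 K (s2 K \<alpha>) = x \<Longrightarrow> hcomp K (i2 K (i1 K x)) \<alpha> = \<alpha>"
  using strict by (auto simp: strict_2cat_def)

lemma hcomp_assoc [simp]:
  "\<gamma> \<in> c2 K \<Longrightarrow> \<beta> \<in> c2 K \<Longrightarrow> \<alpha> \<in> c2 K \<Longrightarrow> s1 K (s2 K \<gamma>) = t1 K (s2 K \<beta>) \<Longrightarrow>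
    s1 K (s2 K \<beta>) = t1 K (s2 K \<alpha>) \<Longrightarrow>
    hcomp K (hcomp K \<gamma> \<beta>) \<alpha> = hcomp K \<gamma> (hcomp K \<beta> \<alpha>)"
  using strict by (simp add: strict_2cat_def hcomposable_def)

lemma hcomp_i2 [simp]:
  "g \<in> c1 K \<Longrightarrow> f \<in> c1 K \<Longrightarrow> s1 K g = t1 K f \<Longrightarrow> hcomp K (i2 K g) (i2 K f) = i2 K (comp1 K g f)"
  using strict by (simp add: strict_2cat_def)

lemma interchange:
  assumes "\<alpha>' \<in> c2 K" "\<alpha> \<in> c2 K" "s2 K \<alpha>' = t2 K \<alpha>" "\<beta>' \<in> c2 K" "\<beta> \<in> c2 K" "s2 K \<beta>' = t2 K \<beta>"
    "s1 K (s2 K \<beta>) = t1 K (s2 K \<alpha>)"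
  shows "hcomp K (vcomp K \<beta>' \<beta>) (vcomp K \<alpha>' \<alpha>) = vcomp K (hcomp K \<beta>' \<alpha>') (hcomp K \<beta> \<alpha>)"
proof -
  have "\<forall>\<alpha> \<alpha>' \<beta> \<beta>'. vcomposable K \<alpha>' \<alpha> \<longrightarrow> vcomposable K \<beta>' \<beta> \<longrightarrow> hcomposable K \<beta> \<alpha> \<longrightarrow>
      hcomp K (vcomp K \<beta>' \<beta>) (vcomp K \<alpha>' \<alpha>) = vcomp K (hcomp K \<beta>' \<alpha>') (hcomp K \<beta> \<alpha>)"
    using strict unfolding strict_2cat_def by (elim conjE)
  with assms show ?thesis by (simp add: vcomposable_def hcomposable_def)
qed

lemma obj_homcat: "obj (homcat K x y) = hom1 K x y"
  by (simp add: homcat_def Let_def)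

lemma arr_homcat: "arr (homcat K x y) = {\<alpha> \<in> c2 K. s1 K (s2 K \<alpha>) = x \<and> t1 K (s2 K \<alpha>) = y}"
  by (auto simp: homcat_def Let_def hom1_def)

lemma homcat_simps:
  "\<alpha> \<in> arr (homcat K x y) \<Longrightarrow> src (homcat K x y) \<alpha> = s2 K \<alpha>"
  "\<alpha> \<in> arr (homcat K x y) \<Longrightarrow> trg (homcat K x y) \<alpha> = t2 K \<alpha>"
  "f \<in> hom1 K x y \<Longrightarrow> idn (homcat K x y) f = i2 K f"
  "\<beta> \<in> arr (homcat K x y) \<Longrightarrow> \<alpha> \<in> arr (homcat K x y) \<Longrightarrow> s2 K \<beta> = t2 K \<alpha> \<Longrightarrow>
    cmp (homcat K x y) \<beta> \<alpha> = vcomp K \<beta> \<alpha>"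
  by (auto simp: homcat_def Let_def)

lemma category_homcat: "category (homcat K x y)"
proof (rule categoryI)
  note A = arr_homcat obj_homcat homcat_simps
  fix g f assume "\<not> composable (homcat K x y) g f"
  then have "\<not> (g \<in> arr (homcat K x y) \<and> f \<in> arr (homcat K x y) \<and> s2 K g = t2 K f)"
    by (auto simp: composable_def homcat_simps)
  then show "cmp (homcat K x y) g f = undefined"
    by (auto simp: homcat_def Let_def)
next
  show "src (homcat K x y) \<in> extensional (arr (homcat K x y))"
    "trg (homcat K x y) \<in> extensional (arr (homcat K x y))"
    "idn (homcat K x y) \<in> extensional (obj (homcat K x y))"
    by (simp_all add: homcat_def Let_def)
qed (auto simp: obj_homcat homcat_simps, auto simp: arr_homcat obj_homcat homcat_simps hom1_def)

end

section \<open>Sub-2-categories and their inclusions\<close>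

lemma incl_simps [simp]: "F0 incl = (\<lambda>x. x)" "F1 incl = (\<lambda>x. x)" "F2 incl = (\<lambda>x. x)"
  by (simp_all add: incl_def)

text \<open>The first conjunct is an equation of records: the operations of \<open>K\<close> are
  literally those of \<open>L\<close>. Given the closure conditions, the laws of \<open>L\<close>
  are laws of \<open>K\<close> and \<open>incl\<close> is a 2-functor. Both \<open>full_sub2\<close>
  and suitable \<open>locally_full_sub2\<close> are instances.\<close>

definition locally_full_sub :: "('a, 'b, 'c) twocat \<Rightarrow> ('a, 'b, 'c) twocat \<Rightarrow> bool" where
  "locally_full_sub K L \<longleftrightarrow> K = L\<lparr> c0 := c0 K, c1 := c1 K, c2 := {\<alpha> \<in> c2 L. s2 L \<alpha> \<in> c1 K \<and> t2 L \<alpha> \<in> c1 K} \<rparr> \<and>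
     c0 K \<subseteq> c0 L \<and> c1 K \<subseteq> c1 L \<and> (\<forall>f\<in>c1 K. s1 L f \<in> c0 K \<and> t1 L f \<in> c0 K) \<and>
     (\<forall>x\<in>c0 K. i1 L x \<in> c1 K) \<and>
     (\<forall>f\<in>c1 K. \<forall>g\<in>c1 K. s1 L g = t1 L f \<longrightarrow> comp1 L g f \<in> c1 K)"

lemma locally_full_sub_sel:
  assumes "locally_full_sub K L"
  shows "s1 K = s1 L" "t1 K = t1 L" "s2 K = s2 L" "t2 K = t2 L" "i1 K = i1 L" "i2 K = i2 L"
    "comp1 K = comp1 L" "vcomp K = vcomp L" "hcomp K = hcomp L"
    "c2 K = {\<alpha> \<in> c2 L. s2 L \<alpha> \<in> c1 K \<and> t2 L \<alpha> \<in> c1 K}"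
proof -
  \<comment> \<open>Naming the three carrier sets keeps the equation from rewriting the
    \<open>K\<close> on its own right-hand side.\<close>
  obtain a b c where K: "K = L\<lparr> c0 := a, c1 := b, c2 := c \<rparr>" and
    c: "c2 K = {\<alpha> \<in> c2 L. s2 L \<alpha> \<in> c1 K \<and> t2 L \<alpha> \<in> c1 K}"
  proof
    show "K = L\<lparr> c0 := c0 K, c1 := c1 K, c2 := {\<alpha> \<in> c2 L. s2 L \<alpha> \<in> c1 K \<and> t2 L \<alpha> \<in> c1 K} \<rparr>"
      using assms by (simp add: locally_full_sub_def)
    then show "c2 K = {\<alpha> \<in> c2 L. s2 L \<alpha> \<in> c1 K \<and> t2 L \<alpha> \<in> c1 K}"
      by (metis (no_types, lifting) twocat.select_convs(3) twocat.surjective twocat.update_convs(3))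
  qed
  show "s1 K = s1 L" "t1 K = t1 L" "s2 K = s2 L" "t2 K = t2 L" "i1 K = i1 L" "i2 K = i2 L"
    "comp1 K = comp1 L" "vcomp K = vcomp L" "hcomp K = hcomp L"
    unfolding K by simp_all
  show "c2 K = {\<alpha> \<in> c2 L. s2 L \<alpha> \<in> c1 K \<and> t2 L \<alpha> \<in> c1 K}" by (rule c)
qed

lemma locally_full_sub_strict:
  assumes "locally_full_sub K L" "strict_2cat L"
  shows "strict_2cat K"
proof -
  interpret is_2cat L using assms(2) by unfold_locales
  note sel = locally_full_sub_sel[OF assms(1)]
  have sub: "c0 K \<subseteq> c0 L" "c1 K \<subseteq> c1 L"
    "\<And>f. f \<in> c1 K \<Longrightarrow> s1 L f \<in> c0 K" "\<And>f. f \<in> c1 K \<Longrightarrow> t1 L f \<in> c0 K"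
    "\<And>x. x \<in> c0 K \<Longrightarrow> i1 L x \<in> c1 K"
    "\<And>f g. f \<in> c1 K \<Longrightarrow> g \<in> c1 K \<Longrightarrow> s1 L g = t1 L f \<Longrightarrow> comp1 L g f \<in> c1 K"
    using assms(1) by (simp_all add: locally_full_sub_def)
  have sub': "x \<in> c0 K \<Longrightarrow> x \<in> c0 L" "f \<in> c1 K \<Longrightarrow> f \<in> c1 L" for x f
    using sub by auto
  show ?thesis
    unfolding strict_2cat_def hom1_def hom2_def hcomposable_def vcomposable_def sel
    by (intro conjI allI ballI impI) (auto simp: sub sub' interchange)
qed

lemma locally_full_sub_incl:
  assumes "locally_full_sub K L" "strict_2cat L"
  shows "is_2functor K L incl"
proof -
  interpret is_2cat L using assms(2) by unfold_locales
  have "x \<in> c0 K \<Longrightarrow> x \<in> c0 L" "f \<in> c1 K \<Longrightarrow> f \<in> c1 L" for x f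
    using assms(1) by (auto simp: locally_full_sub_def)
  then show ?thesis
    using assms(2) locally_full_sub_strict[OF assms]
    unfolding is_2functor_def hom1_def hom2_def locally_full_sub_sel[OF assms(1)] by simp
qed

lemma full_sub2_simps [simp]:
  "c0 (full_sub2 K Q) = {x \<in> c0 K. Q x}"
  "c1 (full_sub2 K Q) = {f \<in> c1 K. Q (s1 K f) \<and> Q (t1 K f)}"
  "c2 (full_sub2 K Q) = {\<alpha> \<in> c2 K. Q (s1 K (s2 K \<alpha>)) \<and> Q (t1 K (s2 K \<alpha>))}"
  "s1 (full_sub2 K Q) = s1 K" "t1 (full_sub2 K Q) = t1 K" "s2 (full_sub2 K Q) = s2 K"
  "t2 (full_sub2 K Q) = t2 K" "i1 (full_sub2 K Q) = i1 K" "i2 (full_sub2 K Q) = i2 K"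
  "comp1 (full_sub2 K Q) = comp1 K" "vcomp (full_sub2 K Q) = vcomp K"
  "hcomp (full_sub2 K Q) = hcomp K"
  by (simp_all add: full_sub2_def)

lemma locally_full_sub2_simps [simp]:
  "c0 (locally_full_sub2 K Q) = c0 K"
  "c1 (locally_full_sub2 K Q) = {f \<in> c1 K. Q f}"
  "c2 (locally_full_sub2 K Q) = {\<alpha> \<in> c2 K. Q (s2 K \<alpha>) \<and> Q (t2 K \<alpha>)}"
  "s1 (locally_full_sub2 K Q) = s1 K" "t1 (locally_full_sub2 K Q) = t1 K"
  "s2 (locally_full_sub2 K Q) = s2 K" "t2 (locally_full_sub2 K Q) = t2 K"
  "i1 (locally_full_sub2 K Q) = i1 K" "i2 (locally_full_sub2 K Q) = i2 K"
  "comp1 (locally_full_sub2 K Q) = comp1 K" "vcomp (locally_full_sub2 K Q) = vcomp K"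
  "hcomp (locally_full_sub2 K Q) = hcomp K"
  by (simp_all add: locally_full_sub2_def)

lemma full_sub2_full_sub2: "full_sub2 (full_sub2 K P) Q = full_sub2 K (\<lambda>x. P x \<and> Q x)"
  by (simp add: full_sub2_def conj_ac)

text \<open>The ends of 1-cells and 2-cells of a strict 2-category are objects, so agreement of
  \<open>P\<close> and \<open>Q\<close> on objects carries over to all cells.\<close>

lemma full_sub2_cong:
  assumes "strict_2cat K" "\<And>x. x \<in> c0 K \<Longrightarrow> P x = Q x"
  shows "full_sub2 K P = full_sub2 K Q"
proof -
  interpret is_2cat K using assms(1) by unfold_locales
  have "c0 (full_sub2 K P) = c0 (full_sub2 K Q)" "c1 (full_sub2 K P) = c1 (full_sub2 K Q)"
    "c2 (full_sub2 K P) = c2 (full_sub2 K Q)"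
    using assms(2) by auto
  then show ?thesis by (simp add: full_sub2_def)
qed

context is_2cat
begin

lemma locally_full_sub_full_sub2: "locally_full_sub (full_sub2 K Q) K"
proof -
  have c2: "{\<alpha> \<in> c2 K. s2 K \<alpha> \<in> c1 (full_sub2 K Q) \<and> t2 K \<alpha> \<in> c1 (full_sub2 K Q)} =
      c2 (full_sub2 K Q)"
    by auto
  show ?thesis
    unfolding locally_full_sub_def c2 by (intro conjI) (simp add: full_sub2_def, auto)
qed

lemma locally_full_sub_locally_full_sub2:
  assumes "\<And>x. x \<in> c0 K \<Longrightarrow> Q (i1 K x)"
    "\<And>f g. f \<in> c1 K \<Longrightarrow> g \<in> c1 K \<Longrightarrow> s1 K g = t1 K f \<Longrightarrow> Q f \<Longrightarrow> Q g \<Longrightarrow> Q (comp1 K g f)"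
  shows "locally_full_sub (locally_full_sub2 K Q) K"
proof -
  have c2: "{\<alpha> \<in> c2 K. s2 K \<alpha> \<in> c1 (locally_full_sub2 K Q) \<and> t2 K \<alpha> \<in> c1 (locally_full_sub2 K Q)} =
      c2 (locally_full_sub2 K Q)"
    by auto
  show ?thesis
    unfolding locally_full_sub_def c2 by (intro conjI) (simp add: locally_full_sub2_def, use assms in auto)
qed

lemma strict_full_sub2: "strict_2cat (full_sub2 K Q)"
  by (rule locally_full_sub_strict[OF locally_full_sub_full_sub2 strict])

lemma incl_full_sub2: "is_2functor (full_sub2 K Q) K incl"
  by (rule locally_full_sub_incl[OF locally_full_sub_full_sub2 strict])

lemma homcat_full_sub2: "Q x \<Longrightarrow> Q y \<Longrightarrow> homcat (full_sub2 K Q) x y = homcat K x y"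
proof -
  assume Q: "Q x" "Q y"
  have H: "hom1 (full_sub2 K Q) x y = hom1 K x y"
    using Q by (auto simp: hom1_def)
  have A: "{\<alpha> \<in> c2 (full_sub2 K Q). s2 K \<alpha> \<in> hom1 K x y \<and> t2 K \<alpha> \<in> hom1 K x y} =
      {\<alpha> \<in> c2 K. s2 K \<alpha> \<in> hom1 K x y \<and> t2 K \<alpha> \<in> hom1 K x y}"
    using Q by (auto simp: hom1_def)
  show ?thesis
    unfolding homcat_def Let_def H full_sub2_simps(4-) A by simp
qed

lemma internally_equivalent_full_sub2:
  assumes "internally_equivalent K x y" "Q x" "Q y"
  shows "internally_equivalent (full_sub2 K Q) x y"
proof -
  have "hom1 (full_sub2 K Q) x y = hom1 K x y" "hom1 (full_sub2 K Q) y x = hom1 K y x"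
    using assms(2,3) by (auto simp: hom1_def)
  then show ?thesis
    using assms unfolding internally_equivalent_def by (simp add: homcat_full_sub2)
qed

text \<open>On hom-categories the inclusion is the identity functor, so only surjectivity up to
  internal equivalence is left to assume.\<close>

lemma equivalence_full_sub2:
  assumes "\<And>z. z \<in> c0 K \<Longrightarrow> \<exists>x\<in>c0 K. Q x \<and> internally_equivalent K x z"
  shows "equivalence_of_2cats (full_sub2 K Q) K incl"
proof -
  have "hom_functor (full_sub2 K Q) incl x y = fid (homcat K x y)" if "Q x" "Q y" for x y
    by (simp add: hom_functor_def homcat_full_sub2[OF that] fid_def)
  then have "\<forall>x\<in>c0 (full_sub2 K Q). \<forall>y\<in>c0 (full_sub2 K Q). equivalence_of_cats
      (homcat (full_sub2 K Q) x y) (homcat K (F0 incl x) (F0 incl y)) (hom_functor (full_sub2 K Q) incl x y)"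
    by (simp add: homcat_full_sub2 equivalence_fid category_homcat)
  moreover have "\<forall>z\<in>c0 K. \<exists>x\<in>c0 (full_sub2 K Q). internally_equivalent K (F0 incl x) z"
    using assms by fastforce
  ultimately show ?thesis
    using incl_full_sub2 unfolding equivalence_of_2cats_def by blast
qed

lemma internally_equivalent_refl:
  assumes "x \<in> c0 K"
  shows "internally_equivalent K x x"
proof -
  interpret H: is_cat "homcat K x x" using category_homcat by unfold_locales
  have "isomorphic_objs (homcat K x x) (i1 K x) (i1 K x)"
    using assms by (intro H.isomorphic_refl) (simp add: obj_homcat hom1_def)
  then show ?thesis
    using assms unfolding internally_equivalent_def
    by (intro bexI[where x = "i1 K x"] conjI) (simp_all add: hom1_def)
qed

text \<open>All objects stay, and all 2-cells between the chosen 1-cells. So the hom-functors are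
  fully faithful inclusions, and \<open>es\<close> is their essential surjectivity.\<close>

lemma equivalence_locally_full_sub2:
  assumes cl: "\<And>x. x \<in> c0 K \<Longrightarrow> Q (i1 K x)"
      "\<And>f g. f \<in> c1 K \<Longrightarrow> g \<in> c1 K \<Longrightarrow> s1 K g = t1 K f \<Longrightarrow> Q f \<Longrightarrow> Q g \<Longrightarrow> Q (comp1 K g f)"
    and es: "\<And>f. f \<in> c1 K \<Longrightarrow> \<exists>g \<in> hom1 K (s1 K f) (t1 K f). Q g \<and>
      isomorphic_objs (homcat K (s1 K f) (t1 K f)) g f"
  shows "equivalence_of_2cats (locally_full_sub2 K Q) K incl"
proof -
  let ?L = "locally_full_sub2 K Q"
  have lf: "locally_full_sub ?L K" by (rule locally_full_sub_locally_full_sub2[OF cl])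
  interpret L: is_2cat ?L using locally_full_sub_strict[OF lf strict] by unfold_locales
  have "equivalence_of_cats (homcat ?L x y) (homcat K x y) (hom_functor ?L incl x y)"
    if "x \<in> c0 K" "y \<in> c0 K" for x y
  proof (rule equivalence_of_catsI)
    let ?F = "hom_functor ?L incl x y"
    interpret C: is_cat "homcat ?L x y" using L.category_homcat by unfold_locales
    have ar: "f \<in> arr (homcat K x y)" if "f \<in> arr (homcat ?L x y)" for f
      using that unfolding arr_homcat L.arr_homcat by simp
    have F: "fob ?F = restrict (\<lambda>f. f) (hom1 ?L x y)"
      "far ?F = restrict (\<lambda>f. f) (arr (homcat ?L x y))"
      by (simp_all add: hom_functor_def L.obj_homcat)
    have ob: "f \<in> hom1 K x y" if "f \<in> hom1 ?L x y" for f
      using that by (simp add: hom1_def)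
    show "is_functor (homcat ?L x y) (homcat K x y) ?F"
    proof (rule is_functorI)
      fix f assume f: "f \<in> arr (homcat ?L x y)"
      then show "src (homcat K x y) (far ?F f) = fob ?F (src (homcat ?L x y) f)"
        "trg (homcat K x y) (far ?F f) = fob ?F (trg (homcat ?L x y) f)"
        "far ?F f \<in> arr (homcat K x y)"
        using ar[OF f] C.src_obj[OF f] C.trg_obj[OF f]
        by (simp_all add: F homcat_simps L.homcat_simps L.obj_homcat)
    next
      fix g f assume gf: "g \<in> arr (homcat ?L x y)" "f \<in> arr (homcat ?L x y)"
        "src (homcat ?L x y) g = trg (homcat ?L x y) f"
      then show "far ?F (cmp (homcat ?L x y) g f) = cmp (homcat K x y) (far ?F g) (far ?F f)"
        using ar[OF gf(1)] ar[OF gf(2)] C.cmp_arr[OF gf]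
        by (simp add: F homcat_simps L.homcat_simps)
    next
      fix f assume f: "f \<in> obj (homcat ?L x y)"
      then show "far ?F (idn (homcat ?L x y) f) = idn (homcat K x y) (fob ?F f)"
        using C.idn_arr[OF f] ob by (simp add: F L.obj_homcat homcat_simps L.homcat_simps)
    qed (auto simp: F L.obj_homcat obj_homcat ob category_homcat C.category)
    show "faithful (homcat ?L x y) ?F"
      by (auto simp: faithful_def F inj_on_def hom_def)
    show "full (homcat ?L x y) (homcat K x y) ?F"
      unfolding full_def
    proof (intro ballI subsetI)
      fix f g \<alpha> assume fg: "f \<in> obj (homcat ?L x y)" "g \<in> obj (homcat ?L x y)"
        and a: "\<alpha> \<in> hom (homcat K x y) (fob ?F f) (fob ?F g)"
      then have "\<alpha> \<in> arr (homcat K x y)" "s2 K \<alpha> = f" "t2 K \<alpha> = g"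
        by (auto simp: hom_def F L.obj_homcat homcat_simps)
      then have "\<alpha> \<in> arr (homcat ?L x y)" "s2 K \<alpha> = f" "t2 K \<alpha> = g"
        using fg unfolding arr_homcat L.arr_homcat L.obj_homcat by (auto simp: hom1_def)
      then show "\<alpha> \<in> far ?F ` hom (homcat ?L x y) f g"
        by (intro image_eqI[where x = \<alpha>]) (simp_all add: F hom_def L.homcat_simps)
    qed
  next
    fix f assume "f \<in> obj (homcat K x y)"
    then have f: "f \<in> c1 K" "s1 K f = x" "t1 K f = y"
      by (simp_all add: obj_homcat hom1_def)
    then obtain g where "g \<in> hom1 K x y" "Q g" "isomorphic_objs (homcat K x y) g f"
      using es[OF f(1)] by auto
    then show "\<exists>g\<in>obj (homcat ?L x y). isomorphic_objs (homcat K x y) (fob (hom_functor ?L incl x y) g) f"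
      by (intro bexI[where x = g]) (auto simp: hom_functor_def L.obj_homcat hom1_def)
  qed
  moreover have "\<exists>x\<in>c0 ?L. internally_equivalent K (F0 incl x) z" if "z \<in> c0 K" for z
    using that internally_equivalent_refl[OF that] by auto
  ultimately show ?thesis
    using locally_full_sub_incl[OF lf strict] unfolding equivalence_of_2cats_def by auto
qed

end

lemma isomorphism_of_2catsI:
  assumes F: "is_2functor K L F" and b0: "bij_betw (F0 F) (c0 K) (c0 L)"
    and b1: "bij_betw (F1 F) (c1 K) (c1 L)" and b2: "bij_betw (F2 F) (c2 K) (c2 L)"
  shows "isomorphism_of_2cats K L F"
proof -
  interpret K: is_2cat K using F by unfold_locales (simp add: is_2functor_def)
  interpret L: is_2cat L using F by unfold_locales (simp add: is_2functor_def)
  define G where "G = \<lparr> F0 = inv_into (c0 K) (F0 F), F1 = inv_into (c1 K) (F1 F),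
    F2 = inv_into (c2 K) (F2 F) \<rparr>"
  have G [simp]: "x \<in> c0 K \<Longrightarrow> F0 G (F0 F x) = x" "f \<in> c1 K \<Longrightarrow> F1 G (F1 F f) = f"
    "\<alpha> \<in> c2 K \<Longrightarrow> F2 G (F2 F \<alpha>) = \<alpha>" for x f \<alpha>
    using b0 b1 b2 by (simp_all add: G_def bij_betw_def)
  have e0: "\<exists>x\<in>c0 K. y = F0 F x" if "y \<in> c0 L" for y
    using that b0 by (auto simp: bij_betw_def)
  have e1: "\<exists>f\<in>c1 K. g = F1 F f" if "g \<in> c1 L" for g
    using that b1 by (auto simp: bij_betw_def)
  have e2: "\<exists>\<alpha>\<in>c2 K. \<beta> = F2 F \<alpha>" if "\<beta> \<in> c2 L" for \<beta>
    using that b2 by (auto simp: bij_betw_def)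
  have F' [simp]: "f \<in> c1 K \<Longrightarrow> s1 L (F1 F f) = F0 F (s1 K f)" "f \<in> c1 K \<Longrightarrow> t1 L (F1 F f) = F0 F (t1 K f)"
    "\<alpha> \<in> c2 K \<Longrightarrow> s2 L (F2 F \<alpha>) = F1 F (s2 K \<alpha>)" "\<alpha> \<in> c2 K \<Longrightarrow> t2 L (F2 F \<alpha>) = F1 F (t2 K \<alpha>)"
    for f \<alpha>
    using F by (simp_all add: is_2functor_def hom1_def hom2_def)
  \<comment> \<open>Injectivity of \<open>F\<close> on lower cells transfers composability in
    \<open>L\<close> back to \<open>K\<close>, where the operations can then be applied.\<close>
  have i0: "F0 F x = F0 F y \<longleftrightarrow> x = y" if "x \<in> c0 K" "y \<in> c0 K" for x y
    using that G(1) by metis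
  have i1: "F1 F x = F1 F y \<longleftrightarrow> x = y" if "x \<in> c1 K" "y \<in> c1 K" for x y
    using that G(2) by metis
  have ops: "\<And>x. x \<in> c0 K \<Longrightarrow> i1 L (F0 F x) = F1 F (i1 K x)"
    "\<And>f. f \<in> c1 K \<Longrightarrow> i2 L (F1 F f) = F2 F (i2 K f)"
    "\<And>f g. f \<in> c1 K \<Longrightarrow> g \<in> c1 K \<Longrightarrow> s1 K g = t1 K f \<Longrightarrow> comp1 L (F1 F g) (F1 F f) = F1 F (comp1 K g f)"
    "\<And>\<beta> \<alpha>. \<beta> \<in> c2 K \<Longrightarrow> \<alpha> \<in> c2 K \<Longrightarrow> s2 K \<beta> = t2 K \<alpha> \<Longrightarrow> vcomp L (F2 F \<beta>) (F2 F \<alpha>) = F2 F (vcomp K \<beta> \<alpha>)"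
    "\<And>\<beta> \<alpha>. \<beta> \<in> c2 K \<Longrightarrow> \<alpha> \<in> c2 K \<Longrightarrow> s1 K (s2 K \<beta>) = t1 K (s2 K \<alpha>) \<Longrightarrow>
      hcomp L (F2 F \<beta>) (F2 F \<alpha>) = F2 F (hcomp K \<beta> \<alpha>)"
    using F by (simp_all add: is_2functor_def vcomposable_def hcomposable_def)
  have "is_2functor L K G"
    unfolding is_2functor_def vcomposable_def hcomposable_def hom1_def hom2_def
  proof (intro conjI ballI allI impI K.strict L.strict; (elim conjE)?)
    fix y assume "y \<in> c0 L" then show "F0 G y \<in> c0 K" "F1 G (i1 L y) = i1 K (F0 G y)"
      by (auto dest!: e0 simp: ops)
  next
    fix f assume "f \<in> c1 L" then show "F1 G f \<in> {fa \<in> c1 K. s1 K fa = F0 G (s1 L f) \<and> t1 K fa = F0 G (t1 L f)}"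
      "F2 G (i2 L f) = i2 K (F1 G f)"
      by (auto dest!: e1 simp: ops)
  next
    fix \<alpha> assume "\<alpha> \<in> c2 L"
    then show "F2 G \<alpha> \<in> {\<beta> \<in> c2 K. s2 K \<beta> = F1 G (s2 L \<alpha>) \<and> t2 K \<beta> = F1 G (t2 L \<alpha>)}"
      by (auto dest!: e2)
  next
    fix f g assume "f \<in> c1 L" "g \<in> c1 L" "s1 L g = t1 L f"
    then show "F1 G (comp1 L g f) = comp1 K (F1 G g) (F1 G f)"
      by (auto dest!: e1 simp: ops i0)
  next
    fix \<beta> \<alpha> assume "\<beta> \<in> c2 L" "\<alpha> \<in> c2 L" "s2 L \<beta> = t2 L \<alpha>"
    then show "F2 G (vcomp L \<beta> \<alpha>) = vcomp K (F2 G \<beta>) (F2 G \<alpha>)"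
      by (auto dest!: e2 simp: ops i1)
  next
    fix \<beta> \<alpha> assume "\<beta> \<in> c2 L" "\<alpha> \<in> c2 L" "s1 L (s2 L \<beta>) = t1 L (s2 L \<alpha>)"
    then show "F2 G (hcomp L \<beta> \<alpha>) = hcomp K (F2 G \<beta>) (F2 G \<alpha>)"
      by (auto dest!: e2 simp: ops i0)
  qed
  moreover have "\<forall>y\<in>c0 L. F0 F (F0 G y) = y" "\<forall>g\<in>c1 L. F1 F (F1 G g) = g" "\<forall>\<beta>\<in>c2 L. F2 F (F2 G \<beta>) = \<beta>"
    by (auto dest!: e0 e1 e2)
  ultimately show ?thesis
    using F unfolding isomorphism_of_2cats_def by (intro conjI exI[where x = G]) simp_all
qed

section \<open>Universal arrows\<close>

definition cells :: "('a, 'b, 'c) twocat \<Rightarrow> 'a \<Rightarrow> 'a \<Rightarrow> 'c set" where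
  "cells K x y = {\<alpha> \<in> c2 K. s1 K (s2 K \<alpha>) = x \<and> t1 K (s2 K \<alpha>) = y}"

text \<open>Objectwise form of a left 2-adjoint to the inclusion of the objects satisfying
  \<open>Q\<close>. Bijectivity on 1-cells and on 2-cells makes precomposition with \<open>e\<close>
  an isomorphism of hom-categories; functoriality of \<open>p\<close> in \<open>x\<close> is a
  consequence of uniqueness.\<close>

definition has_universal_arrows :: "('a, 'b, 'c) twocat \<Rightarrow> ('a \<Rightarrow> bool) \<Rightarrow> bool" where
  "has_universal_arrows K Q \<longleftrightarrow> (\<forall>x\<in>c0 K. \<exists>p\<in>c0 K. Q p \<and> (\<exists>e\<in>hom1 K x p. \<forall>y\<in>c0 K. Q y \<longrightarrow>
     bij_betw (\<lambda>f. comp1 K f e) (hom1 K p y) (hom1 K x y) \<and>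
     bij_betw (\<lambda>\<alpha>. hcomp K \<alpha> (i2 K e)) (cells K p y) (cells K x y)))"

lemma left_2adjoint_full_sub2:
  assumes "strict_2cat L" "has_universal_arrows L Q"
  shows "has_left_2adjoint (full_sub2 L Q) L incl"
proof -
  let ?K = "full_sub2 L Q"
  interpret is_2cat L using assms(1) by unfold_locales
  interpret K: is_2cat ?K using strict_full_sub2 by unfold_locales
  obtain p e where pe: "\<And>x. x \<in> c0 L \<Longrightarrow> p x \<in> c0 L \<and> Q (p x) \<and> e x \<in> hom1 L x (p x) \<and>
    (\<forall>y\<in>c0 L. Q y \<longrightarrow>
      bij_betw (\<lambda>f. comp1 L f (e x)) (hom1 L (p x) y) (hom1 L x y) \<and>
      bij_betw (\<lambda>\<alpha>. hcomp L \<alpha> (i2 L (e x))) (cells L (p x) y) (cells L x y))"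
    using assms(2) unfolding has_universal_arrows_def by metis
  have [simp]: "x \<in> c0 L \<Longrightarrow> p x \<in> c0 L" "x \<in> c0 L \<Longrightarrow> Q (p x)" "x \<in> c0 L \<Longrightarrow> e x \<in> c1 L"
    "x \<in> c0 L \<Longrightarrow> s1 L (e x) = x" "x \<in> c0 L \<Longrightarrow> t1 L (e x) = p x" for x
    using pe by (auto simp: hom1_def)
  have b1: "bij_betw (\<lambda>f. comp1 L f (e x)) (hom1 L (p x) y) (hom1 L x y)"
    and b2: "bij_betw (\<lambda>\<alpha>. hcomp L \<alpha> (i2 L (e x))) (cells L (p x) y) (cells L x y)"
    if "x \<in> c0 L" "y \<in> c0 L" "Q y" for x y
    using pe that by auto
  have u1: "f = g" if "f \<in> c1 L" "g \<in> c1 L" "x \<in> c0 L" "s1 L f = p x" "s1 L g = p x" "t1 L f = t1 L g"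
    "Q (t1 L g)" "comp1 L f (e x) = comp1 L g (e x)" for f g x
    using that b1[of x "t1 L g"] by (auto simp: bij_betw_def inj_on_def hom1_def)
  have u2: "\<alpha> = \<beta>" if "\<alpha> \<in> c2 L" "\<beta> \<in> c2 L" "x \<in> c0 L" "s1 L (s2 L \<alpha>) = p x" "s1 L (s2 L \<beta>) = p x"
    "t1 L (s2 L \<alpha>) = t1 L (s2 L \<beta>)"
    "Q (t1 L (s2 L \<beta>))" "hcomp L \<alpha> (i2 L (e x)) = hcomp L \<beta> (i2 L (e x))" for \<alpha> \<beta> x
    using that b2[of x "t1 L (s2 L \<beta>)"] by (auto simp: bij_betw_def inj_on_def cells_def)
  \<comment> \<open>The action of the adjoint on \<open>h\<close> is forced by naturality of the
    unit: \<open>P1 h\<close> after the unit must be the unit after \<open>h\<close>. The action on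
    2-cells is found in the same way.\<close>
  have "\<exists>f. f \<in> c1 L \<and> s1 L f = p (s1 L h) \<and> t1 L f = p (t1 L h) \<and>
      comp1 L f (e (s1 L h)) = comp1 L (e (t1 L h)) h" if h: "h \<in> c1 L" for h
  proof -
    have "comp1 L (e (t1 L h)) h \<in> hom1 L (s1 L h) (p (t1 L h))"
      using h by (simp add: hom1_def)
    then have "comp1 L (e (t1 L h)) h \<in> (\<lambda>f. comp1 L f (e (s1 L h))) ` hom1 L (p (s1 L h)) (p (t1 L h))"
      using b1[of "s1 L h" "p (t1 L h)"] h by (simp add: bij_betw_def)
    then show ?thesis by (auto simp: hom1_def)
  qed
  then obtain P1 where P1 [simp]: "\<And>h. h \<in> c1 L \<Longrightarrow> P1 h \<in> c1 L" "\<And>h. h \<in> c1 L \<Longrightarrow> s1 L (P1 h) = p (s1 L h)"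
    "\<And>h. h \<in> c1 L \<Longrightarrow> t1 L (P1 h) = p (t1 L h)"
    and P1e: "\<And>h. h \<in> c1 L \<Longrightarrow> comp1 L (P1 h) (e (s1 L h)) = comp1 L (e (t1 L h)) h"
    by metis
  have "\<exists>\<beta>. \<beta> \<in> c2 L \<and> s1 L (s2 L \<beta>) = p (s1 L (s2 L \<alpha>)) \<and> t1 L (s2 L \<beta>) = p (t1 L (s2 L \<alpha>)) \<and>
      hcomp L \<beta> (i2 L (e (s1 L (s2 L \<alpha>)))) = hcomp L (i2 L (e (t1 L (s2 L \<alpha>)))) \<alpha>"
    if a: "\<alpha> \<in> c2 L" for \<alpha>
  proof -
    have "hcomp L (i2 L (e (t1 L (s2 L \<alpha>)))) \<alpha> \<in> cells L (s1 L (s2 L \<alpha>)) (p (t1 L (s2 L \<alpha>)))"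
      using a by (simp add: cells_def)
    then have "hcomp L (i2 L (e (t1 L (s2 L \<alpha>)))) \<alpha> \<in> (\<lambda>\<beta>. hcomp L \<beta> (i2 L (e (s1 L (s2 L \<alpha>))))) `
        cells L (p (s1 L (s2 L \<alpha>))) (p (t1 L (s2 L \<alpha>)))"
      using b2[of "s1 L (s2 L \<alpha>)" "p (t1 L (s2 L \<alpha>))"] a by (simp add: bij_betw_def)
    then show ?thesis by (auto simp: cells_def)
  qed
  then obtain P2 where P2 [simp]: "\<And>\<alpha>. \<alpha> \<in> c2 L \<Longrightarrow> P2 \<alpha> \<in> c2 L"
    and P2s: "\<And>\<alpha>. \<alpha> \<in> c2 L \<Longrightarrow> s1 L (s2 L (P2 \<alpha>)) = p (s1 L (s2 L \<alpha>))"
    "\<And>\<alpha>. \<alpha> \<in> c2 L \<Longrightarrow> t1 L (s2 L (P2 \<alpha>)) = p (t1 L (s2 L \<alpha>))"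
    and P2e: "\<And>\<alpha>. \<alpha> \<in> c2 L \<Longrightarrow> hcomp L (P2 \<alpha>) (i2 L (e (s1 L (s2 L \<alpha>)))) =
      hcomp L (i2 L (e (t1 L (s2 L \<alpha>)))) \<alpha>"
    by metis
  \<comment> \<open>The 1-cells bounding \<open>P2 \<alpha>\<close> were not part of its choice;
    they are recovered by cancelling the unit in the boundary of the defining equation.\<close>
  have P2_st [simp]: "s2 L (P2 \<alpha>) = P1 (s2 L \<alpha>)" "t2 L (P2 \<alpha>) = P1 (t2 L \<alpha>)" if a: "\<alpha> \<in> c2 L" for \<alpha>
  proof -
    have "comp1 L (s2 L (P2 \<alpha>)) (e (s1 L (s2 L \<alpha>))) = s2 L (hcomp L (P2 \<alpha>) (i2 L (e (s1 L (s2 L \<alpha>)))))"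
      using a by (simp add: P2s)
    also have "\<dots> = comp1 L (e (t1 L (s2 L \<alpha>))) (s2 L \<alpha>)"
      using a by (simp add: P2e)
    finally show "s2 L (P2 \<alpha>) = P1 (s2 L \<alpha>)"
      using a by - (rule u1[of _ _ "s1 L (s2 L \<alpha>)"], simp_all add: P2s P1e)
    have "comp1 L (t2 L (P2 \<alpha>)) (e (s1 L (s2 L \<alpha>))) = t2 L (hcomp L (P2 \<alpha>) (i2 L (e (s1 L (s2 L \<alpha>)))))"
      using a by (simp add: P2s)
    also have "\<dots> = comp1 L (e (t1 L (t2 L \<alpha>))) (t2 L \<alpha>)"
      using a by (simp add: P2e)
    finally show "t2 L (P2 \<alpha>) = P1 (t2 L \<alpha>)"
      using a P1e[of "t2 L \<alpha>"] by - (rule u1[of _ _ "s1 L (s2 L \<alpha>)"], simp_all add: P2s)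
  qed
  define P where "P = \<lparr> F0 = p, F1 = P1, F2 = P2 \<rparr>"
  have P: "is_2functor L ?K P"
    unfolding is_2functor_def vcomposable_def hcomposable_def hom1_def hom2_def
  proof (intro conjI ballI allI impI strict K.strict; (elim conjE)?)
    fix x assume x: "x \<in> c0 L"
    have "P1 (i1 L x) = i1 L (p x)"
      by (rule u1[of _ _ x]) (use x P1e[of "i1 L x"] in simp_all)
    then show "F1 P (i1 L x) = i1 ?K (F0 P x)" by (simp add: P_def)
  next
    fix f assume f: "f \<in> c1 L"
    have "P2 (i2 L f) = i2 L (P1 f)"
      by (rule u2[of _ _ "s1 L f"]) (use f P2e[of "i2 L f"] P1e[of f] in simp_all)
    then show "F2 P (i2 L f) = i2 ?K (F1 P f)" by (simp add: P_def)
  next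
    fix f g assume fg: "f \<in> c1 L" "g \<in> c1 L" "s1 L g = t1 L f"
    have "comp1 L (P1 g) (comp1 L (P1 f) (e (s1 L f))) = comp1 L (comp1 L (P1 g) (e (s1 L g))) f"
      using fg by (simp add: P1e)
    also have "\<dots> = comp1 L (e (t1 L g)) (comp1 L g f)"
      using fg P1e[OF fg(2)] by simp
    finally have "P1 (comp1 L g f) = comp1 L (P1 g) (P1 f)"
      by - (rule u1[of _ _ "s1 L f"], (use fg P1e[of "comp1 L g f"] in simp_all))
    then show "F1 P (comp1 L g f) = comp1 ?K (F1 P g) (F1 P f)" by (simp add: P_def)
  next
    fix \<beta> \<alpha> assume ba: "\<beta> \<in> c2 L" "\<alpha> \<in> c2 L" "s2 L \<beta> = t2 L \<alpha>"
    let ?x = "s1 L (s2 L \<alpha>)" and ?y = "t1 L (s2 L \<alpha>)"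
    have xy: "s1 L (s2 L \<beta>) = ?x" "t1 L (s2 L \<beta>) = ?y" using ba by simp_all
    \<comment> \<open>The identity 2-cell on the unit is written as a vertical composite with itself
      so that interchange applies.\<close>
    have "hcomp L (vcomp L (P2 \<beta>) (P2 \<alpha>)) (vcomp L (i2 L (e ?x)) (i2 L (e ?x))) =
        vcomp L (hcomp L (P2 \<beta>) (i2 L (e ?x))) (hcomp L (P2 \<alpha>) (i2 L (e ?x)))"
      by (rule interchange) (use ba in simp_all)
    also have "\<dots> = vcomp L (hcomp L (i2 L (e ?y)) \<beta>) (hcomp L (i2 L (e ?y)) \<alpha>)"
      using P2e[OF ba(1)] P2e[OF ba(2)] xy by simp
    also have "\<dots> = hcomp L (vcomp L (i2 L (e ?y)) (i2 L (e ?y))) (vcomp L \<beta> \<alpha>)"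
      by (rule interchange[symmetric]) (use ba in simp_all)
    finally have "hcomp L (vcomp L (P2 \<beta>) (P2 \<alpha>)) (i2 L (e ?x)) = hcomp L (i2 L (e ?y)) (vcomp L \<beta> \<alpha>)"
      using ba by simp
    then have "P2 (vcomp L \<beta> \<alpha>) = vcomp L (P2 \<beta>) (P2 \<alpha>)"
      by - (rule u2[of _ _ ?x], (use ba P2e[of "vcomp L \<beta> \<alpha>"] in simp_all))
    then show "F2 P (vcomp L \<beta> \<alpha>) = vcomp ?K (F2 P \<beta>) (F2 P \<alpha>)" by (simp add: P_def)
  next
    fix \<beta> \<alpha> assume ba: "\<beta> \<in> c2 L" "\<alpha> \<in> c2 L" "s1 L (s2 L \<beta>) = t1 L (s2 L \<alpha>)"
    have "hcomp L (P2 \<beta>) (hcomp L (P2 \<alpha>) (i2 L (e (s1 L (s2 L \<alpha>))))) =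
        hcomp L (hcomp L (P2 \<beta>) (i2 L (e (s1 L (s2 L \<beta>))))) \<alpha>"
      using ba by (simp add: P2e)
    also have "\<dots> = hcomp L (i2 L (e (t1 L (s2 L \<beta>)))) (hcomp L \<beta> \<alpha>)"
      using ba P2e[OF ba(1)] by simp
    finally have "P2 (hcomp L \<beta> \<alpha>) = hcomp L (P2 \<beta>) (P2 \<alpha>)"
      by - (rule u2[of _ _ "s1 L (s2 L \<alpha>)"], (use ba P2e[of "hcomp L \<beta> \<alpha>"] in simp_all))
    then show "F2 P (hcomp L \<beta> \<alpha>) = hcomp ?K (F2 P \<beta>) (F2 P \<alpha>)" by (simp add: P_def)
  qed (simp_all add: P_def)
  define \<Phi> where "\<Phi> x y = \<lparr> fob = restrict (\<lambda>f. comp1 L f (e x)) (hom1 L (p x) y),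
    far = restrict (\<lambda>\<alpha>. hcomp L \<alpha> (i2 L (e x))) (cells L (p x) y) \<rparr>" for x y
  have ar: "arr (homcat L x y) = cells L x y" for x y
    by (simp add: arr_homcat cells_def)
  have \<Phi>: "isomorphism_of_cats (homcat ?K (p x) y) (homcat L x y) (\<Phi> x y)"
    if x: "x \<in> c0 L" and y: "y \<in> c0 L" "Q y" for x y
  proof -
    have K: "homcat ?K (p x) y = homcat L (p x) y"
      using x y by (simp add: homcat_full_sub2)
    show ?thesis
      unfolding K
    proof (rule isomorphism_of_catsI)
      interpret H: is_cat "homcat L (p x) y" using category_homcat by unfold_locales
      have cell: "hcomp L \<alpha> (i2 L (e x)) \<in> arr (homcat L x y)" if "\<alpha> \<in> cells L (p x) y" for \<alpha>
        using that x by (simp add: ar cells_def)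
      have ob: "comp1 L f (e x) \<in> hom1 L x y" if "f \<in> hom1 L (p x) y" for f
        using that x by (simp add: hom1_def)
      show "is_functor (homcat L (p x) y) (homcat L x y) (\<Phi> x y)"
      proof (rule is_functorI)
        fix \<alpha> assume a: "\<alpha> \<in> arr (homcat L (p x) y)"
        then have a': "\<alpha> \<in> cells L (p x) y" by (simp add: ar)
        have "s2 L \<alpha> \<in> hom1 L (p x) y" "t2 L \<alpha> \<in> hom1 L (p x) y"
          using a' by (auto simp: cells_def hom1_def)
        then show "far (\<Phi> x y) \<alpha> \<in> arr (homcat L x y)"
          "src (homcat L x y) (far (\<Phi> x y) \<alpha>) = fob (\<Phi> x y) (src (homcat L (p x) y) \<alpha>)"
          "trg (homcat L x y) (far (\<Phi> x y) \<alpha>) = fob (\<Phi> x y) (trg (homcat L (p x) y) \<alpha>)"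
          using cell[OF a'] a a' x by (simp_all add: \<Phi>_def homcat_simps, simp_all add: cells_def)
      next
        fix f assume "f \<in> obj (homcat L (p x) y)"
        then have f: "f \<in> hom1 L (p x) y" by (simp add: obj_homcat)
        have "i2 L f \<in> cells L (p x) y" using f by (simp add: cells_def hom1_def)
        then show "far (\<Phi> x y) (idn (homcat L (p x) y) f) = idn (homcat L x y) (fob (\<Phi> x y) f)"
          using f ob[OF f] x by (simp add: \<Phi>_def homcat_simps) (simp add: hom1_def)
      next
        fix \<beta> \<alpha> assume ba: "\<beta> \<in> arr (homcat L (p x) y)" "\<alpha> \<in> arr (homcat L (p x) y)"
          "src (homcat L (p x) y) \<beta> = trg (homcat L (p x) y) \<alpha>"
        then have st: "s2 L \<beta> = t2 L \<alpha>" by (simp add: homcat_simps)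
        have ba': "\<beta> \<in> cells L (p x) y" "\<alpha> \<in> cells L (p x) y" using ba by (simp_all add: ar)
        have "hcomp L (vcomp L \<beta> \<alpha>) (vcomp L (i2 L (e x)) (i2 L (e x))) =
            vcomp L (hcomp L \<beta> (i2 L (e x))) (hcomp L \<alpha> (i2 L (e x)))"
          by (rule interchange) (use ba' st x in \<open>simp_all add: cells_def\<close>)
        then have "hcomp L (vcomp L \<beta> \<alpha>) (i2 L (e x)) =
            vcomp L (hcomp L \<beta> (i2 L (e x))) (hcomp L \<alpha> (i2 L (e x)))"
          using x by simp
        moreover have "vcomp L \<beta> \<alpha> \<in> cells L (p x) y" using ba' st by (simp add: cells_def)
        moreover have "s2 L (hcomp L \<beta> (i2 L (e x))) = t2 L (hcomp L \<alpha> (i2 L (e x)))"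
          using ba' st x by (simp add: cells_def)
        ultimately show "far (\<Phi> x y) (cmp (homcat L (p x) y) \<beta> \<alpha>) =
            cmp (homcat L x y) (far (\<Phi> x y) \<beta>) (far (\<Phi> x y) \<alpha>)"
          using ba ba' st cell[OF ba'(1)] cell[OF ba'(2)]
          by (simp add: homcat_simps \<Phi>_def)
      qed (use ob in \<open>auto simp: category_homcat \<Phi>_def obj_homcat ar\<close>)
      show "bij_betw (fob (\<Phi> x y)) (obj (homcat L (p x) y)) (obj (homcat L x y))"
        using b1[OF x y] by (simp add: \<Phi>_def obj_homcat)
      show "bij_betw (far (\<Phi> x y)) (arr (homcat L (p x) y)) (arr (homcat L x y))"
        using b2[OF x y] by (simp add: \<Phi>_def ar)
    qed
  qed
  have "fob (\<Phi> (s1 L h) (t1 L k)) (comp1 L k (comp1 L f (P1 h))) =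
      comp1 L k (comp1 L (fob (\<Phi> (t1 L h) (s1 L k)) f) h)"
    if "h \<in> c1 L" "k \<in> c1 L" "f \<in> hom1 L (p (t1 L h)) (s1 L k)" for h k f
    using that by (simp add: \<Phi>_def hom1_def P1e)
  moreover have "far (\<Phi> (s1 L (s2 L \<eta>)) (t1 L (s2 L \<kappa>))) (hcomp L \<kappa> (hcomp L \<alpha> (P2 \<eta>))) =
      hcomp L \<kappa> (hcomp L (far (\<Phi> (t1 L (s2 L \<eta>)) (s1 L (s2 L \<kappa>))) \<alpha>) \<eta>)"
    if "\<eta> \<in> c2 L" "\<kappa> \<in> c2 L" "\<alpha> \<in> cells L (p (t1 L (s2 L \<eta>))) (s1 L (s2 L \<kappa>))" for \<eta> \<kappa> \<alpha>
    using that by (simp add: \<Phi>_def cells_def P2e)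
  ultimately show ?thesis
    unfolding has_left_2adjoint_def
  proof (intro conjI exI[where x = P] exI[where x = \<Phi>] incl_full_sub2 P ballI)
    assume n1: "\<And>h k f. h \<in> c1 L \<Longrightarrow> k \<in> c1 L \<Longrightarrow> f \<in> hom1 L (p (t1 L h)) (s1 L k) \<Longrightarrow>
      fob (\<Phi> (s1 L h) (t1 L k)) (comp1 L k (comp1 L f (P1 h))) =
      comp1 L k (comp1 L (fob (\<Phi> (t1 L h) (s1 L k)) f) h)"
    and n2: "\<And>\<eta> \<kappa> \<alpha>. \<eta> \<in> c2 L \<Longrightarrow> \<kappa> \<in> c2 L \<Longrightarrow> \<alpha> \<in> cells L (p (t1 L (s2 L \<eta>))) (s1 L (s2 L \<kappa>)) \<Longrightarrow>
      far (\<Phi> (s1 L (s2 L \<eta>)) (t1 L (s2 L \<kappa>))) (hcomp L \<kappa> (hcomp L \<alpha> (P2 \<eta>))) =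
      hcomp L \<kappa> (hcomp L (far (\<Phi> (t1 L (s2 L \<eta>)) (s1 L (s2 L \<kappa>))) \<alpha>) \<eta>)"
    show "isomorphism_of_cats (homcat ?K (F0 P x) y) (homcat L x (F0 incl y)) (\<Phi> x y)"
      if "x \<in> c0 L" "y \<in> c0 ?K" for x y
      using that \<Phi> by (simp add: P_def)
    show "fob (\<Phi> (s1 L h) (t1 ?K k)) (comp1 ?K k (comp1 ?K f (F1 P h))) =
        comp1 L (F1 incl k) (comp1 L (fob (\<Phi> (t1 L h) (s1 ?K k)) f) h)"
      if "h \<in> c1 L" "k \<in> c1 ?K" "f \<in> hom1 ?K (F0 P (t1 L h)) (s1 ?K k)" for h k f
      using that n1[of h k f] by (simp add: P_def hom1_def)
    show "far (\<Phi> (s1 L (s2 L \<eta>)) (t1 ?K (s2 ?K \<kappa>))) (hcomp ?K \<kappa> (hcomp ?K \<alpha> (F2 P \<eta>))) =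
        hcomp L (F2 incl \<kappa>) (hcomp L (far (\<Phi> (t1 L (s2 L \<eta>)) (s1 ?K (s2 ?K \<kappa>))) \<alpha>) \<eta>)"
      if "\<eta> \<in> c2 L" "\<kappa> \<in> c2 ?K" "\<alpha> \<in> arr (homcat ?K (F0 P (t1 L (s2 L \<eta>))) (s1 ?K (s2 ?K \<kappa>)))" for \<eta> \<kappa> \<alpha>
      using that n2[of \<eta> \<kappa> \<alpha>] by (simp add: P_def K.arr_homcat cells_def)
  qed
qed

lemma bij_betw_conjugate:
  assumes "bij_betw v A A'" "bij_betw w B B'" "bij_betw f A B" "\<And>a. a \<in> A \<Longrightarrow> f' (v a) = w (f a)"
  shows "bij_betw f' A' B'"
proof -
  have "bij_betw (w \<circ> f) A B'"
    using assms(3,2) by (rule bij_betw_trans)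
  moreover have "bij_betw (f' \<circ> v) A B' \<longleftrightarrow> bij_betw (w \<circ> f) A B'"
    using assms(4) by (intro bij_betw_cong) simp
  ultimately have "bij_betw (f' \<circ> v) A B'" by simp
  then show ?thesis
    using assms(1) by (simp add: bij_betw_comp_iff)
qed

text \<open>Universal arrows are stated purely inside the 2-category, so a 2-functor bijective on
  all cells carries them over. This yields the adjoint for strict maps of comprehension categories
  from the one for display maps.\<close>

lemma has_universal_arrows_transport:
  assumes V: "is_2functor L L' V" and b0: "bij_betw (F0 V) (c0 L) (c0 L')"
    and b1: "bij_betw (F1 V) (c1 L) (c1 L')" and b2: "bij_betw (F2 V) (c2 L) (c2 L')"
    and Q: "\<And>x. x \<in> c0 L \<Longrightarrow> Q' (F0 V x) = Q x"
    and un: "has_universal_arrows L Q"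
  shows "has_universal_arrows L' Q'"
proof -
  interpret L: is_2cat L using V by unfold_locales (simp add: is_2functor_def)
  interpret L': is_2cat L' using V by unfold_locales (simp add: is_2functor_def)
  have V' [simp]: "x \<in> c0 L \<Longrightarrow> F0 V x \<in> c0 L'" "f \<in> c1 L \<Longrightarrow> F1 V f \<in> c1 L'" "\<alpha> \<in> c2 L \<Longrightarrow> F2 V \<alpha> \<in> c2 L'"
    "f \<in> c1 L \<Longrightarrow> s1 L' (F1 V f) = F0 V (s1 L f)" "f \<in> c1 L \<Longrightarrow> t1 L' (F1 V f) = F0 V (t1 L f)"
    "\<alpha> \<in> c2 L \<Longrightarrow> s2 L' (F2 V \<alpha>) = F1 V (s2 L \<alpha>)" "\<alpha> \<in> c2 L \<Longrightarrow> t2 L' (F2 V \<alpha>) = F1 V (t2 L \<alpha>)"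
    for x f \<alpha>
    using V by (simp_all add: is_2functor_def hom1_def hom2_def)
  have i0: "F0 V x = F0 V y \<longleftrightarrow> x = y" if "x \<in> c0 L" "y \<in> c0 L" for x y
    using b0 that by (auto simp: bij_betw_def inj_on_def)
  \<comment> \<open>Bijectivity on all 1-cells restricts to hom-sets because \<open>V\<close> is
    injective on objects.\<close>
  have h1: "bij_betw (F1 V) (hom1 L x y) (hom1 L' (F0 V x) (F0 V y))" if xy: "x \<in> c0 L" "y \<in> c0 L" for x y
  proof (rule bij_betw_subset[OF b1])
    show "F1 V ` hom1 L x y = hom1 L' (F0 V x) (F0 V y)"
    proof (intro subset_antisym subsetI)
      fix g assume g: "g \<in> hom1 L' (F0 V x) (F0 V y)"
      then obtain f where f: "f \<in> c1 L" "g = F1 V f"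
        using b1 by (auto simp: bij_betw_def hom1_def)
      then have "f \<in> hom1 L x y"
        using g xy by (auto simp: hom1_def i0)
      with f show "g \<in> F1 V ` hom1 L x y" by auto
    qed (auto simp: hom1_def)
  qed (auto simp: hom1_def)
  have h2: "bij_betw (F2 V) (cells L x y) (cells L' (F0 V x) (F0 V y))" if xy: "x \<in> c0 L" "y \<in> c0 L" for x y
  proof (rule bij_betw_subset[OF b2])
    show "F2 V ` cells L x y = cells L' (F0 V x) (F0 V y)"
    proof (intro subset_antisym subsetI)
      fix \<beta> assume b: "\<beta> \<in> cells L' (F0 V x) (F0 V y)"
      then obtain \<alpha> where a: "\<alpha> \<in> c2 L" "\<beta> = F2 V \<alpha>"
        using b2 by (auto simp: bij_betw_def cells_def)
      then have "\<alpha> \<in> cells L x y"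
        using b xy by (auto simp: cells_def i0)
      with a show "\<beta> \<in> F2 V ` cells L x y" by auto
    qed (auto simp: cells_def)
  qed (auto simp: cells_def)
  show ?thesis
    unfolding has_universal_arrows_def
  proof
    fix x' assume "x' \<in> c0 L'"
    then obtain x where x: "x \<in> c0 L" "x' = F0 V x"
      using b0 by (auto simp: bij_betw_def)
    obtain p e where p: "p \<in> c0 L" "Q p" and e: "e \<in> hom1 L x p" and
      bij: "\<And>y. y \<in> c0 L \<Longrightarrow> Q y \<Longrightarrow> bij_betw (\<lambda>f. comp1 L f e) (hom1 L p y) (hom1 L x y)"
      "\<And>y. y \<in> c0 L \<Longrightarrow> Q y \<Longrightarrow> bij_betw (\<lambda>\<alpha>. hcomp L \<alpha> (i2 L e)) (cells L p y) (cells L x y)"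
      using un x(1) unfolding has_universal_arrows_def by metis
    have e': "e \<in> c1 L" "s1 L e = x" "t1 L e = p" using e by (simp_all add: hom1_def)
    show "\<exists>p\<in>c0 L'. Q' p \<and> (\<exists>e\<in>hom1 L' x' p. \<forall>y\<in>c0 L'. Q' y \<longrightarrow>
        bij_betw (\<lambda>f. comp1 L' f e) (hom1 L' p y) (hom1 L' x' y) \<and>
        bij_betw (\<lambda>\<alpha>. hcomp L' \<alpha> (i2 L' e)) (cells L' p y) (cells L' x' y))"
    proof (intro bexI[where x = "F0 V p"] bexI[where x = "F1 V e"] conjI ballI impI)
      fix y' assume "y' \<in> c0 L'" "Q' y'"
      then obtain y where "y \<in> c0 L" "y' = F0 V y"
        using b0 by (auto simp: bij_betw_def)
      then have y: "y \<in> c0 L" "Q y" "y' = F0 V y"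
        using Q \<open>Q' y'\<close> by simp_all
      show "bij_betw (\<lambda>f. comp1 L' f (F1 V e)) (hom1 L' (F0 V p) y') (hom1 L' x' y')"
        unfolding x y(3)
        by (rule bij_betw_conjugate[OF h1[OF p(1) y(1)] h1[OF x(1) y(1)] bij(1)[OF y(1,2)]])
          (use V e' in \<open>simp add: is_2functor_def hom1_def\<close>)
      show "bij_betw (\<lambda>\<alpha>. hcomp L' \<alpha> (i2 L' (F1 V e))) (cells L' (F0 V p) y') (cells L' x' y')"
        unfolding x y(3)
        by (rule bij_betw_conjugate[OF h2[OF p(1) y(1)] h2[OF x(1) y(1)] bij(2)[OF y(1,2)]])
          (use V e' in \<open>simp add: is_2functor_def cells_def hcomposable_def\<close>)
    qed (use p Q x e' in \<open>simp_all add: hom1_def\<close>)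
  qed
qed

section \<open>Comprehension categories and pseudo maps\<close>

lemma (in is_cat) iso_cancel:
  assumes "iso_arr C i" "f \<in> arr C" "g \<in> arr C" "trg C f = src C i" "trg C g = src C i"
    "cmp C i f = cmp C i g"
  shows "f = g"
proof -
  obtain j where j: "i \<in> arr C" "j \<in> arr C" "src C j = trg C i" "trg C j = src C i"
    "cmp C j i = idn C (src C i)"
    using assms(1) by (rule isoE)
  have "cmp C (cmp C j i) f = cmp C (cmp C j i) g"
    using j(1-4) assms by simp
  then show ?thesis using j assms by simp
qed

locale compr_cat =
  fixes X :: "('o, 'm, 't, 's, 'z) compcat_scheme"
  assumes comprehension: "comprehension_category X"

sublocale compr_cat \<subseteq> base: is_cat "base X"
  using comprehension by unfold_locales (simp add: comprehension_category_def)

sublocale compr_cat \<subseteq> p: is_ftr "tot X" "base X" "proj X"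
  using comprehension by unfold_locales (simp add: comprehension_category_def fibration_def)

sublocale compr_cat \<subseteq> chi: is_ftr "tot X" "arrcat (base X)" "compr X"
  using comprehension by unfold_locales (simp add: comprehension_category_def)

context compr_cat
begin

lemma proj_eq: "proj X = fcomp (tot X) (codf (base X)) (compr X)"
  using comprehension by (simp add: comprehension_category_def)

lemma compr_obj [simp]: "A \<in> obj (tot X) \<Longrightarrow> fob (compr X) A \<in> arr (base X)"
  using chi.fob_obj by simp

lemma trg_compr [simp]: "A \<in> obj (tot X) \<Longrightarrow> trg (base X) (fob (compr X) A) = fob (proj X) A"
  by (subst proj_eq) (simp add: codf_def)

lemma src_compr [simp]: "A \<in> obj (tot X) \<Longrightarrow> src (base X) (fob (compr X) A) = ext X A"
  by (simp add: ext_def)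

lemma ext_obj [simp]: "A \<in> obj (tot X) \<Longrightarrow> ext X A \<in> obj (base X)"
  using base.src_obj[OF compr_obj] by simp

lemma compr_arr [simp]:
  assumes "u \<in> arr (tot X)"
  shows "sqsrc (far (compr X) u) = fob (compr X) (src (tot X) u)"
    "sqtrg (far (compr X) u) = fob (compr X) (trg (tot X) u)"
    "sqcod (far (compr X) u) = far (proj X) u"
    "sqdom (far (compr X) u) \<in> arr (base X)"
    "src (base X) (sqdom (far (compr X) u)) = ext X (src (tot X) u)"
    "trg (base X) (sqdom (far (compr X) u)) = ext X (trg (tot X) u)"
proof -
  note u = chi.far_arr[OF assms]
  show 1: "sqsrc (far (compr X) u) = fob (compr X) (src (tot X) u)"
    "sqtrg (far (compr X) u) = fob (compr X) (trg (tot X) u)"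
    using assms chi.src_far[OF assms] chi.trg_far[OF assms] src_arrcat[OF u] trg_arrcat[OF u]
    by simp_all
  show "sqcod (far (compr X) u) = far (proj X) u"
    using assms u by (subst proj_eq) (simp add: codf_def)
  show "sqdom (far (compr X) u) \<in> arr (base X)"
    "src (base X) (sqdom (far (compr X) u)) = ext X (src (tot X) u)"
    "trg (base X) (sqdom (far (compr X) u)) = ext X (trg (tot X) u)"
    using square_arrD[OF u] 1 assms by simp_all
qed

lemma cartesian_compr:
  "cartesian (tot X) (base X) (proj X) u \<Longrightarrow>
    cartesian (arrcat (base X)) (base X) (codf (base X)) (far (compr X) u)"
  using comprehension pullback_iff_cartesian[OF base.category] by (simp add: comprehension_category_def)

text \<open>Reflection of cartesian arrows, applied to the comprehension; the functor composed with
  it is the codomain functor, and the composite is the projection by \<open>proj_eq\<close>.\<close>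

lemma cartesian_full:
  assumes "full_cc X" "u \<in> arr (tot X)"
    "cartesian (arrcat (base X)) (base X) (codf (base X)) (far (compr X) u)"
  shows "cartesian (tot X) (base X) (proj X) u"
  using cartesian_reflect[OF chi.is_functor functor_codf[OF base.category], of u] assms
  by (simp add: full_cc_def flip: proj_eq)

lemma cartesian_ex:
  assumes "A \<in> obj (tot X)" "f \<in> arr (base X)" "trg (base X) f = fob (proj X) A"
  shows "\<exists>u. cartesian (tot X) (base X) (proj X) u \<and> trg (tot X) u = A \<and> far (proj X) u = f"
  using assms comprehension unfolding comprehension_category_def fibration_def by blast

end

locale ps_map = X: compr_cat X + Y: compr_cat Y
  for X Y :: "('o, 'm, 't, 's, 'z) compcat_scheme" +
  fixes F :: "('o, 'm, 'o, 'm) fctr" and F' :: "('t, 's, 't, 's) fctr" and \<phi> :: "'t \<Rightarrow> 'm square"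
  assumes pseudo_map: "pseudo_map X Y F F' \<phi>"

sublocale ps_map \<subseteq> F: is_ftr "base X" "base Y" F
  using pseudo_map by unfold_locales (simp add: pseudo_map_def)

sublocale ps_map \<subseteq> F': is_ftr "tot X" "tot Y" F'
  using pseudo_map by unfold_locales (simp add: pseudo_map_def)

sublocale ps_map \<subseteq> \<phi>: is_nt "tot X" "arrcat (base Y)" "fcomp (tot X) (compr Y) F'"
    "fcomp (tot X) (arrf (base X) F) (compr X)" \<phi>
  using pseudo_map by unfold_locales (simp add: pseudo_map_def nat_iso_def)

context ps_map
begin

lemma proj_map: "fcomp (tot X) (proj Y) F' = fcomp (tot X) F (proj X)"
  using pseudo_map by (simp add: pseudo_map_def)

lemma proj_fob [simp]: "A \<in> obj (tot X) \<Longrightarrow> fob (proj Y) (fob F' A) = fob F (fob (proj X) A)"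
  and proj_far [simp]: "u \<in> arr (tot X) \<Longrightarrow> far (proj Y) (far F' u) = far F (far (proj X) u)"
  using arg_cong[OF proj_map, of "\<lambda>G. fob G A"] arg_cong[OF proj_map, of "\<lambda>G. far G u"] by simp_all

lemma cartesian_map: "cartesian (tot X) (base X) (proj X) u \<Longrightarrow>
    cartesian (tot Y) (base Y) (proj Y) (far F' u)"
  using pseudo_map by (simp add: pseudo_map_def)

lemma phi_iso: "A \<in> obj (tot X) \<Longrightarrow> iso_arr (arrcat (base Y)) (\<phi> A)"
  using pseudo_map by (simp add: pseudo_map_def nat_iso_def)

lemma phi [simp]:
  assumes "A \<in> obj (tot X)"
  shows "\<phi> A \<in> arr (arrcat (base Y))" "sqsrc (\<phi> A) = fob (compr Y) (fob F' A)"
    "sqtrg (\<phi> A) = far F (fob (compr X) A)" "sqcod (\<phi> A) = idn (base Y) (fob F (fob (proj X) A))"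
    "sqdom (\<phi> A) \<in> arr (base Y)" "src (base Y) (sqdom (\<phi> A)) = ext Y (fob F' A)"
    "trg (base Y) (sqdom (\<phi> A)) = fob F (ext X A)"
proof -
  note a = \<phi>.nt_arr[OF assms]
  show "\<phi> A \<in> arr (arrcat (base Y))" by (rule a)
  show 1: "sqsrc (\<phi> A) = fob (compr Y) (fob F' A)" "sqtrg (\<phi> A) = far F (fob (compr X) A)"
    using assms \<phi>.src_nt[OF assms] \<phi>.trg_nt[OF assms] src_arrcat[OF a] trg_arrcat[OF a] by simp_all
  show "sqcod (\<phi> A) = idn (base Y) (fob F (fob (proj X) A))"
    using pseudo_map assms by (simp add: pseudo_map_def)
  show "sqdom (\<phi> A) \<in> arr (base Y)" "src (base Y) (sqdom (\<phi> A)) = ext Y (fob F' A)"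
    "trg (base Y) (sqdom (\<phi> A)) = fob F (ext X A)"
    using square_arrD[OF a] 1 assms by simp_all
qed

lemma arrf_arr [simp]:
  assumes "s \<in> arr (arrcat (base X))"
  shows "far (arrf (base X) F) s \<in> arr (arrcat (base Y))"
proof -
  interpret G: is_ftr "arrcat (base X)" "arrcat (base Y)" "arrf (base X) F"
    using functor_arrf[OF F.is_functor] by unfold_locales
  show ?thesis using assms by (rule G.far_arr)
qed

lemma phi_nat:
  assumes "u \<in> arr (tot X)" "src (tot X) u = A" "trg (tot X) u = B"
  shows "cmp (arrcat (base Y)) (\<phi> B) (far (compr Y) (far F' u)) =
    cmp (arrcat (base Y)) (far (arrf (base X) F) (far (compr X) u)) (\<phi> A)"
  using \<phi>.naturality[OF assms] assms by (simp del: arrf_simps)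

end

section \<open>Pseudo maps into a full comprehension category\<close>

lemma pseudo_mapI:
  assumes "is_functor (base X) (base Y) F" "is_functor (tot X) (tot Y) F'"
    "\<And>A. A \<in> obj (tot X) \<Longrightarrow> fob (proj Y) (fob F' A) = fob F (fob (proj X) A)"
    "\<And>u. u \<in> arr (tot X) \<Longrightarrow> far (proj Y) (far F' u) = far F (far (proj X) u)"
    "\<And>u. cartesian (tot X) (base X) (proj X) u \<Longrightarrow> cartesian (tot Y) (base Y) (proj Y) (far F' u)"
    "nat_iso (tot X) (arrcat (base Y))
       (fcomp (tot X) (compr Y) F') (fcomp (tot X) (arrf (base X) F) (compr X)) \<phi>"
    "\<And>A. A \<in> obj (tot X) \<Longrightarrow> sqcod (\<phi> A) = idn (base Y) (fob F (fob (proj X) A))"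
  shows "pseudo_map X Y F F' \<phi>"
  using assms unfolding pseudo_map_def by (auto simp: fcomp_def intro!: restrict_ext)

text \<open>The action on arrows is conjugation by \<open>\<phi>\<close>, pulled back along the full comprehension of \<open>Y\<close>.\<close>

lemma pseudo_map_into_full:
  assumes X: "comprehension_category X" and Y: "comprehension_category Y" and full: "full_cc Y"
    and F: "is_functor (base X) (base Y) F"
    and a: "\<And>A. A \<in> obj (tot X) \<Longrightarrow> a A \<in> obj (tot Y)"
    and iso: "\<And>A. A \<in> obj (tot X) \<Longrightarrow> iso_arr (arrcat (base Y)) (\<phi> A)"
    and \<phi>: "\<And>A. A \<in> obj (tot X) \<Longrightarrow> sqsrc (\<phi> A) = fob (compr Y) (a A)"
      "\<And>A. A \<in> obj (tot X) \<Longrightarrow> sqtrg (\<phi> A) = far F (fob (compr X) A)"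
      "\<And>A. A \<in> obj (tot X) \<Longrightarrow> sqcod (\<phi> A) = idn (base Y) (fob F (fob (proj X) A))"
    and pb: "\<And>u. cartesian (tot X) (base X) (proj X) u \<Longrightarrow>
      pullback_square (base Y) (far (arrf (base X) F) (far (compr X) u))"
  shows "\<exists>F'. pseudo_map X Y F F' (restrict \<phi> (obj (tot X))) \<and> fob F' = restrict a (obj (tot X))"
proof -
  interpret X: compr_cat X using X by unfold_locales
  interpret Y: compr_cat Y using Y by unfold_locales
  interpret F: is_ftr "base X" "base Y" F using F by unfold_locales
  interpret G: is_ftr "arrcat (base X)" "arrcat (base Y)" "arrf (base X) F"
    using functor_arrf[OF F] by unfold_locales
  interpret q: is_ftr "arrcat (base Y)" "base Y" "codf (base Y)"
    using functor_codf[OF Y.base.category] by unfold_locales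
  let ?A = "arrcat (base Y)" and ?G = "arrf (base X) F"
  note [simp del] = arrf_simps Square_arr
  have ful: "full (tot Y) ?A (compr Y)" and fai: "faithful (tot Y) (compr Y)"
    using full by (simp_all add: full_cc_def)
  have \<phi>a [simp]: "\<phi> A \<in> arr ?A" "src ?A (\<phi> A) = fob (compr Y) (a A)"
    "trg ?A (\<phi> A) = far F (fob (compr X) A)" if "A \<in> obj (tot X)" for A
    using iso[OF that] \<phi>[OF that] by (auto simp: iso_arr_def src_arrcat trg_arrcat)
  have Gob [simp]: "fob ?G (fob (compr X) A) = far F (fob (compr X) A)" if "A \<in> obj (tot X)" for A
    using that by (simp add: arrf_simps)
  have "\<exists>j. j \<in> arr ?A \<and> src ?A j = trg ?A (\<phi> A) \<and> trg ?A j = src ?A (\<phi> A) \<and>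
      cmp ?A j (\<phi> A) = idn ?A (src ?A (\<phi> A)) \<and> cmp ?A (\<phi> A) j = idn ?A (trg ?A (\<phi> A))"
    if "A \<in> obj (tot X)" for A
    using iso[OF that] by (auto simp: iso_arr_def hom_def)
  then obtain \<psi> where \<psi>0: "\<And>A. A \<in> obj (tot X) \<Longrightarrow> \<psi> A \<in> arr ?A \<and> src ?A (\<psi> A) = trg ?A (\<phi> A) \<and>
      trg ?A (\<psi> A) = src ?A (\<phi> A) \<and> cmp ?A (\<psi> A) (\<phi> A) = idn ?A (src ?A (\<phi> A)) \<and>
      cmp ?A (\<phi> A) (\<psi> A) = idn ?A (trg ?A (\<phi> A))"
    by metis
  then have \<psi> [simp]: "\<And>A. A \<in> obj (tot X) \<Longrightarrow> \<psi> A \<in> arr ?A"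
    "\<And>A. A \<in> obj (tot X) \<Longrightarrow> src ?A (\<psi> A) = far F (fob (compr X) A)"
    "\<And>A. A \<in> obj (tot X) \<Longrightarrow> trg ?A (\<psi> A) = fob (compr Y) (a A)"
    "\<And>A. A \<in> obj (tot X) \<Longrightarrow> cmp ?A (\<psi> A) (\<phi> A) = idn ?A (fob (compr Y) (a A))"
    "\<And>A. A \<in> obj (tot X) \<Longrightarrow> cmp ?A (\<phi> A) (\<psi> A) = idn ?A (far F (fob (compr X) A))"
    by simp_all
  have \<phi>\<psi> [simp]: "cmp ?A (\<phi> A) (cmp ?A (\<psi> A) s) = s"
    if "A \<in> obj (tot X)" "s \<in> arr ?A" "trg ?A s = far F (fob (compr X) A)" for A s
    using Y.chi.cod.cmp_assoc[of "\<phi> A" "\<psi> A" s] that by simp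
  define t where "t u = cmp ?A (\<psi> (trg (tot X) u))
    (cmp ?A (far ?G (far (compr X) u)) (\<phi> (src (tot X) u)))" for u
  have t [simp]: "t u \<in> arr ?A" "src ?A (t u) = fob (compr Y) (a (src (tot X) u))"
    "trg ?A (t u) = fob (compr Y) (a (trg (tot X) u))" if "u \<in> arr (tot X)" for u
    using that by (simp_all add: t_def)
  have \<phi>t: "cmp ?A (\<phi> (trg (tot X) u)) (t u) = cmp ?A (far ?G (far (compr X) u)) (\<phi> (src (tot X) u))"
    if "u \<in> arr (tot X)" for u
    using that by (simp add: t_def)
  have "\<exists>k. k \<in> arr (tot Y) \<and> src (tot Y) k = a (src (tot X) u) \<and> trg (tot Y) k = a (trg (tot X) u) \<and>
      far (compr Y) k = t u" if "u \<in> arr (tot X)" for u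
    by (rule Y.chi.full_lift[OF ful]) (use that a in simp_all)
  then obtain k where k [simp]: "\<And>u. u \<in> arr (tot X) \<Longrightarrow> k u \<in> arr (tot Y)"
    "\<And>u. u \<in> arr (tot X) \<Longrightarrow> src (tot Y) (k u) = a (src (tot X) u)"
    "\<And>u. u \<in> arr (tot X) \<Longrightarrow> trg (tot Y) (k u) = a (trg (tot X) u)"
    "\<And>u. u \<in> arr (tot X) \<Longrightarrow> far (compr Y) (k u) = t u"
    by metis
  define F' where "F' = \<lparr> fob = restrict a (obj (tot X)), far = restrict k (arr (tot X)) \<rparr>"
  have F'_simps [simp]: "A \<in> obj (tot X) \<Longrightarrow> fob F' A = a A" "u \<in> arr (tot X) \<Longrightarrow> far F' u = k u" for A u
    by (simp_all add: F'_def)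
  have ftr: "is_functor (tot X) (tot Y) F'"
  proof (rule is_functorI)
    fix v u assume vu: "v \<in> arr (tot X)" "u \<in> arr (tot X)" "src (tot X) v = trg (tot X) u"
    \<comment> \<open>The definition of \<open>t\<close> contains inverses; composing with the
      invertible \<open>\<phi>\<close> replaces it by the naturality equation
      \<open>\<phi>t\<close>, which can be chained.\<close>
    have "t (cmp (tot X) v u) = cmp ?A (t v) (t u)"
    proof (rule Y.chi.cod.iso_cancel[OF iso[of "trg (tot X) v"]])
      have "cmp ?A (\<phi> (trg (tot X) v)) (cmp ?A (t v) (t u)) =
          cmp ?A (cmp ?A (\<phi> (trg (tot X) v)) (t v)) (t u)"
        using vu by simp
      also have "\<dots> = cmp ?A (far ?G (far (compr X) v)) (cmp ?A (\<phi> (trg (tot X) u)) (t u))"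
        using vu unfolding \<phi>t[OF vu(1)] by simp
      also have "\<dots> = cmp ?A (\<phi> (trg (tot X) v)) (t (cmp (tot X) v u))"
        using vu \<phi>t[of "cmp (tot X) v u"] unfolding \<phi>t[OF vu(2)] by simp
      finally show "cmp ?A (\<phi> (trg (tot X) v)) (t (cmp (tot X) v u)) =
          cmp ?A (\<phi> (trg (tot X) v)) (cmp ?A (t v) (t u))" by simp
    qed (use vu in simp_all)
    then show "far F' (cmp (tot X) v u) = cmp (tot Y) (far F' v) (far F' u)"
      by - (rule Y.chi.faithful_eq[OF fai], use vu a in simp_all)
  next
    fix A assume A: "A \<in> obj (tot X)"
    have "t (idn (tot X) A) = idn ?A (fob (compr Y) (a A))"
      using A a by (simp add: t_def)
    then show "far F' (idn (tot X) A) = idn (tot Y) (fob F' A)"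
      by - (rule Y.chi.faithful_eq[OF fai], use A a in simp_all)
  qed (auto simp: X.p.dom.category Y.p.dom.category a, auto simp: F'_def)
  have codt: "far (proj Y) (k u) = far F (far (proj X) u)" if u: "u \<in> arr (tot X)" for u
  proof -
    \<comment> \<open>The codomain sides of \<open>\<phi>\<close> are identities, so
      \<open>t u\<close> has the codomain side of the image square. This is where verticality makes
      the new functor lie strictly over \<open>F\<close>.\<close>
    have "far (codf (base Y)) (t u) = far (codf (base Y)) (cmp ?A (\<phi> (trg (tot X) u)) (t u))"
      using u \<phi>(3)[of "trg (tot X) u"] \<phi>(1)[of "trg (tot X) u"] q.src_far[of "\<phi> (trg (tot X) u)"] 
        square_arrD(7)[OF \<phi>a(1)[of "trg (tot X) u"]] a q.trg_far[of "t u"]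
        square_arrD(4)[OF t(1)[OF u]]
      by (simp, simp add: codf_def)
    also have "\<dots> = cmp (base Y) (far (codf (base Y)) (far ?G (far (compr X) u)))
        (far (codf (base Y)) (\<phi> (src (tot X) u)))"
      unfolding \<phi>t[OF u] using u by simp
    also have "\<dots> = far F (far (proj X) u)"
      using u \<phi>(3)[of "src (tot X) u"] G.far_arr[of "far (compr X) u"]
      by (simp add: codf_def arrf_simps)
    finally have "far (codf (base Y)) (t u) = far F (far (proj X) u)" .
    then show ?thesis
      using u by (subst Y.proj_eq) simp
  qed
  have "nat_iso (tot X) ?A (fcomp (tot X) (compr Y) F') (fcomp (tot X) ?G (compr X))
      (restrict \<phi> (obj (tot X)))"
    unfolding nat_iso_def
  proof (intro conjI nat_transI)
    show "is_functor (tot X) ?A (fcomp (tot X) (compr Y) F')"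
      "is_functor (tot X) ?A (fcomp (tot X) ?G (compr X))"
      by (auto intro: functor_fcomp ftr Y.chi.is_functor X.chi.is_functor G.is_functor)
  qed (use iso \<phi>t in simp_all)
  moreover have "cartesian (tot Y) (base Y) (proj Y) (far F' u)"
    if u: "cartesian (tot X) (base X) (proj X) u" for u
  proof (rule Y.cartesian_full[OF full])
    have ua: "u \<in> arr (tot X)" using u by (rule X.p.cartesian_arr)
    then show "far F' u \<in> arr (tot Y)" by simp
    have iso': "iso_arr ?A (\<psi> (trg (tot X) u))" "iso_arr ?A (\<phi> (src (tot X) u))"
      using ua iso by (auto intro!: Y.chi.cod.isoI[where g = "\<phi> (trg (tot X) u)"])
    \<comment> \<open>The image square is a pullback by \<open>pb\<close>, and \<open>t u\<close>
      differs from it by an isomorphism on each side.\<close>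
    have "cartesian ?A (base Y) (codf (base Y)) (far ?G (far (compr X) u))"
      using pb[OF u] by (simp add: pullback_iff_cartesian[OF Y.base.category])
    then have "cartesian ?A (base Y) (codf (base Y)) (t u)"
      unfolding t_def using ua
      by (intro q.cartesian_cmp[OF q.cartesian_iso[OF iso'(1)]] q.cartesian_cmp[OF _ q.cartesian_iso[OF iso'(2)]])
        simp_all
    then show "cartesian ?A (base Y) (codf (base Y)) (far (compr Y) (far F' u))"
      using ua by simp
  qed
  \<comment> \<open>Strictness over \<open>F\<close> on objects is read off from strictness on
    identity arrows.\<close>
  moreover have "fob (proj Y) (a A) = fob F (fob (proj X) A)" if A: "A \<in> obj (tot X)" for A
    using codt[of "idn (tot X) A"] Y.p.src_far[of "k (idn (tot X) A)"] A a by simp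
  ultimately have "pseudo_map X Y F F' (restrict \<phi> (obj (tot X)))"
    using F ftr codt \<phi>(3) by (intro pseudo_mapI) simp_all
  then show ?thesis by (auto simp: F'_def)
qed

text \<open>Naturality of the invertible \<open>\<phi>\<close> determines the comprehension of each
  image arrow, and the comprehension of \<open>Y\<close> is faithful.\<close>

lemma pseudo_map_into_full_unique:
  assumes X: "comprehension_category X" and Y: "comprehension_category Y" and full: "full_cc Y"
    and 1: "pseudo_map X Y F G \<phi>" and 2: "pseudo_map X Y F H \<phi>"
    and ob: "\<And>A. A \<in> obj (tot X) \<Longrightarrow> fob G A = fob H A"
  shows "G = H"
proof -
  interpret X: compr_cat X using X by unfold_locales
  interpret Y: compr_cat Y using Y by unfold_locales
  interpret A: ps_map X Y F G \<phi> using 1 by unfold_locales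
  interpret B: ps_map X Y F H \<phi> using 2 by unfold_locales
  show ?thesis
  proof (rule fctr_eqI[OF A.F'.is_functor B.F'.is_functor ob])
    fix u assume u: "u \<in> arr (tot X)"
    have "far (compr Y) (far G u) = far (compr Y) (far H u)"
      by (rule Y.chi.cod.iso_cancel[OF A.phi_iso[of "trg (tot X) u"]])
        (use u ob A.phi_nat[OF u refl refl] B.phi_nat[OF u refl refl] in \<open>simp_all add: src_arrcat trg_arrcat\<close>)
    then show "far G u = far H u"
      using full u ob by (intro Y.chi.faithful_eq) (simp_all add: full_cc_def)
  qed
qed

context compr_cat
begin

lemma dom_compr_cmp [simp]:
  assumes "v \<in> arr (tot X)" "u \<in> arr (tot X)" "src (tot X) v = trg (tot X) u"
  shows "sqdom (cmp (arrcat (base X)) (far (compr X) v) (far (compr X) u)) =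
    cmp (base X) (sqdom (far (compr X) v)) (sqdom (far (compr X) u))"
  using assms by (simp add: cmp_arrcat)

lemma dom_compr_idn [simp]:
  "A \<in> obj (tot X) \<Longrightarrow> sqdom (idn (arrcat (base X)) (fob (compr X) A)) = idn (base X) (ext X A)"
  by (simp add: idn_arrcat)

end

lemma (in ps_map) phi_nat_dom:
  assumes u: "u \<in> arr (tot X)" "src (tot X) u = A" "trg (tot X) u = B"
  shows "cmp (base Y) (sqdom (\<phi> B)) (sqdom (far (compr Y) (far F' u))) =
    cmp (base Y) (far F (sqdom (far (compr X) u))) (sqdom (\<phi> A))"
proof -
  have "A \<in> obj (tot X)" "B \<in> obj (tot X)" using u by auto
  then show ?thesis
    using arg_cong[OF phi_nat[OF u], of sqdom] u arrf_arr[of "far (compr X) u"]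
    by (simp add: cmp_arrcat del: Square_arr)
qed

abbreviation iso_comp ::
  "('o, 'm, 't, 's, 'z) compcat_scheme \<Rightarrow> ('o, 'm, 't, 's, 'z) compcat_scheme \<Rightarrow>
    ('o, 'm, 't, 's, 'z) compcat_scheme \<Rightarrow> ('o, 'm, 'o, 'm) fctr \<Rightarrow> ('t \<Rightarrow> 'm square) \<Rightarrow>
    ('t, 's, 't, 's) fctr \<Rightarrow> ('t \<Rightarrow> 'm square) \<Rightarrow> 't \<Rightarrow> 'm square" where
  "iso_comp X Y Z H \<eta> F' \<phi> \<equiv> (\<lambda>A\<in>obj (tot X). cmp (arrcat (base Z))
     (far (arrf (base Y) H) (\<phi> A)) (\<eta> (fob F' A)))"

lemma ps_map_id:
  assumes "comprehension_category X"
  shows "ps_map X X (fid (base X)) (fid (tot X))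
    (\<lambda>A\<in>obj (tot X). idn (arrcat (base X)) (fob (compr X) A))"
proof -
  interpret X: compr_cat X using assms by unfold_locales
  have 1: "fcomp (tot X) (compr X) (fid (tot X)) = compr X"
    by (rule fcomp_fid_right[OF X.chi.is_functor])
  have 2: "fcomp (tot X) (arrf (base X) (fid (base X))) (compr X) = compr X"
    using fcomp_fid_left[OF X.chi.is_functor] by (simp add: arrf_fid[OF X.base.category])
  have "pseudo_map X X (fid (base X)) (fid (tot X))
      (\<lambda>A\<in>obj (tot X). idn (arrcat (base X)) (fob (compr X) A))"
  proof (rule pseudo_mapI, unfold 1 2)
    show "nat_iso (tot X) (arrcat (base X)) (compr X) (compr X)
        (\<lambda>A\<in>obj (tot X). idn (arrcat (base X)) (fob (compr X) A))"
      using nat_trans_id[OF X.chi.is_functor] by (simp add: nat_iso_def X.chi.cod.iso_idn)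
  qed (use X.p.cartesian_arr in
      \<open>auto simp: functor_fid X.base.category X.p.dom.category idn_arrcat\<close>)
  then show ?thesis by unfold_locales
qed

lemma ps_map_comp:
  assumes f: "ps_map X Y F F' \<phi>" and h: "ps_map Y Z H H' \<eta>"
  shows "ps_map X Z (fcomp (base X) H F) (fcomp (tot X) H' F') (iso_comp X Y Z H \<eta> F' \<phi>)"
proof -
  interpret f: ps_map X Y F F' \<phi> by (rule f)
  interpret h: ps_map Y Z H H' \<eta> by (rule h)
  interpret G: is_ftr "arrcat (base Y)" "arrcat (base Z)" "arrf (base Y) H"
    using functor_arrf[OF h.F.is_functor] by unfold_locales
  interpret K: is_ftr "arrcat (base X)" "arrcat (base Y)" "arrf (base X) F"
    using functor_arrf[OF f.F.is_functor] by unfold_locales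
  have HF: "arrf (base X) (fcomp (base X) H F) = fcomp (arrcat (base X)) (arrf (base Y) H) (arrf (base X) F)"
    by (rule arrf_fcomp[OF f.F.is_functor h.F.is_functor])
  note [simp del] = arrf_simps Square_arr
  have sim [simp]: "src (arrcat (base Y)) (\<phi> A) = fob (compr Y) (fob F' A)"
    "trg (arrcat (base Y)) (\<phi> A) = far F (fob (compr X) A)"
    "fob (arrf (base X) F) (fob (compr X) A) = far F (fob (compr X) A)"
    if "A \<in> obj (tot X)" for A
    using that by (simp_all add: src_arrcat trg_arrcat arrf_simps)
  have sim' [simp]: "src (arrcat (base Z)) (\<eta> A) = fob (compr Z) (fob H' A)"
    "trg (arrcat (base Z)) (\<eta> A) = fob (arrf (base Y) H) (fob (compr Y) A)"
    if "A \<in> obj (tot Y)" for A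
    using that by (simp_all add: src_arrcat trg_arrcat arrf_simps)
  have "pseudo_map X Z (fcomp (base X) H F) (fcomp (tot X) H' F') (iso_comp X Y Z H \<eta> F' \<phi>)"
  proof (rule pseudo_mapI)
    show "nat_iso (tot X) (arrcat (base Z)) (fcomp (tot X) (compr Z) (fcomp (tot X) H' F'))
       (fcomp (tot X) (arrf (base X) (fcomp (base X) H F)) (compr X)) (iso_comp X Y Z H \<eta> F' \<phi>)"
      unfolding nat_iso_def
    proof (intro conjI nat_transI ballI)
      show "is_functor (tot X) (arrcat (base Z)) (fcomp (tot X) (compr Z) (fcomp (tot X) H' F'))"
        "is_functor (tot X) (arrcat (base Z)) (fcomp (tot X) (arrf (base X) (fcomp (base X) H F)) (compr X))"
        by (auto simp: HF intro!: functor_fcomp f.F'.is_functor h.F'.is_functor h.Y.chi.is_functor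
            f.X.chi.is_functor G.is_functor K.is_functor)
    next
      fix A assume A: "A \<in> obj (tot X)"
      show "iso_arr (arrcat (base Z)) (iso_comp X Y Z H \<eta> F' \<phi> A)"
        using A f.phi_iso[OF A] h.phi_iso[of "fob F' A"]
        by (auto intro!: h.Y.chi.cod.iso_cmp G.iso_far)
    next
      fix u assume u: "u \<in> arr (tot X)"
      \<comment> \<open>The naturality square of \<open>\<phi>\<close> is mapped by the arrow
        functor of \<open>H\<close>; it is then pasted to the one of \<open>\<eta>\<close>.\<close>
      have "cmp (arrcat (base Z)) (far (arrf (base Y) H) (\<phi> (trg (tot X) u)))
          (far (arrf (base Y) H) (far (compr Y) (far F' u))) =
        cmp (arrcat (base Z)) (far (arrf (base Y) H) (far (arrf (base X) F) (far (compr X) u)))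
          (far (arrf (base Y) H) (\<phi> (src (tot X) u)))"
        using f.phi_nat[OF u refl refl] u G.far_cmp[of "\<phi> (trg (tot X) u)" "far (compr Y) (far F' u)"]
          G.far_cmp[of "far (arrf (base X) F) (far (compr X) u)" "\<phi> (src (tot X) u)"] by simp
      from h.Y.chi.cod.cmp_eq_cmp[OF this, of "\<eta> (fob F' (src (tot X) u))"]
      show "cmp (arrcat (base Z)) (iso_comp X Y Z H \<eta> F' \<phi> (trg (tot X) u))
          (far (fcomp (tot X) (compr Z) (fcomp (tot X) H' F')) u) =
        cmp (arrcat (base Z)) (far (fcomp (tot X) (arrf (base X) (fcomp (base X) H F)) (compr X)) u)
          (iso_comp X Y Z H \<eta> F' \<phi> (src (tot X) u))"
        using u h.phi_nat[of "far F' u" "fob F' (src (tot X) u)" "fob F' (trg (tot X) u)"]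
        by (simp add: HF)
    qed (simp_all add: HF)
    fix A assume A: "A \<in> obj (tot X)"
    have "far (arrf (base Y) H) (\<phi> A) \<in> arr (arrcat (base Z))" "\<phi> A \<in> arr (arrcat (base Y))"
      using A by simp_all
    then show "sqcod (iso_comp X Y Z H \<eta> F' \<phi> A) =
        idn (base Z) (fob (fcomp (base X) H F) (fob (proj X) A))"
      using A by (simp add: cmp_arrcat arrf_simps)
  qed (auto intro: functor_fcomp f.F.is_functor h.F.is_functor f.F'.is_functor h.F'.is_functor
      simp: f.cartesian_map h.cartesian_map f.X.p.cartesian_arr)
  then show ?thesis by unfold_locales
qed

section \<open>Transformations of pseudo maps\<close>

locale transf = f: ps_map X Y F F' \<phi> + g: ps_map X Y G G' \<gamma> + b: is_nt "base X" "base Y" F G a +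
    t: is_nt "tot X" "tot Y" F' G' a'
  for X Y :: "('o, 'm, 't, 's, 'z) compcat_scheme" and F F' \<phi> G G' \<gamma> a a' +
  assumes proj_tot [simp]: "A \<in> obj (tot X) \<Longrightarrow> far (proj Y) (a' A) = a (fob (proj X) A)"
    and dom_tot: "A \<in> obj (tot X) \<Longrightarrow>
      cmp (base Y) (sqdom (\<gamma> A)) (sqdom (far (compr Y) (a' A))) =
      cmp (base Y) (a (ext X A)) (sqdom (\<phi> A))"

lemma transf_id:
  assumes "ps_map X Y F F' \<phi>"
  shows "transf X Y F F' \<phi> F F' \<phi> (nt_id (base X) (base Y) F) (nt_id (tot X) (tot Y) F')"
proof -
  interpret f: ps_map X Y F F' \<phi> by (rule assms)
  show ?thesis
  proof (intro transf.intro transf_axioms.intro is_nt.intro nat_trans_id assms)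
  qed (simp_all add: f.F.is_functor f.F'.is_functor)
qed

lemma transf_vcomp:
  assumes "transf X Y F F' \<phi> G G' \<gamma> a a'" "transf X Y G G' \<gamma> H H' \<eta> b b'"
  shows "transf X Y F F' \<phi> H H' \<eta> (nt_vcomp (base X) (base Y) b a) (nt_vcomp (tot X) (tot Y) b' a')"
proof -
  interpret a: transf X Y F F' \<phi> G G' \<gamma> a a' by (rule assms(1))
  interpret b: transf X Y G G' \<gamma> H H' \<eta> b b' by (rule assms(2))
  show ?thesis
  proof (intro transf.intro transf_axioms.intro is_nt.intro)
    fix A assume A: "A \<in> obj (tot X)"
    have "cmp (base Y) (sqdom (\<eta> A)) (cmp (base Y) (sqdom (far (compr Y) (b' A))) (sqdom (far (compr Y) (a' A)))) =
        cmp (base Y) (b (ext X A)) (cmp (base Y) (sqdom (\<gamma> A)) (sqdom (far (compr Y) (a' A))))"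
      by (rule a.f.Y.base.cmp_eq_cmp[OF b.dom_tot]) (use A in simp_all)
    also have "\<dots> = cmp (base Y) (b (ext X A)) (cmp (base Y) (a (ext X A)) (sqdom (\<phi> A)))"
      using A by (simp add: a.dom_tot)
    finally show "cmp (base Y) (sqdom (\<eta> A)) (sqdom (far (compr Y) (nt_vcomp (tot X) (tot Y) b' a' A))) =
        cmp (base Y) (nt_vcomp (base X) (base Y) b a (ext X A)) (sqdom (\<phi> A))"
      using A by simp
  next
    show "nat_trans (base X) (base Y) F H (nt_vcomp (base X) (base Y) b a)"
      by (rule nat_trans_vcomp[OF a.b.nat_trans b.b.nat_trans])
    show "nat_trans (tot X) (tot Y) F' H' (nt_vcomp (tot X) (tot Y) b' a')"
      by (rule nat_trans_vcomp[OF a.t.nat_trans b.t.nat_trans])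
  qed (simp_all add: a.f.ps_map_axioms b.g.ps_map_axioms)
qed

lemma transf_hcomp:
  assumes "transf X Y F F' \<phi> G G' \<gamma> a a'" "transf Y Z H H' \<eta> K K' \<kappa> b b'"
  shows "transf X Z (fcomp (base X) H F) (fcomp (tot X) H' F') (iso_comp X Y Z H \<eta> F' \<phi>)
    (fcomp (base X) K G) (fcomp (tot X) K' G') (iso_comp X Y Z K \<kappa> G' \<gamma>)
    (nt_hcomp (base X) (base Z) G H b a) (nt_hcomp (tot X) (tot Z) G' H' b' a')"
proof -
  interpret a: transf X Y F F' \<phi> G G' \<gamma> a a' by (rule assms(1))
  interpret b: transf Y Z H H' \<eta> K K' \<kappa> b b' by (rule assms(2))
  \<comment> \<open>Coherence is an equation between domain sides, so the comparisons of both
    composite maps are reduced to theirs once and for all.\<close>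
  have dom: "sqdom (iso_comp X Y Z M \<mu> N' \<nu> A) = cmp (base Z) (far M (sqdom (\<nu> A))) (sqdom (\<mu> (fob N' A)))"
    if "ps_map X Y N N' \<nu>" "ps_map Y Z M M' \<mu>" "A \<in> obj (tot X)" for N N' \<nu> M M' \<mu> A
  proof -
    interpret n: ps_map X Y N N' \<nu> by (rule that)
    interpret m: ps_map Y Z M M' \<mu> by (rule that)
    show ?thesis
      using that(3) m.arrf_arr[of "\<nu> A"] by (simp add: cmp_arrcat del: Square_arr)
  qed
  show ?thesis
  proof (intro transf.intro transf_axioms.intro is_nt.intro)
    fix A assume A: "A \<in> obj (tot X)"
    let ?d = "\<lambda>u. sqdom (far (compr Z) u)" and ?c = "cmp (base Z)"
    \<comment> \<open>The chain uses, in turn, coherence of \<open>b'\<close> at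
      \<open>fob G' A\<close>, naturality of \<open>\<eta>\<close> at \<open>a' A\<close>,
      naturality of \<open>b\<close> at the domain side of \<open>\<gamma> A\<close>, and the image
      under \<open>H\<close> of the coherence of \<open>a'\<close>.\<close>
    have "?c (sqdom (\<kappa> (fob G' A))) (?c (?d (b' (fob G' A))) (?d (far H' (a' A)))) =
        ?c (b (ext Y (fob G' A))) (?c (sqdom (\<eta> (fob G' A))) (?d (far H' (a' A))))"
      by (rule b.f.Y.base.cmp_eq_cmp[OF b.dom_tot]) (use A in simp_all)
    also have "?c (sqdom (\<eta> (fob G' A))) (?d (far H' (a' A))) =
        ?c (far H (sqdom (far (compr Y) (a' A)))) (sqdom (\<eta> (fob F' A)))"
      by (rule b.f.phi_nat_dom) (use A in simp_all)
    finally have "?c (far K (sqdom (\<gamma> A))) (?c (sqdom (\<kappa> (fob G' A)))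
          (?c (?d (b' (fob G' A))) (?d (far H' (a' A))))) =
        ?c (far K (sqdom (\<gamma> A))) (?c (b (ext Y (fob G' A)))
          (?c (far H (sqdom (far (compr Y) (a' A)))) (sqdom (\<eta> (fob F' A)))))"
      by simp
    also have "\<dots> = ?c (b (fob G (ext X A))) (?c (far H (sqdom (\<gamma> A)))
        (?c (far H (sqdom (far (compr Y) (a' A)))) (sqdom (\<eta> (fob F' A)))))"
      by (rule b.f.Y.base.cmp_eq_cmp[OF b.b.naturality[symmetric]]) (use A in simp_all)
    also have "?c (far H (sqdom (\<gamma> A))) (?c (far H (sqdom (far (compr Y) (a' A)))) (sqdom (\<eta> (fob F' A)))) =
        ?c (far H (a (ext X A))) (?c (far H (sqdom (\<phi> A))) (sqdom (\<eta> (fob F' A))))"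
    proof (rule b.f.Y.base.cmp_eq_cmp)
      show "?c (far H (sqdom (\<gamma> A))) (far H (sqdom (far (compr Y) (a' A)))) =
          ?c (far H (a (ext X A))) (far H (sqdom (\<phi> A)))"
        using a.dom_tot[OF A] A b.f.F.far_cmp[of "sqdom (\<gamma> A)" "sqdom (far (compr Y) (a' A))"]
          b.f.F.far_cmp[of "a (ext X A)" "sqdom (\<phi> A)"] by simp
    qed (use A in simp_all)
    finally show "?c (sqdom (iso_comp X Y Z K \<kappa> G' \<gamma> A)) (?d (nt_hcomp (tot X) (tot Z) G' H' b' a' A)) =
        ?c (nt_hcomp (base X) (base Z) G H b a (ext X A)) (sqdom (iso_comp X Y Z H \<eta> F' \<phi> A))"
      using A unfolding dom[OF a.g.ps_map_axioms b.g.ps_map_axioms A] dom[OF a.f.ps_map_axioms b.f.ps_map_axioms A]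
      by simp
  next
    show "nat_trans (base X) (base Z) (fcomp (base X) H F) (fcomp (base X) K G) (nt_hcomp (base X) (base Z) G H b a)"
      by (rule nat_trans_hcomp[OF a.b.nat_trans b.b.nat_trans])
    show "nat_trans (tot X) (tot Z) (fcomp (tot X) H' F') (fcomp (tot X) K' G')
        (nt_hcomp (tot X) (tot Z) G' H' b' a')"
      by (rule nat_trans_hcomp[OF a.t.nat_trans b.t.nat_trans])
  qed (use ps_map_comp a.f.ps_map_axioms a.g.ps_map_axioms b.f.ps_map_axioms b.g.ps_map_axioms
      in \<open>auto intro: ps_map_comp\<close>)
qed

text \<open>The transformation that \<open>\<alpha>\<close> induces between the arrow functors of
  \<open>F\<close> and \<open>G\<close>; its components are the naturality squares of
  \<open>\<alpha>\<close>.\<close>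

definition arrt ::
  "('o, 'm) cat \<Rightarrow> ('o, 'm, 'p, 'n) fctr \<Rightarrow> ('o, 'm, 'p, 'n) fctr \<Rightarrow> ('o \<Rightarrow> 'n) \<Rightarrow> 'm \<Rightarrow> 'n square" where
  "arrt C F G \<alpha> = (\<lambda>f\<in>arr C. Square (far F f) (far G f) (\<alpha> (src C f)) (\<alpha> (trg C f)))"

lemma nat_trans_arrt:
  assumes "nat_trans C D F G \<alpha>"
  shows "nat_trans (arrcat C) (arrcat D) (arrf C F) (arrf C G) (arrt C F G \<alpha>)"
proof -
  interpret a: is_nt C D F G \<alpha> using assms by unfold_locales
  have t: "arrt C F G \<alpha> f \<in> arr (arrcat D)" if "f \<in> arr C" for f
    using that by (simp add: arrt_def a.naturality)
  show ?thesis
  proof (rule nat_transI)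
    fix s assume "s \<in> arr (arrcat C)"
    note s = this square_arrD[OF this]
    have F: "far (arrf C F) s \<in> arr (arrcat D)" "far (arrf C G) s \<in> arr (arrcat D)"
      using is_ftr.far_arr[OF is_ftr.intro[OF functor_arrf[OF a.F.is_functor]] s(1)]
        is_ftr.far_arr[OF is_ftr.intro[OF functor_arrf[OF a.G.is_functor]] s(1)] by simp_all
    have "cmp (arrcat D) (arrt C F G \<alpha> (sqtrg s)) (far (arrf C F) s) =
        cmp (arrcat D) (far (arrf C G) s) (arrt C F G \<alpha> (sqsrc s))"
      using s t[of "sqsrc s"] t[of "sqtrg s"] F
      by (simp add: cmp_arrcat arrt_def a.naturality del: Square_arr)
    then show "cmp (arrcat D) (arrt C F G \<alpha> (trg (arrcat C) s)) (far (arrf C F) s) =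
        cmp (arrcat D) (far (arrf C G) s) (arrt C F G \<alpha> (src (arrcat C) s))"
      using s(1) by (simp add: src_arrcat trg_arrcat)
  qed (use t in \<open>auto intro: functor_arrf a.F.is_functor a.G.is_functor
      simp: src_arrcat trg_arrcat simp del: Square_arr, auto simp: arrt_def\<close>)
qed

text \<open>
  As an equation in the arrow category, the two conditions on a transformation determine the
  comprehension of its component, because \<open>\<gamma> A\<close> is invertible.
\<close>

lemma transf_square_iff:
  assumes f: "ps_map X Y F F' \<phi>" and g: "ps_map X Y G G' \<gamma>" and a: "nat_trans (base X) (base Y) F G a"
    and A: "A \<in> obj (tot X)" and u: "u \<in> arr (tot Y)" "src (tot Y) u = fob F' A" "trg (tot Y) u = fob G' A"
  shows "cmp (arrcat (base Y)) (\<gamma> A) (far (compr Y) u) =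
      cmp (arrcat (base Y)) (arrt (base X) F G a (fob (compr X) A)) (\<phi> A) \<longleftrightarrow>
    far (proj Y) u = a (fob (proj X) A) \<and>
    cmp (base Y) (sqdom (\<gamma> A)) (sqdom (far (compr Y) u)) = cmp (base Y) (a (ext X A)) (sqdom (\<phi> A))"
proof -
  interpret f: ps_map X Y F F' \<phi> by (rule f)
  interpret g: ps_map X Y G G' \<gamma> by (rule g)
  interpret a: is_nt "base X" "base Y" F G a using a by unfold_locales
  interpret t: is_nt "arrcat (base X)" "arrcat (base Y)" "arrf (base X) F" "arrf (base X) G" "arrt (base X) F G a"
    using nat_trans_arrt[OF a] by unfold_locales
  have te: "arrt (base X) F G a (fob (compr X) A) =
      Square (far F (fob (compr X) A)) (far G (fob (compr X) A)) (a (ext X A)) (a (fob (proj X) A))"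
    using A by (simp add: arrt_def)
  have ta: "arrt (base X) F G a (fob (compr X) A) \<in> arr (arrcat (base Y))"
    using A by simp
  have "trg (base Y) (far (proj Y) u) = fob G (fob (proj X) A)"
    using u A by simp
  then show ?thesis
    using A u ta unfolding te by (auto simp: cmp_arrcat simp del: Square_arr)
qed

text \<open>By \<open>transf_square_iff\<close> the composite of \<open>\<gamma> A\<close> with the
  comprehension of the component at \<open>A\<close> is fixed by \<open>a\<close>; then
  \<open>\<gamma> A\<close> is cancelled and faithfulness applies.\<close>

lemma transf_unique:
  assumes t1: "transf X Y F F' \<phi> G G' \<gamma> a b" and t2: "transf X Y F F' \<phi> G G' \<gamma> a c" and full: "full_cc Y"
  shows "b = c"
proof -
  interpret b: transf X Y F F' \<phi> G G' \<gamma> a b by (rule t1)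
  interpret c: transf X Y F F' \<phi> G G' \<gamma> a c by (rule t2)
  show ?thesis
  proof (rule extensionalityI[OF b.t.nt_ext c.t.nt_ext])
    fix A assume A: "A \<in> obj (tot X)"
    note sq = transf_square_iff[OF b.f.ps_map_axioms b.g.ps_map_axioms b.b.nat_trans A]
    have "cmp (arrcat (base Y)) (\<gamma> A) (far (compr Y) (b A)) = cmp (arrcat (base Y)) (\<gamma> A) (far (compr Y) (c A))"
      using sq[of "b A"] sq[of "c A"] A b.dom_tot[OF A] c.dom_tot[OF A] by simp
    then have "far (compr Y) (b A) = far (compr Y) (c A)"
      using A by - (rule b.f.Y.chi.cod.iso_cancel[OF b.g.phi_iso[OF A]], simp_all add: src_arrcat)
    then show "b A = c A"
      using full A by (intro b.f.Y.chi.faithful_eq) (simp_all add: full_cc_def)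
  qed
qed

text \<open>The comprehension of the component at \<open>A\<close> has to be the inverse of
  \<open>\<gamma> A\<close> after the naturality square of \<open>a\<close> after
  \<open>\<phi> A\<close>; fullness provides an arrow with this comprehension.\<close>

lemma transf_exists:
  assumes f: "ps_map X Y F F' \<phi>" and g: "ps_map X Y G G' \<gamma>" and a: "nat_trans (base X) (base Y) F G a"
    and full: "full_cc Y"
  shows "\<exists>a'. transf X Y F F' \<phi> G G' \<gamma> a a'"
proof -
  interpret f: ps_map X Y F F' \<phi> by (rule f)
  interpret g: ps_map X Y G G' \<gamma> by (rule g)
  interpret a: is_nt "base X" "base Y" F G a using a by unfold_locales
  interpret t: is_nt "arrcat (base X)" "arrcat (base Y)" "arrf (base X) F" "arrf (base X) G" "arrt (base X) F G a"
    using nat_trans_arrt[OF a] by unfold_locales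
  let ?A = "arrcat (base Y)" and ?t = "\<lambda>A. arrt (base X) F G a (fob (compr X) A)"
  note [simp del] = arrf_simps Square_arr
  have ful: "full (tot Y) ?A (compr Y)" and fai: "faithful (tot Y) (compr Y)"
    using full by (simp_all add: full_cc_def)
  have sim [simp]: "src ?A (\<phi> A) = fob (compr Y) (fob F' A)" "trg ?A (\<phi> A) = far F (fob (compr X) A)"
    "src ?A (\<gamma> A) = fob (compr Y) (fob G' A)" "trg ?A (\<gamma> A) = far G (fob (compr X) A)"
    if "A \<in> obj (tot X)" for A
    using that by (simp_all add: src_arrcat trg_arrcat)
  have sim' [simp]: "src ?A (?t A) = far F (fob (compr X) A)" "trg ?A (?t A) = far G (fob (compr X) A)"
    "?t A \<in> arr ?A"
    "fob (arrf (base X) F) (fob (compr X) A) = far F (fob (compr X) A)"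
    "fob (arrf (base X) G) (fob (compr X) A) = far G (fob (compr X) A)"
    if "A \<in> obj (tot X)" for A
    using that by (simp_all add: arrf_simps)
  have "\<exists>k. k \<in> arr (tot Y) \<and> src (tot Y) k = fob F' A \<and> trg (tot Y) k = fob G' A \<and>
      cmp ?A (\<gamma> A) (far (compr Y) k) = cmp ?A (?t A) (\<phi> A)" if A: "A \<in> obj (tot X)" for A
  proof -
    obtain j where j: "j \<in> arr ?A" "src ?A j = trg ?A (\<gamma> A)" "trg ?A j = src ?A (\<gamma> A)"
      "cmp ?A (\<gamma> A) j = idn ?A (trg ?A (\<gamma> A))"
      using g.phi_iso[OF A] by (rule f.Y.chi.cod.isoE)
    obtain k where k: "k \<in> arr (tot Y)" "src (tot Y) k = fob F' A" "trg (tot Y) k = fob G' A"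
      "far (compr Y) k = cmp ?A j (cmp ?A (?t A) (\<phi> A))"
      using f.Y.chi.full_lift[OF ful, of "fob F' A" "fob G' A" "cmp ?A j (cmp ?A (?t A) (\<phi> A))"] A j
      by auto
    have "cmp ?A (\<gamma> A) (far (compr Y) k) = cmp ?A (cmp ?A (\<gamma> A) j) (cmp ?A (?t A) (\<phi> A))"
      using A j(1-3) k(4) by simp
    also have "\<dots> = cmp ?A (?t A) (\<phi> A)"
      using A j by simp
    finally show ?thesis using k by blast
  qed
  then obtain k where k [simp]: "\<And>A. A \<in> obj (tot X) \<Longrightarrow> k A \<in> arr (tot Y)"
    "\<And>A. A \<in> obj (tot X) \<Longrightarrow> src (tot Y) (k A) = fob F' A"
    "\<And>A. A \<in> obj (tot X) \<Longrightarrow> trg (tot Y) (k A) = fob G' A"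
    and k\<gamma>: "\<And>A. A \<in> obj (tot X) \<Longrightarrow> cmp ?A (\<gamma> A) (far (compr Y) (k A)) = cmp ?A (?t A) (\<phi> A)"
    by metis
  have "nat_trans (tot X) (tot Y) F' G' (restrict k (obj (tot X)))"
  proof (rule nat_transI)
    fix u assume u: "u \<in> arr (tot X)"
    let ?x = "src (tot X) u" and ?y = "trg (tot X) u"
    \<comment> \<open>Naturality is tested in the arrow category and after composing with the
      invertible \<open>\<gamma> ?y\<close>.\<close>
    have "cmp ?A (\<gamma> ?y) (cmp ?A (far (compr Y) (k ?y)) (far (compr Y) (far F' u))) =
        cmp ?A (?t ?y) (cmp ?A (\<phi> ?y) (far (compr Y) (far F' u)))"
      by (rule f.Y.chi.cod.cmp_eq_cmp[OF k\<gamma>]) (use u in simp_all)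
    also have "\<dots> = cmp ?A (cmp ?A (?t ?y) (far (arrf (base X) F) (far (compr X) u))) (\<phi> ?x)"
      using u by (simp add: f.phi_nat)
    also have "\<dots> = cmp ?A (far (arrf (base X) G) (far (compr X) u)) (cmp ?A (?t ?x) (\<phi> ?x))"
      using u t.naturality[of "far (compr X) u" "fob (compr X) ?x" "fob (compr X) ?y"] by simp
    also have "\<dots> = cmp ?A (cmp ?A (far (arrf (base X) G) (far (compr X) u)) (\<gamma> ?x)) (far (compr Y) (k ?x))"
      using u k\<gamma>[of ?x] by simp
    also have "\<dots> = cmp ?A (\<gamma> ?y) (cmp ?A (far (compr Y) (far G' u)) (far (compr Y) (k ?x)))"
      using u g.phi_nat[OF u refl refl, symmetric] by simp
    finally have "cmp ?A (far (compr Y) (k ?y)) (far (compr Y) (far F' u)) =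
        cmp ?A (far (compr Y) (far G' u)) (far (compr Y) (k ?x))"
      using u by - (rule f.Y.chi.cod.iso_cancel[OF g.phi_iso[of ?y]], simp_all)
    then have "cmp (tot Y) (k ?y) (far F' u) = cmp (tot Y) (far G' u) (k ?x)"
      using u by - (rule f.Y.chi.faithful_eq[OF fai], simp_all)
    then show "cmp (tot Y) (restrict k (obj (tot X)) ?y) (far F' u) =
        cmp (tot Y) (far G' u) (restrict k (obj (tot X)) ?x)"
      using u by simp
  qed (simp_all add: f.F'.is_functor g.F'.is_functor)
  then have "transf X Y F F' \<phi> G G' \<gamma> a (restrict k (obj (tot X)))"
    using transf_square_iff[OF f g a, of _ "k _"] k\<gamma>
    by (intro transf.intro transf_axioms.intro is_nt.intro f g a) simp_all
  then show ?thesis by blast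
qed

section \<open>The 2-category of rooted comprehension categories\<close>

lemma rooted_compr_cat: "rooted_cc X \<Longrightarrow> compr_cat X"
  by (simp add: rooted_cc_def compr_cat_def)

lemma rooted_terminal: "rooted_cc X \<Longrightarrow> terminal (base X) (pt X)"
  by (simp add: rooted_cc_def)

lemma rooted_pt: "rooted_cc X \<Longrightarrow> pt X \<in> obj (base X)"
  by (simp add: rooted_cc_def terminal_def)

definition rtd_map :: "('o, 'm, 't, 's) cc_map \<Rightarrow> bool" where
  "rtd_map f \<longleftrightarrow> rooted_cc (msrc f) \<and> rooted_cc (mtrg f) \<and> pointed_pseudo_map f"

definition rtd_trans :: "('o, 'm, 't, 's) cc_trans \<Rightarrow> bool" where
  "rtd_trans \<alpha> \<longleftrightarrow> rtd_map (tsrc \<alpha>) \<and> rtd_map (ttrg \<alpha>) \<and> pointed_transformation \<alpha>"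

lemma CompCat_rtd_simps [simp]:
  "c0 CompCat_rtd = {X. rooted_cc X}" "c1 CompCat_rtd = {f. rtd_map f}"
  "c2 CompCat_rtd = {\<alpha>. rtd_trans \<alpha>}"
  "s1 CompCat_rtd = msrc" "t1 CompCat_rtd = mtrg" "s2 CompCat_rtd = tsrc" "t2 CompCat_rtd = ttrg"
  "i1 CompCat_rtd = cc_id" "i2 CompCat_rtd = cc_trans_id" "comp1 CompCat_rtd = cc_comp"
  "vcomp CompCat_rtd = cc_vcomp" "hcomp CompCat_rtd = cc_hcomp"
  by (simp_all add: CompCat_rtd_def Let_def rtd_map_def rtd_trans_def)

lemma rtd_map_iff:
  "rtd_map f \<longleftrightarrow> rooted_cc (msrc f) \<and> rooted_cc (mtrg f) \<and>
    ps_map (msrc f) (mtrg f) (mbase f) (mtot f) (miso f) \<and>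
    mpt f \<in> arr (base (mtrg f)) \<and> src (base (mtrg f)) (mpt f) = fob (mbase f) (pt (msrc f)) \<and>
    trg (base (mtrg f)) (mpt f) = pt (mtrg f) \<and> iso_arr (base (mtrg f)) (mpt f)"
  by (auto simp: rtd_map_def pointed_pseudo_map_def ps_map_def ps_map_axioms_def rooted_compr_cat hom_def)

lemma rtd_map_rooted: "rtd_map f \<Longrightarrow> rooted_cc (msrc f)" "rtd_map f \<Longrightarrow> rooted_cc (mtrg f)"
  by (simp_all add: rtd_map_def)

text \<open>The pointedness equation compares two arrows into the root of the target, which is
  terminal, so it holds for every \<open>transf\<close> between rooted structures.\<close>

lemma rtd_trans_iff:
  "rtd_trans \<alpha> \<longleftrightarrow> rtd_map (tsrc \<alpha>) \<and> rtd_map (ttrg \<alpha>) \<and>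
    msrc (ttrg \<alpha>) = msrc (tsrc \<alpha>) \<and> mtrg (ttrg \<alpha>) = mtrg (tsrc \<alpha>) \<and>
    transf (msrc (tsrc \<alpha>)) (mtrg (tsrc \<alpha>)) (mbase (tsrc \<alpha>)) (mtot (tsrc \<alpha>)) (miso (tsrc \<alpha>))
      (mbase (ttrg \<alpha>)) (mtot (ttrg \<alpha>)) (miso (ttrg \<alpha>)) (tbase \<alpha>) (ttot \<alpha>)"
  (is "_ \<longleftrightarrow> ?r")
proof
  assume "rtd_trans \<alpha>"
  then show ?r
    by (auto simp: rtd_trans_def rtd_map_iff pointed_transformation_def Let_def transf_def transf_axioms_def
        is_nt_def)
next
  assume r: ?r
  let ?X = "msrc (tsrc \<alpha>)" and ?Y = "mtrg (tsrc \<alpha>)"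
  interpret transf ?X ?Y "mbase (tsrc \<alpha>)" "mtot (tsrc \<alpha>)" "miso (tsrc \<alpha>)"
    "mbase (ttrg \<alpha>)" "mtot (ttrg \<alpha>)" "miso (ttrg \<alpha>)" "tbase \<alpha>" "ttot \<alpha>"
    using r by blast
  have rt: "rooted_cc ?X" "rooted_cc ?Y" using r by (auto simp: rtd_map_def)
  have "cmp (base ?Y) (mpt (ttrg \<alpha>)) (tbase \<alpha> (pt ?X)) = mpt (tsrc \<alpha>)"
    by (rule f.Y.base.terminal_unique[OF rooted_terminal[OF rt(2)]])
      (use r rooted_pt[OF rt(1)] in \<open>auto simp: rtd_map_iff hom_def\<close>)
  then show "rtd_trans \<alpha>"
    using r dom_tot by (simp add: rtd_trans_def pointed_transformation_def Let_def b.nat_trans t.nat_trans)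
qed

lemma cc_id_simps [simp]:
  "msrc (cc_id X) = X" "mtrg (cc_id X) = X" "mbase (cc_id X) = fid (base X)" "mtot (cc_id X) = fid (tot X)"
  "miso (cc_id X) = (\<lambda>A\<in>obj (tot X). idn (arrcat (base X)) (fob (compr X) A))"
  "mpt (cc_id X) = idn (base X) (pt X)"
  by (simp_all add: cc_id_def)

lemma cc_comp_simps [simp]:
  "msrc (cc_comp g f) = msrc f" "mtrg (cc_comp g f) = mtrg g"
  "mbase (cc_comp g f) = fcomp (base (msrc f)) (mbase g) (mbase f)"
  "mtot (cc_comp g f) = fcomp (tot (msrc f)) (mtot g) (mtot f)"
  "miso (cc_comp g f) = iso_comp (msrc f) (msrc g) (mtrg g) (mbase g) (miso g) (mtot f) (miso f)"
  "mpt (cc_comp g f) = cmp (base (mtrg g)) (mpt g) (far (mbase g) (mpt f))"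
  by (simp_all add: cc_comp_def Let_def)

lemma cc_trans_id_simps [simp]:
  "tsrc (cc_trans_id f) = f" "ttrg (cc_trans_id f) = f"
  "tbase (cc_trans_id f) = nt_id (base (msrc f)) (base (mtrg f)) (mbase f)"
  "ttot (cc_trans_id f) = nt_id (tot (msrc f)) (tot (mtrg f)) (mtot f)"
  by (simp_all add: cc_trans_id_def)

lemma cc_vcomp_simps [simp]:
  "tsrc (cc_vcomp \<beta> \<alpha>) = tsrc \<alpha>" "ttrg (cc_vcomp \<beta> \<alpha>) = ttrg \<beta>"
  "tbase (cc_vcomp \<beta> \<alpha>) = nt_vcomp (base (msrc (tsrc \<alpha>))) (base (mtrg (tsrc \<alpha>))) (tbase \<beta>) (tbase \<alpha>)"
  "ttot (cc_vcomp \<beta> \<alpha>) = nt_vcomp (tot (msrc (tsrc \<alpha>))) (tot (mtrg (tsrc \<alpha>))) (ttot \<beta>) (ttot \<alpha>)"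
  by (simp_all add: cc_vcomp_def Let_def)

lemma cc_hcomp_simps [simp]:
  "tsrc (cc_hcomp \<beta> \<alpha>) = cc_comp (tsrc \<beta>) (tsrc \<alpha>)" "ttrg (cc_hcomp \<beta> \<alpha>) = cc_comp (ttrg \<beta>) (ttrg \<alpha>)"
  "tbase (cc_hcomp \<beta> \<alpha>) = nt_hcomp (base (msrc (tsrc \<alpha>))) (base (mtrg (tsrc \<beta>))) (mbase (ttrg \<alpha>))
     (mbase (tsrc \<beta>)) (tbase \<beta>) (tbase \<alpha>)"
  "ttot (cc_hcomp \<beta> \<alpha>) = nt_hcomp (tot (msrc (tsrc \<alpha>))) (tot (mtrg (tsrc \<beta>))) (mtot (ttrg \<alpha>))
     (mtot (tsrc \<beta>)) (ttot \<beta>) (ttot \<alpha>)"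
  by (simp_all add: cc_hcomp_def Let_def)

lemma rtd_map_id: "rooted_cc X \<Longrightarrow> rtd_map (cc_id X)"
proof -
  assume X: "rooted_cc X"
  then interpret X: compr_cat X by (rule rooted_compr_cat)
  show ?thesis
    using X ps_map_id[OF X.comprehension] rooted_pt[OF X] by (simp add: rtd_map_iff X.base.iso_idn)
qed

lemma rtd_map_comp:
  assumes f: "rtd_map f" and g: "rtd_map g" and gf: "msrc g = mtrg f"
  shows "rtd_map (cc_comp g f)"
proof -
  interpret f: ps_map "msrc f" "mtrg f" "mbase f" "mtot f" "miso f"
    using f by (simp add: rtd_map_iff)
  interpret g: ps_map "mtrg f" "mtrg g" "mbase g" "mtot g" "miso g"
    using g gf by (simp add: rtd_map_iff)
  have "pt (msrc f) \<in> obj (base (msrc f))"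
    using f by (auto simp: rtd_map_def rooted_pt)
  then show ?thesis
    using f g gf ps_map_comp[OF f.ps_map_axioms g.ps_map_axioms]
    by (auto simp: rtd_map_iff intro!: g.Y.base.iso_cmp g.F.iso_far)
qed

lemma cc_comp_id_right:
  assumes f: "rtd_map f"
  shows "cc_comp f (cc_id (msrc f)) = f"
proof -
  interpret f: ps_map "msrc f" "mtrg f" "mbase f" "mtot f" "miso f"
    using f by (simp add: rtd_map_iff)
  interpret G: is_ftr "arrcat (base (msrc f))" "arrcat (base (mtrg f))" "arrf (base (msrc f)) (mbase f)"
    using functor_arrf[OF f.F.is_functor] by unfold_locales
  have "miso (cc_comp f (cc_id (msrc f))) = miso f"
  proof (rule extensionalityI[OF _ f.\<phi>.nt_ext])
    fix A assume A: "A \<in> obj (tot (msrc f))"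
    then have "far (arrf (base (msrc f)) (mbase f)) (idn (arrcat (base (msrc f))) (fob (compr (msrc f)) A)) =
        idn (arrcat (base (mtrg f))) (far (mbase f) (fob (compr (msrc f)) A))"
      using G.far_idn[of "fob (compr (msrc f)) A"] by simp
    then show "miso (cc_comp f (cc_id (msrc f))) A = miso f A"
      using A by (simp add: trg_arrcat del: arrf_simps)
  qed simp
  moreover have "pt (msrc f) \<in> obj (base (msrc f))"
    using f by (auto simp: rtd_map_def rooted_pt)
  ultimately show ?thesis
    using f by (intro cc_map.equality)
      (simp_all add: fcomp_fid_right[OF f.F.is_functor] fcomp_fid_right[OF f.F'.is_functor] rtd_map_iff)
qed

lemma cc_comp_id_left:
  assumes f: "rtd_map f"
  shows "cc_comp (cc_id (mtrg f)) f = f"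
proof -
  interpret f: ps_map "msrc f" "mtrg f" "mbase f" "mtot f" "miso f"
    using f by (simp add: rtd_map_iff)
  have "miso (cc_comp (cc_id (mtrg f)) f) = miso f"
  proof (rule extensionalityI[OF _ f.\<phi>.nt_ext])
    fix A assume A: "A \<in> obj (tot (msrc f))"
    then show "miso (cc_comp (cc_id (mtrg f)) f) A = miso f A"
      by (simp add: arrf_fid[OF f.Y.base.category] src_arrcat del: arrf_simps)
  qed simp
  then show ?thesis
    using f by (intro cc_map.equality)
      (simp_all add: fcomp_fid_left[OF f.F.is_functor] fcomp_fid_left[OF f.F'.is_functor] rtd_map_iff)
qed

lemma cc_comp_assoc:
  assumes f: "rtd_map f" and g: "rtd_map g" and h: "rtd_map h" and gf: "msrc g = mtrg f" and hg: "msrc h = mtrg g"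
  shows "cc_comp h (cc_comp g f) = cc_comp (cc_comp h g) f"
proof -
  interpret f: ps_map "msrc f" "mtrg f" "mbase f" "mtot f" "miso f"
    using f by (simp add: rtd_map_iff)
  interpret g: ps_map "mtrg f" "mtrg g" "mbase g" "mtot g" "miso g"
    using g gf by (simp add: rtd_map_iff)
  interpret h: ps_map "mtrg g" "mtrg h" "mbase h" "mtot h" "miso h"
    using h hg by (simp add: rtd_map_iff)
  interpret G: is_ftr "arrcat (base (mtrg f))" "arrcat (base (mtrg g))" "arrf (base (mtrg f)) (mbase g)"
    using functor_arrf[OF g.F.is_functor] by unfold_locales
  interpret H: is_ftr "arrcat (base (mtrg g))" "arrcat (base (mtrg h))" "arrf (base (mtrg g)) (mbase h)"
    using functor_arrf[OF h.F.is_functor] by unfold_locales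
  have "miso (cc_comp h (cc_comp g f)) A = miso (cc_comp (cc_comp h g) f) A"
    if A: "A \<in> obj (tot (msrc f))" for A
  proof -
    note [simp del] = arrf_simps(2)
    have "src (arrcat (base (mtrg f))) (miso f A) = fob (compr (mtrg f)) (fob (mtot f) A)"
      "trg (arrcat (base (mtrg g))) (miso g (fob (mtot f) A)) = far (mbase g) (fob (compr (mtrg f)) (fob (mtot f) A))"
      "src (arrcat (base (mtrg g))) (miso g (fob (mtot f) A)) = fob (compr (mtrg g)) (fob (mtot g) (fob (mtot f) A))"
      "trg (arrcat (base (mtrg h))) (miso h (fob (mtot g) (fob (mtot f) A))) =
        far (mbase h) (fob (compr (mtrg g)) (fob (mtot g) (fob (mtot f) A)))"
      using A by (simp_all add: src_arrcat trg_arrcat)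
    then show ?thesis
      using A gf hg by (simp add: arrf_fcomp[OF g.F.is_functor h.F.is_functor])
  qed
  then have "miso (cc_comp h (cc_comp g f)) = miso (cc_comp (cc_comp h g) f)"
    by (intro extensionalityI[where A = "obj (tot (msrc f))"]) simp_all
  then show ?thesis
    using f g h gf hg by (intro cc_map.equality)
      (simp_all add: fcomp_assoc[OF f.F.is_functor] fcomp_assoc[OF f.F'.is_functor] rtd_map_iff)
qed

lemma rtd_trans_id:
  assumes "rtd_map f"
  shows "rtd_trans (cc_trans_id f)"
  using assms transf_id by (auto simp: rtd_trans_iff rtd_map_iff)

lemma rtd_trans_vcomp:
  assumes "rtd_trans \<beta>" "rtd_trans \<alpha>" "tsrc \<beta> = ttrg \<alpha>"
  shows "rtd_trans (cc_vcomp \<beta> \<alpha>)"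
  using assms by (auto simp: rtd_trans_iff intro!: transf_vcomp)

lemma rtd_trans_hcomp:
  assumes "rtd_trans \<beta>" "rtd_trans \<alpha>" "msrc (tsrc \<beta>) = mtrg (tsrc \<alpha>)"
  shows "rtd_trans (cc_hcomp \<beta> \<alpha>)"
proof -
  have "transf (msrc (tsrc \<alpha>)) (mtrg (tsrc \<alpha>)) (mbase (tsrc \<alpha>)) (mtot (tsrc \<alpha>)) (miso (tsrc \<alpha>))
      (mbase (ttrg \<alpha>)) (mtot (ttrg \<alpha>)) (miso (ttrg \<alpha>)) (tbase \<alpha>) (ttot \<alpha>)"
    "transf (mtrg (tsrc \<alpha>)) (mtrg (tsrc \<beta>)) (mbase (tsrc \<beta>)) (mtot (tsrc \<beta>)) (miso (tsrc \<beta>))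
      (mbase (ttrg \<beta>)) (mtot (ttrg \<beta>)) (miso (ttrg \<beta>)) (tbase \<beta>) (ttot \<beta>)"
    using assms by (simp_all add: rtd_trans_iff)
  from transf_hcomp[OF this] show ?thesis
    using assms by (simp add: rtd_trans_iff rtd_map_comp)
qed

lemma rtd_transD:
  assumes "rtd_trans \<alpha>"
  shows "rtd_map (tsrc \<alpha>)" "rtd_map (ttrg \<alpha>)" "msrc (ttrg \<alpha>) = msrc (tsrc \<alpha>)" "mtrg (ttrg \<alpha>) = mtrg (tsrc \<alpha>)"
    "nat_trans (base (msrc (tsrc \<alpha>))) (base (mtrg (tsrc \<alpha>))) (mbase (tsrc \<alpha>)) (mbase (ttrg \<alpha>)) (tbase \<alpha>)"
    "nat_trans (tot (msrc (tsrc \<alpha>))) (tot (mtrg (tsrc \<alpha>))) (mtot (tsrc \<alpha>)) (mtot (ttrg \<alpha>)) (ttot \<alpha>)"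
  using assms by (simp_all add: rtd_trans_iff transf_def is_nt_def)

lemma rtd_map_functor:
  assumes "rtd_map f"
  shows "is_functor (base (msrc f)) (base (mtrg f)) (mbase f)" "is_functor (tot (msrc f)) (tot (mtrg f)) (mtot f)"
proof -
  interpret f: ps_map "msrc f" "mtrg f" "mbase f" "mtot f" "miso f"
    using assms by (simp add: rtd_map_iff)
  show "is_functor (base (msrc f)) (base (mtrg f)) (mbase f)" "is_functor (tot (msrc f)) (tot (mtrg f)) (mtot f)"
    by (rule f.F.is_functor, rule f.F'.is_functor)
qed

lemma cc_hcomp_assoc:
  assumes c: "rtd_trans \<gamma>" and b: "rtd_trans \<beta>" and a: "rtd_trans \<alpha>"
    and cb: "msrc (tsrc \<gamma>) = mtrg (tsrc \<beta>)" and ba: "msrc (tsrc \<beta>) = mtrg (tsrc \<alpha>)"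
  shows "cc_hcomp \<gamma> (cc_hcomp \<beta> \<alpha>) = cc_hcomp (cc_hcomp \<gamma> \<beta>) \<alpha>"
proof -
  note c = rtd_transD[OF c] and b = rtd_transD[OF b] and a = rtd_transD[OF a]
  have "tbase (cc_hcomp \<gamma> (cc_hcomp \<beta> \<alpha>)) = tbase (cc_hcomp (cc_hcomp \<gamma> \<beta>) \<alpha>)"
    using nt_hcomp_assoc[OF a(5) b(5)[unfolded ba] c(5)[unfolded cb]] a(3,4) b(3,4) ba cb by simp
  moreover have "ttot (cc_hcomp \<gamma> (cc_hcomp \<beta> \<alpha>)) = ttot (cc_hcomp (cc_hcomp \<gamma> \<beta>) \<alpha>)"
    using nt_hcomp_assoc[OF a(6) b(6)[unfolded ba] c(6)[unfolded cb]] a(3,4) b(3,4) ba cb by simp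
  ultimately show ?thesis
    using a(1-4) b(1-4) c(1-4) ba cb
    by (intro cc_trans.equality) (simp_all add: cc_comp_assoc del: cc_hcomp_simps(3,4))
qed

lemma cc_interchange:
  assumes a: "rtd_trans \<alpha>" and a': "rtd_trans \<alpha>'" and b: "rtd_trans \<beta>" and b': "rtd_trans \<beta>'"
    and aa: "tsrc \<alpha>' = ttrg \<alpha>" and bb: "tsrc \<beta>' = ttrg \<beta>" and ba: "msrc (tsrc \<beta>) = mtrg (tsrc \<alpha>)"
  shows "cc_hcomp (cc_vcomp \<beta>' \<beta>) (cc_vcomp \<alpha>' \<alpha>) = cc_vcomp (cc_hcomp \<beta>' \<alpha>') (cc_hcomp \<beta> \<alpha>)"
proof -
  note b = rtd_transD[OF b] and a = rtd_transD[OF a]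
  note b' = rtd_transD[OF b', unfolded bb b(3,4)] and a' = rtd_transD[OF a', unfolded aa a(3,4)]
  show ?thesis
    using nt_interchange[OF a(5) a'(5) b(5)[unfolded ba] b'(5)[unfolded ba]]
      nt_interchange[OF a(6) a'(6) b(6)[unfolded ba] b'(6)[unfolded ba]] aa bb ba a(3,4) b(3,4)
    by (intro cc_trans.equality) simp_all
qed

text \<open>Equality of 2-cells is checked on base and total components separately, each time by the
  corresponding law for natural transformations.\<close>

lemma strict_CompCat_rtd: "strict_2cat (CompCat_rtd :: ('o, 'm) rcc_2cat)"
  unfolding strict_2cat_def hom1_def hom2_def hcomposable_def vcomposable_def CompCat_rtd_simps mem_Collect_eq
proof (intro conjI allI ballI impI; (elim CollectE)?; (elim conjE)?)
  fix \<alpha> :: "('o, 'm) rcc_trans" assume a: "rtd_trans \<alpha>"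
  note a' = rtd_transD[OF a]
  show "cc_vcomp \<alpha> (cc_trans_id (tsrc \<alpha>)) = \<alpha>" "cc_vcomp (cc_trans_id (ttrg \<alpha>)) \<alpha> = \<alpha>"
    using nt_vcomp_id_right[OF a'(5)] nt_vcomp_id_right[OF a'(6)] nt_vcomp_id_left[OF a'(5)]
      nt_vcomp_id_left[OF a'(6)] a'(3,4)
    by (intro cc_trans.equality; simp)+
  show "cc_hcomp \<alpha> (cc_trans_id (cc_id (msrc (tsrc \<alpha>)))) = \<alpha>"
    using nt_hcomp_id_right[OF a'(5)] nt_hcomp_id_right[OF a'(6)]
      cc_comp_id_right[OF a'(1)] cc_comp_id_right[OF a'(2)] a'(3,4)
    by (intro cc_trans.equality) simp_all
  show "cc_hcomp (cc_trans_id (cc_id (mtrg (tsrc \<alpha>)))) \<alpha> = \<alpha>"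
    using nt_hcomp_id_left[OF a'(5)] nt_hcomp_id_left[OF a'(6)]
      cc_comp_id_left[OF a'(1)] cc_comp_id_left[OF a'(2)] a'(3,4)
    by (intro cc_trans.equality) simp_all
next
  fix f g :: "('o, 'm) rcc_map" assume f: "rtd_map f" and g: "rtd_map g" and gf: "msrc g = mtrg f"
  show "cc_hcomp (cc_trans_id g) (cc_trans_id f) = cc_trans_id (cc_comp g f)"
    using nt_hcomp_id_id[OF rtd_map_functor(1)[OF f] rtd_map_functor(1)[OF g, unfolded gf]]
      nt_hcomp_id_id[OF rtd_map_functor(2)[OF f] rtd_map_functor(2)[OF g, unfolded gf]] gf
    by (intro cc_trans.equality) simp_all
next
  fix \<gamma> \<beta> \<alpha> :: "('o, 'm) rcc_trans"
  assume c: "rtd_trans \<gamma>" and b: "rtd_trans \<beta>" and a: "rtd_trans \<alpha>"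
    and cb: "tsrc \<gamma> = ttrg \<beta>" and ba: "tsrc \<beta> = ttrg \<alpha>"
  note a' = rtd_transD[OF a]
  note b' = rtd_transD[OF b, unfolded ba a'(3,4)]
  note c' = rtd_transD[OF c, unfolded cb ba b'(3,4)]
  show "cc_vcomp \<gamma> (cc_vcomp \<beta> \<alpha>) = cc_vcomp (cc_vcomp \<gamma> \<beta>) \<alpha>"
    using nt_vcomp_assoc[OF a'(5) b'(5) c'(5)] nt_vcomp_assoc[OF a'(6) b'(6) c'(6)] cb ba a'(3,4)
    by (intro cc_trans.equality) simp_all
qed (simp_all add: rtd_map_id rtd_map_comp rtd_trans_id rtd_trans_vcomp rtd_trans_hcomp
    cc_comp_id_left cc_comp_id_right cc_comp_assoc cc_hcomp_assoc cc_interchange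
    rtd_map_rooted rtd_transD(1-4))

section \<open>Maps and transformations into a full target\<close>

lemma rtd_trans_ex:
  assumes f: "rtd_map f" and g: "rtd_map g" and fg: "msrc g = msrc f" "mtrg g = mtrg f"
    and full: "full_cc (mtrg f)"
    and a: "nat_trans (base (msrc f)) (base (mtrg f)) (mbase f) (mbase g) a"
  shows "\<exists>\<alpha>. rtd_trans \<alpha> \<and> tsrc \<alpha> = f \<and> ttrg \<alpha> = g \<and> tbase \<alpha> = a"
proof -
  obtain a' where "transf (msrc f) (mtrg f) (mbase f) (mtot f) (miso f) (mbase g) (mtot g) (miso g) a a'"
    using transf_exists[OF _ _ a full] f g fg unfolding rtd_map_iff by metis
  then show ?thesis
    using f g fg by (intro exI[where x = "\<lparr> tsrc = f, ttrg = g, tbase = a, ttot = a' \<rparr>"])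
      (simp add: rtd_trans_iff)
qed

lemma rtd_trans_eq:
  assumes "rtd_trans \<alpha>" "rtd_trans \<beta>" "tsrc \<alpha> = tsrc \<beta>" "ttrg \<alpha> = ttrg \<beta>" "tbase \<alpha> = tbase \<beta>"
    and "full_cc (mtrg (tsrc \<beta>))"
  shows "\<alpha> = \<beta>"
  using assms by (intro cc_trans.equality) (auto simp: rtd_trans_iff intro: transf_unique)

text \<open>Both 2-cells are taken over the identity transformation of the common base functor.
  Their composites lie over it too, and so are identities by \<open>rtd_trans_eq\<close>.\<close>

lemma isomorphic_maps_into_full:
  fixes f g :: "('o, 'm) rcc_map"
  assumes f: "rtd_map f" and g: "rtd_map g" and fg: "msrc g = msrc f" "mtrg g = mtrg f"
    and full: "full_cc (mtrg f)" and eq: "mbase g = mbase f"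
  shows "isomorphic_objs (homcat CompCat_rtd (msrc f) (mtrg f)) f g"
proof -
  let ?H = "homcat CompCat_rtd (msrc f) (mtrg f) :: (('o, 'm) rcc_map, ('o, 'm) rcc_trans) cat"
  interpret K: is_2cat "CompCat_rtd :: ('o, 'm) rcc_2cat"
    using strict_CompCat_rtd by unfold_locales
  interpret H: is_cat ?H using K.category_homcat by unfold_locales
  note id = nat_trans_id[OF rtd_map_functor(1)[OF f]]
  obtain \<alpha> where a: "rtd_trans \<alpha>" "tsrc \<alpha> = f" "ttrg \<alpha> = g"
    "tbase \<alpha> = nt_id (base (msrc f)) (base (mtrg f)) (mbase f)"
    using rtd_trans_ex[OF f g fg full] id eq by auto
  obtain \<beta> where b: "rtd_trans \<beta>" "tsrc \<beta> = g" "ttrg \<beta> = f"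
    "tbase \<beta> = nt_id (base (msrc f)) (base (mtrg f)) (mbase f)"
    using rtd_trans_ex[OF g f] fg full id eq by auto
  have "cc_vcomp \<beta> \<alpha> = cc_trans_id f"
    by (rule rtd_trans_eq)
      (use a b f full nt_vcomp_id_right[OF id] in \<open>simp_all add: rtd_trans_vcomp rtd_trans_id\<close>)
  moreover have "cc_vcomp \<alpha> \<beta> = cc_trans_id g"
    by (rule rtd_trans_eq)
      (use a b g fg eq full nt_vcomp_id_right[OF id] in \<open>simp_all add: rtd_trans_vcomp rtd_trans_id\<close>)
  moreover have ab: "\<alpha> \<in> arr ?H" "\<beta> \<in> arr ?H"
    using a b fg by (simp_all add: K.arr_homcat)
  moreover have "f \<in> hom1 CompCat_rtd (msrc f) (mtrg f)" "g \<in> hom1 CompCat_rtd (msrc f) (mtrg f)"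
    using f g fg by (simp_all add: hom1_def)
  ultimately have "iso_arr ?H \<alpha>"
    using a b by (intro H.isoI[where g = \<beta>]) (simp_all add: K.homcat_simps)
  then show ?thesis
    using ab a by (auto simp: isomorphic_objs_def hom_def K.homcat_simps)
qed

text \<open>Isomorphisms with identity codomain side are the comparison data of a pseudo map over
  the identity functor. Over that functor the pullback condition is free: comprehensions of
  cartesian arrows are pullback squares already.\<close>

lemma vertical_map:
  fixes X Y :: "('o, 'm) rcc"
  assumes X: "rooted_cc X" and Y: "rooted_cc Y" and full: "full_cc Y"
    and eq: "base Y = base X" "pt Y = pt X"
    and ob: "\<And>A. A \<in> obj (tot X) \<Longrightarrow> \<exists>B\<in>obj (tot Y). \<exists>i. iso_arr (arrcat (base X)) i \<and>
      sqsrc i = fob (compr Y) B \<and> sqtrg i = fob (compr X) A \<and> sqcod i = idn (base X) (fob (proj X) A)"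
  shows "\<exists>f. rtd_map f \<and> msrc f = X \<and> mtrg f = Y \<and> mbase f = fid (base X)"
proof -
  interpret X: compr_cat X using X by (rule rooted_compr_cat)
  interpret Y: compr_cat Y using Y by (rule rooted_compr_cat)
  obtain a \<phi> where a: "\<And>A. A \<in> obj (tot X) \<Longrightarrow> a A \<in> obj (tot Y) \<and> iso_arr (arrcat (base X)) (\<phi> A) \<and>
      sqsrc (\<phi> A) = fob (compr Y) (a A) \<and> sqtrg (\<phi> A) = fob (compr X) A \<and>
      sqcod (\<phi> A) = idn (base X) (fob (proj X) A)"
    using ob by metis
  have "\<exists>F'. pseudo_map X Y (fid (base X)) F' (restrict \<phi> (obj (tot X))) \<and> fob F' = restrict a (obj (tot X))"
  proof (rule pseudo_map_into_full[OF X.comprehension Y.comprehension full])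
    show "is_functor (base X) (base Y) (fid (base X))"
      using functor_fid[OF X.base.category] eq by simp
    fix u assume u: "cartesian (tot X) (base X) (proj X) u"
    then show "pullback_square (base Y) (far (arrf (base X) (fid (base X))) (far (compr X) u))"
      using X.cartesian_compr[OF u] X.p.cartesian_arr[OF u]
      by (simp add: eq arrf_fid[OF X.base.category] pullback_iff_cartesian[OF X.base.category] del: arrf_simps)
  qed (use a eq in auto)
  then obtain F' where "ps_map X Y (fid (base X)) F' (restrict \<phi> (obj (tot X)))"
    by (auto simp: ps_map_def ps_map_axioms_def X.compr_cat_axioms Y.compr_cat_axioms)
  then show ?thesis
    using X Y eq rooted_pt[OF X]
    by (intro exI[where x = "\<lparr> msrc = X, mtrg = Y, mbase = fid (base X), mtot = F',
        miso = restrict \<phi> (obj (tot X)), mpt = idn (base X) (pt X) \<rparr>"])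
      (simp add: rtd_map_iff X.base.iso_idn)
qed

text \<open>The composites of the two vertical maps have the identity as base functor, as identity
  maps do, so \<open>isomorphic_maps_into_full\<close> compares them.\<close>

lemma internally_equivalentI:
  fixes X Y :: "('o, 'm) rcc"
  assumes X: "rooted_cc X" "full_cc X" and Y: "rooted_cc Y" "full_cc Y"
    and eq: "base Y = base X" "pt Y = pt X"
    and XY: "\<And>A. A \<in> obj (tot X) \<Longrightarrow> \<exists>B\<in>obj (tot Y). \<exists>i. iso_arr (arrcat (base X)) i \<and>
      sqsrc i = fob (compr Y) B \<and> sqtrg i = fob (compr X) A \<and> sqcod i = idn (base X) (fob (proj X) A)"
    and YX: "\<And>B. B \<in> obj (tot Y) \<Longrightarrow> \<exists>A\<in>obj (tot X). \<exists>i. iso_arr (arrcat (base X)) i \<and>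
      sqsrc i = fob (compr X) A \<and> sqtrg i = fob (compr Y) B \<and> sqcod i = idn (base X) (fob (proj Y) B)"
  shows "internally_equivalent CompCat_rtd X Y"
proof -
  interpret X: compr_cat X using X(1) by (rule rooted_compr_cat)
  obtain f where f: "rtd_map f" "msrc f = X" "mtrg f = Y" "mbase f = fid (base X)"
    using vertical_map[OF X(1) Y eq XY] by blast
  obtain g where g: "rtd_map g" "msrc g = Y" "mtrg g = X" "mbase g = fid (base X)"
    using vertical_map[OF Y(1) X] eq YX by auto
  have fid: "fcomp (base X) (fid (base X)) (fid (base X)) = fid (base X)"
    by (rule fcomp_fid_left[OF functor_fid[OF X.base.category]])
  have "isomorphic_objs (homcat CompCat_rtd X X) (cc_id X) (cc_comp g f)"
    using isomorphic_maps_into_full[OF rtd_map_id[OF X(1)] rtd_map_comp[OF f(1) g(1)]] f g X(2) fid by simp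
  moreover have "isomorphic_objs (homcat CompCat_rtd Y Y) (cc_comp f g) (cc_id Y)"
    using isomorphic_maps_into_full[OF rtd_map_comp[OF g(1) f(1)] rtd_map_id[OF Y(1)]] f g Y(2) fid eq by simp
  ultimately show ?thesis
    using f g unfolding internally_equivalent_def
    by (intro bexI[where x = f] bexI[where x = g]) (simp_all add: hom1_def)
qed

section \<open>Comprehension categories with full comprehension\<close>

text \<open>With \<open>c\<close> the identity on a set of display maps this is
  \<open>view0\<close>; with \<open>c\<close> the comprehension of \<open>X\<close> on objects it is
  the full image of \<open>X\<close>.\<close>

definition along_cc :: "('o, 'm) cat \<Rightarrow> 'm set \<Rightarrow> ('m \<Rightarrow> 'm) \<Rightarrow> 'o \<Rightarrow> ('o, 'm) rcc" where
  "along_cc C S c t = \<lparr> base = C, tot = along C S c, proj = fcomp (along C S c) (codf C) (alongf C S c),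
     compr = alongf C S c, pt = t \<rparr>"

lemma along_cc_simps [simp]: "base (along_cc C S c t) = C" "tot (along_cc C S c t) = along C S c"
  "proj (along_cc C S c t) = fcomp (along C S c) (codf C) (alongf C S c)"
  "compr (along_cc C S c t) = alongf C S c" "pt (along_cc C S c t) = t"
  by (simp_all add: along_cc_def)

lemma alongf_ob [simp]: "A \<in> S \<Longrightarrow> fob (alongf C S c) A = c A"
  by (simp add: alongf_def)

lemma full_cc_along_cc: "category C \<Longrightarrow> c \<in> S \<rightarrow> arr C \<Longrightarrow> full_cc (along_cc C S c t)"
  by (simp add: full_cc_def is_cat.full_alongf is_cat.faithful_alongf is_cat.intro)

lemma comprehension_along_cc:
  assumes C: "category C" and c: "c \<in> S \<rightarrow> arr C"
    and lift: "\<And>A f. A \<in> S \<Longrightarrow> f \<in> arr C \<Longrightarrow> trg C f = trg C (c A) \<Longrightarrow>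
      \<exists>B\<in>S. \<exists>q. pullback_square C (Square (c B) (c A) q f)"
  shows "comprehension_category (along_cc C S c t)"
proof -
  let ?T = "along C S c" and ?p = "fcomp (along C S c) (codf C) (alongf C S c)"
  interpret C: is_cat C using C by unfold_locales
  interpret H: is_ftr ?T "arrcat C" "alongf C S c"
    using C.functor_alongf[OF c] by unfold_locales
  interpret q: is_ftr "arrcat C" C "codf C" using functor_codf[OF C] by unfold_locales
  interpret p: is_ftr ?T C ?p using functor_fcomp[OF H.is_functor q.is_functor] by unfold_locales
  \<comment> \<open>Each lift is returned together with the pullback property of its square: an
    arbitrary cartesian arrow over the same data differs from it by an isomorphism, so its square is
    a pullback as well.\<close>
  have ex: "\<exists>u. cartesian ?T C ?p u \<and> trg ?T u = A \<and> far ?p u = f \<and>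
      cartesian (arrcat C) C (codf C) (far (alongf C S c) u)"
    if A: "A \<in> S" and f: "f \<in> arr C" "trg C f = fob ?p A" for A f
  proof -
    have "trg C f = trg C (c A)" using A f c by (auto simp: codf_def Pi_iff)
    from lift[OF A f(1) this] obtain B q where B: "B \<in> S" "pullback_square C (Square (c B) (c A) q f)"
      by blast
    let ?u = "Square B A q f"
    have sq: "Square (c B) (c A) q f \<in> arr (arrcat C)"
      using B(2) by (simp add: pullback_square_def)
    then have u: "?u \<in> arr ?T" using A B by (simp add: along_arr)
    have fu: "far (alongf C S c) ?u = Square (c B) (c A) q f"
      using u by (simp add: alongf_def)
    then have ca: "cartesian (arrcat C) C (codf C) (far (alongf C S c) ?u)"
      using B(2) by (simp add: pullback_iff_cartesian[OF C])
    have "cartesian ?T C ?p ?u"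
      by (rule cartesian_reflect[OF H.is_functor q.is_functor C.full_alongf[OF c] C.faithful_alongf[OF c] u ca])
    then show ?thesis
      using ca u fu sq by (intro exI[where x = ?u]) (simp add: trg_along codf_def del: Square_arr)
  qed
  have "pullback_square C (far (alongf C S c) u)" if u: "cartesian ?T C ?p u" for u
  proof -
    have ua: "u \<in> arr ?T" using u by (rule p.cartesian_arr)
    then have "trg ?T u \<in> S" using H.dom.trg_obj by simp
    from ex[OF this, of "far ?p u"] ua obtain u' where u': "cartesian ?T C ?p u'" "trg ?T u' = trg ?T u"
      "far ?p u' = far ?p u" "cartesian (arrcat C) C (codf C) (far (alongf C S c) u')"
      using p.trg_far[OF ua] p.far_arr[OF ua] by blast
    from cartesian_preserve[OF H.is_functor q.is_functor p.is_functor u' u] show ?thesis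
      by (simp add: pullback_iff_cartesian[OF C])
  qed
  moreover have "\<exists>u. cartesian ?T C ?p u \<and> trg ?T u = A \<and> far ?p u = f"
    if "A \<in> S" "f \<in> arr C" "trg C f = fob ?p A" for A f
    using ex[OF that] by blast
  ultimately show ?thesis
    unfolding comprehension_category_def fibration_def along_cc_simps obj_along
    by (intro conjI ballI allI impI C H.is_functor p.is_functor refl)
qed

lemma contexts_mono:
  assumes "pt Z = pt X" "\<And>A. A \<in> obj (tot X) \<Longrightarrow>
    \<exists>B\<in>obj (tot Z). fob (proj Z) B = fob (proj X) A \<and> ext Z B = ext X A"
  shows "contexts X \<subseteq> contexts Z"
proof
  fix x assume "x \<in> contexts X"
  then show "x \<in> contexts Z"
  proof induction
    case empty
    then show ?case using contexts.empty[of Z] assms(1) by simp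
  next
    case (extend \<Gamma> A)
    then obtain B where "B \<in> obj (tot Z)" "fob (proj Z) B = \<Gamma>" "ext Z B = ext X A"
      using assms(2) by metis
    with extend show ?case using contexts.extend[of \<Gamma> Z B] by simp
  qed
qed

text \<open>The assumption \<open>ob\<close> keeps every context of \<open>X\<close> a context of
  the new structure, so the given isomorphisms to contexts still serve.\<close>

lemma rooted_along_cc:
  assumes X: "rooted_cc X" and c: "c \<in> S \<rightarrow> arr (base X)"
    and lift: "\<And>A f. A \<in> S \<Longrightarrow> f \<in> arr (base X) \<Longrightarrow> trg (base X) f = trg (base X) (c A) \<Longrightarrow>
      \<exists>B\<in>S. \<exists>q. pullback_square (base X) (Square (c B) (c A) q f)"
    and ob: "\<And>A. A \<in> obj (tot X) \<Longrightarrow> \<exists>B\<in>S. c B = fob (compr X) A"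
  shows "rooted_cc (along_cc (base X) S c (pt X))"
proof -
  interpret X: compr_cat X using X by (rule rooted_compr_cat)
  let ?Z = "along_cc (base X) S c (pt X)"
  have Z: "comprehension_category ?Z"
    by (rule comprehension_along_cc[OF X.base.category c lift])
  have "contexts X \<subseteq> contexts ?Z"
  proof (rule contexts_mono)
    fix A assume A: "A \<in> obj (tot X)"
    then obtain B where B: "B \<in> S" "c B = fob (compr X) A" using ob by blast
    then show "\<exists>B\<in>obj (tot ?Z). fob (proj ?Z) B = fob (proj X) A \<and> ext ?Z B = ext X A"
      using A X.compr_obj[OF A] by (intro bexI[where x = B]) (simp_all add: codf_def ext_def del: X.src_compr)
  qed simp
  then show ?thesis
    using X Z unfolding rooted_cc_def by simp blast
qed

lemma (in compr_cat) pullback_ex: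
  assumes "A \<in> obj (tot X)" "f \<in> arr (base X)" "trg (base X) f = fob (proj X) A"
  shows "\<exists>B\<in>obj (tot X). \<exists>q. pullback_square (base X) (Square (fob (compr X) B) (fob (compr X) A) q f)"
proof -
  obtain u where u: "cartesian (tot X) (base X) (proj X) u" "trg (tot X) u = A" "far (proj X) u = f"
    using cartesian_ex[OF assms] by blast
  have ua: "u \<in> arr (tot X)" using u(1) by (rule p.cartesian_arr)
  then have "far (compr X) u = Square (fob (compr X) (src (tot X) u)) (fob (compr X) A) (sqdom (far (compr X) u)) f"
    using u(2,3) by (intro square.expand) simp
  then show ?thesis
    using cartesian_compr[OF u(1)] ua unfolding pullback_iff_cartesian[OF base.category]
    by (intro bexI[where x = "src (tot X) u"] exI[where x = "sqdom (far (compr X) u)"]) simp_all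
qed

section \<open>Display map categories as comprehension categories\<close>

lemma view0_simps [simp]: "base (view0 D) = dbase D" "tot (view0 D) = full_sub (arrcat (dbase D)) (disp D)"
  "compr (view0 D) = fid (tot (view0 D))" "pt (view0 D) = dtop D"
  by (simp_all add: view0_def Let_def)

lemma obj_full_sub [simp]: "obj (full_sub C S) = S"
  by (simp add: full_sub_def Let_def)

lemma full_sub_arrcat_arr: "u \<in> arr (full_sub (arrcat C) S) \<longleftrightarrow> u \<in> arr (arrcat C) \<and> sqsrc u \<in> S \<and> sqtrg u \<in> S"
  by (auto simp: full_sub_def Let_def src_arrcat trg_arrcat)

lemma src_trg_full_sub:
  assumes "u \<in> arr (full_sub (arrcat C) S)"
  shows "src (full_sub (arrcat C) S) u = sqsrc u" "trg (full_sub (arrcat C) S) u = sqtrg u"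
  using assms by (auto simp: full_sub_def Let_def src_arrcat trg_arrcat)

lemma view0_eq_along_cc:
  assumes "disp D \<subseteq> arr (dbase D)"
  shows "view0 D = along_cc (dbase D) (disp D) (\<lambda>d. d) (dtop D)"
  unfolding view0_def Let_def along_cc_def full_sub_eq_along[OF assms] alongf_eq_fid[OF assms] by simp

lemma sub_cc_view0: "disp D \<subseteq> arr (dbase D) \<Longrightarrow> sub_cc (view0 D)"
  by (simp add: sub_cc_def)

text \<open>Inverse to \<open>view0\<close> on subcategorical structures, where the objects of the
  total category are arrows of the base.\<close>

definition underlying_dmc :: "('o, 'm) rcc \<Rightarrow> ('o, 'm) dmc" where
  "underlying_dmc X = \<lparr> dbase = base X, disp = obj (tot X), dtop = pt X \<rparr>"

lemma underlying_dmc_view0 [simp]: "underlying_dmc (view0 D) = D"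
  by (simp add: underlying_dmc_def)

lemma view0_underlying_dmc:
  assumes "comprehension_category X" "sub_cc X"
  shows "view0 (underlying_dmc X) = X"
proof -
  interpret X: compr_cat X using assms(1) by unfold_locales
  have T: "full_sub (arrcat (base X)) (obj (tot X)) = tot X" "fid (tot X) = compr X"
    using assms(2) by (simp_all add: sub_cc_def)
  show ?thesis
    unfolding view0_def Let_def underlying_dmc_def dmc.simps T X.proj_eq[symmetric] by simp
qed

lemma full_cc_view0: "category (dbase D) \<Longrightarrow> disp D \<subseteq> arr (dbase D) \<Longrightarrow> full_cc (view0 D)"
  by (simp add: view0_eq_along_cc full_cc_along_cc subset_iff)

lemma sub_full:
  fixes X :: "('o, 'm) rcc"
  assumes "comprehension_category X" "sub_cc X"
  shows "full_cc X"
proof -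
  have "full_cc (view0 (underlying_dmc X))"
    using assms by (intro full_cc_view0) (simp_all add: underlying_dmc_def comprehension_category_def sub_cc_def)
  then show ?thesis by (simp add: view0_underlying_dmc[OF assms])
qed

lemma rooted_view0:
  assumes D: "rooted_sdmc D"
  shows "rooted_cc (view0 D)"
proof -
  let ?C = "dbase D" and ?X = "view0 D"
  have C: "category ?C" and sub: "disp D \<subseteq> arr ?C"
    using D by (simp_all add: rooted_sdmc_def structured_dmc_def)
  interpret C: is_cat ?C using C by unfold_locales
  have lift: "\<exists>e\<in>disp D. \<exists>q. pullback_square ?C (Square e d q f)"
    if "d \<in> disp D" "f \<in> arr ?C" "trg ?C f = trg ?C d" for d f
    using D that by (simp add: rooted_sdmc_def structured_dmc_def)
  have X: "comprehension_category ?X"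
    unfolding view0_eq_along_cc[OF sub] by (rule comprehension_along_cc[OF C]) (use sub lift in auto)
  interpret X: compr_cat ?X using X by unfold_locales
  interpret A: is_cat "arrcat ?C" using C.category_arrcat by unfold_locales
  interpret q: is_ftr "arrcat ?C" ?C "codf ?C" using functor_codf[OF C] by unfold_locales
  \<comment> \<open>Contexts are built by display maps alone, while composites may pass through
    isomorphisms; the induction therefore allows the target to be merely isomorphic to a
    context.\<close>
  have step: "f \<in> arr ?C \<and> (\<forall>\<Gamma>\<in>contexts ?X. isomorphic_objs ?C \<Gamma> (trg ?C f) \<longrightarrow>
      (\<exists>\<Delta>\<in>contexts ?X. isomorphic_objs ?C \<Delta> (src ?C f)))" if "f \<in> disp_composites D" for f
    using that
  proof induction
    case (disp d)
    have "\<exists>\<Delta>\<in>contexts ?X. isomorphic_objs ?C \<Delta> (src ?C d)"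
      if \<Gamma>: "\<Gamma> \<in> contexts ?X" "isomorphic_objs ?C \<Gamma> (trg ?C d)" for \<Gamma>
    proof -
      obtain t where t: "t \<in> arr ?C" "src ?C t = \<Gamma>" "trg ?C t = trg ?C d" "iso_arr ?C t"
        using \<Gamma>(2) by (auto simp: isomorphic_objs_def hom_def)
      \<comment> \<open>The display map is pulled back along the isomorphism \<open>t\<close> out of
        \<open>\<Gamma>\<close>. The result extends \<open>\<Gamma>\<close> itself, and the pullback
        square is invertible because \<open>t\<close> is.\<close>
      from lift[OF disp t(1,3)] obtain e q where e: "e \<in> disp D" "pullback_square ?C (Square e d q t)"
        by blast
      then have sq: "Square e d q t \<in> arr (arrcat ?C)" by (simp add: pullback_square_def)
      have "iso_arr (arrcat ?C) (Square e d q t)"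
      proof (rule q.cartesian_over_iso)
        show "cartesian (arrcat ?C) ?C (codf ?C) (Square e d q t)"
          using e(2) by (simp add: pullback_iff_cartesian[OF C])
      qed (use sq t in \<open>simp add: codf_def\<close>)
      then have "iso_arr ?C q" using square_iso(1)[OF C] by force
      then have "isomorphic_objs ?C (src ?C e) (src ?C d)"
        using sq by (auto simp: isomorphic_objs_def hom_def)
      moreover have "ext ?X e \<in> contexts ?X"
        by (rule contexts.extend[OF \<Gamma>(1)]) (use e(1) sq t X.trg_compr[of e] in simp_all)
      ultimately show ?thesis using e(1) by (auto simp: ext_def)
    qed
    then show ?case using disp sub by blast
  next
    case (iso f)
    then have f: "f \<in> arr ?C" by (simp add: iso_arr_def)
    have "isomorphic_objs ?C (src ?C f) (trg ?C f)"
      unfolding isomorphic_objs_def by (rule bexI[where x = f]) (use f iso in \<open>simp_all add: hom_def\<close>)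
    from C.isomorphic_trans[OF _ C.isomorphic_sym[OF this]] show ?case
      using f by blast
  next
    case (comp g f)
    then have "src ?C g = trg ?C f" by (simp add: composable_def)
    with comp.IH show ?case by simp
  qed
  have "\<exists>\<Gamma>\<in>contexts ?X. isomorphic_objs ?C x \<Gamma>" if x: "x \<in> obj ?C" for x
  proof -
    have top: "dtop D \<in> obj ?C" using D by (simp add: rooted_sdmc_def terminal_def)
    obtain f where f: "f \<in> arr ?C" "src ?C f = x" "trg ?C f = dtop D"
      using D x by (auto simp: rooted_sdmc_def terminal_def hom_def)
    then have "f \<in> disp_composites D" using D by (simp add: rooted_sdmc_def)
    moreover have "dtop D \<in> contexts ?X" using contexts.empty[of ?X] by simp
    ultimately obtain \<Delta> where "\<Delta> \<in> contexts ?X" "isomorphic_objs ?C \<Delta> x"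
      using step[of f] f C.isomorphic_refl[OF top] by metis
    then show ?thesis using C.isomorphic_sym by blast
  qed
  then show ?thesis
    using X D by (simp add: rooted_cc_def rooted_sdmc_def)
qed

lemma rooted_underlying_dmc:
  assumes X: "rooted_cc X" and sub: "sub_cc X"
  shows "rooted_sdmc (underlying_dmc X)"
proof -
  let ?D = "underlying_dmc X"
  interpret X: compr_cat X using X by (rule rooted_compr_cat)
  have D [simp]: "dbase ?D = base X" "disp ?D = obj (tot X)" "dtop ?D = pt X"
    by (simp_all add: underlying_dmc_def)
  have compr: "fob (compr X) A = A" if "A \<in> obj (tot X)" for A
    using sub that unfolding sub_cc_def by (metis fid_simps(1))
  have ob: "A \<in> arr (base X)" "trg (base X) A = fob (proj X) A" "src (base X) A = ext X A"
    if "A \<in> obj (tot X)" for A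
    using compr[OF that] X.compr_obj[OF that] X.trg_compr[OF that] X.src_compr[OF that] by simp_all
  have "structured_dmc ?D"
    unfolding structured_dmc_def D
  proof (intro conjI ballI impI)
    fix d f assume d: "d \<in> obj (tot X)" and f: "f \<in> arr (base X)" "trg (base X) f = trg (base X) d"
    then show "\<exists>e\<in>obj (tot X). \<exists>q. pullback_square (base X) (Square e d q f)"
      using X.pullback_ex[OF d f(1)] ob[OF d] compr by auto
  qed (use X.base.category ob in auto)
  moreover have tm: "terminal (base X) (pt X)" using X by (rule rooted_terminal)
  \<comment> \<open>The arrow from an iterated extension to the root is unique, hence equal to the
    composite of the display maps that built the extension.\<close>
  have ctx: "\<Gamma> \<in> obj (base X) \<and> (\<forall>f\<in>hom (base X) \<Gamma> (pt X). f \<in> disp_composites ?D)"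
    if "\<Gamma> \<in> contexts X" for \<Gamma>
    using that
  proof induction
    case empty
    have o: "pt X \<in> obj (base X)" using X by (rule rooted_pt)
    have "f = idn (base X) (pt X)" if "f \<in> hom (base X) (pt X) (pt X)" for f
      by (rule X.base.terminal_unique[OF tm that]) (use o in \<open>simp add: hom_def\<close>)
    then show ?case
      using o X.base.iso_idn[OF o] disp_composites.iso[of ?D] by auto
  next
    case (extend \<Gamma> A)
    obtain t where t: "t \<in> hom (base X) \<Gamma> (pt X)"
      using extend.IH tm by (auto simp: terminal_def)
    have "f \<in> disp_composites ?D" if f: "f \<in> hom (base X) (ext X A) (pt X)" for f
    proof -
      have co: "composable (base X) t A"
        using t ob[OF extend.hyps(2)] extend.hyps(3) by (simp add: composable_def hom_def)
      have "f = cmp (base X) t A"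
        by (rule X.base.terminal_unique[OF tm f])
          (use co t ob[OF extend.hyps(2)] in \<open>simp add: composable_def hom_def\<close>)
      moreover have "t \<in> disp_composites ?D" "A \<in> disp_composites ?D"
        using t extend disp_composites.disp[of A ?D] by auto
      ultimately show ?thesis
        using disp_composites.comp[of t ?D A] co by simp
    qed
    then show ?case using extend by auto
  qed
  have "f \<in> disp_composites ?D" if f: "f \<in> arr (base X)" "trg (base X) f = pt X" for f
  proof -
    obtain \<Gamma> i where G: "\<Gamma> \<in> contexts X" and i: "iso_arr (base X) i" "i \<in> arr (base X)"
      "src (base X) i = src (base X) f" "trg (base X) i = \<Gamma>"
      using X X.base.src_obj[OF f(1)] by (auto simp: rooted_cc_def isomorphic_objs_def hom_def)
    obtain t where t: "t \<in> hom (base X) \<Gamma> (pt X)"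
      using ctx[OF G] tm by (auto simp: terminal_def)
    have "f = cmp (base X) t i"
      by (rule X.base.terminal_unique[OF tm, of _ "src (base X) f"]) (use f t i in \<open>simp_all add: hom_def\<close>)
    moreover have "t \<in> disp_composites ?D" using ctx[OF G] t by blast
    moreover have "i \<in> disp_composites ?D" using i(1) by (intro disp_composites.iso) simp
    ultimately show ?thesis
      using disp_composites.comp[of t ?D i] t i by (simp add: composable_def hom_def)
  qed
  ultimately show ?thesis
    using tm by (simp add: rooted_sdmc_def)
qed

text \<open>In a full subcategory an arrow belongs as soon as both of its ends do, so repleteness is
  a condition on objects only.\<close>

lemma repl_cc_view0:
  assumes "rooted_sdmc D"
  shows "repl_cc (view0 D) \<longleftrightarrow> replete_dmc D"
proof -
  have sub: "disp D \<subseteq> arr (dbase D)"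
    using assms by (simp add: rooted_sdmc_def structured_dmc_def)
  have "replete_sub (arrcat (dbase D)) (tot (view0 D)) \<longleftrightarrow> replete_dmc D"
    unfolding replete_sub_def replete_dmc_def isomorphic_objs_def hom_def
    by (auto simp: full_sub_def Let_def iso_arr_def) 
  then show ?thesis
    using sub_cc_view0[OF sub] by (simp add: repl_cc_def)
qed

section \<open>Strict maps into subcategorical targets\<close>

lemma strict_cc_map_id:
  assumes "comprehension_category X"
  shows "strict_cc_map (cc_id X)"
proof -
  interpret X: compr_cat X using assms by unfold_locales
  show ?thesis
    by (auto simp: strict_cc_map_def arrf_fid[OF X.base.category] fcomp_fid_left[OF X.chi.is_functor]
        fcomp_fid_right[OF X.chi.is_functor] intro!: restrict_ext)
qed

lemma strict_cc_map_comp: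
  assumes f: "rtd_map f" and g: "rtd_map g" and gf: "msrc g = mtrg f"
    and sf: "strict_cc_map f" and sg: "strict_cc_map g"
  shows "strict_cc_map (cc_comp g f)"
proof -
  interpret f: ps_map "msrc f" "mtrg f" "mbase f" "mtot f" "miso f"
    using f by (simp add: rtd_map_iff)
  interpret g: ps_map "mtrg f" "mtrg g" "mbase g" "mtot g" "miso g"
    using g gf by (simp add: rtd_map_iff)
  interpret G: is_ftr "arrcat (base (mtrg f))" "arrcat (base (mtrg g))" "arrf (base (mtrg f)) (mbase g)"
    using functor_arrf[OF g.F.is_functor] by unfold_locales
  have 1: "fcomp (tot (msrc f)) (compr (mtrg f)) (mtot f) =
      fcomp (tot (msrc f)) (arrf (base (msrc f)) (mbase f)) (compr (msrc f))"
    and 2: "fcomp (tot (mtrg f)) (compr (mtrg g)) (mtot g) =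
      fcomp (tot (mtrg f)) (arrf (base (mtrg f)) (mbase g)) (compr (mtrg f))"
    using sf sg gf by (simp_all add: strict_cc_map_def)
  have mf: "miso f A = idn (arrcat (base (mtrg f))) (fob (compr (mtrg f)) (fob (mtot f) A))"
    if "A \<in> obj (tot (msrc f))" for A
    using sf that by (simp add: strict_cc_map_def)
  have mg: "miso g A = idn (arrcat (base (mtrg g))) (fob (compr (mtrg g)) (fob (mtot g) A))"
    if "A \<in> obj (tot (mtrg f))" for A
    using sg gf that by (simp add: strict_cc_map_def)
  have "fcomp (tot (msrc f)) (compr (mtrg g)) (fcomp (tot (msrc f)) (mtot g) (mtot f)) =
      fcomp (tot (msrc f)) (arrf (base (mtrg f)) (mbase g)) (fcomp (tot (msrc f)) (compr (mtrg f)) (mtot f))"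
    unfolding fcomp_assoc[OF f.F'.is_functor] 2 ..
  also have "\<dots> = fcomp (tot (msrc f)) (arrf (base (msrc f)) (fcomp (base (msrc f)) (mbase g) (mbase f)))
      (compr (msrc f))"
    unfolding 1 fcomp_assoc[OF f.X.chi.is_functor] arrf_fcomp[OF f.F.is_functor g.F.is_functor] ..
  finally have eq: "fcomp (tot (msrc f)) (compr (mtrg g)) (fcomp (tot (msrc f)) (mtot g) (mtot f)) =
      fcomp (tot (msrc f)) (arrf (base (msrc f)) (fcomp (base (msrc f)) (mbase g) (mbase f))) (compr (msrc f))" .
  have "cmp (arrcat (base (mtrg g))) (far (arrf (base (mtrg f)) (mbase g)) (miso f A)) (miso g (fob (mtot f) A)) =
      idn (arrcat (base (mtrg g))) (fob (compr (mtrg g)) (fob (mtot g) (fob (mtot f) A)))"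
    if A: "A \<in> obj (tot (msrc f))" for A
  proof -
    have B: "fob (mtot f) A \<in> obj (tot (mtrg f))" using A by simp
    have "fob (arrf (base (mtrg f)) (mbase g)) (fob (compr (mtrg f)) (fob (mtot f) A)) =
        fob (compr (mtrg g)) (fob (mtot g) (fob (mtot f) A))"
      using arg_cong[OF 2, of "\<lambda>H. fob H (fob (mtot f) A)"] B by simp
    then show ?thesis
      using G.far_idn[of "fob (compr (mtrg f)) (fob (mtot f) A)"] A B
      by (simp add: mf mg del: arrf_simps)
  qed
  then show ?thesis
    unfolding strict_cc_map_def cc_comp_simps using eq gf by (simp cong: restrict_cong)
qed

lemma sub_cc_compr:
  assumes "sub_cc X"
  shows "A \<in> obj (tot X) \<Longrightarrow> fob (compr X) A = A" "u \<in> arr (tot X) \<Longrightarrow> far (compr X) u = u"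
    "compr X = fid (tot X)"
  using assms unfolding sub_cc_def by (metis fid_simps(1), metis fid_simps(2), simp)

text \<open>Taking \<open>far F (fob (compr X) A)\<close> itself as the image of \<open>A\<close>
  lets all comparison squares be identities; \<open>ob\<close> says that it is an object of the
  total category of \<open>Y\<close>.\<close>

lemma strict_map_into_sub:
  fixes X Y :: "('o, 'm) rcc"
  assumes X: "rooted_cc X" and Y: "rooted_cc Y" and sub: "sub_cc Y"
    and F: "is_functor (base X) (base Y) F"
    and ob: "\<And>A. A \<in> obj (tot X) \<Longrightarrow> far F (fob (compr X) A) \<in> obj (tot Y)"
    and pb: "\<And>u. cartesian (tot X) (base X) (proj X) u \<Longrightarrow>
      pullback_square (base Y) (far (arrf (base X) F) (far (compr X) u))"
    and tm: "terminal (base Y) (fob F (pt X))"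
  shows "\<exists>f. rtd_map f \<and> strict_cc_map f \<and> msrc f = X \<and> mtrg f = Y \<and> mbase f = F"
proof -
  interpret X: compr_cat X using X by (rule rooted_compr_cat)
  interpret Y: compr_cat Y using Y by (rule rooted_compr_cat)
  interpret F: is_ftr "base X" "base Y" F using F by unfold_locales
  interpret G: is_ftr "arrcat (base X)" "arrcat (base Y)" "arrf (base X) F"
    using functor_arrf[OF F] by unfold_locales
  define a where "a A = far F (fob (compr X) A)" for A
  define \<phi> where "\<phi> = (\<lambda>A\<in>obj (tot X). idn (arrcat (base Y)) (a A))"
  note aY [simp] = ob[folded a_def]
  have "\<exists>F'. pseudo_map X Y F F' (restrict \<phi> (obj (tot X))) \<and> fob F' = restrict a (obj (tot X))"
  proof (rule pseudo_map_into_full[OF X.comprehension Y.comprehension _ F])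
    fix A assume A: "A \<in> obj (tot X)"
    then have "a A \<in> arr (base Y)" by (simp add: a_def)
    then show "sqsrc (\<phi> A) = fob (compr Y) (a A)" "sqtrg (\<phi> A) = far F (fob (compr X) A)"
      "sqcod (\<phi> A) = idn (base Y) (fob F (fob (proj X) A))" "iso_arr (arrcat (base Y)) (\<phi> A)"
      using A aY[OF A] Y.chi.cod.iso_idn[of "a A"]
      by (simp_all add: \<phi>_def sub_cc_compr[OF sub], simp_all add: idn_arrcat, simp_all add: a_def)
  qed (use pb sub_full[OF Y.comprehension sub] in simp_all)
  then obtain F' where F': "pseudo_map X Y F F' \<phi>" "fob F' = restrict a (obj (tot X))"
    by (auto simp: \<phi>_def)
  then interpret f: ps_map X Y F F' \<phi> by unfold_locales
  have strict: "fcomp (tot X) (compr Y) F' = fcomp (tot X) (arrf (base X) F) (compr X)"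
  proof (rule fctr_eqI)
    show "is_functor (tot X) (arrcat (base Y)) (fcomp (tot X) (compr Y) F')"
      "is_functor (tot X) (arrcat (base Y)) (fcomp (tot X) (arrf (base X) F) (compr X))"
      by (auto intro!: functor_fcomp f.F'.is_functor Y.chi.is_functor X.chi.is_functor G.is_functor)
    fix A assume "A \<in> obj (tot X)"
    then show "fob (fcomp (tot X) (compr Y) F') A = fob (fcomp (tot X) (arrf (base X) F) (compr X)) A"
      using F'(2) aY by (simp add: sub_cc_compr[OF sub]) (simp add: a_def)
  next
    fix u assume u: "u \<in> arr (tot X)"
    \<comment> \<open>With identity comparisons, naturality of \<open>\<phi>\<close> becomes
      strictness on arrows.\<close>
    have i: "\<phi> A = idn (arrcat (base Y)) (fob (compr Y) (fob F' A))" "\<phi> A = idn (arrcat (base Y)) (fob (arrf (base X) F) (fob (compr X) A))"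
      if "A \<in> obj (tot X)" for A
      using that F'(2) by (simp_all add: \<phi>_def sub_cc_compr[OF sub], simp add: a_def)
    have "far (compr Y) (far F' u) = far (arrf (base X) F) (far (compr X) u)"
      using f.phi_nat[OF u refl refl] i(1)[of "trg (tot X) u"] i(2)[of "src (tot X) u"] u
      by (simp del: arrf_simps)
    then show "far (fcomp (tot X) (compr Y) F') u = far (fcomp (tot X) (arrf (base X) F) (compr X)) u"
      using u by simp
  qed
  \<comment> \<open>The root comparison is the only arrow into the terminal root; \<open>tm\<close>
    makes it invertible.\<close>
  define m where "m = (THE u. u \<in> hom (base Y) (fob F (pt X)) (pt Y))"
  have ex1: "\<exists>!u. u \<in> hom (base Y) (fob F (pt X)) (pt Y)"
    using rooted_terminal[OF Y] rooted_pt[OF X] by (simp add: terminal_def)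
  have m: "m \<in> hom (base Y) (fob F (pt X)) (pt Y)"
    unfolding m_def by (rule theI'[OF ex1])
  have "iso_arr (base Y) m"
    by (rule Y.base.terminal_iso[OF tm rooted_terminal[OF Y] m])
  then have "rtd_map \<lparr> msrc = X, mtrg = Y, mbase = F, mtot = F', miso = \<phi>, mpt = m \<rparr>"
    using X Y f.ps_map_axioms m by (simp add: rtd_map_iff hom_def)
  moreover have "strict_cc_map \<lparr> msrc = X, mtrg = Y, mbase = F, mtot = F', miso = \<phi>, mpt = m \<rparr>"
    using strict F'(2) by (auto simp: strict_cc_map_def \<phi>_def sub_cc_compr[OF sub] intro!: restrict_ext)
  ultimately show ?thesis by force
qed

lemma view1_simps [simp]:
  "msrc (view1 f) = view0 (dsrc f)" "mtrg (view1 f) = view0 (dtrg f)" "mbase (view1 f) = dfun f"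
  by (simp_all add: view1_def Let_def)

lemma view2_simps [simp]:
  "tsrc (view2 \<alpha>) = view1 (dtsrc \<alpha>)" "ttrg (view2 \<alpha>) = view1 (dttrg \<alpha>)" "tbase (view2 \<alpha>) = dtnat \<alpha>"
  by (simp_all add: view2_def Let_def)

text \<open>A strict map into a subcategorical target is determined by its base functor: strictness
  gives the total functor and the comparisons, and terminality of the root gives the root
  comparison.\<close>

lemma view1_eqI:
  assumes g: "rtd_map g" "strict_cc_map g" and f: "msrc g = view0 (dsrc f)" "mtrg g = view0 (dtrg f)" "mbase g = dfun f"
    and sub: "disp (dtrg f) \<subseteq> arr (dbase (dtrg f))"
  shows "view1 f = g"
proof -
  interpret g: ps_map "view0 (dsrc f)" "view0 (dtrg f)" "dfun f" "mtot g" "miso g"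
    using g f by (simp add: rtd_map_iff)
  let ?T = "tot (view0 (dsrc f))" and ?S = "tot (view0 (dtrg f))"
  note s = g(2)[unfolded strict_cc_map_def f]
  have "mtot g = fcomp ?T (fid ?S) (mtot g)"
    using fcomp_fid_left[OF g.F'.is_functor] by simp
  also have "\<dots> = fcomp ?T (arrf (dbase (dsrc f)) (dfun f)) (fid ?T)"
    using s by simp
  finally have tot: "mtot g = mtot (view1 f)"
    by (simp add: view1_def Let_def)
  have fob_tot: "fob (mtot g) d = far (dfun f) d" if "d \<in> disp (dsrc f)" for d
    using that g.X.compr_obj[of d] unfolding tot by (simp add: view1_def Let_def)
  have "miso g = miso (view1 f)"
    using s fob_tot g.F'.fob_obj by (auto simp: view1_def Let_def intro!: restrict_ext)
  moreover have "mpt (view1 f) = mpt g"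
  proof -
    have m: "mpt g \<in> hom (base (view0 (dtrg f))) (fob (dfun f) (pt (view0 (dsrc f)))) (pt (view0 (dtrg f)))"
      using g(1) f by (simp add: rtd_map_iff hom_def)
    have tm: "terminal (base (view0 (dtrg f))) (pt (view0 (dtrg f)))"
      using rtd_map_rooted(2)[OF g(1)] rooted_terminal f by metis
    have "(THE u. u \<in> hom (base (view0 (dtrg f))) (fob (dfun f) (pt (view0 (dsrc f)))) (pt (view0 (dtrg f)))) = mpt g"
      using m g.Y.base.terminal_unique[OF tm _ m] by (intro the_equality)
    then show ?thesis by (simp add: view1_def Let_def)
  qed
  ultimately show ?thesis
    using f tot by (intro cc_map.equality) simp_all
qed

definition rtd_dmc_map :: "('o, 'm) dmc_map \<Rightarrow> bool" where
  "rtd_dmc_map f \<longleftrightarrow> rooted_sdmc (dsrc f) \<and> rooted_sdmc (dtrg f) \<and> is_dmc_map f"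

lemma rooted_sdmcD:
  assumes "rooted_sdmc D"
  shows "category (dbase D)" "disp D \<subseteq> arr (dbase D)" "terminal (dbase D) (dtop D)"
  using assms by (simp_all add: rooted_sdmc_def structured_dmc_def)

lemma rtd_dmc_mapD:
  assumes "rtd_dmc_map f"
  shows "rooted_sdmc (dsrc f)" "rooted_sdmc (dtrg f)" "is_functor (dbase (dsrc f)) (dbase (dtrg f)) (dfun f)"
    "\<And>d. d \<in> disp (dsrc f) \<Longrightarrow> far (dfun f) d \<in> disp (dtrg f)"
    "\<And>s. pullback_square (dbase (dsrc f)) s \<Longrightarrow> sqtrg s \<in> disp (dsrc f) \<Longrightarrow>
       pullback_square (dbase (dtrg f)) (far (arrf (dbase (dsrc f)) (dfun f)) s)"
    "\<And>x. terminal (dbase (dsrc f)) x \<Longrightarrow> terminal (dbase (dtrg f)) (fob (dfun f) x)"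
  using assms by (simp_all add: rtd_dmc_map_def is_dmc_map_def Let_def)

text \<open>\<open>strict_map_into_sub\<close> provides some strict map over \<open>dfun f\<close>,
  and \<open>view1_eqI\<close> recognises it as \<open>view1 f\<close>; the axioms are not checked
  on the explicit record.\<close>

lemma view1_map:
  assumes f: "rtd_dmc_map f"
  shows "rtd_map (view1 f)" "strict_cc_map (view1 f)"
proof -
  note D = rtd_dmc_mapD[OF f]
  have X: "rooted_cc (view0 (dsrc f))" and Y: "rooted_cc (view0 (dtrg f))"
    using D(1,2) by (simp_all add: rooted_view0)
  interpret X: compr_cat "view0 (dsrc f)" using X by (rule rooted_compr_cat)
  have dX: "d \<in> arr (dbase (dsrc f))" if "d \<in> disp (dsrc f)" for d
    using rooted_sdmcD(2)[OF D(1)] that by auto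
  have "\<exists>g. rtd_map g \<and> strict_cc_map g \<and> msrc g = view0 (dsrc f) \<and> mtrg g = view0 (dtrg f) \<and> mbase g = dfun f"
  proof (rule strict_map_into_sub[OF X Y sub_cc_view0[OF rooted_sdmcD(2)[OF D(2)]]])
    fix u assume u: "cartesian (tot (view0 (dsrc f))) (base (view0 (dsrc f))) (proj (view0 (dsrc f))) u"
    have ua: "u \<in> arr (tot (view0 (dsrc f)))" by (rule X.p.cartesian_arr[OF u])
    have "pullback_square (dbase (dsrc f)) (far (compr (view0 (dsrc f))) u)"
      using X.cartesian_compr[OF u] pullback_iff_cartesian[OF X.base.category] by simp
    then have "pullback_square (dbase (dsrc f)) u" using ua by simp
    moreover have "sqtrg u \<in> disp (dsrc f)" using ua by (simp add: full_sub_arrcat_arr)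
    ultimately show "pullback_square (base (view0 (dtrg f)))
        (far (arrf (base (view0 (dsrc f))) (dfun f)) (far (compr (view0 (dsrc f))) u))"
      using D(5) ua by (simp del: arrf_simps)
  qed (use D dX rooted_sdmcD(3)[OF D(1)] in simp_all)
  then obtain g where g: "rtd_map g" "strict_cc_map g" "msrc g = view0 (dsrc f)" "mtrg g = view0 (dtrg f)"
    "mbase g = dfun f"
    by blast
  have "view1 f = g"
    by (rule view1_eqI[OF g rooted_sdmcD(2)[OF D(2)]])
  with g show "rtd_map (view1 f)" "strict_cc_map (view1 f)" by simp_all
qed

definition underlying_map :: "('o, 'm) rcc_map \<Rightarrow> ('o, 'm) dmc_map" where
  "underlying_map g = \<lparr> dsrc = underlying_dmc (msrc g), dtrg = underlying_dmc (mtrg g), dfun = mbase g \<rparr>"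

lemma underlying_map_view1 [simp]: "underlying_map (view1 f) = f"
  by (simp add: underlying_map_def)

text \<open>By naturality the image square is \<open>\<phi>\<close> after the comprehension of
  \<open>far F' u\<close> after an inverse of \<open>\<phi>\<close>, hence a pullback. So the
  condition \<open>pb\<close> of \<open>pseudo_map_into_full\<close> holds for the base functor of
  every pseudo map.\<close>

lemma (in ps_map) cartesian_base:
  assumes u: "cartesian (tot X) (base X) (proj X) u"
  shows "cartesian (arrcat (base Y)) (base Y) (codf (base Y)) (far (arrf (base X) F) (far (compr X) u))"
proof -
  let ?A = "arrcat (base Y)"
  interpret q: is_ftr ?A "base Y" "codf (base Y)" using functor_codf[OF Y.base.category] by unfold_locales
  interpret G: is_ftr "arrcat (base X)" ?A "arrf (base X) F"
    using functor_arrf[OF F.is_functor] by unfold_locales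
  note [simp del] = arrf_simps(2)
  have ua: "u \<in> arr (tot X)" by (rule X.p.cartesian_arr[OF u])
  let ?a = "src (tot X) u" and ?b = "trg (tot X) u"
  have st [simp]: "src ?A (\<phi> A) = fob (compr Y) (fob F' A)" "trg ?A (\<phi> A) = far F (fob (compr X) A)"
    if "A \<in> obj (tot X)" for A
    using that by (simp_all add: src_arrcat trg_arrcat)
  obtain j where j: "\<phi> ?a \<in> arr ?A" "j \<in> arr ?A" "src ?A j = trg ?A (\<phi> ?a)" "trg ?A j = src ?A (\<phi> ?a)"
    "cmp ?A j (\<phi> ?a) = idn ?A (src ?A (\<phi> ?a))" "cmp ?A (\<phi> ?a) j = idn ?A (trg ?A (\<phi> ?a))"
    using phi_iso[of ?a] ua by (auto elim: Y.chi.cod.isoE)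
  have "iso_arr ?A j" using j by (intro Y.chi.cod.isoI[where g = "\<phi> ?a"]) simp_all
  have "far (arrf (base X) F) (far (compr X) u) =
      cmp ?A (cmp ?A (far (arrf (base X) F) (far (compr X) u)) (\<phi> ?a)) j"
    using ua j by simp
  also have "cmp ?A (far (arrf (base X) F) (far (compr X) u)) (\<phi> ?a) = cmp ?A (\<phi> ?b) (far (compr Y) (far F' u))"
    by (rule phi_nat[OF ua refl refl, symmetric])
  also have "cartesian ?A (base Y) (codf (base Y)) (cmp ?A (cmp ?A (\<phi> ?b) (far (compr Y) (far F' u))) j)"
    using ua j \<open>iso_arr ?A j\<close> phi_iso[of ?b]
    by (intro q.cartesian_cmp q.cartesian_iso[OF \<open>iso_arr ?A j\<close>] q.cartesian_iso[OF phi_iso]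
        Y.cartesian_compr cartesian_map u) simp_all
  finally show ?thesis .
qed

lemma underlying_map:
  assumes g: "rtd_map g" "strict_cc_map g" and X: "sub_cc (msrc g)" and Y: "sub_cc (mtrg g)"
  shows "rtd_dmc_map (underlying_map g)" "view1 (underlying_map g) = g"
proof -
  let ?X = "msrc g" and ?Y = "mtrg g" and ?F = "mbase g"
  interpret g: ps_map ?X ?Y ?F "mtot g" "miso g" using g(1) by (simp add: rtd_map_iff)
  let ?A = "arrcat (base ?X)"
  interpret G: is_ftr ?A "arrcat (base ?Y)" "arrf (base ?X) ?F"
    using functor_arrf[OF g.F.is_functor] by unfold_locales
  interpret p: is_ftr ?A "base ?X" "codf (base ?X)" using functor_codf[OF g.X.base.category] by unfold_locales
  interpret q: is_ftr "arrcat (base ?Y)" "base ?Y" "codf (base ?Y)"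
    using functor_codf[OF g.Y.base.category] by unfold_locales
  have rt: "rooted_cc ?X" "rooted_cc ?Y" using g(1) by (simp_all add: rtd_map_rooted)
  have U: "rooted_sdmc (underlying_dmc ?X)" "rooted_sdmc (underlying_dmc ?Y)"
    using rt X Y by (simp_all add: rooted_underlying_dmc)
  have V: "view0 (underlying_dmc ?X) = ?X" "view0 (underlying_dmc ?Y) = ?Y"
    by (simp_all add: view0_underlying_dmc g.X.comprehension g.Y.comprehension X Y)
  have disp: "far ?F d \<in> obj (tot ?Y)" if d: "d \<in> obj (tot ?X)" for d
  proof -
    have "fob (compr ?Y) (fob (mtot g) d) = fob (arrf (base ?X) ?F) (fob (compr ?X) d)"
      using d arg_cong[OF g(2)[unfolded strict_cc_map_def, THEN conjunct1], of "\<lambda>H. fob H d"]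
      by (simp del: arrf_simps)
    then have "fob (mtot g) d = far ?F d"
      using d g.X.compr_obj[OF d] by (simp add: sub_cc_compr[OF X] sub_cc_compr[OF Y])
    then show ?thesis using g.F'.fob_obj[OF d] by simp
  qed
  \<comment> \<open>The left side of \<open>s\<close> may fail to be a display map, so
    \<open>s\<close> is compared with the comprehension of a cartesian lift having the same right
    side and codomain side.\<close>
  have pb: "pullback_square (base ?Y) (far (arrf (base ?X) ?F) s)"
    if s: "pullback_square (base ?X) s" "sqtrg s \<in> obj (tot ?X)" for s
  proof -
    have sa: "s \<in> arr ?A" using s(1) by (simp add: pullback_square_def)
    have transf: "trg (base ?X) (sqtrg s) = fob (proj ?X) (sqtrg s)"
      using g.X.trg_compr[OF s(2)] s(2) by (simp add: sub_cc_compr[OF X])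
    obtain u where u: "cartesian (tot ?X) (base ?X) (proj ?X) u" "trg (tot ?X) u = sqtrg s"
      "far (proj ?X) u = sqcod s"
      using g.X.cartesian_ex[OF s(2), of "sqcod s"] square_arrD[OF sa] transf by auto
    have ua: "u \<in> arr (tot ?X)" by (rule g.X.p.cartesian_arr[OF u(1)])
    have "cartesian (arrcat (base ?Y)) (base ?Y) (codf (base ?Y)) (far (arrf (base ?X) ?F) s)"
    proof (rule cartesian_preserve[OF G.is_functor q.is_functor p.is_functor])
      show "cartesian ?A (base ?X) (codf (base ?X)) (far (compr ?X) u)"
        by (rule g.X.cartesian_compr[OF u(1)])
      show "trg ?A (far (compr ?X) u) = trg ?A s"
        using ua u(2) sa sub_cc_compr(1)[OF X s(2)] by (simp add: trg_arrcat)
      show "far (codf (base ?X)) (far (compr ?X) u) = far (codf (base ?X)) s"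
        using ua sa u(3) by (simp add: codf_def)
      show "cartesian (arrcat (base ?Y)) (base ?Y) (codf (base ?Y)) (far (arrf (base ?X) ?F) (far (compr ?X) u))"
        by (rule g.cartesian_base[OF u(1)])
      show "cartesian ?A (base ?X) (codf (base ?X)) s"
        using s(1) by (simp add: pullback_iff_cartesian[OF g.X.base.category])
    qed
    then show ?thesis by (simp add: pullback_iff_cartesian[OF g.Y.base.category])
  qed
  \<comment> \<open>Any terminal object is isomorphic to the root, and the root is preserved up to
    the isomorphism \<open>mpt g\<close>.\<close>
  have tm: "terminal (base ?Y) (fob ?F x)" if x: "terminal (base ?X) x" for x
  proof -
    have xo: "x \<in> obj (base ?X)" using x by (simp add: terminal_def)
    obtain i where i: "i \<in> hom (base ?X) x (pt ?X)"
      using rooted_terminal[OF rt(1)] xo by (auto simp: terminal_def)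
    have "iso_arr (base ?X) i" by (rule g.X.base.terminal_iso[OF x rooted_terminal[OF rt(1)] i])
    then have "iso_arr (base ?Y) (cmp (base ?Y) (mpt g) (far ?F i))"
      using i g(1) by (intro g.Y.base.iso_cmp g.F.iso_far) (auto simp: rtd_map_iff hom_def)
    then have "isomorphic_objs (base ?Y) (fob ?F x) (pt ?Y)"
      using i g(1) unfolding isomorphic_objs_def
      by (intro bexI[where x = "cmp (base ?Y) (mpt g) (far ?F i)"]) (auto simp: hom_def rtd_map_iff)
    then show ?thesis
      using g.Y.base.terminal_isomorphic[OF rooted_terminal[OF rt(2)] g.Y.base.isomorphic_sym] by blast
  qed
  show "rtd_dmc_map (underlying_map g)"
    using U disp pb tm g.F.is_functor
    by (simp add: rtd_dmc_map_def is_dmc_map_def Let_def underlying_map_def)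
      (simp add: underlying_dmc_def del: arrf_simps)
  show "view1 (underlying_map g) = g"
    using g V g.Y.compr_obj sub_cc_compr(1)[OF Y]
    by (intro view1_eqI) (auto simp: underlying_map_def underlying_dmc_def)
qed

section \<open>The 2-category of rooted structured display map categories\<close>

definition rtd_dmc_trans :: "('o, 'm) dmc_trans \<Rightarrow> bool" where
  "rtd_dmc_trans \<alpha> \<longleftrightarrow> rtd_dmc_map (dtsrc \<alpha>) \<and> rtd_dmc_map (dttrg \<alpha>) \<and> is_dmc_trans \<alpha>"

lemma sDMC_rtd_simps [simp]:
  "c0 sDMC_rtd = {X. rooted_sdmc X}" "c1 sDMC_rtd = {f. rtd_dmc_map f}" "c2 sDMC_rtd = {\<alpha>. rtd_dmc_trans \<alpha>}"
  "s1 sDMC_rtd = dsrc" "t1 sDMC_rtd = dtrg" "s2 sDMC_rtd = dtsrc" "t2 sDMC_rtd = dttrg"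
  "i1 sDMC_rtd = dmc_id" "i2 sDMC_rtd = dmc_trans_id" "comp1 sDMC_rtd = dmc_comp"
  "vcomp sDMC_rtd = dmc_vcomp" "hcomp sDMC_rtd = dmc_hcomp"
  by (simp_all add: sDMC_rtd_def Let_def rtd_dmc_map_def rtd_dmc_trans_def)

lemma dmc_id_simps [simp]: "dsrc (dmc_id X) = X" "dtrg (dmc_id X) = X" "dfun (dmc_id X) = fid (dbase X)"
  by (simp_all add: dmc_id_def)

lemma dmc_comp_simps [simp]: "dsrc (dmc_comp g f) = dsrc f" "dtrg (dmc_comp g f) = dtrg g"
  "dfun (dmc_comp g f) = fcomp (dbase (dsrc f)) (dfun g) (dfun f)"
  by (simp_all add: dmc_comp_def)

lemma dmc_trans_id_simps [simp]: "dtsrc (dmc_trans_id f) = f" "dttrg (dmc_trans_id f) = f"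
  "dtnat (dmc_trans_id f) = nt_id (dbase (dsrc f)) (dbase (dtrg f)) (dfun f)"
  by (simp_all add: dmc_trans_id_def)

lemma dmc_vcomp_simps [simp]: "dtsrc (dmc_vcomp \<beta> \<alpha>) = dtsrc \<alpha>" "dttrg (dmc_vcomp \<beta> \<alpha>) = dttrg \<beta>"
  "dtnat (dmc_vcomp \<beta> \<alpha>) =
    nt_vcomp (dbase (dsrc (dtsrc \<alpha>))) (dbase (dtrg (dtsrc \<alpha>))) (dtnat \<beta>) (dtnat \<alpha>)"
  by (simp_all add: dmc_vcomp_def)

lemma dmc_hcomp_simps [simp]:
  "dtsrc (dmc_hcomp \<beta> \<alpha>) = dmc_comp (dtsrc \<beta>) (dtsrc \<alpha>)"
  "dttrg (dmc_hcomp \<beta> \<alpha>) = dmc_comp (dttrg \<beta>) (dttrg \<alpha>)"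
  "dtnat (dmc_hcomp \<beta> \<alpha>) = nt_hcomp (dbase (dsrc (dtsrc \<alpha>))) (dbase (dtrg (dtsrc \<beta>)))
    (dfun (dttrg \<alpha>)) (dfun (dtsrc \<beta>)) (dtnat \<beta>) (dtnat \<alpha>)"
  by (simp_all add: dmc_hcomp_def Let_def)

lemma rtd_dmc_trans_iff:
  "rtd_dmc_trans \<alpha> \<longleftrightarrow> rtd_dmc_map (dtsrc \<alpha>) \<and> rtd_dmc_map (dttrg \<alpha>) \<and>
    dsrc (dttrg \<alpha>) = dsrc (dtsrc \<alpha>) \<and> dtrg (dttrg \<alpha>) = dtrg (dtsrc \<alpha>) \<and>
    nat_trans (dbase (dsrc (dtsrc \<alpha>))) (dbase (dtrg (dtsrc \<alpha>)))
      (dfun (dtsrc \<alpha>)) (dfun (dttrg \<alpha>)) (dtnat \<alpha>)"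
  by (simp add: rtd_dmc_trans_def is_dmc_trans_def)

lemma rtd_dmc_transD:
  assumes "rtd_dmc_trans \<alpha>"
  shows "rtd_dmc_map (dtsrc \<alpha>)" "rtd_dmc_map (dttrg \<alpha>)"
    "dsrc (dttrg \<alpha>) = dsrc (dtsrc \<alpha>)" "dtrg (dttrg \<alpha>) = dtrg (dtsrc \<alpha>)"
    "nat_trans (dbase (dsrc (dtsrc \<alpha>))) (dbase (dtrg (dtsrc \<alpha>)))
      (dfun (dtsrc \<alpha>)) (dfun (dttrg \<alpha>)) (dtnat \<alpha>)"
  using assms by (simp_all add: rtd_dmc_trans_iff)

lemma rtd_dmc_mapI:
  assumes "rooted_sdmc (dsrc f)" "rooted_sdmc (dtrg f)" "is_functor (dbase (dsrc f)) (dbase (dtrg f)) (dfun f)"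
    "\<And>d. d \<in> disp (dsrc f) \<Longrightarrow> far (dfun f) d \<in> disp (dtrg f)"
    "\<And>s. pullback_square (dbase (dsrc f)) s \<Longrightarrow> sqtrg s \<in> disp (dsrc f) \<Longrightarrow>
       pullback_square (dbase (dtrg f)) (far (arrf (dbase (dsrc f)) (dfun f)) s)"
    "\<And>x. terminal (dbase (dsrc f)) x \<Longrightarrow> terminal (dbase (dtrg f)) (fob (dfun f) x)"
  shows "rtd_dmc_map f"
  using assms by (simp add: rtd_dmc_map_def is_dmc_map_def Let_def del: arrf_simps)

lemma pullback_square_arr: "pullback_square C s \<Longrightarrow> s \<in> arr (arrcat C)"
  by (simp add: pullback_square_def)

text \<open>Serves both for identity maps and for the map from a structure to its repletion.\<close>

lemma rtd_dmc_map_inclusion: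
  assumes "rooted_sdmc X" "rooted_sdmc Y" "dbase Y = dbase X" "disp X \<subseteq> disp Y"
  shows "rtd_dmc_map \<lparr> dsrc = X, dtrg = Y, dfun = fid (dbase X) \<rparr>"
proof -
  note C = rooted_sdmcD[OF assms(1)]
  have "far (fid (dbase X)) d = d" if "d \<in> disp X" for d
    using that C(2) by auto
  then show ?thesis
    by (intro rtd_dmc_mapI)
      (use assms in \<open>auto simp: functor_fid C(1) arrf_fid pullback_square_arr terminal_def
        simp del: arrf_simps\<close>)
qed

lemma rtd_dmc_map_id: "rooted_sdmc X \<Longrightarrow> rtd_dmc_map (dmc_id X)"
  using rtd_dmc_map_inclusion[of X X] by (simp add: dmc_id_def)

lemma rtd_dmc_map_comp:
  assumes f: "rtd_dmc_map f" and g: "rtd_dmc_map g" and gf: "dsrc g = dtrg f"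
  shows "rtd_dmc_map (dmc_comp g f)"
proof -
  note f = rtd_dmc_mapD[OF f] and g = rtd_dmc_mapD[OF g, unfolded gf]
  show ?thesis
  proof (rule rtd_dmc_mapI, unfold dmc_comp_simps)
    fix d assume d: "d \<in> disp (dsrc f)"
    then show "far (fcomp (dbase (dsrc f)) (dfun g) (dfun f)) d \<in> disp (dtrg g)"
      using f(4) g(4) rooted_sdmcD(2)[OF f(1)] by auto
  next
    fix s assume s: "pullback_square (dbase (dsrc f)) s" "sqtrg s \<in> disp (dsrc f)"
    then show "pullback_square (dbase (dtrg g))
        (far (arrf (dbase (dsrc f)) (fcomp (dbase (dsrc f)) (dfun g) (dfun f))) s)"
      using f(5)[OF s] g(5)[of "far (arrf (dbase (dsrc f)) (dfun f)) s"] f(4)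
        pullback_square_arr[OF s(1)]
      unfolding arrf_fcomp[OF f(3) g(3)] by simp
  next
    fix x assume "terminal (dbase (dsrc f)) x"
    then show "terminal (dbase (dtrg g)) (fob (fcomp (dbase (dsrc f)) (dfun g) (dfun f)) x)"
      using f(6) g(6) by (simp add: terminal_def)
  qed (use f g functor_fcomp in auto)
qed

lemma dmc_comp_assoc:
  assumes "rtd_dmc_map f" "dsrc g = dtrg f"
  shows "dmc_comp h (dmc_comp g f) = dmc_comp (dmc_comp h g) f"
  using fcomp_assoc[OF rtd_dmc_mapD(3)[OF assms(1)]] assms(2) by (intro dmc_map.equality) simp_all

lemma rtd_dmc_trans_id: "rtd_dmc_map f \<Longrightarrow> rtd_dmc_trans (dmc_trans_id f)"
  by (simp add: rtd_dmc_trans_iff nat_trans_id rtd_dmc_mapD(3))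

lemma rtd_dmc_trans_vcomp:
  assumes "rtd_dmc_trans \<beta>" "rtd_dmc_trans \<alpha>" "dtsrc \<beta> = dttrg \<alpha>"
  shows "rtd_dmc_trans (dmc_vcomp \<beta> \<alpha>)"
  using assms by (auto simp: rtd_dmc_trans_iff intro!: nat_trans_vcomp)

lemma rtd_dmc_trans_hcomp:
  assumes b: "rtd_dmc_trans \<beta>" and a: "rtd_dmc_trans \<alpha>" and ba: "dsrc (dtsrc \<beta>) = dtrg (dtsrc \<alpha>)"
  shows "rtd_dmc_trans (dmc_hcomp \<beta> \<alpha>)"
proof -
  note a = rtd_dmc_transD[OF a] and b = rtd_dmc_transD[OF b]
  show ?thesis
    using nat_trans_hcomp[OF a(5) b(5)[unfolded ba]] a b ba
    by (simp add: rtd_dmc_trans_iff rtd_dmc_map_comp)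
qed

lemma strict_sDMC_rtd: "strict_2cat (sDMC_rtd :: ('o, 'm) dmc_2cat)"
  unfolding strict_2cat_def hom1_def hom2_def hcomposable_def vcomposable_def sDMC_rtd_simps mem_Collect_eq
proof (intro conjI allI ballI impI; (elim CollectE)?; (elim conjE)?)
  fix f :: "('o, 'm) dmc_map" assume f: "rtd_dmc_map f"
  note f' = rtd_dmc_mapD[OF f]
  show "dmc_comp f (dmc_id (dsrc f)) = f" "dmc_comp (dmc_id (dtrg f)) f = f"
    using fcomp_fid_left[OF f'(3)] fcomp_fid_right[OF f'(3)] by (intro dmc_map.equality; simp)+
next
  fix f g :: "('o, 'm) dmc_map" assume f: "rtd_dmc_map f" and g: "rtd_dmc_map g" and gf: "dsrc g = dtrg f"
  show "dmc_hcomp (dmc_trans_id g) (dmc_trans_id f) = dmc_trans_id (dmc_comp g f)"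
    using nt_hcomp_id_id[OF rtd_dmc_mapD(3)[OF f] rtd_dmc_mapD(3)[OF g, unfolded gf]] gf
    by (intro dmc_trans.equality) simp_all
next
  fix \<alpha> :: "('o, 'm) dmc_trans" assume a: "rtd_dmc_trans \<alpha>"
  note a' = rtd_dmc_transD[OF a] and s = rtd_dmc_mapD(3)[OF rtd_dmc_transD(1)[OF a]]
    and t = rtd_dmc_mapD(3)[OF rtd_dmc_transD(2)[OF a]]
  show "dmc_vcomp \<alpha> (dmc_trans_id (dtsrc \<alpha>)) = \<alpha>" "dmc_vcomp (dmc_trans_id (dttrg \<alpha>)) \<alpha> = \<alpha>"
    using nt_vcomp_id_right[OF a'(5)] nt_vcomp_id_left[OF a'(5)] a'(3,4)
    by (intro dmc_trans.equality; simp)+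
  have "dmc_comp (dtsrc \<alpha>) (dmc_id (dsrc (dtsrc \<alpha>))) = dtsrc \<alpha>"
    "dmc_comp (dttrg \<alpha>) (dmc_id (dsrc (dtsrc \<alpha>))) = dttrg \<alpha>"
    "dmc_comp (dmc_id (dtrg (dtsrc \<alpha>))) (dtsrc \<alpha>) = dtsrc \<alpha>"
    "dmc_comp (dmc_id (dtrg (dtsrc \<alpha>))) (dttrg \<alpha>) = dttrg \<alpha>"
    using fcomp_fid_left[OF s] fcomp_fid_right[OF s] fcomp_fid_left[OF t] fcomp_fid_right[OF t] a'(3,4)
    by (intro dmc_map.equality; simp)+
  then show "dmc_hcomp \<alpha> (dmc_trans_id (dmc_id (dsrc (dtsrc \<alpha>)))) = \<alpha>"
    "dmc_hcomp (dmc_trans_id (dmc_id (dtrg (dtsrc \<alpha>)))) \<alpha> = \<alpha>"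
    using nt_hcomp_id_right[OF a'(5)] nt_hcomp_id_left[OF a'(5)] a'(3,4)
    by (intro dmc_trans.equality; simp)+
next
  fix \<gamma> \<beta> \<alpha> :: "('o, 'm) dmc_trans"
  assume c: "rtd_dmc_trans \<gamma>" and b: "rtd_dmc_trans \<beta>" and a: "rtd_dmc_trans \<alpha>"
    and cb: "dtsrc \<gamma> = dttrg \<beta>" and ba: "dtsrc \<beta> = dttrg \<alpha>"
  note a' = rtd_dmc_transD[OF a]
  note b' = rtd_dmc_transD[OF b, unfolded ba a'(3,4)]
  note c' = rtd_dmc_transD[OF c, unfolded cb ba b'(3,4)]
  show "dmc_vcomp \<gamma> (dmc_vcomp \<beta> \<alpha>) = dmc_vcomp (dmc_vcomp \<gamma> \<beta>) \<alpha>"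
    using nt_vcomp_assoc[OF a'(5) b'(5) c'(5)] cb ba a'(3,4)
    by (intro dmc_trans.equality) simp_all
next
  fix \<gamma> \<beta> \<alpha> :: "('o, 'm) dmc_trans"
  assume c: "rtd_dmc_trans \<gamma>" and b: "rtd_dmc_trans \<beta>" and a: "rtd_dmc_trans \<alpha>"
    and cb: "dsrc (dtsrc \<gamma>) = dtrg (dtsrc \<beta>)" and ba: "dsrc (dtsrc \<beta>) = dtrg (dtsrc \<alpha>)"
  note c = rtd_dmc_transD[OF c] and b = rtd_dmc_transD[OF b] and a = rtd_dmc_transD[OF a]
  show "dmc_hcomp \<gamma> (dmc_hcomp \<beta> \<alpha>) = dmc_hcomp (dmc_hcomp \<gamma> \<beta>) \<alpha>"
    using nt_hcomp_assoc[OF a(5) b(5)[unfolded ba] c(5)[unfolded cb]] a(1-4) b(3,4) ba cb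
    by (intro dmc_trans.equality) (simp_all add: dmc_comp_assoc)
next
  fix \<alpha> \<alpha>' \<beta> \<beta>' :: "('o, 'm) dmc_trans"
  assume a': "rtd_dmc_trans \<alpha>'" and a: "rtd_dmc_trans \<alpha>" and aa: "dtsrc \<alpha>' = dttrg \<alpha>"
    and b': "rtd_dmc_trans \<beta>'" and b: "rtd_dmc_trans \<beta>" and bb: "dtsrc \<beta>' = dttrg \<beta>"
    and ba: "dsrc (dtsrc \<beta>) = dtrg (dtsrc \<alpha>)"
  note b = rtd_dmc_transD[OF b] and a = rtd_dmc_transD[OF a]
  note b' = rtd_dmc_transD[OF b', unfolded bb b(3,4)] and a' = rtd_dmc_transD[OF a', unfolded aa a(3,4)]
  show "dmc_hcomp (dmc_vcomp \<beta>' \<beta>) (dmc_vcomp \<alpha>' \<alpha>) = dmc_vcomp (dmc_hcomp \<beta>' \<alpha>') (dmc_hcomp \<beta> \<alpha>)"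
    using nt_interchange[OF a(5) a'(5) b(5)[unfolded ba] b'(5)[unfolded ba]] aa bb ba a(3,4) b(3,4)
    by (intro dmc_trans.equality) simp_all
qed (simp_all add: rtd_dmc_map_id rtd_dmc_map_comp dmc_comp_assoc rtd_dmc_trans_id rtd_dmc_trans_vcomp
    rtd_dmc_trans_hcomp rtd_dmc_transD(1-4) rtd_dmc_mapD(1,2))

text \<open>\<open>rtd_trans_ex\<close> provides a 2-cell over \<open>dtnat \<alpha>\<close>; its
  total component is computed and found to be the one in \<open>view2 \<alpha>\<close>.\<close>

lemma view2_trans:
  assumes a: "rtd_dmc_trans \<alpha>"
  shows "rtd_trans (view2 \<alpha>)"
proof -
  note a = rtd_dmc_transD[OF a]
  let ?f = "dtsrc \<alpha>" and ?g = "dttrg \<alpha>"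
  let ?D = "dsrc ?f" and ?E = "dtrg ?f"
  note f = view1_map[OF a(1)] and g = view1_map[OF a(2)]
  have E: "full_cc (view0 ?E)"
    using rooted_sdmcD[OF rtd_dmc_mapD(2)[OF a(1)]] by (simp add: full_cc_view0)
  obtain \<beta> where b: "rtd_trans \<beta>" "tsrc \<beta> = view1 ?f" "ttrg \<beta> = view1 ?g" "tbase \<beta> = dtnat \<alpha>"
    using rtd_trans_ex[OF f(1) g(1)] a(3-5) E by auto
  interpret b: transf "view0 ?D" "view0 ?E" "dfun ?f" "mtot (view1 ?f)" "miso (view1 ?f)"
    "dfun ?g" "mtot (view1 ?g)" "miso (view1 ?g)" "dtnat \<alpha>" "ttot \<beta>"
    using b by (simp add: rtd_trans_iff)
  have arr: "d \<in> arr (dbase ?D)" if "d \<in> disp ?D" for d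
    using b.f.X.compr_obj[of d] that by simp
  have "ttot \<beta> = ttot (view2 \<alpha>)"
  proof (rule extensionalityI[of _ "disp ?D"])
    show "ttot \<beta> \<in> extensional (disp ?D)" using b.t.nt_ext by simp
    show "ttot (view2 \<alpha>) \<in> extensional (disp ?D)" by (simp add: view2_def Let_def)
    fix d assume d: "d \<in> disp ?D"
    have fo: "fob (mtot (view1 ?f)) d = far (dfun ?f) d" "fob (mtot (view1 ?g)) d = far (dfun ?g) d"
      using d arr[OF d] a(3) by (simp_all add: view1_def Let_def)
    have ex: "ext (view0 ?D) d = src (dbase ?D) d" "fob (proj (view0 ?D)) d = trg (dbase ?D) d"
      using b.f.X.src_compr[of d] b.f.X.trg_compr[of d] d by simp_all
    have t: "ttot \<beta> d \<in> arr (tot (view0 ?E))" "src (tot (view0 ?E)) (ttot \<beta> d) = far (dfun ?f) d"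
      "trg (tot (view0 ?E)) (ttot \<beta> d) = far (dfun ?g) d"
      using b.t.nt_arr[of d] b.t.src_nt[of d] b.t.trg_nt[of d] d fo by simp_all
    have sq: "sqsrc (ttot \<beta> d) = far (dfun ?f) d" "sqtrg (ttot \<beta> d) = far (dfun ?g) d"
      using t src_trg_full_sub[OF t(1)[unfolded view0_simps]] by simp_all
    \<comment> \<open>The codomain side is known because the component lies over the base component;
      the domain side will come from coherence, in which both comparisons are identities.\<close>
    have co: "sqcod (ttot \<beta> d) = dtnat \<alpha> (trg (dbase ?D) d)"
      using b.proj_tot[of d] b.f.Y.compr_arr(3)[OF t(1)] t(1) d ex by simp
    have sd: "sqdom (miso (view1 ?f) d) = idn (dbase ?E) (fob (dfun ?f) (src (dbase ?D) d))"
      "sqdom (miso (view1 ?g) d) = idn (dbase ?E) (fob (dfun ?g) (src (dbase ?D) d))"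
      using d arr[OF d] a(3,4) b.f.F.far_arr[of d] b.g.F.far_arr[of d] b.f.F.src_far[of d] b.g.F.src_far[of d]
      by (simp_all add: view1_def Let_def idn_arrcat)
    have s: "ttot \<beta> d \<in> arr (arrcat (dbase ?E))" using t(1) by (simp add: full_sub_arrcat_arr)
    have "sqdom (ttot \<beta> d) = dtnat \<alpha> (src (dbase ?D) d)"
      using b.dom_tot[of d] d t(1) sd ex sq square_arrD(3,5,6)[OF s] arr[OF d]
        b.f.F.src_far[of d] b.g.F.src_far[of d] b.b.nt_arr[of "src (dbase ?D) d"] b.b.src_nt[of "src (dbase ?D) d"]
        b.f.X.base.src_obj[of d] b.f.Y.base.cmp_idl[of "sqdom (ttot \<beta> d)"]
        b.f.Y.base.cmp_idr[of "dtnat \<alpha> (src (dbase ?D) d)"]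
      by simp
    then show "ttot \<beta> d = ttot (view2 \<alpha>) d"
      using sq co d by (simp add: view2_def Let_def square.expand)
  qed
  then have "view2 \<alpha> = \<beta>"
    using b by (intro cc_trans.equality) simp_all
  with b show ?thesis by simp
qed

section \<open>Display map structures and strict maps of subcategorical structures\<close>

lemma CompCat_rtd_sub_str2_simps [simp]:
  "c0 CompCat_rtd_sub_str2 = {X. rooted_cc X \<and> sub_cc X}"
  "c1 CompCat_rtd_sub_str2 = {f. rtd_map f \<and> sub_cc (msrc f) \<and> sub_cc (mtrg f) \<and> strict_cc_map f}"
  "c2 CompCat_rtd_sub_str2 = {\<alpha>. rtd_trans \<alpha> \<and> sub_cc (msrc (tsrc \<alpha>)) \<and> sub_cc (mtrg (tsrc \<alpha>)) \<and>
     strict_cc_map (tsrc \<alpha>) \<and> strict_cc_map (ttrg \<alpha>)}"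
  "s1 CompCat_rtd_sub_str2 = msrc" "t1 CompCat_rtd_sub_str2 = mtrg"
  "s2 CompCat_rtd_sub_str2 = tsrc" "t2 CompCat_rtd_sub_str2 = ttrg"
  "i1 CompCat_rtd_sub_str2 = cc_id" "i2 CompCat_rtd_sub_str2 = cc_trans_id"
  "comp1 CompCat_rtd_sub_str2 = cc_comp" "vcomp CompCat_rtd_sub_str2 = cc_vcomp"
  "hcomp CompCat_rtd_sub_str2 = cc_hcomp"
  by (auto simp: CompCat_rtd_sub_str2_def CompCat_rtd_sub_def)

lemma strict_locally_full:
  "locally_full_sub (locally_full_sub2 (full_sub2 CompCat_rtd Q) strict_cc_map)
    (full_sub2 CompCat_rtd Q :: ('o, 'm) rcc_2cat)"
proof -
  interpret K: is_2cat "CompCat_rtd :: ('o, 'm) rcc_2cat"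
    using strict_CompCat_rtd by unfold_locales
  interpret Q: is_2cat "full_sub2 CompCat_rtd Q :: ('o, 'm) rcc_2cat"
    using K.strict_full_sub2 by unfold_locales
  show "locally_full_sub (locally_full_sub2 (full_sub2 CompCat_rtd Q) strict_cc_map) (full_sub2 CompCat_rtd Q :: ('o, 'm) rcc_2cat)"
    by (rule Q.locally_full_sub_locally_full_sub2) (auto simp: rooted_cc_def strict_cc_map_id strict_cc_map_comp)
qed

lemma strict_CompCat_rtd_sub_str2: "strict_2cat (CompCat_rtd_sub_str2 :: ('o, 'm) rcc_2cat)"
  unfolding CompCat_rtd_sub_str2_def CompCat_rtd_sub_def
  by (rule locally_full_sub_strict[OF strict_locally_full])
    (intro is_2cat.strict_full_sub2 is_2cat.intro strict_CompCat_rtd)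

lemma view_simps [simp]: "F0 view = view0" "F1 view = view1" "F2 view = view2"
  by (simp_all add: view_def)

lemma rooted_sub_view0: "rooted_sdmc D \<Longrightarrow> rooted_cc (view0 D) \<and> sub_cc (view0 D)"
  by (simp add: rooted_view0 sub_cc_view0 rooted_sdmcD)

lemma full_cc_rooted_view0: "rooted_sdmc D \<Longrightarrow> full_cc (view0 D)"
  by (simp add: full_cc_view0 rooted_sdmcD)

text \<open>The two sides of each functoriality equation have the same base functor or base
  component, so \<open>view1_eqI\<close> and \<open>rtd_trans_eq\<close> settle it.\<close>

lemma view_2functor: "is_2functor sDMC_rtd (CompCat_rtd_sub_str2 :: ('o, 'm) rcc_2cat) view"
proof -
  have v1: "view1 f \<in> c1 CompCat_rtd_sub_str2" if "rtd_dmc_map f" for f :: "('o, 'm) dmc_map"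
    using that view1_map[OF that] rtd_dmc_mapD(1,2)[OF that] by (simp add: rooted_sub_view0)
  interpret D: is_2cat "sDMC_rtd :: ('o, 'm) dmc_2cat" using strict_sDMC_rtd by unfold_locales
  have vid: "view1 (dmc_id X) = cc_id (view0 X)" if X: "rooted_sdmc X" for X :: "('o, 'm) dmc"
    by (rule view1_eqI)
      (use rooted_sub_view0[OF X] rooted_sdmcD(2)[OF X] in
        \<open>simp_all add: rtd_map_id strict_cc_map_id rooted_cc_def\<close>)
  have vco: "view1 (dmc_comp g f) = cc_comp (view1 g) (view1 f)"
    if f: "rtd_dmc_map f" and g: "rtd_dmc_map g" and gf: "dsrc g = dtrg f" for f g :: "('o, 'm) dmc_map"
    by (rule view1_eqI)
      (use view1_map[OF f] view1_map[OF g] rooted_sdmcD(2)[OF rtd_dmc_mapD(2)[OF g]] gf in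
        \<open>simp_all add: rtd_map_comp strict_cc_map_comp\<close>)
  have full: "full_cc (view0 (dtrg f))" if "rtd_dmc_map f" for f :: "('o, 'm) dmc_map"
    using rtd_dmc_mapD(2)[OF that] by (rule full_cc_rooted_view0)
  show ?thesis
    unfolding is_2functor_def hom1_def hom2_def vcomposable_def hcomposable_def
  proof (intro conjI ballI allI impI strict_sDMC_rtd strict_CompCat_rtd_sub_str2; (elim conjE)?)
    fix f :: "('o, 'm) dmc_map" assume "f \<in> c1 sDMC_rtd"
    then have f: "rtd_dmc_map f" by simp
    have "view2 (dmc_trans_id f) = cc_trans_id (view1 f)"
      by (rule rtd_trans_eq)
        (use f view2_trans[of "dmc_trans_id f"] D.i2(1)[of f] full[OF f] in
          \<open>simp_all add: rtd_trans_id view1_map\<close>)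
    then show "F2 view (i2 sDMC_rtd f) = i2 CompCat_rtd_sub_str2 (F1 view f)" by simp
  next
    fix \<beta> \<alpha> :: "('o, 'm) dmc_trans"
    assume "\<beta> \<in> c2 sDMC_rtd" "\<alpha> \<in> c2 sDMC_rtd" "s2 sDMC_rtd \<beta> = t2 sDMC_rtd \<alpha>"
    then have ba: "rtd_dmc_trans \<beta>" "rtd_dmc_trans \<alpha>" "dtsrc \<beta> = dttrg \<alpha>" by simp_all
    have "view2 (dmc_vcomp \<beta> \<alpha>) = cc_vcomp (view2 \<beta>) (view2 \<alpha>)"
      by (rule rtd_trans_eq)
        (use ba D.vcomp(1)[of \<beta> \<alpha>] full[OF rtd_dmc_transD(1)[OF ba(2)]] in
          \<open>simp_all add: view2_trans rtd_trans_vcomp\<close>)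
    then show "F2 view (vcomp sDMC_rtd \<beta> \<alpha>) = vcomp CompCat_rtd_sub_str2 (F2 view \<beta>) (F2 view \<alpha>)" by simp
  next
    fix \<beta> \<alpha> :: "('o, 'm) dmc_trans"
    assume "\<beta> \<in> c2 sDMC_rtd" "\<alpha> \<in> c2 sDMC_rtd" "s1 sDMC_rtd (s2 sDMC_rtd \<beta>) = t1 sDMC_rtd (s2 sDMC_rtd \<alpha>)"
    then have ba: "rtd_dmc_trans \<beta>" "rtd_dmc_trans \<alpha>" "dsrc (dtsrc \<beta>) = dtrg (dtsrc \<alpha>)" by simp_all
    note a = rtd_dmc_transD[OF ba(2)] and b = rtd_dmc_transD[OF ba(1)]
    have "view2 (dmc_hcomp \<beta> \<alpha>) = cc_hcomp (view2 \<beta>) (view2 \<alpha>)"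
      by (rule rtd_trans_eq)
        (use ba D.hcomp(1)[of \<beta> \<alpha>] full[OF b(1)] vco[OF a(1) b(1)] vco[OF a(2) b(2)] a(3,4) b(3,4) in
          \<open>simp_all add: view2_trans rtd_trans_hcomp\<close>)
    then show "F2 view (hcomp sDMC_rtd \<beta> \<alpha>) = hcomp CompCat_rtd_sub_str2 (F2 view \<beta>) (F2 view \<alpha>)" by simp
  next
    fix \<alpha> :: "('o, 'm) dmc_trans" assume "\<alpha> \<in> c2 sDMC_rtd"
    then have a: "rtd_dmc_trans \<alpha>" by simp
    show "F2 view \<alpha> \<in> {\<beta> \<in> c2 CompCat_rtd_sub_str2. s2 CompCat_rtd_sub_str2 \<beta> = F1 view (s2 sDMC_rtd \<alpha>) \<and>
        t2 CompCat_rtd_sub_str2 \<beta> = F1 view (t2 sDMC_rtd \<alpha>)}"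
      using view2_trans[OF a] v1[OF rtd_dmc_transD(1)[OF a]] v1[OF rtd_dmc_transD(2)[OF a]] by simp
  qed (use v1 in \<open>simp_all add: rooted_sub_view0 vid vco\<close>)
qed

lemma view_bij:
  "bij_betw (F0 view) (c0 sDMC_rtd) (c0 (CompCat_rtd_sub_str2 :: ('o, 'm) rcc_2cat))"
  "bij_betw (F1 view) (c1 sDMC_rtd) (c1 (CompCat_rtd_sub_str2 :: ('o, 'm) rcc_2cat))"
  "bij_betw (F2 view) (c2 sDMC_rtd) (c2 (CompCat_rtd_sub_str2 :: ('o, 'm) rcc_2cat))"
proof -
  \<comment> \<open>The inverse on 2-cells keeps only the base component; the total component is
    recovered by uniqueness of 2-cells into a full target.\<close>
  define G where "G \<beta> = \<lparr> dtsrc = underlying_map (tsrc \<beta>), dttrg = underlying_map (ttrg \<beta>), dtnat = tbase \<beta> \<rparr>"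
    for \<beta> :: "('o, 'm) rcc_trans"
  have V: "x \<in> c0 sDMC_rtd \<Longrightarrow> view0 x \<in> c0 CompCat_rtd_sub_str2"
    "f \<in> c1 sDMC_rtd \<Longrightarrow> view1 f \<in> c1 CompCat_rtd_sub_str2"
    "\<alpha> \<in> c2 sDMC_rtd \<Longrightarrow> view2 \<alpha> \<in> c2 CompCat_rtd_sub_str2"
    for x :: "('o, 'm) dmc" and f :: "('o, 'm) dmc_map" and \<alpha> :: "('o, 'm) dmc_trans"
    using view_2functor[where 'o = 'o and 'm = 'm] by (simp_all add: is_2functor_def hom1_def hom2_def)
  show "bij_betw (F0 view) (c0 sDMC_rtd) (c0 (CompCat_rtd_sub_str2 :: ('o, 'm) rcc_2cat))"
    by (rule bij_betw_byWitness[where f' = underlying_dmc])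
      (use V(1) in \<open>auto simp: rooted_underlying_dmc rooted_cc_def intro!: view0_underlying_dmc\<close>)
  show "bij_betw (F1 view) (c1 sDMC_rtd) (c1 (CompCat_rtd_sub_str2 :: ('o, 'm) rcc_2cat))"
    by (rule bij_betw_byWitness[where f' = underlying_map])
      (use V(2) in \<open>auto simp: underlying_map\<close>)
  have G: "rtd_dmc_trans (G \<beta>) \<and> view2 (G \<beta>) = \<beta>" if b: "\<beta> \<in> c2 CompCat_rtd_sub_str2" for \<beta> :: "('o, 'm) rcc_trans"
  proof -
    have bt: "rtd_trans \<beta>" and s: "sub_cc (msrc (tsrc \<beta>))" "sub_cc (mtrg (tsrc \<beta>))"
      "strict_cc_map (tsrc \<beta>)" "strict_cc_map (ttrg \<beta>)"
      using b by simp_all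
    note b' = rtd_transD[OF bt]
    note us = underlying_map[OF b'(1) s(3,1,2)] and ut = underlying_map[OF b'(2) s(4), unfolded b'(3,4), OF s(1,2)]
    have t: "rtd_dmc_trans (G \<beta>)"
      using us(1) ut(1) b'(3-5)
      by (simp add: rtd_dmc_trans_iff G_def) (simp add: underlying_map_def underlying_dmc_def)
    have "full_cc (mtrg (tsrc \<beta>))"
      using sub_full[OF _ s(2)] rtd_map_rooted(2)[OF b'(1)] by (simp add: rooted_cc_def)
    then have "view2 (G \<beta>) = \<beta>"
      by (intro rtd_trans_eq view2_trans t bt) (simp_all add: G_def us(2) ut(2))
    with t show ?thesis by blast
  qed
  have "G (view2 \<alpha>) = \<alpha>" for \<alpha> :: "('o, 'm) dmc_trans"
    by (simp add: G_def)
  then show "bij_betw (F2 view) (c2 sDMC_rtd) (c2 (CompCat_rtd_sub_str2 :: ('o, 'm) rcc_2cat))"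
    by (intro bij_betw_byWitness[where f' = G]) (use V(3) G in \<open>auto simp del: CompCat_rtd_sub_str2_simps\<close>)
qed

section \<open>Repletion\<close>

text \<open>Composing with the inverse of \<open>i\<close>, itself cartesian, gives \<open>s\<close>
  back.\<close>

lemma (in is_ftr) cartesian_iso_cancel:
  assumes i: "iso_arr C i" and s: "s \<in> arr C" "trg C s = src C i" and c: "cartesian C D F (cmp C i s)"
  shows "cartesian C D F s"
proof -
  obtain j where j: "i \<in> arr C" "j \<in> arr C" "src C j = trg C i" "trg C j = src C i"
    "cmp C j i = idn C (src C i)" "cmp C i j = idn C (trg C i)"
    using i by (rule dom.isoE)
  have "iso_arr C j" using j by (intro dom.isoI[where g = i]) simp_all
  then have "cartesian C D F (cmp C j (cmp C i s))"
    using cartesian_cmp[OF cartesian_iso[OF \<open>iso_arr C j\<close>] c] i j s by simp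
  moreover have "cmp C j (cmp C i s) = s"
    using j s dom.cmp_assoc[of j i s] by simp
  ultimately show ?thesis by simp
qed

definition repletion :: "('o, 'm) dmc \<Rightarrow> ('o, 'm) dmc" where
  "repletion D = D\<lparr> disp := {e. \<exists>d\<in>disp D. isomorphic_objs (arrcat (dbase D)) d e} \<rparr>"

lemma repletion_simps [simp]: "dbase (repletion D) = dbase D" "dtop (repletion D) = dtop D"
  by (simp_all add: repletion_def)

lemma disp_repletion: "e \<in> disp (repletion D) \<longleftrightarrow> (\<exists>d\<in>disp D. isomorphic_objs (arrcat (dbase D)) d e)"
  by (simp add: repletion_def)

text \<open>The isomorphism is oriented from the new display map to the old one, so that its
  codomain side moves arrows into the codomain of \<open>e\<close> to arrows into the codomain of
  \<open>d\<close>.\<close>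

lemma disp_repletionE:
  assumes "rooted_sdmc D" "e \<in> disp (repletion D)"
  obtains d i where "d \<in> disp D" "iso_arr (arrcat (dbase D)) i" "i \<in> arr (arrcat (dbase D))"
    "src (arrcat (dbase D)) i = e" "trg (arrcat (dbase D)) i = d" "sqsrc i = e" "sqtrg i = d"
    "e \<in> arr (dbase D)"
proof -
  interpret C: is_cat "dbase D" using rooted_sdmcD(1)[OF assms(1)] by unfold_locales
  interpret A: is_cat "arrcat (dbase D)" using C.category_arrcat by unfold_locales
  obtain d where d: "d \<in> disp D" "isomorphic_objs (arrcat (dbase D)) d e"
    using assms(2) by (auto simp: disp_repletion)
  then obtain i where "iso_arr (arrcat (dbase D)) i" "i \<in> arr (arrcat (dbase D))"
    "src (arrcat (dbase D)) i = e" "trg (arrcat (dbase D)) i = d"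
    using A.isomorphic_sym[OF d(2)] by (auto simp: isomorphic_objs_def hom_def)
  with that[OF d(1)] show thesis
    by (metis square_arrD(1) src_arrcat trg_arrcat)
qed

lemma disp_subset_repletion:
  assumes "rooted_sdmc D"
  shows "disp D \<subseteq> disp (repletion D)"
proof
  interpret C: is_cat "dbase D" using rooted_sdmcD(1)[OF assms(1)] by unfold_locales
  interpret A: is_cat "arrcat (dbase D)" using C.category_arrcat by unfold_locales
  fix d assume "d \<in> disp D"
  then show "d \<in> disp (repletion D)"
    using A.isomorphic_refl[of d] rooted_sdmcD(2)[OF assms] by (auto simp: disp_repletion)
qed

text \<open>The pullback is found among the original display maps, which is stronger than finding it
  in the repletion; with \<open>f\<close> an identity it gives the vertical isomorphisms.\<close>

lemma pullback_repletion:
  assumes D: "rooted_sdmc D" and e: "e \<in> disp (repletion D)" and f: "f \<in> arr (dbase D)" "trg (dbase D) f = trg (dbase D) e"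
  shows "\<exists>d\<in>disp D. \<exists>q. pullback_square (dbase D) (Square d e q f)"
proof -
  let ?C = "dbase D" and ?A = "arrcat (dbase D)"
  note C = rooted_sdmcD(1)[OF D]
  interpret C: is_cat ?C using C by unfold_locales
  interpret q: is_ftr ?A ?C "codf ?C" using functor_codf[OF C] by unfold_locales
  obtain d i where d: "d \<in> disp D" and i: "iso_arr ?A i" "i \<in> arr ?A" "src ?A i = e" "trg ?A i = d"
    "sqsrc i = e" "sqtrg i = d"
    using disp_repletionE[OF D e] by blast
  note i' = square_arrD[OF i(2), unfolded i(5,6)]
  \<comment> \<open>The original \<open>d\<close> is pulled back along \<open>f\<close> followed by
    the codomain side of \<open>i\<close>; the inverse \<open>j\<close> of \<open>i\<close> then
    leads back to \<open>e\<close>.\<close>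
  obtain d' r where d': "d' \<in> disp D" "pullback_square ?C (Square d' d r (cmp ?C (sqcod i) f))"
    using D d i' f unfolding rooted_sdmc_def structured_dmc_def
    by (metis C.cmp_arr C.trg_cmp)
  let ?u = "Square d' d r (cmp ?C (sqcod i) f)"
  have u: "?u \<in> arr ?A" by (rule pullback_square_arr[OF d'(2)])
  obtain j where j: "j \<in> arr ?A" "src ?A j = d" "trg ?A j = e" "cmp ?A j i = idn ?A e" "cmp ?A i j = idn ?A d"
    using i by (auto elim: q.dom.isoE)
  have "iso_arr ?A j" using i j by (intro q.dom.isoI[where g = i]) simp_all
  have j': "sqsrc j = d" "sqtrg j = e" using j by (simp_all add: src_arrcat trg_arrcat)
  note j'' = square_arrD[OF j(1), unfolded j']
  have "cmp ?C (sqcod j) (sqcod i) = idn ?C (trg ?C e)"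
    using arg_cong[OF j(4), of sqcod] i j j' i' by (simp add: cmp_arrcat idn_arrcat)
  then have "cmp ?C (sqcod j) (cmp ?C (sqcod i) f) = f"
    using C.cmp_assoc[of "sqcod j" "sqcod i" f] i' j'' f by simp
  then have eq: "cmp ?A j ?u = Square d' e (cmp ?C (sqdom j) r) f"
    using cmp_arrcat[OF j(1) u] j' by simp
  have "cartesian ?A ?C (codf ?C) (cmp ?A j ?u)"
    using q.cartesian_cmp[OF q.cartesian_iso[OF \<open>iso_arr ?A j\<close>] d'(2)[unfolded pullback_iff_cartesian[OF C]]]
      j u by (simp add: trg_arrcat del: Square_arr)
  then show ?thesis
    using d'(1) unfolding eq pullback_iff_cartesian[OF C] by blast
qed

lemma rooted_repletion:
  assumes D: "rooted_sdmc D"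
  shows "rooted_sdmc (repletion D)"
proof -
  have "f \<in> disp_composites (repletion D)" if "f \<in> disp_composites D" for f
    using that
  proof induction
    case (disp d)
    then show ?case using disp_subset_repletion[OF D] by (auto intro: disp_composites.disp)
  next
    case (comp g f)
    then show ?case using disp_composites.comp[of g "repletion D" f] by simp
  qed (auto intro: disp_composites.iso)
  moreover have "disp (repletion D) \<subseteq> arr (dbase D)"
    using disp_repletionE[OF D] by blast
  moreover have "\<exists>d\<in>disp (repletion D). \<exists>q. pullback_square (dbase D) (Square d e q f)"
    if "e \<in> disp (repletion D)" "f \<in> arr (dbase D)" "trg (dbase D) f = trg (dbase D) e" for e f
    using pullback_repletion[OF D that] disp_subset_repletion[OF D] by blast
  ultimately show ?thesis
    using D by (simp add: rooted_sdmc_def structured_dmc_def)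
qed

lemma replete_repletion:
  assumes D: "rooted_sdmc D"
  shows "replete_dmc (repletion D)"
proof -
  interpret C: is_cat "dbase D" using rooted_sdmcD(1)[OF assms(1)] by unfold_locales
  interpret A: is_cat "arrcat (dbase D)" using C.category_arrcat by unfold_locales
  show ?thesis
    unfolding replete_dmc_def repletion_simps
  proof (intro ballI allI impI)
    fix d e assume "d \<in> disp (repletion D)" and de: "isomorphic_objs (arrcat (dbase D)) d e"
    then obtain c where "c \<in> disp D" "isomorphic_objs (arrcat (dbase D)) c d"
      by (auto simp: disp_repletion)
    then show "e \<in> disp (repletion D)"
      using A.isomorphic_trans[OF _ de] by (auto simp: disp_repletion)
  qed
qed

lemma idn_vertical:
  assumes "category C" "d \<in> arr C"
  shows "iso_arr (arrcat C) (idn (arrcat C) d) \<and> sqsrc (idn (arrcat C) d) = d \<and>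
    sqtrg (idn (arrcat C) d) = d \<and> sqcod (idn (arrcat C) d) = idn C (trg C d)"
proof -
  interpret C: is_cat C using assms(1) by unfold_locales
  interpret A: is_cat "arrcat C" using C.category_arrcat by unfold_locales
  show ?thesis
    using A.iso_idn[of d] assms(2) by (simp add: idn_arrcat)
qed

text \<open>The isomorphic display map over the same codomain is a pullback of \<open>e\<close> along an identity.\<close>

lemma repletion_vertical:
  assumes D: "rooted_sdmc D" and e: "e \<in> disp (repletion D)"
  shows "\<exists>d\<in>disp D. \<exists>i. iso_arr (arrcat (dbase D)) i \<and> sqsrc i = d \<and> sqtrg i = e \<and>
    sqcod i = idn (dbase D) (trg (dbase D) e)"
proof -
  let ?C = "dbase D" and ?A = "arrcat (dbase D)"
  note C = rooted_sdmcD(1)[OF D]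
  interpret C: is_cat ?C using C by unfold_locales
  interpret q: is_ftr ?A ?C "codf ?C" using functor_codf[OF C] by unfold_locales
  have ea: "e \<in> arr ?C" using disp_repletionE[OF D e] by blast
  obtain d r where d: "d \<in> disp D" "pullback_square ?C (Square d e r (idn ?C (trg ?C e)))"
    using pullback_repletion[OF D e, of "idn ?C (trg ?C e)"] ea by auto
  let ?u = "Square d e r (idn ?C (trg ?C e))"
  have u: "?u \<in> arr ?A" by (rule pullback_square_arr[OF d(2)])
  have "iso_arr ?A ?u"
  proof (rule q.cartesian_over_iso)
    show "cartesian ?A ?C (codf ?C) ?u" using d(2) by (simp add: pullback_iff_cartesian[OF C])
    show "iso_arr ?C (far (codf ?C) ?u)" using u ea by (simp add: codf_def C.iso_idn)
  qed
  then show ?thesis using d(1) by (intro bexI[where x = d] exI[where x = ?u]) simp_all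
qed

lemma view0_repletion_equivalent:
  fixes D :: "('o, 'm) dmc"
  assumes D: "rooted_sdmc D"
  shows "internally_equivalent CompCat_rtd (view0 (repletion D)) (view0 D)"
proof -
  note R = rooted_repletion[OF D]
  note C = rooted_sdmcD(1)[OF D]
  interpret X: compr_cat "view0 (repletion D)" using rooted_view0[OF R] by (rule rooted_compr_cat)
  interpret Y: compr_cat "view0 D" using rooted_view0[OF D] by (rule rooted_compr_cat)
  have pr: "fob (proj (view0 (repletion D))) e = trg (dbase D) e" if "e \<in> disp (repletion D)" for e
    using X.trg_compr[of e] that by simp
  have pr': "fob (proj (view0 D)) d = trg (dbase D) d" if "d \<in> disp D" for d
    using Y.trg_compr[of d] that by simp
  show ?thesis
  proof (rule internally_equivalentI)
    fix e assume "e \<in> obj (tot (view0 (repletion D)))"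
    then show "\<exists>B\<in>obj (tot (view0 D)). \<exists>i. iso_arr (arrcat (base (view0 (repletion D)))) i \<and>
        sqsrc i = fob (compr (view0 D)) B \<and> sqtrg i = fob (compr (view0 (repletion D))) e \<and>
        sqcod i = idn (base (view0 (repletion D))) (fob (proj (view0 (repletion D))) e)"
      using repletion_vertical[OF D, of e] pr by simp
  next
    fix d assume "d \<in> obj (tot (view0 D))"
    then have d: "d \<in> disp D" by simp
    then have "d \<in> disp (repletion D)" "d \<in> arr (dbase D)"
      using disp_subset_repletion[OF D] rooted_sdmcD(2)[OF D] by auto
    with d show "\<exists>A\<in>obj (tot (view0 (repletion D))). \<exists>i. iso_arr (arrcat (base (view0 (repletion D)))) i \<and>
        sqsrc i = fob (compr (view0 (repletion D))) A \<and> sqtrg i = fob (compr (view0 D)) d \<and>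
        sqcod i = idn (base (view0 (repletion D))) (fob (proj (view0 D)) d)"
      using idn_vertical[OF C, of d] pr'[OF d]
      by (intro bexI[where x = d] exI[where x = "idn (arrcat (dbase D)) d"]) simp_all
  qed (simp_all add: rooted_view0 R D full_cc_rooted_view0)
qed

text \<open>Objects of the total category with equal comprehension become one display map; this is
  what makes the new comprehension injective on objects.\<close>

definition image_dmc :: "('o, 'm) rcc \<Rightarrow> ('o, 'm) dmc" where
  "image_dmc X = \<lparr> dbase = base X, disp = fob (compr X) ` obj (tot X), dtop = pt X \<rparr>"

lemma rooted_image:
  assumes X: "rooted_cc X"
  shows "rooted_cc (view0 (image_dmc X))" "disp (image_dmc X) \<subseteq> arr (base X)"
proof -
  interpret X: compr_cat X using X by (rule rooted_compr_cat)
  show sub: "disp (image_dmc X) \<subseteq> arr (base X)" by (auto simp: image_dmc_def)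
  have "rooted_cc (along_cc (base X) (fob (compr X) ` obj (tot X)) (\<lambda>d. d) (pt X))"
  proof (rule rooted_along_cc[OF X])
    fix d f assume "d \<in> fob (compr X) ` obj (tot X)" "f \<in> arr (base X)" "trg (base X) f = trg (base X) d"
    then show "\<exists>e\<in>fob (compr X) ` obj (tot X). \<exists>q. pullback_square (base X) (Square e d q f)"
      using X.pullback_ex by fastforce
  qed auto
  then show "rooted_cc (view0 (image_dmc X))"
    using view0_eq_along_cc[of "image_dmc X"] sub by (simp add: image_dmc_def)
qed

text \<open>An object and its image have the same comprehension, so identity squares serve as the
  vertical isomorphisms in both directions.\<close>

lemma image_equivalent:
  fixes X :: "('o, 'm) rcc"
  assumes X: "rooted_cc X" and full: "full_cc X"
  shows "internally_equivalent CompCat_rtd (view0 (image_dmc X)) X"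
proof -
  interpret X: compr_cat X using X by (rule rooted_compr_cat)
  note I = rooted_image[OF X]
  have D [simp]: "dbase (image_dmc X) = base X" "disp (image_dmc X) = fob (compr X) ` obj (tot X)"
    "dtop (image_dmc X) = pt X"
    by (simp_all add: image_dmc_def)
  interpret Y: compr_cat "view0 (image_dmc X)" using I(1) by (rule rooted_compr_cat)
  have pr: "fob (proj (view0 (image_dmc X))) d = trg (base X) d" if "d \<in> fob (compr X) ` obj (tot X)" for d
    using Y.trg_compr[of d] that by simp
  show ?thesis
  proof (rule internally_equivalentI)
    fix d assume "d \<in> obj (tot (view0 (image_dmc X)))"
    then obtain A where A: "A \<in> obj (tot X)" "d = fob (compr X) A" by auto
    then show "\<exists>B\<in>obj (tot X). \<exists>i. iso_arr (arrcat (base (view0 (image_dmc X)))) i \<and>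
        sqsrc i = fob (compr X) B \<and> sqtrg i = fob (compr (view0 (image_dmc X))) d \<and>
        sqcod i = idn (base (view0 (image_dmc X))) (fob (proj (view0 (image_dmc X))) d)"
      using idn_vertical[OF X.base.category X.compr_obj[OF A(1)]] pr[of d]
      by (intro bexI[where x = A] exI[where x = "idn (arrcat (base X)) d"]) simp_all
  next
    fix A assume A: "A \<in> obj (tot X)"
    then show "\<exists>d\<in>obj (tot (view0 (image_dmc X))). \<exists>i. iso_arr (arrcat (base (view0 (image_dmc X)))) i \<and>
        sqsrc i = fob (compr (view0 (image_dmc X))) d \<and> sqtrg i = fob (compr X) A \<and>
        sqcod i = idn (base (view0 (image_dmc X))) (fob (proj X) A)"
      using idn_vertical[OF X.base.category X.compr_obj[OF A]]
      by (intro bexI[where x = "fob (compr X) A"] exI[where x = "idn (arrcat (base X)) (fob (compr X) A)"]) simp_all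
  qed (use X full I X.base.category in \<open>simp_all add: full_cc_view0\<close>)
qed

section \<open>Universal arrows into the full and the replete case\<close>

text \<open>\<open>Z\<close> keeps objects and comprehensions and takes all squares as arrows, so
  the unit can be the identity on the base, on objects and in all of its comparisons.\<close>

lemma full_image_unit:
  fixes X :: "('o, 'm) rcc"
  assumes X: "rooted_cc X"
  defines "Z \<equiv> along_cc (base X) (obj (tot X)) (fob (compr X)) (pt X)"
  shows "rooted_cc Z" "full_cc Z"
    "\<exists>e. rtd_map e \<and> msrc e = X \<and> mtrg e = Z \<and> mbase e = fid (base X) \<and>
      (\<forall>A\<in>obj (tot X). fob (mtot e) A = A \<and> miso e A = idn (arrcat (base X)) (fob (compr X) A)) \<and>
      mpt e = idn (base X) (pt X)"
proof -
  interpret X: compr_cat X using X by (rule rooted_compr_cat)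
  show Z: "rooted_cc Z"
    unfolding Z_def
  proof (rule rooted_along_cc[OF X])
    fix A f assume "A \<in> obj (tot X)" "f \<in> arr (base X)" "trg (base X) f = trg (base X) (fob (compr X) A)"
    then show "\<exists>B\<in>obj (tot X). \<exists>q. pullback_square (base X) (Square (fob (compr X) B) (fob (compr X) A) q f)"
      using X.pullback_ex by simp
  qed auto
  show full: "full_cc Z"
    unfolding Z_def by (rule full_cc_along_cc[OF X.base.category]) simp
  interpret Z: compr_cat Z using Z by (rule rooted_compr_cat)
  have Zs: "base Z = base X" "obj (tot Z) = obj (tot X)" "pt Z = pt X" by (simp_all add: Z_def)
  have Zc: "fob (compr Z) A = fob (compr X) A" if "A \<in> obj (tot X)" for A
    using that by (simp add: Z_def)
  define \<phi> where "\<phi> = (\<lambda>A\<in>obj (tot X). idn (arrcat (base X)) (fob (compr X) A))"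
  have "\<exists>F'. pseudo_map X Z (fid (base X)) F' (restrict \<phi> (obj (tot X))) \<and>
      fob F' = restrict (\<lambda>A. A) (obj (tot X))"
  proof (rule pseudo_map_into_full[OF X.comprehension Z.comprehension full])
    show "is_functor (base X) (base Z) (fid (base X))"
      by (simp add: Zs functor_fid X.base.category)
    fix u assume u: "cartesian (tot X) (base X) (proj X) u"
    show "pullback_square (base Z) (far (arrf (base X) (fid (base X))) (far (compr X) u))"
      using X.cartesian_compr[OF u] X.p.cartesian_arr[OF u]
      by (simp add: Zs arrf_fid[OF X.base.category] pullback_iff_cartesian[OF X.base.category] del: arrf_simps)
  qed (use idn_vertical[OF X.base.category X.compr_obj] in \<open>simp_all add: Zs Zc \<phi>_def\<close>)
  then obtain F' where F': "pseudo_map X Z (fid (base X)) F' \<phi>" "fob F' = restrict (\<lambda>A. A) (obj (tot X))"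
    by (auto simp: \<phi>_def)
  have "rtd_map \<lparr> msrc = X, mtrg = Z, mbase = fid (base X), mtot = F', miso = \<phi>, mpt = idn (base X) (pt X) \<rparr>"
    using X Z F'(1) rooted_pt[OF X] X.compr_cat_axioms Z.compr_cat_axioms
    by (simp add: rtd_map_iff Zs ps_map_def ps_map_axioms_def X.base.iso_idn)
  with F'(2) show "\<exists>e. rtd_map e \<and> msrc e = X \<and> mtrg e = Z \<and> mbase e = fid (base X) \<and>
      (\<forall>A\<in>obj (tot X). fob (mtot e) A = A \<and> miso e A = idn (arrcat (base X)) (fob (compr X) A)) \<and>
      mpt e = idn (base X) (pt X)"
    by (intro exI[where x = "\<lparr> msrc = X, mtrg = Z, mbase = fid (base X), mtot = F', miso = \<phi>,
        mpt = idn (base X) (pt X) \<rparr>"]) (simp add: \<phi>_def)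
qed

lemma universal_arrows_full: "has_universal_arrows (CompCat_rtd :: ('o, 'm) rcc_2cat) full_cc"
  unfolding has_universal_arrows_def
proof
  fix X :: "('o, 'm) rcc" assume "X \<in> c0 CompCat_rtd"
  then have X: "rooted_cc X" by simp
  define Z where "Z = along_cc (base X) (obj (tot X)) (fob (compr X)) (pt X)"
  note U = full_image_unit[OF X, folded Z_def]
  obtain e where e: "rtd_map e" "msrc e = X" "mtrg e = Z" "mbase e = fid (base X)" "mpt e = idn (base X) (pt X)"
    and eA: "\<And>A. A \<in> obj (tot X) \<Longrightarrow> fob (mtot e) A = A"
      "\<And>A. A \<in> obj (tot X) \<Longrightarrow> miso e A = idn (arrcat (base X)) (fob (compr X) A)"
    using U(3) by blast
  interpret X: compr_cat X using X by (rule rooted_compr_cat)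
  interpret Z: compr_cat Z using U(1) by (rule rooted_compr_cat)
  interpret e: ps_map X Z "fid (base X)" "mtot e" "miso e" using e by (simp add: rtd_map_iff)
  have Zs: "base Z = base X" "obj (tot Z) = obj (tot X)" "pt Z = pt X" by (simp_all add: Z_def)
  have Zc: "fob (compr Z) A = fob (compr X) A" if "A \<in> obj (tot X)" for A
    using that by (simp add: Z_def)
  have Zp: "fob (proj Z) A = fob (proj X) A" if "A \<in> obj (tot X)" for A
    using Z.trg_compr[of A] X.trg_compr[of A] that by (simp add: Zs Zc)
  \<comment> \<open>Naturality with identity comparisons: the unit followed by the comprehension of
    \<open>Z\<close> is the comprehension of \<open>X\<close>.\<close>
  have compr_e: "far (compr Z) (far (mtot e) u) = far (compr X) u" if u: "u \<in> arr (tot X)" for u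
    using e.phi_nat[OF u refl refl] u eA X.chi.far_arr[OF u] Z.chi.cod.cmp_idl Z.chi.far_arr[of "far (mtot e) u"]
    by (simp add: arrf_fid[OF X.base.category] Zs Zc trg_arrcat src_arrcat del: arrf_simps)
  \<comment> \<open>Precomposition with the unit leaves alone exactly the data that determine a map
    into a full target: base functor, action on objects, comparison and root isomorphism.\<close>
  have pc: "mbase (cc_comp f e) = mbase f" "mpt (cc_comp f e) = mpt f" "miso (cc_comp f e) = miso f"
    "\<And>A. A \<in> obj (tot X) \<Longrightarrow> fob (mtot (cc_comp f e)) A = fob (mtot f) A"
    if f: "rtd_map f" "msrc f = Z" for f
  proof -
    interpret f: ps_map Z "mtrg f" "mbase f" "mtot f" "miso f" using f by (simp add: rtd_map_iff)
    interpret G: is_ftr "arrcat (base Z)" "arrcat (base (mtrg f))" "arrf (base Z) (mbase f)"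
      using functor_arrf[OF f.F.is_functor] by unfold_locales
    show "mbase (cc_comp f e) = mbase f"
      using fcomp_fid_right[OF f.F.is_functor] by (simp add: e Zs)
    show "mpt (cc_comp f e) = mpt f"
      using f(1,2) rooted_pt[OF X] f.F.far_idn[of "pt X"] by (simp add: e Zs rtd_map_iff)
    show "\<And>A. A \<in> obj (tot X) \<Longrightarrow> fob (mtot (cc_comp f e)) A = fob (mtot f) A"
      by (simp add: e eA)
    show "miso (cc_comp f e) = miso f"
    proof (rule extensionalityI)
      show "miso (cc_comp f e) \<in> extensional (obj (tot X))" by (simp add: e)
      show "miso f \<in> extensional (obj (tot X))" using f.\<phi>.nt_ext by (simp add: Zs)
      fix A assume A: "A \<in> obj (tot X)"
      then show "miso (cc_comp f e) A = miso f A"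
        using G.far_idn[of "fob (compr X) A"] f.phi(1)[of A] f.phi(3)[of A]
        by (simp add: e eA f(2) Zs Zc trg_arrcat del: arrf_simps(2))
    qed
  qed
  show "\<exists>p\<in>c0 CompCat_rtd. full_cc p \<and> (\<exists>e\<in>hom1 CompCat_rtd X p. \<forall>Y\<in>c0 CompCat_rtd. full_cc Y \<longrightarrow>
      bij_betw (\<lambda>f. comp1 CompCat_rtd f e) (hom1 CompCat_rtd p Y) (hom1 CompCat_rtd X Y) \<and>
      bij_betw (\<lambda>\<alpha>. hcomp CompCat_rtd \<alpha> (i2 CompCat_rtd e)) (cells CompCat_rtd p Y) (cells CompCat_rtd X Y))"
  proof (intro bexI[where x = Z] bexI[where x = e] conjI U(2) ballI impI)
    show "e \<in> hom1 CompCat_rtd X Z" using e by (simp add: hom1_def)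
    show "Z \<in> c0 CompCat_rtd" using U(1) by simp
    fix Y :: "('o, 'm) rcc" assume "Y \<in> c0 CompCat_rtd" and full: "full_cc Y"
    then have Y: "rooted_cc Y" by simp
    interpret Y: compr_cat Y using Y by (rule rooted_compr_cat)
    have inj: "f = g" if f: "rtd_map f" "msrc f = Z" "mtrg f = Y" and g: "rtd_map g" "msrc g = Z" "mtrg g = Y"
      and eq: "cc_comp f e = cc_comp g e" for f g
    proof -
      have eq': "mbase f = mbase g" "mpt f = mpt g" "miso f = miso g"
        "\<And>A. A \<in> obj (tot X) \<Longrightarrow> fob (mtot f) A = fob (mtot g) A"
        using pc[OF f(1,2)] pc[OF g(1,2)] eq by simp_all
      interpret f: ps_map Z Y "mbase g" "mtot f" "miso g" using f eq' by (simp add: rtd_map_iff)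
      interpret g: ps_map Z Y "mbase g" "mtot g" "miso g" using g by (simp add: rtd_map_iff)
      have "mtot f = mtot g"
        by (rule pseudo_map_into_full_unique[OF Z.comprehension Y.comprehension full f.pseudo_map g.pseudo_map])
          (use eq'(4) Zs in simp)
      then show ?thesis using f g eq' by (intro cc_map.equality) simp_all
    qed
    have surj: "\<exists>f. rtd_map f \<and> msrc f = Z \<and> mtrg f = Y \<and> cc_comp f e = g"
      if g: "rtd_map g" "msrc g = X" "mtrg g = Y" for g
    proof -
      interpret g: ps_map X Y "mbase g" "mtot g" "miso g" using g by (simp add: rtd_map_iff)
      interpret q: is_ftr "arrcat (base Y)" "base Y" "codf (base Y)"
        using functor_codf[OF Y.base.category] by unfold_locales
      let ?G = "arrf (base X) (mbase g)"
      have GZ: "is_functor (tot Z) (arrcat (base Y)) (fcomp (tot Z) ?G (compr Z))"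
        using functor_fcomp[OF Z.chi.is_functor, of "arrcat (base Y)" ?G] functor_arrf[OF g.F.is_functor]
        by (simp add: Zs)
      have "\<exists>F'. pseudo_map Z Y (mbase g) F' (restrict (miso g) (obj (tot Z))) \<and>
          fob F' = restrict (fob (mtot g)) (obj (tot Z))"
      proof (rule pseudo_map_into_full[OF Z.comprehension Y.comprehension full])
        fix u assume u: "cartesian (tot Z) (base Z) (proj Z) u"
        have ua: "u \<in> arr (tot Z)" by (rule Z.p.cartesian_arr[OF u])
        have t: "trg (tot Z) u \<in> obj (tot X)" using Z.p.dom.trg_obj[OF ua] by (simp add: Zs)
        \<comment> \<open>\<open>Z\<close> may have arrows that do not come from \<open>X\<close>,
          so the cartesian \<open>u\<close> is compared with the image of a cartesian arrow
          \<open>v\<close> of \<open>X\<close> over the same base arrow, to which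
          \<open>cartesian_base\<close> for \<open>g\<close> applies.\<close>
        obtain v where v: "cartesian (tot X) (base X) (proj X) v" "trg (tot X) v = trg (tot Z) u"
          "far (proj X) v = far (proj Z) u"
          using X.cartesian_ex[OF t, of "far (proj Z) u"] Z.p.far_arr[OF ua] Z.p.trg_far[OF ua] t
          by (auto simp: Zs Zp)
        have va: "v \<in> arr (tot X)" by (rule X.p.cartesian_arr[OF v(1)])
        have "cartesian (arrcat (base Y)) (base Y) (codf (base Y)) (far (fcomp (tot Z) ?G (compr Z)) u)"
        proof (rule cartesian_preserve[OF GZ q.is_functor Z.p.is_functor e.cartesian_map[OF v(1)] _ _ _ u])
          show "trg (tot Z) (far (mtot e) v) = trg (tot Z) u"
            using va v(2) t by (simp add: eA)
          show "far (proj Z) (far (mtot e) v) = far (proj Z) u"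
            using e.proj_far[OF va] X.p.far_arr[OF va] v(3) by simp
          show "cartesian (arrcat (base Y)) (base Y) (codf (base Y)) (far (fcomp (tot Z) ?G (compr Z)) (far (mtot e) v))"
            using g.cartesian_base[OF v(1)] va by (simp add: compr_e del: arrf_simps)
        qed
        then show "pullback_square (base Y) (far (arrf (base Z) (mbase g)) (far (compr Z) u))"
          using ua by (simp add: pullback_iff_cartesian[OF Y.base.category] Zs del: arrf_simps)
      qed (use g.phi_iso g.F.is_functor in \<open>simp_all add: Zs Zc Zp\<close>)
      then obtain F' where F': "pseudo_map Z Y (mbase g) F' (miso g)" "fob F' = restrict (fob (mtot g)) (obj (tot X))"
        using g.\<phi>.nt_ext by (auto simp: Zs extensional_restrict)
      define f where "f = \<lparr> msrc = Z, mtrg = Y, mbase = mbase g, mtot = F', miso = miso g, mpt = mpt g \<rparr>"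
      have f: "rtd_map f" "msrc f = Z" "mtrg f = Y"
        using F'(1) U(1) Y g(1,2,3) Y.compr_cat_axioms Z.compr_cat_axioms
        by (simp_all add: f_def rtd_map_iff ps_map_def ps_map_axioms_def Zs)
      have fe: "rtd_map (cc_comp f e)" using rtd_map_comp[OF e(1) f(1)] e f by simp
      interpret fe: ps_map X Y "mbase g" "mtot (cc_comp f e)" "miso g"
        using fe pc(1,3)[OF f(1,2)] e f by (simp add: rtd_map_iff f_def del: cc_comp_simps(3-))
      \<comment> \<open>Both total functors belong to pseudo maps with the same base functor,
        comparison and action on objects, so uniqueness identifies them on arrows.\<close>
      have "mtot (cc_comp f e) = mtot g"
        by (rule pseudo_map_into_full_unique[OF X.comprehension Y.comprehension full fe.pseudo_map g.pseudo_map])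
          (use pc(4)[OF f(1,2)] F'(2) in \<open>simp add: f_def\<close>)
      then have "cc_comp f e = g"
        using pc(1-3)[OF f(1,2)] e f g by (intro cc_map.equality) (simp_all add: f_def)
      with f show ?thesis by blast
    qed
    show "bij_betw (\<lambda>f. comp1 CompCat_rtd f e) (hom1 CompCat_rtd Z Y) (hom1 CompCat_rtd X Y)"
      unfolding bij_betw_def
    proof
      show "inj_on (\<lambda>f. comp1 CompCat_rtd f e) (hom1 CompCat_rtd Z Y)"
        using inj by (auto simp: inj_on_def hom1_def)
      show "(\<lambda>f. comp1 CompCat_rtd f e) ` hom1 CompCat_rtd Z Y = hom1 CompCat_rtd X Y"
      proof (intro subset_antisym subsetI)
        fix g assume "g \<in> hom1 CompCat_rtd X Y"
        then obtain f where "rtd_map f" "msrc f = Z" "mtrg f = Y" "cc_comp f e = g"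
          using surj by (auto simp: hom1_def)
        then show "g \<in> (\<lambda>f. comp1 CompCat_rtd f e) ` hom1 CompCat_rtd Z Y"
          by (intro image_eqI[where x = f]) (simp_all add: hom1_def)
      qed (use rtd_map_comp[OF e(1)] e in \<open>auto simp: hom1_def\<close>)
    qed
    \<comment> \<open>Whiskering with the unit does not change base components, so 2-cells are
      compared and constructed through these.\<close>
    have tb: "tbase (cc_hcomp \<alpha> (cc_trans_id e)) = tbase \<alpha>" if a: "rtd_trans \<alpha>" "msrc (tsrc \<alpha>) = Z" for \<alpha>
      using nt_hcomp_id_right[OF rtd_transD(5)[OF a(1)]] a(2) by (simp add: e Zs)
    have wh: "rtd_trans (cc_hcomp \<alpha> (cc_trans_id e))" if a: "rtd_trans \<alpha>" "msrc (tsrc \<alpha>) = Z" for \<alpha>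
      using rtd_trans_hcomp[OF a(1) rtd_trans_id[OF e(1)]] a(2) e by simp
    show "bij_betw (\<lambda>\<alpha>. hcomp CompCat_rtd \<alpha> (i2 CompCat_rtd e)) (cells CompCat_rtd Z Y) (cells CompCat_rtd X Y)"
      unfolding bij_betw_def
    proof
      show "inj_on (\<lambda>\<alpha>. hcomp CompCat_rtd \<alpha> (i2 CompCat_rtd e)) (cells CompCat_rtd Z Y)"
      proof (rule inj_onI)
        fix \<alpha> \<beta> assume a: "\<alpha> \<in> cells CompCat_rtd Z Y" and b: "\<beta> \<in> cells CompCat_rtd Z Y"
          and eq: "hcomp CompCat_rtd \<alpha> (i2 CompCat_rtd e) = hcomp CompCat_rtd \<beta> (i2 CompCat_rtd e)"
        have a: "rtd_trans \<alpha>" "msrc (tsrc \<alpha>) = Z" "mtrg (tsrc \<alpha>) = Y"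
          and b: "rtd_trans \<beta>" "msrc (tsrc \<beta>) = Z" "mtrg (tsrc \<beta>) = Y"
          using a b by (simp_all add: cells_def)
        note a' = rtd_transD[OF a(1), unfolded a(2,3)] and b' = rtd_transD[OF b(1), unfolded b(2,3)]
        have "tbase \<alpha> = tbase \<beta>"
          using arg_cong[OF eq, of tbase] tb[OF a(1,2)] tb[OF b(1,2)] by (simp del: cc_hcomp_simps)
        moreover have "tsrc \<alpha> = tsrc \<beta>"
          by (rule inj[OF a'(1) a(2,3) b'(1) b(2,3)]) (use arg_cong[OF eq, of tsrc] in simp)
        moreover have "ttrg \<alpha> = ttrg \<beta>"
          by (rule inj[OF a'(2-4) b'(2-4)]) (use arg_cong[OF eq, of ttrg] in simp)
        ultimately show "\<alpha> = \<beta>"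
          using a b full by (intro rtd_trans_eq) simp_all
      qed
      show "(\<lambda>\<alpha>. hcomp CompCat_rtd \<alpha> (i2 CompCat_rtd e)) ` cells CompCat_rtd Z Y = cells CompCat_rtd X Y"
      proof (intro subset_antisym subsetI)
        fix \<gamma> assume "\<gamma> \<in> cells CompCat_rtd X Y"
        then have c: "rtd_trans \<gamma>" "msrc (tsrc \<gamma>) = X" "mtrg (tsrc \<gamma>) = Y" by (simp_all add: cells_def)
        note c' = rtd_transD[OF c(1), unfolded c(2,3)]
        obtain f where f: "rtd_map f" "msrc f = Z" "mtrg f = Y" "cc_comp f e = tsrc \<gamma>"
          using surj[OF c'(1) c(2,3)] by blast
        obtain g where g: "rtd_map g" "msrc g = Z" "mtrg g = Y" "cc_comp g e = ttrg \<gamma>"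
          using surj[OF c'(2-4)] by blast
        have "nat_trans (base X) (base Y) (mbase f) (mbase g) (tbase \<gamma>)"
          using c'(5) pc(1)[OF f(1,2)] pc(1)[OF g(1,2)] f(4) g(4) by simp
        then obtain \<alpha> where a: "rtd_trans \<alpha>" "tsrc \<alpha> = f" "ttrg \<alpha> = g" "tbase \<alpha> = tbase \<gamma>"
          using rtd_trans_ex[OF f(1) g(1)] f(2,3) g(2,3) full by (auto simp: Zs)
        have "cc_hcomp \<alpha> (cc_trans_id e) = \<gamma>"
          by (rule rtd_trans_eq)
            (use a c f g full wh[of \<alpha>] tb[of \<alpha>] in \<open>simp_all del: cc_hcomp_simps(3,4)\<close>)
        then show "\<gamma> \<in> (\<lambda>\<alpha>. hcomp CompCat_rtd \<alpha> (i2 CompCat_rtd e)) ` cells CompCat_rtd Z Y"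
          using a f by (intro image_eqI[where x = \<alpha>]) (simp_all add: cells_def)
      qed (use wh e in \<open>auto simp: cells_def\<close>)
    qed
  qed
qed

lemma rtd_dmc_map_repletion:
  assumes g: "rtd_dmc_map g" and rep: "replete_dmc (dtrg g)"
  shows "rtd_dmc_map \<lparr> dsrc = repletion (dsrc g), dtrg = dtrg g, dfun = dfun g \<rparr>"
proof -
  let ?D = "dsrc g" and ?E = "dtrg g" and ?F = "dfun g"
  let ?C = "dbase ?D" and ?B = "dbase ?E"
  note g = rtd_dmc_mapD[OF g]
  interpret F: is_ftr ?C ?B ?F using g(3) by unfold_locales
  interpret G: is_ftr "arrcat ?C" "arrcat ?B" "arrf ?C ?F" using functor_arrf[OF g(3)] by unfold_locales
  interpret p: is_ftr "arrcat ?C" ?C "codf ?C" using functor_codf[OF F.dom.category] by unfold_locales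
  interpret q: is_ftr "arrcat ?B" ?B "codf ?B" using functor_codf[OF F.cod.category] by unfold_locales
  show ?thesis
  proof (rule rtd_dmc_mapI, unfold dmc_map.simps repletion_simps)
    fix e assume "e \<in> disp (repletion ?D)"
    then obtain d i where d: "d \<in> disp ?D" and i: "iso_arr (arrcat ?C) i" "i \<in> arr (arrcat ?C)"
      "src (arrcat ?C) i = e" "trg (arrcat ?C) i = d" "e \<in> arr ?C"
      using disp_repletionE[OF g(1)] by blast
    have "d \<in> arr ?C" using d rooted_sdmcD(2)[OF g(1)] by auto
    then have "isomorphic_objs (arrcat ?B) (far ?F e) (far ?F d)"
      using G.iso_far[OF i(1)] G.far_arr[OF i(2)] G.src_far[OF i(2)] G.trg_far[OF i(2)] i
      unfolding isomorphic_objs_def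
      by (intro bexI[where x = "far (arrf ?C ?F) i"]) (simp_all add: hom_def del: arrf_simps(2))
    then have "isomorphic_objs (arrcat ?B) (far ?F d) (far ?F e)"
      by (rule G.cod.isomorphic_sym)
    then show "far ?F e \<in> disp ?E"
      using rep g(4)[OF d] unfolding replete_dmc_def by blast
  next
    fix s assume s: "pullback_square ?C s" "sqtrg s \<in> disp (repletion ?D)"
    then obtain d i where d: "d \<in> disp ?D" and i: "iso_arr (arrcat ?C) i" "i \<in> arr (arrcat ?C)"
      "src (arrcat ?C) i = sqtrg s" "trg (arrcat ?C) i = d" "sqtrg i = d" "sqsrc i = sqtrg s"
      using disp_repletionE[OF g(1)] by blast
    have sa: "s \<in> arr (arrcat ?C)" by (rule pullback_square_arr[OF s(1)])
    have ends: "trg (arrcat ?C) s = src (arrcat ?C) i" using sa i by (simp add: trg_arrcat)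
    \<comment> \<open>The square is extended by \<open>i\<close> to one over an original display
      map, where preservation is known; afterwards the image of \<open>i\<close> is
      cancelled.\<close>
    have "cartesian (arrcat ?C) ?C (codf ?C) (cmp (arrcat ?C) i s)"
      using p.cartesian_cmp[OF p.cartesian_iso[OF i(1)] s(1)[unfolded pullback_iff_cartesian[OF F.dom.category]]]
        ends by simp
    then have "pullback_square ?C (cmp (arrcat ?C) i s)"
      by (simp add: pullback_iff_cartesian[OF F.dom.category])
    moreover have "sqtrg (cmp (arrcat ?C) i s) = d"
      using sa i by (simp add: cmp_arrcat)
    ultimately have "pullback_square ?B (far (arrf ?C ?F) (cmp (arrcat ?C) i s))"
      using g(5) d by blast
    then have "cartesian (arrcat ?B) ?B (codf ?B) (cmp (arrcat ?B) (far (arrf ?C ?F) i) (far (arrf ?C ?F) s))"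
      using i(2) sa ends by (simp add: pullback_iff_cartesian[OF F.cod.category] del: arrf_simps)
    then have "cartesian (arrcat ?B) ?B (codf ?B) (far (arrf ?C ?F) s)"
      using G.iso_far[OF i(1)] i(2) sa ends
      by - (rule q.cartesian_iso_cancel[of "far (arrf ?C ?F) i"], simp_all del: arrf_simps)
    then show "pullback_square ?B (far (arrf ?C ?F) s)"
      by (simp add: pullback_iff_cartesian[OF F.cod.category])
  qed (use g rooted_repletion in auto)
qed

lemma universal_arrows_replete: "has_universal_arrows (sDMC_rtd :: ('o, 'm) dmc_2cat) replete_dmc"
  unfolding has_universal_arrows_def
proof
  fix D :: "('o, 'm) dmc" assume "D \<in> c0 sDMC_rtd"
  then have D: "rooted_sdmc D" by simp
  define e where "e = \<lparr> dsrc = D, dtrg = repletion D, dfun = fid (dbase D) \<rparr>"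
  have e: "rtd_dmc_map e" "dsrc e = D" "dtrg e = repletion D" "dfun e = fid (dbase D)"
    using rtd_dmc_map_inclusion[OF D rooted_repletion[OF D]] disp_subset_repletion[OF D]
    by (simp_all add: e_def)
  \<comment> \<open>Since \<open>e\<close> is the identity on the base, precomposition with it
    changes only the recorded source; \<open>G\<close> changes it back.\<close>
  have pc: "dmc_comp f e = \<lparr> dsrc = D, dtrg = dtrg f, dfun = dfun f \<rparr>"
    if "rtd_dmc_map f" "dsrc f = repletion D" for f
    using fcomp_fid_right[OF rtd_dmc_mapD(3)[OF that(1)]] that(2) e by (intro dmc_map.equality) simp_all
  show "\<exists>p\<in>c0 sDMC_rtd. replete_dmc p \<and> (\<exists>e\<in>hom1 sDMC_rtd D p. \<forall>Y\<in>c0 sDMC_rtd. replete_dmc Y \<longrightarrow>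
      bij_betw (\<lambda>f. comp1 sDMC_rtd f e) (hom1 sDMC_rtd p Y) (hom1 sDMC_rtd D Y) \<and>
      bij_betw (\<lambda>\<alpha>. hcomp sDMC_rtd \<alpha> (i2 sDMC_rtd e)) (cells sDMC_rtd p Y) (cells sDMC_rtd D Y))"
  proof (intro bexI[where x = "repletion D"] bexI[where x = e] conjI replete_repletion[OF D] ballI impI)
    show "e \<in> hom1 sDMC_rtd D (repletion D)" using e by (simp add: hom1_def)
    show "repletion D \<in> c0 sDMC_rtd" using rooted_repletion[OF D] by simp
    fix Y :: "('o, 'm) dmc" assume "Y \<in> c0 sDMC_rtd" and rep: "replete_dmc Y"
    define G where "G f = \<lparr> dsrc = repletion D, dtrg = dtrg f, dfun = dfun f \<rparr>" for f :: "('o, 'm) dmc_map"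
    have G: "rtd_dmc_map (G g) \<and> dsrc (G g) = repletion D \<and> dtrg (G g) = Y \<and> dmc_comp (G g) e = g"
      if g: "rtd_dmc_map g" "dsrc g = D" "dtrg g = Y" for g
    proof -
      have "rtd_dmc_map (G g)"
        using rtd_dmc_map_repletion[OF g(1)] rep g by (simp add: G_def)
      then show ?thesis
        using pc[of "G g"] g by (simp add: G_def)
    qed
    have G': "G (dmc_comp f e) = f" if "rtd_dmc_map f" "dsrc f = repletion D" for f
      using pc[OF that] that by (simp add: G_def)
    show "bij_betw (\<lambda>f. comp1 sDMC_rtd f e) (hom1 sDMC_rtd (repletion D) Y) (hom1 sDMC_rtd D Y)"
      by (rule bij_betw_byWitness[where f' = G])
        (use G G' rtd_dmc_map_comp[OF e(1)] e in \<open>auto simp: hom1_def\<close>)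
    define H where "H \<gamma> = \<lparr> dtsrc = G (dtsrc \<gamma>), dttrg = G (dttrg \<gamma>), dtnat = dtnat \<gamma> \<rparr>" for \<gamma> :: "('o, 'm) dmc_trans"
    have tb: "dtnat (dmc_hcomp \<alpha> (dmc_trans_id e)) = dtnat \<alpha>"
      if "rtd_dmc_trans \<alpha>" "dsrc (dtsrc \<alpha>) = repletion D" for \<alpha>
      using nt_hcomp_id_right[OF rtd_dmc_transD(5)[OF that(1)]] that(2) by (simp add: e)
    have H': "H (dmc_hcomp \<alpha> (dmc_trans_id e)) = \<alpha>"
      if "rtd_dmc_trans \<alpha>" "dsrc (dtsrc \<alpha>) = repletion D" for \<alpha>
      using tb[OF that] rtd_dmc_transD[OF that(1)] that(2) G'
      by (intro dmc_trans.equality) (simp_all add: H_def del: dmc_hcomp_simps(3))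
    have H: "rtd_dmc_trans (H \<gamma>) \<and> dsrc (dtsrc (H \<gamma>)) = repletion D \<and> dtrg (dtsrc (H \<gamma>)) = Y \<and>
        dmc_hcomp (H \<gamma>) (dmc_trans_id e) = \<gamma>"
      if c: "rtd_dmc_trans \<gamma>" "dsrc (dtsrc \<gamma>) = D" "dtrg (dtsrc \<gamma>) = Y" for \<gamma>
    proof -
      note c' = rtd_dmc_transD[OF c(1), unfolded c(2,3)]
      note s = G[OF c'(1) c(2,3)] and t = G[OF c'(2-4)]
      have h: "rtd_dmc_trans (H \<gamma>)"
        using s t c'(5) by (simp add: rtd_dmc_trans_iff H_def) (simp add: G_def)
      moreover have "dmc_hcomp (H \<gamma>) (dmc_trans_id e) = \<gamma>"
        using tb[OF h] s t
        by (intro dmc_trans.equality) (simp_all add: H_def del: dmc_hcomp_simps(3))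
      ultimately show ?thesis using s by (simp add: H_def)
    qed
    show "bij_betw (\<lambda>\<alpha>. hcomp sDMC_rtd \<alpha> (i2 sDMC_rtd e)) (cells sDMC_rtd (repletion D) Y) (cells sDMC_rtd D Y)"
      by (rule bij_betw_byWitness[where f' = H])
        (use H H' rtd_dmc_trans_hcomp[OF _ rtd_dmc_trans_id[OF e(1)]] e in \<open>auto simp: cells_def\<close>)
  qed
qed

section \<open>The comparison of the 2-categories\<close>

lemma bij_betw_Collect:
  assumes v: "bij_betw v A B" and P: "\<And>a. a \<in> A \<Longrightarrow> P' (v a) = P a"
  shows "bij_betw v {a \<in> A. P a} {b \<in> B. P' b}"
proof (rule bij_betw_subset[OF v])
  have "B = v ` A" using v by (simp add: bij_betw_def)
  then show "v ` {a \<in> A. P a} = {b \<in> B. P' b}"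
    using P by (auto simp del: image_Collect)
qed auto

lemma isomorphism_full_sub2:
  assumes V: "is_2functor K L V" and b0: "bij_betw (F0 V) (c0 K) (c0 L)"
    and b1: "bij_betw (F1 V) (c1 K) (c1 L)" and b2: "bij_betw (F2 V) (c2 K) (c2 L)"
    and Q: "\<And>x. x \<in> c0 K \<Longrightarrow> Q' (F0 V x) = Q x"
  shows "isomorphism_of_2cats (full_sub2 K Q) (full_sub2 L Q') V"
proof (rule isomorphism_of_2catsI)
  interpret K: is_2cat K using V by unfold_locales (simp add: is_2functor_def)
  interpret L: is_2cat L using V by unfold_locales (simp add: is_2functor_def)
  have V' [simp]: "x \<in> c0 K \<Longrightarrow> F0 V x \<in> c0 L" "f \<in> c1 K \<Longrightarrow> F1 V f \<in> c1 L" "\<alpha> \<in> c2 K \<Longrightarrow> F2 V \<alpha> \<in> c2 L"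
    "f \<in> c1 K \<Longrightarrow> s1 L (F1 V f) = F0 V (s1 K f)" "f \<in> c1 K \<Longrightarrow> t1 L (F1 V f) = F0 V (t1 K f)"
    "\<alpha> \<in> c2 K \<Longrightarrow> s2 L (F2 V \<alpha>) = F1 V (s2 K \<alpha>)" "\<alpha> \<in> c2 K \<Longrightarrow> t2 L (F2 V \<alpha>) = F1 V (t2 K \<alpha>)"
    for x f \<alpha>
    using V by (simp_all add: is_2functor_def hom1_def hom2_def)
  show "is_2functor (full_sub2 K Q) (full_sub2 L Q') V"
    using V K.strict_full_sub2 L.strict_full_sub2
    by (simp add: is_2functor_def hom1_def hom2_def vcomposable_def hcomposable_def Q)
  show "bij_betw (F0 V) (c0 (full_sub2 K Q)) (c0 (full_sub2 L Q'))"
    using bij_betw_Collect[OF b0, of Q' Q] Q by simp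
  show "bij_betw (F1 V) (c1 (full_sub2 K Q)) (c1 (full_sub2 L Q'))"
    using bij_betw_Collect[OF b1, of "\<lambda>f. Q' (s1 L f) \<and> Q' (t1 L f)" "\<lambda>f. Q (s1 K f) \<and> Q (t1 K f)"] Q
    by simp
  show "bij_betw (F2 V) (c2 (full_sub2 K Q)) (c2 (full_sub2 L Q'))"
    using bij_betw_Collect[OF b2, of "\<lambda>\<alpha>. Q' (s1 L (s2 L \<alpha>)) \<and> Q' (t1 L (s2 L \<alpha>))"
        "\<lambda>\<alpha>. Q (s1 K (s2 K \<alpha>)) \<and> Q (t1 K (s2 K \<alpha>))"] Q
    by simp
qed

text \<open>Restricting objects commutes with restricting 1-cells. In this form the replete case is
  a full sub-2-category of the strict subcategorical one, to which the results on
  \<open>view\<close> restrict.\<close>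

lemma CompCat_rtd_repl_str2_eq: "CompCat_rtd_repl_str2 = full_sub2 CompCat_rtd_sub_str2 repl_cc"
  unfolding CompCat_rtd_repl_str2_def CompCat_rtd_repl_def CompCat_rtd_sub_str2_def CompCat_rtd_sub_def
  by (rule twocat.equality) (auto simp: repl_cc_def)

text \<open>Rooted subcategorical structures are full, so this inclusion is again one of a full
  sub-2-category and \<open>equivalence_full_sub2\<close> can be applied to it.\<close>

lemma CompCat_rtd_sub_eq: "(CompCat_rtd_sub :: ('o, 'm) rcc_2cat) = full_sub2 CompCat_rtd_full sub_cc"
proof -
  have "full_cc X \<and> sub_cc X \<longleftrightarrow> sub_cc X" if "X \<in> c0 CompCat_rtd" for X :: "('o, 'm) rcc"
    using that sub_full[of X] by (auto simp: rooted_cc_def)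
  then show ?thesis
    unfolding CompCat_rtd_sub_def CompCat_rtd_full_def full_sub2_full_sub2
    by (intro full_sub2_cong strict_CompCat_rtd) simp
qed

lemma CompCat_rtd_repl_eq: "(CompCat_rtd_repl :: ('o, 'm) rcc_2cat) = full_sub2 CompCat_rtd_sub repl_cc"
  unfolding CompCat_rtd_sub_def CompCat_rtd_repl_def full_sub2_full_sub2
  by (intro full_sub2_cong strict_CompCat_rtd) (auto simp: repl_cc_def)

lemma repl_full: "rooted_cc X \<Longrightarrow> repl_cc X \<Longrightarrow> full_cc (X :: ('o, 'm) rcc)"
  using sub_full[of X] by (simp add: repl_cc_def rooted_cc_def)

lemma strict_replacement:
  fixes f :: "('o, 'm) rcc_map"
  assumes f: "rtd_map f" and rep: "repl_cc (mtrg f)"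
  shows "\<exists>g. rtd_map g \<and> strict_cc_map g \<and> msrc g = msrc f \<and> mtrg g = mtrg f \<and> mbase g = mbase f"
proof -
  let ?X = "msrc f" and ?Y = "mtrg f" and ?F = "mbase f"
  interpret f: ps_map ?X ?Y ?F "mtot f" "miso f" using f by (simp add: rtd_map_iff)
  have sub: "sub_cc ?Y" using rep by (simp add: repl_cc_def)
  show ?thesis
  proof (rule strict_map_into_sub[OF rtd_map_rooted[OF f] sub f.F.is_functor])
    fix A assume A: "A \<in> obj (tot ?X)"
    \<comment> \<open>The comparison at \<open>A\<close> is an isomorphism out of an object of the
      total category of \<open>?Y\<close>, and repleteness puts its target there too.\<close>
    have "src (arrcat (base ?Y)) (miso f A) = fob (mtot f) A" "trg (arrcat (base ?Y)) (miso f A) = far ?F (fob (compr ?X) A)"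
      using A by (simp_all add: src_arrcat trg_arrcat sub_cc_compr[OF sub])
    then show "far ?F (fob (compr ?X) A) \<in> obj (tot ?Y)"
      using rep f.phi_iso[OF A] f.F'.fob_obj[OF A] unfolding repl_cc_def replete_sub_def by metis
  next
    fix u assume "cartesian (tot ?X) (base ?X) (proj ?X) u"
    then show "pullback_square (base ?Y) (far (arrf (base ?X) ?F) (far (compr ?X) u))"
      using f.cartesian_base by (simp add: pullback_iff_cartesian[OF f.Y.base.category] del: arrf_simps)
  next
    have "isomorphic_objs (base ?Y) (fob ?F (pt ?X)) (pt ?Y)"
      using f unfolding isomorphic_objs_def by (intro bexI[where x = "mpt f"]) (simp_all add: rtd_map_iff hom_def)
    then show "terminal (base ?Y) (fob ?F (pt ?X))"
      using f.Y.base.terminal_isomorphic[OF rooted_terminal[OF rtd_map_rooted(2)[OF f]]] f.Y.base.isomorphic_sym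
      by blast
  qed
qed

theorem theorem28:
  shows
  "(isomorphism_of_2cats (DMC_rtd :: ('o, 'm) dmc_2cat) CompCat_rtd_repl_str2 view \<and>
    equivalence_of_2cats (CompCat_rtd_repl_str2 :: ('o, 'm) rcc_2cat) CompCat_rtd_repl incl) \<and>
   (equivalence_of_2cats (CompCat_rtd_repl :: ('o, 'm) rcc_2cat) CompCat_rtd_sub incl \<and>
    equivalence_of_2cats (CompCat_rtd_sub :: ('o, 'm) rcc_2cat) CompCat_rtd_full incl \<and>
    has_left_2adjoint (CompCat_rtd_full :: ('o, 'm) rcc_2cat) CompCat_rtd incl) \<and>
   isomorphism_of_2cats (sDMC_rtd :: ('o, 'm) dmc_2cat) CompCat_rtd_sub_str2 view \<and>
   (has_left_2adjoint (DMC_rtd :: ('o, 'm) dmc_2cat) sDMC_rtd incl \<and>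
    has_left_2adjoint (CompCat_rtd_repl_str2 :: ('o, 'm) rcc_2cat) CompCat_rtd_sub_str2 incl)"
proof (intro conjI)
  interpret K: is_2cat "CompCat_rtd :: ('o, 'm) rcc_2cat" using strict_CompCat_rtd by unfold_locales
  interpret Full: is_2cat "CompCat_rtd_full :: ('o, 'm) rcc_2cat"
    using K.strict_full_sub2 by unfold_locales (simp add: CompCat_rtd_full_def)
  interpret Sub: is_2cat "CompCat_rtd_sub :: ('o, 'm) rcc_2cat"
    using K.strict_full_sub2 by unfold_locales (simp add: CompCat_rtd_sub_def)
  interpret Repl: is_2cat "CompCat_rtd_repl :: ('o, 'm) rcc_2cat"
    using K.strict_full_sub2 by unfold_locales (simp add: CompCat_rtd_repl_def)
  have Q: "repl_cc (F0 view D) = replete_dmc D" if "D \<in> c0 sDMC_rtd" for D :: "('o, 'm) dmc"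
    using that by (simp add: repl_cc_view0)
  show "isomorphism_of_2cats (DMC_rtd :: ('o, 'm) dmc_2cat) CompCat_rtd_repl_str2 view"
    unfolding DMC_rtd_def CompCat_rtd_repl_str2_eq
    by (rule isomorphism_full_sub2[where Q' = repl_cc and Q = replete_dmc, OF view_2functor view_bij Q])
  show "isomorphism_of_2cats (sDMC_rtd :: ('o, 'm) dmc_2cat) CompCat_rtd_sub_str2 view"
    by (rule isomorphism_of_2catsI[OF view_2functor view_bij])
  show "has_left_2adjoint (CompCat_rtd_full :: ('o, 'm) rcc_2cat) CompCat_rtd incl"
    unfolding CompCat_rtd_full_def by (rule left_2adjoint_full_sub2[OF strict_CompCat_rtd universal_arrows_full])
  show "has_left_2adjoint (DMC_rtd :: ('o, 'm) dmc_2cat) sDMC_rtd incl"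
    unfolding DMC_rtd_def by (rule left_2adjoint_full_sub2[OF strict_sDMC_rtd universal_arrows_replete])
  \<comment> \<open>The universal arrows are those of display map categories, carried along
    \<open>view\<close>, which matches \<open>replete_dmc\<close> with
    \<open>repl_cc\<close>.\<close>
  show "has_left_2adjoint (CompCat_rtd_repl_str2 :: ('o, 'm) rcc_2cat) CompCat_rtd_sub_str2 incl"
    unfolding CompCat_rtd_repl_str2_eq
    by (rule left_2adjoint_full_sub2[OF strict_CompCat_rtd_sub_str2
          has_universal_arrows_transport[where Q' = repl_cc and Q = replete_dmc,
            OF view_2functor view_bij Q universal_arrows_replete]])
  show "equivalence_of_2cats (CompCat_rtd_sub :: ('o, 'm) rcc_2cat) CompCat_rtd_full incl"
    unfolding CompCat_rtd_sub_eq
  proof (rule Full.equivalence_full_sub2)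
    fix X :: "('o, 'm) rcc" assume "X \<in> c0 CompCat_rtd_full"
    then have X: "rooted_cc X" "full_cc X" by (simp_all add: CompCat_rtd_full_def)
    let ?I = "view0 (image_dmc X)"
    have "dbase (image_dmc X) = base X" by (simp add: image_dmc_def)
    moreover have "category (base X)" using X(1) by (simp add: rooted_cc_def comprehension_category_def)
    ultimately have I: "rooted_cc ?I" "full_cc ?I" "sub_cc ?I"
      using rooted_image[OF X(1)] by (simp_all add: full_cc_view0 sub_cc_view0)
    \<comment> \<open>The equivalence was built in \<open>CompCat_rtd\<close>; it restricts because
      both of its ends lie in the full sub-2-category.\<close>
    show "\<exists>Y\<in>c0 CompCat_rtd_full. sub_cc Y \<and> internally_equivalent CompCat_rtd_full Y X"
      using K.internally_equivalent_full_sub2[OF image_equivalent[OF X] I(2) X(2)] I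
      by (intro bexI[where x = ?I]) (simp_all add: CompCat_rtd_full_def)
  qed
  show "equivalence_of_2cats (CompCat_rtd_repl :: ('o, 'm) rcc_2cat) CompCat_rtd_sub incl"
    unfolding CompCat_rtd_repl_eq
  proof (rule Sub.equivalence_full_sub2)
    fix X :: "('o, 'm) rcc" assume "X \<in> c0 CompCat_rtd_sub"
    then have X: "rooted_cc X" "sub_cc X" by (simp_all add: CompCat_rtd_sub_def)
    let ?D = "underlying_dmc X"
    have D: "rooted_sdmc ?D" "view0 ?D = X"
      using X rooted_underlying_dmc[OF X] by (simp_all add: view0_underlying_dmc rooted_cc_def)
    note R = rooted_repletion[OF D(1)]
    have r: "repl_cc (view0 (repletion ?D))"
      by (simp add: repl_cc_view0[OF R] replete_repletion[OF D(1)])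
    have s: "rooted_cc (view0 (repletion ?D))" "sub_cc (view0 (repletion ?D))"
      using rooted_sub_view0[OF R] by simp_all
    show "\<exists>Y\<in>c0 CompCat_rtd_sub. repl_cc Y \<and> internally_equivalent CompCat_rtd_sub Y X"
      using K.internally_equivalent_full_sub2[OF view0_repletion_equivalent[OF D(1)], of sub_cc] r s X D(2)
      by (intro bexI[where x = "view0 (repletion ?D)"]) (simp_all add: CompCat_rtd_sub_def)
  qed
  show "equivalence_of_2cats (CompCat_rtd_repl_str2 :: ('o, 'm) rcc_2cat) CompCat_rtd_repl incl"
    unfolding CompCat_rtd_repl_str2_def
  proof (rule Repl.equivalence_locally_full_sub2)
    fix f :: "('o, 'm) rcc_map" assume "f \<in> c1 CompCat_rtd_repl"
    then have f: "rtd_map f" "repl_cc (msrc f)" "repl_cc (mtrg f)" by (simp_all add: CompCat_rtd_repl_def)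
    obtain g where g: "rtd_map g" "strict_cc_map g" "msrc g = msrc f" "mtrg g = mtrg f" "mbase g = mbase f"
      using strict_replacement[OF f(1,3)] by blast
    have "full_cc (mtrg g)" using repl_full[OF rtd_map_rooted(2)[OF f(1)] f(3)] g(4) by simp
    then have "isomorphic_objs (homcat CompCat_rtd (msrc f) (mtrg f)) g f"
      using isomorphic_maps_into_full[OF g(1) f(1)] g by simp
    then show "\<exists>g\<in>hom1 CompCat_rtd_repl (s1 CompCat_rtd_repl f) (t1 CompCat_rtd_repl f). strict_cc_map g \<and>
        isomorphic_objs (homcat CompCat_rtd_repl (s1 CompCat_rtd_repl f) (t1 CompCat_rtd_repl f)) g f"
      using f g by (intro bexI[where x = g])
        (simp_all add: CompCat_rtd_repl_def K.homcat_full_sub2 hom1_def)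
  qed (auto simp: CompCat_rtd_repl_def rooted_cc_def strict_cc_map_id strict_cc_map_comp)
qed

end
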